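(* The weak limits of Bergman metrics along geodesic rays are generically given by the normalized zero distributions of holomorphic sections of $L^k$; i.e., as $t\to\infty$, $$\frac1k\,\partial\bar\partial\log\sum_j e^{t\lambda_j}|s^U_j(z)|^2\;\longrightarrow\;\frac1k\,\partial\bar\partial\log|s|^2,$$ where $s$ is a holomorphic section of $L^k$. If the highest weight $\lambda_{\max}=\max_j\lambda_j$ has multiplicity $r$, then the limit is $$\frac1k\,\partial\bar\partial\log\sum_{j=1}^r|s_j|^2,$$ where $1\le r\le n$ and $\{s_j\}_{j=1}^r$ is any set of sections in $H^0(M,L^k)$.
   Context: $M$ is a compact Kähler manifold with integral Kähler form $\omega_0$, $L\to M$ is an ample line bundle with $c_1(L)=[\omega_0]$, and $H^0(M,L^k)$ is the space of holomorphic sections of the power $L^k$, whose bases define holomorphic embeddings of $M$ into projective space. Write $n=N_k=\dim H^0(M,L^k)$. Fix a reference basis $s_1,\dots,s_{N_k}$ of $H^0(M,L^k)$ that is orthonormal for the inner product induced by the background metric (these reference sections are not to be confused with the sections $\{s_j\}_{j=1}^r$ in the claim). For $U$ unitary, $s^U_j=\sum_l U_{jl}s_l$ is the rotated basis. Bergman metrics of degree $k$ are the Kähler metrics $\frac{i}{k}\partial\bar\partial\log\sum_{i,j}\bar s_i(z)P_{ij}s_j(z)$ with $P$ a positive definite Hermitian matrix, so they are parametrized by the symmetric space $SL(N_k,\mathbb C)/SU(N_k)$. A geodesic ray in the space of Bergman potentials is a one-parameter family of potentials $\beta_t=\frac1k\log\sum_j e^{t\lambda_j}|s^U_j(z)|^2$,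 $t\ge0$, with $\lambda_j$ real; the corresponding ray in the symmetric space starts at the origin with initial vector $(U,\Lambda)$, $\Lambda=\mathrm{diag}(\lambda_1,\dots,\lambda_{N_k})$. The numbers $\lambda_j$ are called weights. Moduli $|s(z)|^2$ are computed in a local holomorphic frame; $\partial\bar\partial\log$ of the expressions in the claim does not depend on the frame. Weak limits are taken in the sense of distributions (currents), i.e. after integration against smooth forms of bidegree $(\dim M-1,\dim M-1)$ on $M$. The normalized zero distribution of $s$ is, up to a universal constant factor, $\frac1k\partial\bar\partial\log|s|^2$, by the Poincaré–Lelong formula.
   Formalization: "Any set of sections" is proved for r = 1 as any nonzero section and for general r as any orthonormal r-tuple, since arbitrary (e.g. rescaled or zero) sets do not all occur as limits; M is taken connected. *)

theory Defs
  imports "HOL-Analysis.Analysis" "HOL-Combinatorics.Permutations"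
begin

section \<open>Calculus on open subsets of complex coordinate space\<close>

text \<open>
  The real dimension of \<^typ>\<open>complex^'m\<close> is \<open>2 * CARD('m)\<close>; \<^const>\<open>frechet_derivative\<close> is the
  real derivative. All sets \<open>S\<close> below are meant to be open.
\<close>

primrec Ck_on :: "nat \<Rightarrow> ('x::real_normed_vector \<Rightarrow> 'y::real_normed_vector) \<Rightarrow> 'x set \<Rightarrow> bool" where
  "Ck_on 0 f S \<longleftrightarrow> continuous_on S f"
| "Ck_on (Suc k) f S \<longleftrightarrow> (\<forall>x\<in>S. f differentiable (at x)) \<and>
     (\<forall>v. Ck_on k (\<lambda>x. frechet_derivative f (at x) v) S)"

definition smooth_fun_on :: "('x::real_normed_vector \<Rightarrow> 'y::real_normed_vector) \<Rightarrow> 'x set \<Rightarrow> bool" where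
  "smooth_fun_on f S \<longleftrightarrow> (\<forall>k. Ck_on k f S)"

definition holo_fun_on :: "(complex^'m \<Rightarrow> complex) \<Rightarrow> (complex^'m) set \<Rightarrow> bool" where
  "holo_fun_on f S \<longleftrightarrow> (\<forall>x\<in>S. \<exists>D. (f has_derivative D) (at x) \<and> (\<forall>c v. D (c *s v) = c * D v))"

definition holo_map_on :: "(complex^'m \<Rightarrow> complex^'p) \<Rightarrow> (complex^'m) set \<Rightarrow> bool" where
  "holo_map_on F S \<longleftrightarrow> (\<forall>a. holo_fun_on (\<lambda>x. F x $ a) S)"

text \<open>
  A complex valued differential form of degree \<open>d\<close> in coordinates is a function of a point and of a
  list of \<open>d\<close> tangent vectors; its values on lists of another length are irrelevant.
  Wedge products follow the convention \<open>(dz \<and> dw)(u, v) = dz(u) dw(v) - dz(v) dw(u)\<close>.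
\<close>

type_synonym 'm cform = "complex^'m \<Rightarrow> (complex^'m) list \<Rightarrow> complex"

text \<open>The directional derivatives \<open>\<Sum>\<^sub>a v\<^sub>a \<partial>f/\<partial>z\<^sub>a\<close> and \<open>\<Sum>\<^sub>a cnj v\<^sub>a \<partial>f/\<partial>(cnj z\<^sub>a)\<close>.\<close>

definition wirt_del :: "complex^'m \<Rightarrow> (complex^'m \<Rightarrow> complex) \<Rightarrow> complex^'m \<Rightarrow> complex" where
  "wirt_del v f x =
     (frechet_derivative f (at x) v - \<i> * frechet_derivative f (at x) (\<i> *s v)) / 2"

definition wirt_dbar :: "complex^'m \<Rightarrow> (complex^'m \<Rightarrow> complex) \<Rightarrow> complex^'m \<Rightarrow> complex" where
  "wirt_dbar v f x =
     (frechet_derivative f (at x) v + \<i> * frechet_derivative f (at x) (\<i> *s v)) / 2"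

text \<open>
  \<open>\<partial>\<alpha> = \<Sum>\<^sub>a dz\<^sub>a \<and> \<partial>\<alpha>/\<partial>z\<^sub>a\<close> and \<open>dbar \<alpha> = \<Sum>\<^sub>a d(cnj z\<^sub>a) \<and> \<partial>\<alpha>/\<partial>(cnj z\<^sub>a)\<close>, evaluated on
  \<open>d + 1\<close> vectors.
\<close>

definition form_del :: "'m::finite cform \<Rightarrow> 'm cform" where
  "form_del \<alpha> x vs =
     (\<Sum>l<length vs. (-1)^l * wirt_del (vs ! l) (\<lambda>y. \<alpha> y (take l vs @ drop (Suc l) vs)) x)"

definition form_dbar :: "'m::finite cform \<Rightarrow> 'm cform" where
  "form_dbar \<alpha> x vs =
     (\<Sum>l<length vs. (-1)^l * wirt_dbar (vs ! l) (\<lambda>y. \<alpha> y (take l vs @ drop (Suc l) vs)) x)"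

definition form_d :: "'m::finite cform \<Rightarrow> 'm cform" where
  "form_d \<alpha> x vs = form_del \<alpha> x vs + form_dbar \<alpha> x vs"

definition ddbar :: "'m::finite cform \<Rightarrow> 'm cform" where
  "ddbar \<alpha> = form_del (form_dbar \<alpha>)"

section \<open>Complex manifolds\<close>

type_synonym ('a, 'm) chart = "'a set \<times> ('a \<Rightarrow> complex^'m)"

definition chart_inv :: "('a, 'm) chart \<Rightarrow> complex^'m \<Rightarrow> 'a" where
  "chart_inv c = inv_into (fst c) (snd c)"

definition complex_atlas :: "('a::topological_space, 'm::finite) chart set \<Rightarrow> bool" where
  "complex_atlas A \<longleftrightarrow>
     \<Union>(fst ` A) = UNIV \<and>
     (\<forall>c\<in>A. open (fst c) \<and> open (snd c ` fst c) \<and>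
            homeomorphism (fst c) (snd c ` fst c) (snd c) (chart_inv c)) \<and>
     (\<forall>c\<in>A. \<forall>c'\<in>A. holo_map_on (snd c' \<circ> chart_inv c) (snd c ` (fst c \<inter> fst c')))"

text \<open>Connectedness is part of the convention for a compact complex manifold.\<close>

definition compact_complex_manifold :: "('a::t2_space, 'm::finite) chart set \<Rightarrow> bool" where
  "compact_complex_manifold A \<longleftrightarrow>
     compact (UNIV :: 'a set) \<and> connected (UNIV :: 'a set) \<and> complex_atlas A"

definition holo_on_mfd :: "('a, 'm::finite) chart set \<Rightarrow> 'a set \<Rightarrow> ('a \<Rightarrow> complex) \<Rightarrow> bool" where
  "holo_on_mfd A V f \<longleftrightarrow> (\<forall>c\<in>A. holo_fun_on (f \<circ> chart_inv c) (snd c ` (fst c \<inter> V)))"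

definition smooth_on_mfd :: "('a, 'm::finite) chart set \<Rightarrow> 'a set \<Rightarrow> ('a \<Rightarrow> real) \<Rightarrow> bool" where
  "smooth_on_mfd A V f \<longleftrightarrow> (\<forall>c\<in>A. smooth_fun_on (f \<circ> chart_inv c) (snd c ` (fst c \<inter> V)))"

text \<open>A form on the manifold is the family of its coordinate expressions, related by pullback.\<close>

type_synonym ('a, 'm) mform = "('a, 'm) chart \<Rightarrow> 'm cform"

definition smooth_form :: "('a, 'm::finite) chart set \<Rightarrow> nat \<Rightarrow> ('a, 'm) mform \<Rightarrow> bool" where
  "smooth_form A d \<alpha> \<longleftrightarrow>
     (\<forall>c\<in>A. \<forall>vs. length vs = d \<longrightarrow>
        smooth_fun_on (\<lambda>y. \<alpha> c y vs) (snd c ` fst c) \<and>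
        (\<forall>y\<in>snd c ` fst c.
           (\<forall>l<d. linear (\<lambda>v. \<alpha> c y (vs[l := v]))) \<and>
           (\<forall>l<d. \<forall>l'<d. l \<noteq> l' \<and> vs ! l = vs ! l' \<longrightarrow> \<alpha> c y vs = 0))) \<and>
     (\<forall>c\<in>A. \<forall>c'\<in>A. \<forall>p\<in>fst c \<inter> fst c'. \<forall>vs. length vs = d \<longrightarrow>
        \<alpha> c (snd c p) vs =
        \<alpha> c' (snd c' p) (map (frechet_derivative (snd c' \<circ> chart_inv c) (at (snd c p))) vs))"

definition real_form :: "('a, 'm::finite) chart set \<Rightarrow> nat \<Rightarrow> ('a, 'm) mform \<Rightarrow> bool" where
  "real_form A d \<alpha> \<longleftrightarrow>
     (\<forall>c\<in>A. \<forall>y\<in>snd c ` fst c. \<forall>vs. length vs = d \<longrightarrow> \<alpha> c y vs \<in> \<real>)"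

text \<open>
  A form of degree \<open>p + q\<close> has bidegree \<open>(p, q)\<close> iff scaling all arguments by \<open>\<zeta>\<close> multiplies it by
  \<open>\<zeta>^p (cnj \<zeta>)^q\<close>.
\<close>

definition smooth_form_pq ::
    "('a, 'm::finite) chart set \<Rightarrow> nat \<Rightarrow> nat \<Rightarrow> ('a, 'm) mform \<Rightarrow> bool" where
  "smooth_form_pq A p q \<alpha> \<longleftrightarrow>
     smooth_form A (p + q) \<alpha> \<and>
     (\<forall>c\<in>A. \<forall>y\<in>snd c ` fst c. \<forall>vs. length vs = p + q \<longrightarrow>
        (\<forall>\<zeta>. \<alpha> c y (map ((*s) \<zeta>) vs) = \<zeta>^p * cnj \<zeta>^q * \<alpha> c y vs))"

definition form_support ::
    "('a::topological_space, 'm::finite) chart set \<Rightarrow> nat \<Rightarrow> ('a, 'm) mform \<Rightarrow> 'a set" where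
  "form_support A d \<alpha> =
     closure {p. \<exists>c\<in>A. p \<in> fst c \<and> (\<exists>vs. length vs = d \<and> \<alpha> c (snd c p) vs \<noteq> 0)}"

text \<open>
  Integration of forms of top degree uses a Borel partition of the manifold into pieces that are
  relatively compact in chart domains, i.e. a partition of unity by indicator functions. On a
  compact manifold one exists, and by the change of variables formula the integral does not
  depend on it. The orientation is the complex one, with positive frame
  \<open>(e\<^sub>1, i e\<^sub>1, \<dots>, e\<^sub>m, i e\<^sub>m)\<close>; reordering the indices is an even permutation of this frame.
\<close>

definition chart_partition ::
    "('a::topological_space, 'm::finite) chart set \<Rightarrow> (('a, 'm) chart \<times> 'a set) set \<Rightarrow> bool" where
  "chart_partition A P \<longleftrightarrow>
     finite P \<and> disjoint_family_on snd P \<and> \<Union>(snd ` P) = UNIV \<and>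
     (\<forall>(c, B)\<in>P. c \<in> A \<and> B \<in> sets borel \<and> (\<exists>K. compact K \<and> B \<subseteq> K \<and> K \<subseteq> fst c))"

definition std_frame :: "(complex^'m::finite) list" where
  "std_frame = concat (map (\<lambda>a. [axis a 1, axis a \<i>])
                 (SOME as. distinct as \<and> set as = (UNIV :: 'm set)))"

definition mfd_integral ::
    "('a::topological_space, 'm::finite) chart set \<Rightarrow> ('a, 'm) mform \<Rightarrow> complex" where
  "mfd_integral A \<beta> =
     (\<Sum>(c, B)\<in>(SOME P. chart_partition A P).
        set_lebesgue_integral lborel (snd c ` B) (\<lambda>y. \<beta> c y std_frame))"

section \<open>Line bundles\<close>

text \<open>
  A holomorphic line bundle is given by local frames \<open>e\<^sub>i\<close> over an open cover together with the
  transition functions \<open>g\<^sub>i\<^sub>j\<close>, where \<open>e\<^sub>j = g\<^sub>i\<^sub>j e\<^sub>i\<close>. A section is the family of its coefficients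
  \<open>s\<^sub>i\<close> with respect to the frames, so \<open>s\<^sub>i = g\<^sub>i\<^sub>j s\<^sub>j\<close>, extended by zero outside the domain of \<open>e\<^sub>i\<close>.
\<close>

record ('a, 'i) line_bundle =
  frame_dom :: "'i \<Rightarrow> 'a set"
  transition :: "'i \<Rightarrow> 'i \<Rightarrow> 'a \<Rightarrow> complex"

type_synonym ('a, 'i) sect = "'i \<Rightarrow> 'a \<Rightarrow> complex"

definition holo_line_bundle ::
    "('a::topological_space, 'm::finite) chart set \<Rightarrow> ('a, 'i) line_bundle \<Rightarrow> bool" where
  "holo_line_bundle A L \<longleftrightarrow>
     (\<forall>i. open (frame_dom L i)) \<and> (\<Union>i. frame_dom L i) = UNIV \<and>
     (\<forall>i j. holo_on_mfd A (frame_dom L i \<inter> frame_dom L j) (transition L i j)) \<and>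
     (\<forall>i j. \<forall>p\<in>frame_dom L i \<inter> frame_dom L j. transition L i j p \<noteq> 0) \<and>
     (\<forall>i. \<forall>p\<in>frame_dom L i. transition L i i p = 1) \<and>
     (\<forall>i j l. \<forall>p\<in>frame_dom L i \<inter> frame_dom L j \<inter> frame_dom L l.
        transition L i j p * transition L j l p = transition L i l p)"

definition bundle_power :: "('a, 'i) line_bundle \<Rightarrow> nat \<Rightarrow> ('a, 'i) line_bundle" where
  "bundle_power L k = L\<lparr>transition := (\<lambda>i j p. transition L i j p ^ k)\<rparr>"

definition H0 ::
    "('a, 'm::finite) chart set \<Rightarrow> ('a, 'i) line_bundle \<Rightarrow> ('a, 'i) sect set" where
  "H0 A L =
     {s. (\<forall>i. holo_on_mfd A (frame_dom L i) (s i)) \<and>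
         (\<forall>i j. \<forall>p\<in>frame_dom L i \<inter> frame_dom L j. s i p = transition L i j p * s j p) \<and>
         (\<forall>i p. p \<notin> frame_dom L i \<longrightarrow> s i p = 0)}"

definition sect_comb :: "'j set \<Rightarrow> ('j \<Rightarrow> complex) \<Rightarrow> ('j \<Rightarrow> ('a, 'i) sect) \<Rightarrow> ('a, 'i) sect" where
  "sect_comb J c s = (\<lambda>i p. \<Sum>j\<in>J. c j * s j i p)"

definition sect_basis ::
    "('a, 'm::finite) chart set \<Rightarrow> ('a, 'i) line_bundle \<Rightarrow> 'j set \<Rightarrow> ('j \<Rightarrow> ('a, 'i) sect) \<Rightarrow> bool" where
  "sect_basis A L J s \<longleftrightarrow>
     finite J \<and> (\<forall>j\<in>J. s j \<in> H0 A L) \<and>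
     (\<forall>t\<in>H0 A L. \<exists>c. t = sect_comb J c s) \<and>
     (\<forall>c. sect_comb J c s = (\<lambda>i p. 0) \<longrightarrow> (\<forall>j\<in>J. c j = 0))"

text \<open>
  The map \<open>p \<mapsto> [s\<^sub>j(p)]\<^sub>j\<^sub>\<in>\<^sub>J\<close> is a well defined, injective immersion into projective space (hence an
  embedding, the manifold being compact); immersivity is expressed in the affine charts
  \<open>s\<^sub>j / s\<^sub>l\<close> of projective space.
\<close>

definition projective_embedding ::
    "('a, 'm::finite) chart set \<Rightarrow> ('a, 'i) line_bundle \<Rightarrow> 'j set \<Rightarrow> ('j \<Rightarrow> ('a, 'i) sect) \<Rightarrow> bool" where
  "projective_embedding A L J s \<longleftrightarrow>
     (\<forall>i. \<forall>p\<in>frame_dom L i. \<exists>j\<in>J. s j i p \<noteq> 0) \<and>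
     (\<forall>i i'. \<forall>p\<in>frame_dom L i. \<forall>q\<in>frame_dom L i'.
        (\<exists>c. c \<noteq> 0 \<and> (\<forall>j\<in>J. s j i p = c * s j i' q)) \<longrightarrow> p = q) \<and>
     (\<forall>c\<in>A. \<forall>i. \<forall>p\<in>fst c \<inter> frame_dom L i. \<forall>l\<in>J. s l i p \<noteq> 0 \<longrightarrow>
        (\<forall>v. (\<forall>j\<in>J. frechet_derivative (\<lambda>y. s j i (chart_inv c y) / s l i (chart_inv c y))
                      (at (snd c p)) v = 0) \<longrightarrow> v = 0))"

definition ample :: "('a, 'm::finite) chart set \<Rightarrow> ('a, 'i) line_bundle \<Rightarrow> bool" where
  "ample A L \<longleftrightarrow>
     (\<exists>q\<ge>1. \<exists>N::nat. \<exists>s. sect_basis A (bundle_power L q) {..<N} s \<and>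
                         projective_embedding A (bundle_power L q) {..<N} s)"

section \<open>Hermitian metrics, curvature and Kaehler forms\<close>

text \<open>\<open>h i\<close> is the squared norm of the frame \<open>e\<^sub>i\<close>.\<close>

definition hermitian_metric ::
    "('a, 'm::finite) chart set \<Rightarrow> ('a, 'i) line_bundle \<Rightarrow> ('i \<Rightarrow> 'a \<Rightarrow> real) \<Rightarrow> bool" where
  "hermitian_metric A L h \<longleftrightarrow>
     (\<forall>i. smooth_on_mfd A (frame_dom L i) (h i)) \<and>
     (\<forall>i. \<forall>p\<in>frame_dom L i. 0 < h i p) \<and>
     (\<forall>i j. \<forall>p\<in>frame_dom L i \<inter> frame_dom L j. h j p = (cmod (transition L i j p))\<^sup>2 * h i p)"

text \<open>
  The first Chern form \<open>-(i/2\<pi>) ddbar log h\<^sub>i\<close> of the Chern connection, in the chart \<open>c\<close> and the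
  frame \<open>e\<^sub>i\<close>.
\<close>

definition chern_form :: "('i \<Rightarrow> 'a \<Rightarrow> real) \<Rightarrow> 'i \<Rightarrow> ('a, 'm::finite) chart \<Rightarrow> 'm cform" where
  "chern_form h i c y vs =
     - (\<i> / (2 * of_real pi)) * ddbar (\<lambda>y vs. of_real (ln (h i (chart_inv c y)))) y vs"

definition has_curvature ::
    "('a, 'm::finite) chart set \<Rightarrow> ('a, 'i) line_bundle \<Rightarrow> ('i \<Rightarrow> 'a \<Rightarrow> real) \<Rightarrow> ('a, 'm) mform \<Rightarrow> bool" where
  "has_curvature A L h \<omega> \<longleftrightarrow>
     (\<forall>c\<in>A. \<forall>i. \<forall>p\<in>fst c \<inter> frame_dom L i. \<forall>vs. length vs = 2 \<longrightarrow>
        \<omega> c (snd c p) vs = chern_form h i c (snd c p) vs)"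

text \<open>\<open>c\<^sub>1(L) = [\<omega>]\<close> in de Rham cohomology. In particular the class of \<open>\<omega>\<close> is integral.\<close>

definition first_chern_class_is ::
    "('a, 'm::finite) chart set \<Rightarrow> ('a, 'i) line_bundle \<Rightarrow> ('a, 'm) mform \<Rightarrow> bool" where
  "first_chern_class_is A L \<omega> \<longleftrightarrow>
     (\<exists>h \<eta>. hermitian_metric A L h \<and> smooth_form A 1 \<eta> \<and> real_form A 1 \<eta> \<and>
        (\<forall>c\<in>A. \<forall>i. \<forall>p\<in>fst c \<inter> frame_dom L i. \<forall>vs. length vs = 2 \<longrightarrow>
           \<omega> c (snd c p) vs = chern_form h i c (snd c p) vs + form_d (\<eta> c) (snd c p) vs))"

definition kaehler_form :: "('a, 'm::finite) chart set \<Rightarrow> ('a, 'm) mform \<Rightarrow> bool" where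
  "kaehler_form A \<omega> \<longleftrightarrow>
     smooth_form_pq A 1 1 \<omega> \<and> real_form A 2 \<omega> \<and>
     (\<forall>c\<in>A. \<forall>y\<in>snd c ` fst c.
        (\<forall>vs. length vs = 3 \<longrightarrow> form_d (\<omega> c) y vs = 0) \<and>
        (\<forall>v. v \<noteq> 0 \<longrightarrow> Re (\<omega> c y [v, \<i> *s v]) > 0))"

text \<open>The volume form \<open>\<omega>^m / m!\<close>.\<close>

definition volume_form :: "('a, 'm::finite) mform \<Rightarrow> ('a, 'm) mform" where
  "volume_form \<omega> c y vs =
     (\<Sum>\<sigma> | \<sigma> permutes {..<2 * CARD('m)}. of_int (sign \<sigma>) *
        (\<Prod>l<CARD('m). \<omega> c y [vs ! \<sigma> (2 * l), vs ! \<sigma> (2 * l + 1)]))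
     / (2 ^ CARD('m) * fact CARD('m))"

text \<open>The pointwise pairing of two sections does not depend on the chosen frame.\<close>

definition fibre_inner ::
    "('a, 'i) line_bundle \<Rightarrow> ('i \<Rightarrow> 'a \<Rightarrow> real) \<Rightarrow> ('a, 'i) sect \<Rightarrow> ('a, 'i) sect \<Rightarrow> 'a \<Rightarrow> complex" where
  "fibre_inner L h s t p =
     (let i = (SOME i. p \<in> frame_dom L i) in s i p * cnj (t i p) * of_real (h i p))"

definition L2_inner ::
    "('a::topological_space, 'm::finite) chart set \<Rightarrow> ('a, 'i) line_bundle \<Rightarrow> ('i \<Rightarrow> 'a \<Rightarrow> real) \<Rightarrow>
     ('a, 'm) mform \<Rightarrow> ('a, 'i) sect \<Rightarrow> ('a, 'i) sect \<Rightarrow> complex" where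
  "L2_inner A L h \<omega> s t =
     mfd_integral A (\<lambda>c y vs. fibre_inner L h s t (chart_inv c y) * volume_form \<omega> c y vs)"

text \<open>
  The inner product induced on \<open>H\<^sup>0(L\<^sup>k)\<close> by the background data: the metric \<open>h\<^sup>k\<close> and the volume
  form of \<open>\<omega>\<close>.
\<close>

definition background_inner ::
    "('a::topological_space, 'm::finite) chart set \<Rightarrow> ('a, 'i) line_bundle \<Rightarrow> ('i \<Rightarrow> 'a \<Rightarrow> real) \<Rightarrow>
     ('a, 'm) mform \<Rightarrow> nat \<Rightarrow> ('a, 'i) sect \<Rightarrow> ('a, 'i) sect \<Rightarrow> complex" where
  "background_inner A L h \<omega> k = L2_inner A (bundle_power L k) (\<lambda>i p. h i p ^ k) \<omega>"

definition orthonormal_sects ::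
    "(('a, 'i) sect \<Rightarrow> ('a, 'i) sect \<Rightarrow> complex) \<Rightarrow> 'j set \<Rightarrow> ('j \<Rightarrow> ('a, 'i) sect) \<Rightarrow> bool" where
  "orthonormal_sects G J s \<longleftrightarrow> (\<forall>j\<in>J. \<forall>l\<in>J. G (s j) (s l) = (if j = l then 1 else 0))"

section \<open>Currents with local potentials, and weak limits\<close>

definition test_form :: "('a, 'm::finite) chart set \<Rightarrow> ('a, 'm) mform \<Rightarrow> bool" where
  "test_form A \<phi> \<longleftrightarrow> smooth_form_pq A (CARD('m) - 1) (CARD('m) - 1) \<phi>"

text \<open>
  \<open>u i\<close> is a locally integrable function on the domain of the frame \<open>e\<^sub>i\<close>, for instance the log of
  a sum of squared moduli computed in that frame; \<open>u i - u j\<close> need not vanish, but is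
  pluriharmonic in the cases of interest.
  The current \<open>T = ddbar u\<close>, a linear functional on test forms, is determined by
  \<open>T(\<phi>) = \<integral> u\<^sub>i ddbar \<phi>\<close> for test forms \<open>\<phi>\<close> supported in the domain of \<open>e\<^sub>i\<close>, since by a smooth
  partition of unity every test form is a finite sum of such forms. Values of \<open>u i\<close> on null sets,
  such as the convention \<open>ln 0 = 0\<close> on the zero set of sections, play no role.
\<close>

definition loc_integrable_potential ::
    "('a::topological_space, 'm::finite) chart set \<Rightarrow> ('a, 'i) line_bundle \<Rightarrow> ('i \<Rightarrow> 'a \<Rightarrow> real) \<Rightarrow> bool" where
  "loc_integrable_potential A L u \<longleftrightarrow>
     (\<forall>c\<in>A. \<forall>i. \<forall>K. compact K \<and> K \<subseteq> snd c ` (fst c \<inter> frame_dom L i) \<longrightarrow>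
        set_integrable lborel K (\<lambda>y. u i (chart_inv c y)))"

definition is_ddbar_current ::
    "('a::topological_space, 'm::finite) chart set \<Rightarrow> ('a, 'i) line_bundle \<Rightarrow> ('i \<Rightarrow> 'a \<Rightarrow> real) \<Rightarrow>
     (('a, 'm) mform \<Rightarrow> complex) \<Rightarrow> bool" where
  "is_ddbar_current A L u T \<longleftrightarrow>
     loc_integrable_potential A L u \<and>
     (\<forall>\<phi> \<psi> a b. test_form A \<phi> \<and> test_form A \<psi> \<longrightarrow>
        T (\<lambda>c y vs. a * \<phi> c y vs + b * \<psi> c y vs) = a * T \<phi> + b * T \<psi>) \<and>
     (\<forall>i \<phi>. test_form A \<phi> \<and> form_support A (2 * (CARD('m) - 1)) \<phi> \<subseteq> frame_dom L i \<longrightarrow>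
        T \<phi> = mfd_integral A (\<lambda>c y vs. of_real (u i (chart_inv c y)) * ddbar (\<phi> c) y vs))"

text \<open>
  \<open>ddbar (u t) \<rightarrow> ddbar v\<close> weakly as \<open>t \<rightarrow> \<infinity>\<close>; the existence of the currents is part of the claim.
\<close>

definition ddbar_tendsto_weakly ::
    "('a::topological_space, 'm::finite) chart set \<Rightarrow> ('a, 'i) line_bundle \<Rightarrow>
     (real \<Rightarrow> 'i \<Rightarrow> 'a \<Rightarrow> real) \<Rightarrow> ('i \<Rightarrow> 'a \<Rightarrow> real) \<Rightarrow> bool" where
  "ddbar_tendsto_weakly A L u v \<longleftrightarrow>
     (\<forall>t\<ge>0. \<exists>T. is_ddbar_current A L (u t) T) \<and>
     (\<exists>T. is_ddbar_current A L v T) \<and>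
     (\<forall>T T'. (\<forall>t\<ge>0. is_ddbar_current A L (u t) (T t)) \<and> is_ddbar_current A L v T' \<longrightarrow>
        (\<forall>\<phi>. test_form A \<phi> \<longrightarrow> ((\<lambda>t. T t \<phi>) \<longlongrightarrow> T' \<phi>) at_top))"

section \<open>Bergman geodesic rays\<close>

definition unitary_matrix :: "complex^'n^'n \<Rightarrow> bool" where
  "unitary_matrix U \<longleftrightarrow> U ** (\<chi> a b. cnj (U $ b $ a)) = mat 1"

definition rotated_basis ::
    "('n::finite \<Rightarrow> ('a, 'i) sect) \<Rightarrow> complex^'n^'n \<Rightarrow> 'n \<Rightarrow> ('a, 'i) sect" where
  "rotated_basis s U j = (\<lambda>i p. \<Sum>l\<in>UNIV. U $ j $ l * s l i p)"

definition bergman_ray ::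
    "nat \<Rightarrow> ('n::finite \<Rightarrow> ('a, 'i) sect) \<Rightarrow> complex^'n^'n \<Rightarrow> real^'n \<Rightarrow> real \<Rightarrow> 'i \<Rightarrow> 'a \<Rightarrow> real" where
  "bergman_ray k s U \<Lambda> t i p =
     ln (\<Sum>j\<in>UNIV. exp (t * \<Lambda> $ j) * (cmod (rotated_basis s U j i p))\<^sup>2) / real k"

definition log_sum_potential :: "nat \<Rightarrow> 'j set \<Rightarrow> ('j \<Rightarrow> ('a, 'i) sect) \<Rightarrow> 'i \<Rightarrow> 'a \<Rightarrow> real" where
  "log_sum_potential k J \<sigma> i p = ln (\<Sum>j\<in>J. (cmod (\<sigma> j i p))\<^sup>2) / real k"

text \<open>
  By the Poincare-Lelong formula, \<open>ddbar\<close> of this potential is, up to a universal constant, the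
  normalized zero distribution of \<open>\<sigma>\<close>.
\<close>

definition zero_potential :: "nat \<Rightarrow> ('a, 'i) sect \<Rightarrow> 'i \<Rightarrow> 'a \<Rightarrow> real" where
  "zero_potential k \<sigma> i p = ln ((cmod (\<sigma> i p))\<^sup>2) / real k"

definition top_weights :: "real^'n::finite \<Rightarrow> 'n set" where
  "top_weights \<Lambda> = {j. \<Lambda> $ j = Max (range (($) \<Lambda>))}"

definition top_multiplicity :: "real^'n::finite \<Rightarrow> nat" where
  "top_multiplicity \<Lambda> = card (top_weights \<Lambda>)"

end

theory Submission
  imports Defs "HOL-Complex_Analysis.Conformal_Mappings"
begin

text \<open>
  Fix a frame and subtract the constant \<open>t \<lambda> / k\<close>, where \<open>\<lambda>\<close> is the highest weight: off the common
  zeros of the sections of top weight, the potentials of the ray then decrease to the potential of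
  these sections. The latter is locally integrable, being bounded above and bounded below by
  \<open>log |f|\<^sup>2\<close> for a holomorphic \<open>f\<close> that vanishes identically on no open set, so dominated convergence
  applies to the integrals against \<open>ddbar \<phi>\<close>.

  Constants, and the pluriharmonic differences \<open>log |g\<^sub>i\<^sub>j|\<^sup>2\<close> of potentials in two frames, do not
  contribute by Stokes' theorem: with a smooth partition of unity it reduces to integration by parts
  in a single chart, once \<open>ddbar \<phi>\<close> is known to transform as a form of top degree. Hence the local
  potentials define currents.

  Every section that occurs in the last two claims is, up to a constant factor, a row of a unitary
  matrix applied to the basis, because \<open>s\<close> is orthonormal and orthonormal rows can be completed.
\<close>

section \<open>Functions of class \<open>C^k\<close>\<close>

text \<open>Two obstacles shape the proof. The first is that \<open>mfd_integral\<close> rests on an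
  arbitrary Borel partition into chart pieces, while the hypotheses only say how a form changes
  between charts, not how \<open>ddbar\<close> of it does. A direct computation would differentiate
  the pulled back coefficients twice. The transformation law is therefore proved weakly: against a
  bump function both derivatives are moved onto the bump, where only the Levi form of a scalar
  function has to be pulled back, and continuity makes the law pointwise. The second obstacle is
  that ln |f|^2 is singular on the zero set of f. Its integrability comes from a submean inequality
  for the smooth functions ln (|f|^2 + \<epsilon>), averaged with a weight whose shape turns the
  radial derivative of the average into an integral of the Laplacian. The bound is uniform in
  \<epsilon>, and monotone convergence also shows that the zeros form a null set. That a nonzero
  section vanishes on no open set needs the identity theorem and the connectedness of the
  manifold.\<close>

lemma frechet_derivative_cong_on_open:
  assumes "open S" "x \<in> S" "\<And>y. y \<in> S \<Longrightarrow> f y = g y"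
  shows "frechet_derivative f (at x) = frechet_derivative g (at x)"
proof -
  have "(f has_derivative D) (at x) \<longleftrightarrow> (g has_derivative D) (at x)" for D
    using has_derivative_transform_within_open[OF _ assms(1,2)] assms(3) by metis
  then show ?thesis
    unfolding frechet_derivative_def by simp
qed

lemma differentiable_cong_on_open:
  assumes "open S" "x \<in> S" "\<And>y. y \<in> S \<Longrightarrow> f y = g y"
  shows "f differentiable (at x) \<longleftrightarrow> g differentiable (at x)"
  unfolding differentiable_def
  using has_derivative_transform_within_open[OF _ assms(1,2)] assms(3) by metis

lemma frechet_derivative_eq: "(f has_derivative D) (at x) \<Longrightarrow> frechet_derivative f (at x) = D"
  using frechet_derivative_at by metis

lemma Ck_on_cong:
  assumes "open S" "\<And>y. y \<in> S \<Longrightarrow> f y = g y"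
  shows "Ck_on k f S \<longleftrightarrow> Ck_on k g S"
  using assms(2)
proof (induction k arbitrary: f g)
  case 0
  then show ?case by (simp cong: continuous_on_cong)
next
  case (Suc k)
  have "f differentiable (at x) \<longleftrightarrow> g differentiable (at x)" if "x \<in> S" for x
    by (rule differentiable_cong_on_open[OF assms(1) that Suc.prems])
  moreover have "Ck_on k (\<lambda>x. frechet_derivative f (at x) v) S
                  \<longleftrightarrow> Ck_on k (\<lambda>x. frechet_derivative g (at x) v) S" for v
    by (rule Suc.IH) (simp add: frechet_derivative_cong_on_open[OF assms(1) _ Suc.prems])
  ultimately show ?case by simp
qed

lemma Ck_on_SucD:
  assumes "Ck_on (Suc k) f S"
  shows "\<And>x. x \<in> S \<Longrightarrow> (f has_derivative frechet_derivative f (at x)) (at x)"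
    "Ck_on k (\<lambda>x. frechet_derivative f (at x) v) S"
  using assms by (auto simp: frechet_derivative_works)

lemma Ck_on_SucI:
  assumes "open S" "\<And>x. x \<in> S \<Longrightarrow> (f has_derivative f' x) (at x)"
    "\<And>v. Ck_on k (\<lambda>x. f' x v) S"
  shows "Ck_on (Suc k) f S"
proof -
  have "Ck_on k (\<lambda>x. frechet_derivative f (at x) v) S \<longleftrightarrow> Ck_on k (\<lambda>x. f' x v) S" for v
    by (rule Ck_on_cong[OF assms(1)]) (simp add: frechet_derivative_eq[OF assms(2)])
  then show ?thesis
    using assms(2,3) by (auto simp: differentiable_def)
qed

lemma Ck_on_pred: "Ck_on (Suc k) f S \<Longrightarrow> Ck_on k f S"
proof (induction k arbitrary: f)
  case 0
  then show ?case
    by (auto intro!: continuous_at_imp_continuous_on differentiable_imp_continuous_within)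
next
  case (Suc k)
  then show ?case
    by (metis Ck_on.simps(2))
qed

lemma Ck_on_le:
  assumes "l \<le> k" "Ck_on k f S"
  shows "Ck_on l f S"
  using assms
proof (induction rule: dec_induct)
  case (step n)
  from step.IH[OF Ck_on_pred[OF step.prems]] show ?case .
qed

lemma Ck_on_imp_continuous_on: "Ck_on k f S \<Longrightarrow> continuous_on S f"
  using Ck_on_le[of 0 k f S] by simp

lemma Ck_on_subset: "Ck_on k f S \<Longrightarrow> T \<subseteq> S \<Longrightarrow> Ck_on k f T"
  by (induction k arbitrary: f) (auto intro: continuous_on_subset)

lemma Ck_on_locally:
  assumes "\<And>x. x \<in> S \<Longrightarrow> \<exists>T. open T \<and> x \<in> T \<and> Ck_on k f T"
  shows "Ck_on k f S"
  using assms
proof (induction k arbitrary: f)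
  case 0
  then show ?case
    by (metis Ck_on.simps(1) continuous_at_imp_continuous_on continuous_on_eq_continuous_at)
next
  case (Suc k)
  have "f differentiable (at x)" if "x \<in> S" for x
    using Suc.prems[OF that] by auto
  moreover have "Ck_on k (\<lambda>x. frechet_derivative f (at x) v) S" for v
    by (rule Suc.IH) (use Suc.prems in \<open>metis Ck_on.simps(2)\<close>)
  ultimately show ?case by simp
qed

lemma Ck_on_const: "Ck_on k (\<lambda>x. c) S"
  by (induction k arbitrary: c) auto

lemma Ck_on_bounded_linear:
  assumes "open S" "bounded_linear L" "Ck_on k f S"
  shows "Ck_on k (\<lambda>x. L (f x)) S"
  using assms(3)
proof (induction k arbitrary: f)
  case 0
  then show ?case
    using bounded_linear.continuous_on[OF assms(2), of S f] by simp
next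
  case (Suc k)
  show ?case
    by (rule Ck_on_SucI[OF assms(1) bounded_linear.has_derivative[OF assms(2) Ck_on_SucD(1)[OF Suc.prems]]
          Suc.IH[OF Ck_on_SucD(2)[OF Suc.prems]]])
qed

lemma Ck_on_add:
  assumes "open S" "Ck_on k f S" "Ck_on k g S"
  shows "Ck_on k (\<lambda>x. f x + g x) S"
  using assms(2,3)
proof (induction k arbitrary: f g)
  case 0
  then show ?case by (auto intro: continuous_intros)
next
  case (Suc k)
  show ?case
    by (rule Ck_on_SucI[OF assms(1) has_derivative_add[OF Ck_on_SucD(1)[OF Suc.prems(1)]
            Ck_on_SucD(1)[OF Suc.prems(2)]]
          Suc.IH[OF Ck_on_SucD(2)[OF Suc.prems(1)] Ck_on_SucD(2)[OF Suc.prems(2)]]])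
qed

lemma Ck_on_sum:
  assumes "open S" "\<And>i. i \<in> I \<Longrightarrow> Ck_on k (f i) S"
  shows "Ck_on k (\<lambda>x. \<Sum>i\<in>I. f i x) S"
  using assms(2)
  by (induction I rule: infinite_finite_induct) (auto intro!: Ck_on_add Ck_on_const assms(1))

lemma Ck_on_bilinear:
  assumes "open S" "bounded_bilinear B" "Ck_on k f S" "Ck_on k g S"
  shows "Ck_on k (\<lambda>x. B (f x) (g x)) S"
  using assms(3,4)
proof (induction k arbitrary: f g)
  case 0
  then show ?case
    using assms(2) by (auto intro: bounded_bilinear.continuous_on)
next
  case (Suc k)
  show ?case
  proof (rule Ck_on_SucI[OF assms(1)])
    fix x assume "x \<in> S"
    then show "((\<lambda>x. B (f x) (g x)) has_derivative
        (\<lambda>v. B (f x) (frechet_derivative g (at x) v) + B (frechet_derivative f (at x) v) (g x))) (at x)"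
      using bounded_bilinear.FDERIV[OF assms(2) Ck_on_SucD(1)[OF Suc.prems(1)] Ck_on_SucD(1)[OF Suc.prems(2)]]
      by blast
  next
    fix v
    show "Ck_on k (\<lambda>x. B (f x) (frechet_derivative g (at x) v) + B (frechet_derivative f (at x) v) (g x)) S"
      by (intro Ck_on_add assms(1) Suc.IH Ck_on_SucD(2)[OF Suc.prems(1)] Ck_on_SucD(2)[OF Suc.prems(2)]
          Ck_on_pred[OF Suc.prems(1)] Ck_on_pred[OF Suc.prems(2)])
  qed
qed

lemmas Ck_on_scaleR = Ck_on_bilinear[OF _ bounded_bilinear_scaleR]
  and Ck_on_mult = Ck_on_bilinear[OF _ bounded_bilinear_mult]

lemma Ck_on_compose:
  fixes F :: "'x::real_normed_vector \<Rightarrow> 'y::euclidean_space"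
  assumes "open S" "open T" "F ` S \<subseteq> T" "Ck_on k f T" "Ck_on k F S"
  shows "Ck_on k (\<lambda>x. f (F x)) S"
  using assms(4,5)
proof (induction k arbitrary: f)
  case 0
  then show ?case
    using assms(3) by (auto intro: continuous_on_compose2)
next
  case (Suc k)
  \<comment> \<open>The direction F'(x) v in which f is differentiated varies with x, while
    \<open>Ck_on\<close> only speaks of fixed directions. Expanding it in the basis leaves fixed
    directions with coefficients of class C^k.\<close>
  let ?G = "\<lambda>x v. \<Sum>b\<in>Basis. (frechet_derivative F (at x) v \<bullet> b) *\<^sub>R frechet_derivative f (at (F x)) b"
  show ?case
  proof (rule Ck_on_SucI[OF assms(1)])
    fix x assume x: "x \<in> S"
    have f: "(f has_derivative frechet_derivative f (at (F x))) (at (F x))"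
      using Ck_on_SucD(1)[OF Suc.prems(1)] x assms(3) by auto
    have F: "(F has_derivative frechet_derivative F (at x)) (at x)"
      using Ck_on_SucD(1)[OF Suc.prems(2)] x by auto
    have "frechet_derivative f (at (F x)) (frechet_derivative F (at x) v) = ?G x v" for v
    proof -
      have lin: "linear (frechet_derivative f (at (F x)))"
        using f has_derivative_linear by blast
      have "frechet_derivative f (at (F x)) (frechet_derivative F (at x) v) =
         frechet_derivative f (at (F x)) (\<Sum>b\<in>Basis. (frechet_derivative F (at x) v \<bullet> b) *\<^sub>R b)"
        by (simp add: euclidean_representation)
      then show ?thesis
        by (simp add: linear_sum[OF lin] linear_cmul[OF lin])
    qed
    then show "((\<lambda>x. f (F x)) has_derivative ?G x) (at x)"
      using has_derivative_compose[OF F f] by simp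
  next
    fix v
    have "Ck_on k (\<lambda>x. frechet_derivative F (at x) v \<bullet> b) S" for b
      by (rule Ck_on_bounded_linear[OF assms(1) bounded_linear_inner_left])
        (rule Ck_on_SucD(2)[OF Suc.prems(2)])
    then show "Ck_on k (\<lambda>x. ?G x v) S"
      by (intro Ck_on_sum Ck_on_scaleR assms(1)) (auto intro!: Suc.IH Ck_on_SucD(2)[OF Suc.prems(1)] Ck_on_pred[OF Suc.prems(2)])
  qed
qed

text \<open>The derivative of 1/f is again built from 1/f and f', so the induction runs on the order
  alone.\<close>

lemma Ck_on_inverse:
  fixes f :: "'x::real_normed_vector \<Rightarrow> real"
  assumes "open S" "\<And>x. x \<in> S \<Longrightarrow> f x \<noteq> 0" "Ck_on k f S"
  shows "Ck_on k (\<lambda>x. inverse (f x)) S"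
  using assms(3)
proof (induction k)
  case 0
  then show ?case
    using assms(2) by (auto intro: continuous_intros)
next
  case (Suc k)
  show ?case
  proof (rule Ck_on_SucI[OF assms(1)])
    fix x assume x: "x \<in> S"
    show "((\<lambda>x. inverse (f x)) has_derivative (\<lambda>v. (-1) * (inverse (f x) * frechet_derivative f (at x) v * inverse (f x)))) (at x)"
      using Deriv.has_derivative_inverse[OF assms(2)[OF x] Ck_on_SucD(1)[OF Suc.prems x]] by simp
  next
    fix v
    show "Ck_on k (\<lambda>x. (-1) * (inverse (f x) * frechet_derivative f (at x) v * inverse (f x))) S"
      using Suc.IH[OF Ck_on_pred[OF Suc.prems]] Ck_on_SucD(2)[OF Suc.prems]
      by (intro Ck_on_mult assms(1) Ck_on_const)
  qed
qed

lemma Ck_on_linear: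
  assumes "open S" "bounded_linear L"
  shows "Ck_on k L S"
proof (cases k)
  case 0
  then show ?thesis using assms by (auto intro: linear_continuous_on)
next
  case (Suc l)
  show ?thesis unfolding Suc
    by (rule Ck_on_SucI[OF assms(1)]) (auto intro: bounded_linear_imp_has_derivative assms Ck_on_const)
qed

text \<open>The functions \<open>t^(-n) exp(-1/t)\<close>, extended by zero, are closed under differentiation up to
  linear combinations.\<close>

definition flat_exp :: "nat \<Rightarrow> real \<Rightarrow> real" where
  "flat_exp n t = (if t > 0 then exp (- inverse t) * inverse t ^ n else 0)"

text \<open>Under t = 1/s the limit from the right becomes that of s^n / exp s at infinity; from the
  left the function is zero.\<close>

lemma flat_exp_tendsto_0: "(flat_exp n \<longlongrightarrow> 0) (at 0)"
proof -
  have "((\<lambda>x. x ^ n / exp x) \<longlongrightarrow> (0::real)) at_top"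
    by (rule tendsto_power_div_exp_0)
  then have "((\<lambda>t. inverse t ^ n / exp (inverse t)) \<longlongrightarrow> (0::real)) (at_right 0)"
    using filterlim_compose filterlim_inverse_at_top_right by fast
  moreover have "\<forall>\<^sub>F t in at_right 0. inverse t ^ n / exp (inverse t) = flat_exp n t"
    by (rule eventually_at_rightI[of 0 1]) (auto simp: flat_exp_def exp_minus field_simps)
  ultimately have R: "(flat_exp n \<longlongrightarrow> 0) (at_right 0)"
    using tendsto_cong by force
  have "\<forall>\<^sub>F t in at_left 0. flat_exp n t = 0"
    by (rule eventually_at_leftI[of "-1"]) (auto simp: flat_exp_def)
  then have L: "(flat_exp n \<longlongrightarrow> 0) (at_left 0)"
    by (simp add: tendsto_eventually)
  show ?thesis
    using L R filterlim_split_at by blast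
qed

text \<open>At 0 the difference quotient of \<open>flat_exp n\<close> is exactly
  \<open>flat_exp (Suc n)\<close>, which tends to 0 there, so the gluing point needs no separate
  estimate.\<close>

lemma flat_exp_has_derivative:
  "(flat_exp n has_field_derivative (flat_exp (n + 2) t - real n * flat_exp (Suc n) t)) (at t)"
proof -
  consider "t > 0" | "t < 0" | "t = 0" by linarith
  then show ?thesis
  proof cases
    case 1
    have "((\<lambda>t. exp (- inverse t) * inverse t ^ n) has_field_derivative
        (flat_exp (n + 2) t - real n * flat_exp (Suc n) t)) (at t)"
      using 1
      apply (auto intro!: derivative_eq_intros simp: flat_exp_def)
      apply (cases n)
       apply (auto simp: field_simps power2_eq_square)
      done
    then show ?thesis
      by (rule has_field_derivative_transform_within_open[where S="{0<..}"]) (use 1 in \<open>auto simp: flat_exp_def\<close>)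
  next
    case 2
    have "((\<lambda>t. 0) has_field_derivative (flat_exp (n + 2) t - real n * flat_exp (Suc n) t)) (at t)"
      using 2 by (simp add: flat_exp_def)
    then show ?thesis
      by (rule has_field_derivative_transform_within_open[where S="{..<0}"]) (use 2 in \<open>auto simp: flat_exp_def\<close>)
  next
    case 3
    have "(\<lambda>y. (flat_exp n y - flat_exp n 0) / (y - 0)) = flat_exp (Suc n)"
      by (simp add: flat_exp_def fun_eq_iff divide_inverse)
    moreover have "flat_exp (n + 2) 0 - real n * flat_exp (Suc n) 0 = 0"
      by (simp add: flat_exp_def)
    ultimately show ?thesis
      using flat_exp_tendsto_0[of "Suc n"] 3
      by (simp only: has_field_derivative_iff)
  qed
qed

lemma Ck_on_flat_exp: "Ck_on k (flat_exp n) UNIV"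
proof (induction k arbitrary: n)
  case 0
  show ?case
    using flat_exp_has_derivative by (auto intro!: DERIV_continuous_on)
next
  case (Suc k)
  show ?case
  proof (rule Ck_on_SucI)
    show "(flat_exp n has_derivative (\<lambda>v. v * (flat_exp (n + 2) t + (- real n) * flat_exp (Suc n) t))) (at t)" for t
      by (rule has_derivative_eq_rhs[OF flat_exp_has_derivative[of n t, unfolded has_field_derivative_def]])
        (simp add: fun_eq_iff mult.commute)
    show "Ck_on k (\<lambda>x. v * (flat_exp (n + 2) x + - real n * flat_exp (Suc n) x)) UNIV" for v
      by (intro Ck_on_mult Ck_on_add Ck_on_const Suc.IH open_UNIV)
  qed simp
qed

text \<open>The squared distance is smooth also at the centre, and for r > 0 the argument of
  \<open>flat_exp\<close> is positive exactly inside the ball. Hence the bump is smooth everywhere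
  and positive exactly there.\<close>

definition bump :: "'x::euclidean_space \<Rightarrow> real \<Rightarrow> 'x \<Rightarrow> real" where
  "bump a r x = flat_exp 0 (r\<^sup>2 - (x - a) \<bullet> (x - a))"

lemma Ck_on_bump: "Ck_on k (bump a r) UNIV"
proof -
  have id: "Ck_on k (\<lambda>x. x - a) UNIV" for a :: 'a
    using Ck_on_add[OF open_UNIV Ck_on_linear[OF open_UNIV bounded_linear_ident] Ck_on_const[of k "-a"]]
    by simp
  have "Ck_on k (\<lambda>x. r\<^sup>2 + (-1) * ((x - a) \<bullet> (x - a))) UNIV"
    by (intro Ck_on_add Ck_on_mult Ck_on_const open_UNIV Ck_on_bilinear[OF _ bounded_bilinear_inner] id)
  then show ?thesis
    unfolding bump_def[abs_def]
    by (intro Ck_on_compose[OF open_UNIV open_UNIV _ Ck_on_flat_exp]) auto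
qed

lemma bump_nonneg: "0 \<le> bump a r x"
  by (auto simp: bump_def flat_exp_def)

lemma bump_pos_iff: "r > 0 \<Longrightarrow> 0 < bump a r x \<longleftrightarrow> x \<in> ball a r"
proof -
  assume "r > 0"
  have "(x - a) \<bullet> (x - a) < r\<^sup>2 \<longleftrightarrow> norm (x - a) < r"
    using \<open>r > 0\<close> power_strict_mono[of "norm (x - a)" r 2] power2_less_imp_less[of "norm (x - a)" r]
    by (auto simp: dot_square_norm)
  then show ?thesis
    by (auto simp: bump_def flat_exp_def dist_norm norm_minus_commute)
qed

lemma bump_eq_0: "r > 0 \<Longrightarrow> x \<notin> ball a r \<Longrightarrow> bump a r x = 0"
  using bump_pos_iff[of r a x] bump_nonneg[of a r x] by simp

section \<open>Wirtinger derivatives and holomorphic functions of several variables\<close>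

lemma norm_vector_smult: "norm (c *s (v :: complex^'m::finite)) = cmod c * norm v"
  by (simp add: norm_vec_def norm_mult L2_set_right_distrib)

lemma of_real_vector_smult: "complex_of_real r *s v = r *\<^sub>R (v :: complex^'m::finite)"
  by (simp add: vec_eq_iff) (simp add: scaleR_conv_of_real)

lemma vector_smult_add: "c *s (v + w) = c *s v + c *s (w :: complex^'m::finite)"
  by (simp add: vec_eq_iff algebra_simps)

lemma vector_smult_scaleR: "c *s (r *\<^sub>R v) = r *\<^sub>R (c *s (v :: complex^'m::finite))"
  by (simp add: vec_eq_iff)

lemma bounded_linear_vector_smult_left: "bounded_linear (\<lambda>c. c *s (v :: complex^'m::finite))"
  by (rule bounded_linear_intro[of _ "norm v"])
    (auto simp: vec_eq_iff algebra_simps norm_vector_smult)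

lemma continuous_on_vector_smult [continuous_intros]:
  fixes v :: "complex^'m::finite"
  assumes "continuous_on S f"
  shows "continuous_on S (\<lambda>t. f t *s v)"
  using bounded_linear.continuous_on[OF bounded_linear_vector_smult_left assms] .

lemma holo_fun_onD:
  assumes "holo_fun_on f S" "x \<in> S"
  shows "(f has_derivative frechet_derivative f (at x)) (at x)"
    "frechet_derivative f (at x) (c *s v) = c * frechet_derivative f (at x) v"
proof -
  obtain D where D: "(f has_derivative D) (at x)" "\<And>c v. D (c *s v) = c * D v"
    using assms unfolding holo_fun_on_def by auto
  with frechet_derivative_eq[OF D(1)]
  show "(f has_derivative frechet_derivative f (at x)) (at x)"
    "frechet_derivative f (at x) (c *s v) = c * frechet_derivative f (at x) v"
    by simp_all
qed

lemma holo_fun_on_imp_continuous_on: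
  assumes "holo_fun_on f S"
  shows "continuous_on S f"
  by (rule continuous_at_imp_continuous_on, rule ballI, rule has_derivative_continuous, rule holo_fun_onD(1)[OF assms])

lemma holo_fun_on_subset: "holo_fun_on f S \<Longrightarrow> T \<subseteq> S \<Longrightarrow> holo_fun_on f T"
  unfolding holo_fun_on_def by blast

lemma holo_fun_on_const: "holo_fun_on (\<lambda>x. c) S"
  unfolding holo_fun_on_def by (auto intro!: exI[of _ "\<lambda>v. 0"])

lemma holo_fun_on_nth: "holo_fun_on (\<lambda>x. x $ a) S"
  unfolding holo_fun_on_def
  by (auto intro!: exI[of _ "\<lambda>x. x $ a"] bounded_linear_imp_has_derivative bounded_linear_vec_nth)

lemma holo_fun_on_add:
  assumes "holo_fun_on f S" "holo_fun_on g S"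
  shows "holo_fun_on (\<lambda>x. f x + g x) S"
  unfolding holo_fun_on_def
proof
  fix x assume x: "x \<in> S"
  from has_derivative_add[OF holo_fun_onD(1)[OF assms(1) x] holo_fun_onD(1)[OF assms(2) x]]
  show "\<exists>D. ((\<lambda>x. f x + g x) has_derivative D) (at x) \<and> (\<forall>c v. D (c *s v) = c * D v)"
    by (intro exI conjI allI, assumption)
      (simp add: holo_fun_onD(2)[OF assms(1) x] holo_fun_onD(2)[OF assms(2) x] algebra_simps)
qed

lemma holo_fun_on_mult:
  assumes "holo_fun_on f S" "holo_fun_on g S"
  shows "holo_fun_on (\<lambda>x. f x * g x) S"
  unfolding holo_fun_on_def
proof
  fix x assume x: "x \<in> S"
  from has_derivative_mult[OF holo_fun_onD(1)[OF assms(1) x] holo_fun_onD(1)[OF assms(2) x]]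
  show "\<exists>D. ((\<lambda>x. f x * g x) has_derivative D) (at x) \<and> (\<forall>c v. D (c *s v) = c * D v)"
    by (intro exI conjI allI, assumption)
      (simp add: holo_fun_onD(2)[OF assms(1) x] holo_fun_onD(2)[OF assms(2) x] algebra_simps)
qed

lemma holo_fun_on_sum:
  "(\<And>i. i \<in> I \<Longrightarrow> holo_fun_on (f i) S) \<Longrightarrow> holo_fun_on (\<lambda>x. \<Sum>i\<in>I. f i x) S"
  by (induction I rule: infinite_finite_induct) (auto intro: holo_fun_on_add holo_fun_on_const)

lemma holo_fun_on_outer_compose:
  assumes "holo_fun_on f S" "g holomorphic_on T" "open T" "f ` S \<subseteq> T"
  shows "holo_fun_on (\<lambda>x. g (f x)) S"
  unfolding holo_fun_on_def
proof
  fix x assume x: "x \<in> S"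
  then have "(g has_derivative (*) (deriv g (f x))) (at (f x))"
    using holomorphic_derivI[OF assms(2,3)] assms(4) by (auto simp: has_field_derivative_def)
  from has_derivative_compose[OF holo_fun_onD(1)[OF assms(1) x] this]
  show "\<exists>D. ((\<lambda>x. g (f x)) has_derivative D) (at x) \<and> (\<forall>c v. D (c *s v) = c * D v)"
    by (intro exI conjI allI, assumption) (simp add: holo_fun_onD(2)[OF assms(1) x])
qed

lemma bounded_linear_axis: "bounded_linear (axis a :: 'y::real_normed_vector \<Rightarrow> 'y^'m::finite)"
proof (rule bounded_linear_intro[of _ 1])
  fix y :: 'y
  have "(norm ((axis a y :: 'y^'m) $ i))\<^sup>2 = (if i = a then (norm y)\<^sup>2 else 0)" for i
    by (simp add: axis_def)
  then show "norm (axis a y :: 'y^'m) \<le> norm y * 1"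
    by (simp add: norm_vec_def L2_set_def)
qed (simp_all add: vec_eq_iff axis_def)

lemma vec_eq_sum_axis: "(\<Sum>a\<in>UNIV. axis a (y $ a)) = (y :: 'y::real_normed_vector^'m::finite)"
  by (simp add: vec_eq_iff axis_def if_distrib cong: if_cong)

lemma has_derivative_vec:
  fixes F :: "'x::real_normed_vector \<Rightarrow> 'y::real_normed_vector^'m::finite"
  assumes "\<And>a. ((\<lambda>x. F x $ a) has_derivative D a) (at x)"
  shows "(F has_derivative (\<lambda>v. \<chi> a. D a v)) (at x)"
proof -
  have "((\<lambda>x. \<Sum>a\<in>UNIV. axis a (F x $ a)) has_derivative (\<lambda>v. \<Sum>a\<in>UNIV. axis a (D a v))) (at x)"
    by (intro has_derivative_sum bounded_linear.has_derivative[OF bounded_linear_axis] assms)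
  moreover have "(\<lambda>v. \<Sum>a\<in>UNIV. axis a (D a v)) = (\<lambda>v. \<chi> a. D a v)"
    by (simp add: vec_eq_iff fun_eq_iff axis_def if_distrib cong: if_cong)
  ultimately show ?thesis
    by (simp add: vec_eq_sum_axis)
qed

lemma holo_map_onD:
  assumes "holo_map_on F S" "x \<in> S"
  shows "(F has_derivative frechet_derivative F (at x)) (at x)"
    "frechet_derivative F (at x) (c *s v) = c *s frechet_derivative F (at x) v"
    "frechet_derivative F (at x) v $ a = frechet_derivative (\<lambda>x. F x $ a) (at x) v"
proof -
  let ?D = "\<lambda>v. \<chi> a. frechet_derivative (\<lambda>x. F x $ a) (at x) v"
  have a: "holo_fun_on (\<lambda>x. F x $ a) S" for a
    using assms(1) by (simp add: holo_map_on_def)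
  have D: "(F has_derivative ?D) (at x)"
    by (rule has_derivative_vec) (rule holo_fun_onD(1)[OF a assms(2)])
  have eq: "frechet_derivative F (at x) = ?D"
    using frechet_derivative_eq[OF D] .
  show "(F has_derivative frechet_derivative F (at x)) (at x)"
    using D eq by simp
  show "frechet_derivative F (at x) (c *s v) = c *s frechet_derivative F (at x) v"
    unfolding eq using holo_fun_onD(2)[OF a assms(2)] by (simp add: vec_eq_iff)
  show "frechet_derivative F (at x) v $ a = frechet_derivative (\<lambda>x. F x $ a) (at x) v"
    unfolding eq by simp
qed

lemma holo_fun_on_compose:
  assumes "holo_fun_on f T" "holo_map_on F S" "F ` S \<subseteq> T"
  shows "holo_fun_on (\<lambda>x. f (F x)) S"
  unfolding holo_fun_on_def
proof
  fix x assume x: "x \<in> S"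
  then have "F x \<in> T" using assms(3) by auto
  from has_derivative_compose[OF holo_map_onD(1)[OF assms(2) x] holo_fun_onD(1)[OF assms(1) this]]
  show "\<exists>D. ((\<lambda>x. f (F x)) has_derivative D) (at x) \<and> (\<forall>c v. D (c *s v) = c * D v)"
    by (intro exI conjI allI, assumption)
      (simp add: holo_fun_onD(2)[OF assms(1) \<open>F x \<in> T\<close>] holo_map_onD(2)[OF assms(2) x])
qed

section \<open>Cauchy's integral formula along complex lines, and smoothness of holomorphic
  functions\<close>

lemma holo_fun_on_line:
  assumes "holo_fun_on f S" "x + z *s v \<in> S"
  shows "((\<lambda>z. f (x + z *s v)) has_field_derivative frechet_derivative f (at (x + z *s v)) v) (at z)"
proof -
  have "((\<lambda>z. x + z *s v) has_derivative (\<lambda>z. z *s v)) (at z)"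
    by (auto intro!: derivative_eq_intros bounded_linear_imp_has_derivative bounded_linear_vector_smult_left)
  from has_derivative_compose[OF this holo_fun_onD(1)[OF assms]]
  show ?thesis
    unfolding has_field_derivative_def
    by (rule has_derivative_eq_rhs) (simp add: holo_fun_onD(2)[OF assms] fun_eq_iff mult.commute)
qed

text \<open>Cauchy's formula for the derivative at 0 of the one-variable function z |-> f (x + z v).
  The contour is the unit circle and v is not normalised, so 1/w^2 times dw/dt leaves only exp (-2
  pi i t) and no radius enters.\<close>

lemma holo_fun_on_Cauchy:
  assumes "holo_fun_on f S" "\<And>z. cmod z \<le> 1 \<Longrightarrow> x + z *s v \<in> S"
  shows "frechet_derivative f (at x) v =
    integral (cbox 0 1) (\<lambda>t. f (x + exp (2 * of_real pi * \<i> * of_real t) *s v) * exp (- (2 * of_real pi * \<i> * of_real t)))"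
proof -
  let ?g = "\<lambda>z. f (x + z *s v)"
  have D: "(?g has_field_derivative frechet_derivative f (at (x + z *s v)) v) (at z)"
    if "cmod z \<le> 1" for z
    using holo_fun_on_line[OF assms(1) assms(2)[OF that]] .
  have hol: "?g holomorphic_on ball 0 1"
    unfolding holomorphic_on_def field_differentiable_def
    using has_field_derivative_at_within[OF D] by (meson less_imp_le mem_ball_0)
  have cont: "continuous_on (cball 0 1) ?g"
    by (rule DERIV_continuous_on, rule has_field_derivative_at_within, rule D) simp
  have "(2 * of_real pi * \<i>) * frechet_derivative f (at x) v
      = contour_integral (circlepath 0 1) (\<lambda>u. ?g u / (u - 0)\<^sup>2)"
    using Cauchy_contour_integral_circlepath_2[OF cont hol, of 0] DERIV_imp_deriv[OF D[of 0]] by simp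
  also have "\<dots> = integral {0..1} (\<lambda>t. (2 * of_real pi * \<i>) *
      (f (x + exp (2 * of_real pi * \<i> * of_real t) *s v) * exp (- (2 * of_real pi * \<i> * of_real t))))"
    unfolding contour_integral_integral vector_derivative_circlepath
  proof (rule integral_cong, goal_cases)
    case (1 t)
    have E: "?g w / w\<^sup>2 * (2 * of_real pi * \<i> * w) = 2 * of_real pi * \<i> * (?g w * inverse w)"
      if "w \<noteq> 0" for w
      using that by (simp add: power2_eq_square divide_inverse)
    show ?case
      using E[of "exp (2 * of_real pi * \<i> * of_real t)"] by (simp add: circlepath exp_minus)
  qed
  also have "\<dots> = (2 * of_real pi * \<i>) * integral {0..1} (\<lambda>t.
      f (x + exp (2 * of_real pi * \<i> * of_real t) *s v) * exp (- (2 * of_real pi * \<i> * of_real t)))"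
    by (rule integral_mult_right)
  finally show ?thesis by simp
qed

text \<open>The point is uniformity: v is scaled down to u so that the discs y + z u stay in S for
  all y near x. Near x the derivative thus becomes a parameter integral over a fixed
  interval.\<close>

lemma holo_fun_on_Cauchy_local:
  fixes f :: "complex^'m::finite \<Rightarrow> complex"
  assumes "open S" "holo_fun_on f S" "x \<in> S"
  obtains d r u where "d > 0"
    "\<And>y z. y \<in> ball x d \<Longrightarrow> cmod z \<le> 1 \<Longrightarrow> y + z *s u \<in> S"
    "\<And>y. y \<in> ball x d \<Longrightarrow> frechet_derivative f (at y) v = of_real r *
       integral (cbox 0 1) (\<lambda>t. f (y + exp (2 * of_real pi * \<i> * of_real t) *s u) *
          exp (- (2 * of_real pi * \<i> * of_real t)))"
proof -
  obtain e where e: "e > 0" "ball x e \<subseteq> S"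
    using assms(1,3) open_contains_ball by blast
  define d where "d = e / 2"
  \<comment> \<open>The summand 1 keeps r positive when v = 0; this size of r gives |u| \<le>
    d.\<close>
  define r where "r = (norm v + 1) / d"
  define u where "u = (1 / r) *\<^sub>R v"
  have d: "d > 0" using e by (simp add: d_def)
  have r: "r > 0"
    unfolding r_def using d by (intro divide_pos_pos) (auto intro: add_nonneg_pos)
  have "norm u = norm v / r" using r by (simp add: u_def)
  also have "\<dots> \<le> d"
    using d r by (simp add: r_def field_simps)
  finally have u: "norm u \<le> d" .
  have mem: "y + z *s u \<in> S" if "y \<in> ball x d" "cmod z \<le> 1" for y z
  proof -
    have "norm (z *s u) \<le> 1 * d"
      unfolding norm_vector_smult by (rule mult_mono) (use u that in auto)
    then have "norm ((y - x) + z *s u) < d + d"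
      using that(1) norm_triangle_ineq[of "y - x" "z *s u"] by (simp add: dist_norm norm_minus_commute)
    then show ?thesis
      using e(2) by (auto simp: dist_norm norm_minus_commute subset_iff d_def algebra_simps)
  qed
  show ?thesis
  proof
    fix y assume y: "y \<in> ball x d"
    then have yS: "y \<in> S" using mem[OF y, of 0] by simp
    have "v = of_real r *s u"
      using r by (simp add: u_def of_real_vector_smult)
    then have "frechet_derivative f (at y) v = of_real r * frechet_derivative f (at y) u"
      using holo_fun_onD(2)[OF assms(2) yS, of "of_real r" u] by simp
    then show "frechet_derivative f (at y) v = of_real r *
       integral (cbox 0 1) (\<lambda>t. f (y + exp (2 * of_real pi * \<i> * of_real t) *s u) *
          exp (- (2 * of_real pi * \<i> * of_real t)))"
      using holo_fun_on_Cauchy[OF assms(2) mem[OF y]] by simp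
  qed (use d mem in auto)
qed

text \<open>Complex differentiability is assumed only pointwise, so continuity of the derivative has
  to be extracted from the Cauchy integral before differentiation under the integral sign becomes
  available.\<close>

lemma frechet_derivative_holo_continuous_on:
  assumes "open S" "holo_fun_on f S"
  shows "continuous_on S (\<lambda>x. frechet_derivative f (at x) v)"
proof (rule continuous_at_imp_continuous_on, rule ballI)
  fix x assume x: "x \<in> S"
  let ?h = "\<lambda>u y t. f (y + exp (2 * of_real pi * \<i> * of_real t) *s u) * exp (- (2 * of_real pi * \<i> * of_real t))"
  obtain d u r where d: "d > 0"
    and mem: "\<And>y z. y \<in> ball x d \<Longrightarrow> cmod z \<le> 1 \<Longrightarrow> y + z *s u \<in> S"
    and eq: "\<And>y. y \<in> ball x d \<Longrightarrow> frechet_derivative f (at y) v = of_real r * integral (cbox 0 1) (?h u y)"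
    by (rule holo_fun_on_Cauchy_local[OF assms x, of v]) (rule that, assumption+)
  have "continuous_on (ball x d \<times> cbox 0 1) (\<lambda>(y, t). ?h u y t)"
    unfolding split_def
    by (intro continuous_intros continuous_on_compose2[OF holo_fun_on_imp_continuous_on[OF assms(2)]])
      (auto intro!: mem)
  then have "continuous_on (ball x d) (\<lambda>y. of_real r * integral (cbox 0 1) (?h u y))"
    by (intro continuous_intros integral_continuous_on_param)
  then have "continuous_on (ball x d) (\<lambda>y. frechet_derivative f (at y) v)"
    by (rule continuous_on_eq) (simp only: eq)
  then show "isCont (\<lambda>y. frechet_derivative f (at y) v) x"
    using d by (simp add: continuous_on_eq_continuous_at)
qed

text \<open>Differentiating the Cauchy integral in its base point gives an integral of derivatives
  of f, and complex linearity passes through the integral.\<close>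

lemma holo_fun_on_frechet_derivative:
  fixes f :: "complex^'m::finite \<Rightarrow> complex"
  assumes "open S" "holo_fun_on f S"
  shows "holo_fun_on (\<lambda>x. frechet_derivative f (at x) v) S"
  unfolding holo_fun_on_def
proof
  fix x assume x: "x \<in> S"
  let ?e = "\<lambda>t. exp (2 * of_real pi * \<i> * of_real t) :: complex"
  obtain d u r where d: "d > 0"
    and mem: "\<And>y z. y \<in> ball x d \<Longrightarrow> cmod z \<le> 1 \<Longrightarrow> y + z *s u \<in> S"
    and eq: "\<And>y. y \<in> ball x d \<Longrightarrow> frechet_derivative f (at y) v = of_real r *
       integral (cbox 0 1) (\<lambda>t. f (y + ?e t *s u) * exp (- (2 * of_real pi * \<i> * of_real t)))"
    by (rule holo_fun_on_Cauchy_local[OF assms x, of v]) (rule that, assumption+)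
  let ?h = "\<lambda>y t. f (y + ?e t *s u) * exp (- (2 * of_real pi * \<i> * of_real t))"
  \<comment> \<open>Differentiation under the integral takes the derivative as a continuous function
    into bounded linear maps; on \<open>ball x d\<close> this wrapper has the expected
    values.\<close>
  define h' where "h' y t = Blinfun (\<lambda>w. frechet_derivative f (at (y + ?e t *s u)) w * exp (- (2 * of_real pi * \<i> * of_real t)))"
    for y :: "complex^'m" and t :: real
  have h': "blinfun_apply (h' y t) = (\<lambda>w. frechet_derivative f (at (y + ?e t *s u)) w * exp (- (2 * of_real pi * \<i> * of_real t)))"
    if "y \<in> ball x d" for y t
    unfolding h'_def
    by (rule bounded_linear_Blinfun_apply, rule bounded_linear_mult_const,
        rule has_derivative_bounded_linear, rule holo_fun_onD(1)[OF assms(2) mem[OF that]]) simp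
  have h_deriv: "((\<lambda>y. ?h y t) has_derivative blinfun_apply (h' y t)) (at y within ball x d)"
    if "y \<in> ball x d" for y t
  proof -
    have "((\<lambda>y. y + ?e t *s u) has_derivative (\<lambda>w. w)) (at y)"
      by (auto intro!: derivative_eq_intros)
    moreover have "(f has_derivative frechet_derivative f (at (y + ?e t *s u))) (at (y + ?e t *s u))"
      by (rule holo_fun_onD(1)[OF assms(2) mem[OF that]]) simp
    ultimately have "((\<lambda>y. f (y + ?e t *s u)) has_derivative (\<lambda>w. frechet_derivative f (at (y + ?e t *s u)) w)) (at y)"
      by (rule has_derivative_compose)
    from has_derivative_mult_left[OF this] show ?thesis
      unfolding h'[OF that] by (rule has_derivative_at_withinI)
  qed
  have cont_h: "continuous_on (ball x d \<times> cbox 0 1) (\<lambda>(y, t). ?h y t)"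
    unfolding split_def
    by (intro continuous_intros continuous_on_compose2[OF holo_fun_on_imp_continuous_on[OF assms(2)]])
      (auto intro!: mem)
  have int_h: "?h y integrable_on cbox 0 1" if "y \<in> ball x d" for y
    by (rule integrable_continuous, rule continuous_on_compose2[OF cont_h, where f="\<lambda>t. (y, t)", simplified])
      (use that in \<open>auto intro!: continuous_intros\<close>)
  have cont_h': "continuous_on (ball x d \<times> cbox 0 1) (\<lambda>(y, t). h' y t)"
  proof (rule continuous_on_blinfun_componentwise)
    fix i :: "complex^'m"
    have "continuous_on (ball x d \<times> cbox 0 1) (\<lambda>p. frechet_derivative f (at (fst p + ?e (snd p) *s u)) i * exp (- (2 * of_real pi * \<i> * of_real (snd p))))"
      by (intro continuous_intros continuous_on_compose2[OF frechet_derivative_holo_continuous_on[OF assms]])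
        (auto intro!: mem)
    then show "continuous_on (ball x d \<times> cbox 0 1) (\<lambda>p. blinfun_apply (case p of (y, t) \<Rightarrow> h' y t) i)"
      by (rule continuous_on_eq) (auto simp: h')
  qed
  have "((\<lambda>y. integral (cbox 0 1) (?h y)) has_derivative integral (cbox 0 1) (h' x)) (at x within ball x d)"
    by (rule leibniz_rule[OF h_deriv int_h cont_h']) (use d in auto)
  then have "((\<lambda>y. integral (cbox 0 1) (?h y)) has_derivative integral (cbox 0 1) (h' x)) (at x)"
    using d at_within_open[of x "ball x d"] by simp
  then have "((\<lambda>y. of_real r * integral (cbox 0 1) (?h y)) has_derivative (\<lambda>w. of_real r * integral (cbox 0 1) (h' x) w)) (at x)"
    by (rule has_derivative_mult_right)
  then have "((\<lambda>y. frechet_derivative f (at y) v) has_derivative (\<lambda>w. of_real r * integral (cbox 0 1) (h' x) w)) (at x)"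
    by (rule has_derivative_transform_within_open[OF _ open_ball[of x d]]) (use d in \<open>simp_all add: eq\<close>)
  moreover have "integral (cbox 0 1) (h' x) (c *s w) = c * integral (cbox 0 1) (h' x) w" for c w
  proof -
    have "h' x integrable_on cbox 0 1"
    proof (rule integrable_continuous)
      have "continuous_on (cbox 0 1) (\<lambda>t. (\<lambda>(y, t). h' y t) (x, t))"
        by (rule continuous_on_compose2[OF cont_h']) (use d in \<open>auto intro!: continuous_intros\<close>)
      then show "continuous_on (cbox 0 1) (h' x)" by simp
    qed
    then have 1: "integral (cbox 0 1) (h' x) w = integral (cbox 0 1) (\<lambda>t. h' x t w)" for w
      by (rule blinfun_apply_integral)
    have x: "x \<in> ball x d" using d by simp
    have "h' x t (c *s w) = c * h' x t w" for t
      unfolding h'[OF x] using holo_fun_onD(2)[OF assms(2) mem[OF x], of "?e t" c w] by simp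
    then show ?thesis
      unfolding 1 by (simp only: integral_mult_right)
  qed
  ultimately show "\<exists>D. ((\<lambda>y. frechet_derivative f (at y) v) has_derivative D) (at x) \<and> (\<forall>c v. D (c *s v) = c * D v)"
    by (intro exI conjI allI) (assumption, simp add: mult.left_commute)
qed

text \<open>The induction is fed by \<open>holo_fun_on_frechet_derivative\<close>: derivatives in
  fixed directions are again holomorphic.\<close>

lemma holo_fun_on_imp_Ck_on:
  assumes "open S" "holo_fun_on f S"
  shows "Ck_on k f S"
  using assms(2)
proof (induction k arbitrary: f)
  case 0
  then show ?case by (simp add: holo_fun_on_imp_continuous_on)
next
  case (Suc k)
  show ?case
    by (rule Ck_on_SucI[OF assms(1) holo_fun_onD(1)[OF Suc.prems]
          Suc.IH[OF holo_fun_on_frechet_derivative[OF assms(1) Suc.prems]]])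
qed

lemma Ck_on_vec:
  fixes F :: "'x::real_normed_vector \<Rightarrow> 'y::real_normed_vector^'m::finite"
  assumes "open S" "\<And>a. Ck_on k (\<lambda>x. F x $ a) S"
  shows "Ck_on k F S"
proof -
  have "Ck_on k (\<lambda>x. \<Sum>a\<in>UNIV. axis a (F x $ a)) S"
    by (intro Ck_on_sum assms Ck_on_bounded_linear[OF _ bounded_linear_axis])
  then show ?thesis by (simp add: vec_eq_sum_axis)
qed

lemma holo_map_on_imp_Ck_on:
  assumes "open S" "holo_map_on F S"
  shows "Ck_on k F S"
  using assms by (intro Ck_on_vec holo_fun_on_imp_Ck_on) (auto simp: holo_map_on_def)

section \<open>Wirtinger derivatives\<close>

lemma wirt_eqI:
  assumes "(f has_derivative D) (at x)"
  shows "wirt_del v f x = (D v - \<i> * D (\<i> *s v)) / 2"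
    and "wirt_dbar v f x = (D v + \<i> * D (\<i> *s v)) / 2"
  using frechet_derivative_eq[OF assms] by (simp_all add: wirt_del_def wirt_dbar_def)

lemma wirt_cong:
  assumes "open S" "x \<in> S" "\<And>y. y \<in> S \<Longrightarrow> f y = g y"
  shows "wirt_del v f x = wirt_del v g x" "wirt_dbar v f x = wirt_dbar v g x"
  using frechet_derivative_cong_on_open[OF assms] by (simp_all add: wirt_del_def wirt_dbar_def)

lemma wirt_const [simp]: "wirt_del v (\<lambda>x. c) x = 0" "wirt_dbar v (\<lambda>x. c) x = 0"
  by (simp_all add: wirt_del_def wirt_dbar_def)

lemma wirt_holo:
  assumes "holo_fun_on f S" "x \<in> S"
  shows "wirt_del v f x = frechet_derivative f (at x) v" "wirt_dbar v f x = 0"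
  by (simp_all add: wirt_del_def wirt_dbar_def holo_fun_onD(2)[OF assms])

lemma wirt_mult:
  assumes "f differentiable (at x)" "g differentiable (at x)"
  shows "wirt_del v (\<lambda>x. f x * g x) x = wirt_del v f x * g x + f x * wirt_del v g x"
    and "wirt_dbar v (\<lambda>x. f x * g x) x = wirt_dbar v f x * g x + f x * wirt_dbar v g x"
proof -
  note f = assms(1)[unfolded frechet_derivative_works] and g = assms(2)[unfolded frechet_derivative_works]
  show "wirt_del v (\<lambda>x. f x * g x) x = wirt_del v f x * g x + f x * wirt_del v g x"
    by (subst wirt_eqI(1)[OF has_derivative_mult[OF f g]]) (simp add: wirt_del_def field_simps)
  show "wirt_dbar v (\<lambda>x. f x * g x) x = wirt_dbar v f x * g x + f x * wirt_dbar v g x"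
    by (subst wirt_eqI(2)[OF has_derivative_mult[OF f g]]) (simp add: wirt_dbar_def field_simps)
qed

lemma wirt_cmult:
  assumes "f differentiable (at x)"
  shows "wirt_del v (\<lambda>x. c * f x) x = c * wirt_del v f x" "wirt_dbar v (\<lambda>x. c * f x) x = c * wirt_dbar v f x"
  using wirt_mult[of "\<lambda>x. c", OF _ assms] by simp_all

lemma wirt_sum:
  assumes "\<And>i. i \<in> I \<Longrightarrow> f i differentiable (at x)"
  shows "wirt_del v (\<lambda>x. \<Sum>i\<in>I. f i x) x = (\<Sum>i\<in>I. wirt_del v (f i) x)"
    and "wirt_dbar v (\<lambda>x. \<Sum>i\<in>I. f i x) x = (\<Sum>i\<in>I. wirt_dbar v (f i) x)"
proof -
  have f: "((\<lambda>x. \<Sum>i\<in>I. f i x) has_derivative (\<lambda>v. \<Sum>i\<in>I. frechet_derivative (f i) (at x) v)) (at x)"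
    by (rule has_derivative_sum) (use assms in \<open>simp add: frechet_derivative_works\<close>)
  show "wirt_del v (\<lambda>x. \<Sum>i\<in>I. f i x) x = (\<Sum>i\<in>I. wirt_del v (f i) x)"
    by (subst wirt_eqI(1)[OF f]) (simp add: wirt_del_def sum_distrib_left sum_subtractf flip: sum_divide_distrib)
  show "wirt_dbar v (\<lambda>x. \<Sum>i\<in>I. f i x) x = (\<Sum>i\<in>I. wirt_dbar v (f i) x)"
    by (subst wirt_eqI(2)[OF f]) (simp add: wirt_dbar_def sum_distrib_left sum.distrib flip: sum_divide_distrib)
qed

lemma wirt_add:
  assumes "f differentiable (at x)" "g differentiable (at x)"
  shows "wirt_del v (\<lambda>x. f x + g x) x = wirt_del v f x + wirt_del v g x"
    and "wirt_dbar v (\<lambda>x. f x + g x) x = wirt_dbar v f x + wirt_dbar v g x"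
proof -
  note D = has_derivative_add[OF assms[unfolded frechet_derivative_works]]
  show "wirt_del v (\<lambda>x. f x + g x) x = wirt_del v f x + wirt_del v g x"
    by (subst wirt_eqI(1)[OF D]) (simp add: wirt_del_def field_simps)
  show "wirt_dbar v (\<lambda>x. f x + g x) x = wirt_dbar v f x + wirt_dbar v g x"
    by (subst wirt_eqI(2)[OF D]) (simp add: wirt_dbar_def field_simps)
qed

text \<open>As functions of the direction, \<open>wirt_del\<close> is the complex linear part and
  \<open>wirt_dbar\<close> the antilinear part of the real derivative.\<close>

lemma wirt_smult:
  assumes "f differentiable (at x)"
  shows "wirt_del (c *s v) f x = c * wirt_del v f x"
    and "wirt_dbar (c *s v) f x = cnj c * wirt_dbar v f x"
proof -
  let ?D = "frechet_derivative f (at x)"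
  have lin: "linear ?D"
    using assms frechet_derivative_works has_derivative_linear by blast
  have 1: "c *s v = Re c *\<^sub>R v + Im c *\<^sub>R (\<i> *s v)"
    by (simp add: vec_eq_iff complex_eq_iff)
  have 2: "\<i> *s (c *s v) = Re c *\<^sub>R (\<i> *s v) + (- Im c) *\<^sub>R v"
    by (simp add: vec_eq_iff complex_eq_iff)
  have D: "?D (c *s v) = Re c * ?D v + Im c * ?D (\<i> *s v)"
    "?D (\<i> *s (c *s v)) = Re c * ?D (\<i> *s v) - Im c * ?D v"
    unfolding 2 unfolding 1 linear_add[OF lin] linear_cmul[OF lin] by (simp_all add: scaleR_conv_of_real)
  have c: "c = Re c + \<i> * Im c" "cnj c = Re c - \<i> * Im c"
    by (simp_all add: complex_eq_iff)
  show "wirt_del (c *s v) f x = c * wirt_del v f x"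
    unfolding wirt_del_def D by (subst (5) c(1)) (simp add: field_simps)
  show "wirt_dbar (c *s v) f x = cnj c * wirt_dbar v f x"
    unfolding wirt_dbar_def D c(2) by (simp add: field_simps)
qed

lemma linear_wirt:
  assumes "f differentiable (at x)"
  shows "linear (\<lambda>v. wirt_del v f x)" "linear (\<lambda>v. wirt_dbar v f x)"
proof -
  have lin: "linear (frechet_derivative f (at x))"
    using assms frechet_derivative_works has_derivative_linear by blast
  show "linear (\<lambda>v. wirt_del v f x)" "linear (\<lambda>v. wirt_dbar v f x)"
    by (rule linearI; simp only: wirt_del_def wirt_dbar_def vector_smult_add vector_smult_scaleR
        linear_add[OF lin] linear_cmul[OF lin]; simp add: field_simps scaleR_conv_of_real)+
qed

lemma wirt_axis_expansion:
  assumes "f differentiable (at x)"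
  shows "wirt_del v f x = (\<Sum>a\<in>UNIV. v $ a * wirt_del (axis a 1) f x)"
    and "wirt_dbar v f x = (\<Sum>a\<in>UNIV. cnj (v $ a) * wirt_dbar (axis a 1) f x)"
proof -
  have v: "v = (\<Sum>a\<in>UNIV. (v $ a) *s axis a 1)"
    by (simp add: vec_eq_iff axis_def if_distrib cong: if_cong)
  show "wirt_del v f x = (\<Sum>a\<in>UNIV. v $ a * wirt_del (axis a 1) f x)"
    by (subst v) (simp only: linear_sum[OF linear_wirt(1)[OF assms]] wirt_smult[OF assms])
  show "wirt_dbar v f x = (\<Sum>a\<in>UNIV. cnj (v $ a) * wirt_dbar (axis a 1) f x)"
    by (subst v) (simp only: linear_sum[OF linear_wirt(2)[OF assms]] wirt_smult[OF assms])
qed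

lemma Ck_on_wirt:
  assumes "open S" "Ck_on (Suc k) f S"
  shows "Ck_on k (wirt_del v f) S" "Ck_on k (wirt_dbar v f) S"
proof -
  have "Ck_on k (\<lambda>x. (1/2) * (frechet_derivative f (at x) v + (-\<i>) * frechet_derivative f (at x) (\<i> *s v))) S"
    "Ck_on k (\<lambda>x. (1/2) * (frechet_derivative f (at x) v + \<i> * frechet_derivative f (at x) (\<i> *s v))) S"
    by (intro Ck_on_mult Ck_on_add Ck_on_const assms(1) Ck_on_SucD(2)[OF assms(2)])+
  then show "Ck_on k (wirt_del v f) S" "Ck_on k (wirt_dbar v f) S"
    by (simp_all add: wirt_del_def[abs_def] wirt_dbar_def[abs_def])
qed

lemma wirt_del_cnj_holo:
  assumes "holo_fun_on f S" "x \<in> S"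
  shows "wirt_del v (\<lambda>x. cnj (f x)) x = 0"
  using wirt_eqI(1)[OF has_derivative_cnj[OF holo_fun_onD(1)[OF assms]]]
  by (simp add: holo_fun_onD(2)[OF assms])

section \<open>Integration by parts\<close>

text \<open>S and the complement of K form an open cover, and the extension agrees with f on the
  first set and with 0 on the second.\<close>

lemma Ck_on_extend_by_zero:
  assumes "open S" "compact K" "K \<subseteq> S" "Ck_on k f S" "\<And>x. x \<in> S - K \<Longrightarrow> f x = 0"
  shows "Ck_on k (\<lambda>x. if x \<in> S then f x else 0) UNIV"
proof (rule Ck_on_locally)
  fix x
  have "Ck_on k (\<lambda>x. if x \<in> S then f x else 0) S"
    using Ck_on_cong[OF assms(1), of "\<lambda>x. if x \<in> S then f x else 0" f] assms(4) by simp
  moreover have "open (- K)"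
    using compact_imp_closed[OF assms(2)] by (simp add: open_Compl)
  moreover have "Ck_on k (\<lambda>x. if x \<in> S then f x else 0) (- K)"
    using Ck_on_cong[OF \<open>open (- K)\<close>, of "\<lambda>x. if x \<in> S then f x else 0" "\<lambda>x. 0"] assms(5) Ck_on_const
    by force
  ultimately show "\<exists>T. open T \<and> x \<in> T \<and> Ck_on k (\<lambda>x. if x \<in> S then f x else 0) T"
    using assms(1,3) by (cases "x \<in> S") blast+
qed

lemma frechet_derivative_eq_0_outside:
  assumes "open T" "\<And>x. x \<in> T \<Longrightarrow> f x = 0" "x \<in> T"
  shows "frechet_derivative f (at x) v = 0"
  using frechet_derivative_cong_on_open[OF assms(1,3), of f "\<lambda>x. 0"] assms(2) by simp

lemma integrable_continuous_compact_support:
  fixes f :: "'x::euclidean_space \<Rightarrow> 'y::{banach, second_countable_topology}"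
  assumes "compact K" "continuous_on K f" "\<And>x. x \<notin> K \<Longrightarrow> f x = 0"
  shows "integrable lborel f"
proof -
  have "(\<lambda>x. indicator K x *\<^sub>R f x) = f"
    using assms(3) by (auto simp: fun_eq_iff indicator_def)
  then show ?thesis
    using borel_integrable_compact[OF assms(1,2)] by simp
qed

text \<open>By translation invariance every difference quotient of g integrates to 0, and the
  quotients converge to the derivative under a common integrable bound.\<close>

lemma integral_frechet_derivative_eq_0:
  fixes g :: "'x::euclidean_space \<Rightarrow> 'y::euclidean_space"
  assumes "Ck_on 1 g UNIV" "compact K" "\<And>x. x \<notin> K \<Longrightarrow> g x = 0"
  shows "(\<integral>x. frechet_derivative g (at x) v \<partial>lborel) = 0"
proof -
  let ?D = "\<lambda>x. frechet_derivative g (at x) v"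
  have C: "Ck_on (Suc 0) g UNIV" using assms(1) by simp
  have D: "(g has_derivative frechet_derivative g (at x)) (at x)" for x
    using Ck_on_SucD(1)[OF C] by simp
  have Dc: "continuous_on UNIV ?D"
    using Ck_on_SucD(2)[OF C] by simp
  have D0: "?D x = 0" if "x \<notin> K" for x
    by (rule frechet_derivative_eq_0_outside[OF open_Compl[OF compact_imp_closed[OF assms(2)]]])
      (use assms(3) that in simp_all)
  have gc: "continuous_on UNIV g" using Ck_on_imp_continuous_on[OF C] .
  have "bounded (?D ` K)"
    using compact_continuous_image[OF continuous_on_subset[OF Dc] assms(2)] compact_imp_bounded by auto
  then obtain B where B: "\<And>x. x \<in> K \<Longrightarrow> norm (?D x) \<le> B" and "B > 0"
    unfolding bounded_pos by auto
  have B: "norm (?D x) \<le> B" for x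
  proof (cases "x \<in> K")
    case False
    show ?thesis unfolding D0[OF False] using \<open>B > 0\<close> by simp
  qed (rule B)
  define e where "e n = 1 / real (Suc n)" for n
  have e: "0 < e n" "e n \<le> 1" for n
    by (simp_all add: e_def)
  define h where "h n x = (g (x + e n *\<^sub>R v) - g x) /\<^sub>R e n" for n x
  \<comment> \<open>All steps e n are at most 1, so K swept backwards along v for unit time contains
    the support of every difference quotient.\<close>
  define K' where "K' = (\<lambda>(x, t). x - t *\<^sub>R v) ` (K \<times> {0..1::real})"
  have K': "compact K'"
    unfolding K'_def using assms(2)
    by (intro compact_continuous_image compact_Times) (auto simp: split_def intro!: continuous_intros)
  have lin: "((\<lambda>t. g (x + t *\<^sub>R v)) has_vector_derivative ?D (x + t *\<^sub>R v)) (at t)" for x t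
  proof -
    have "((\<lambda>t. x + t *\<^sub>R v) has_derivative (\<lambda>t. t *\<^sub>R v)) (at t)"
      by (auto intro!: derivative_eq_intros)
    from has_derivative_compose[OF this D] show ?thesis
      unfolding has_vector_derivative_def
      by (simp add: linear_cmul[OF has_derivative_linear[OF D]])
  qed
  have hbound: "norm (h n x) \<le> B * indicator K' x" for n x
  proof (cases "x \<in> K'")
    case True
    have "norm (g (x + e n *\<^sub>R v) - g (x + 0 *\<^sub>R v)) \<le> B * norm (e n - 0)"
      by (rule differentiable_bound[of UNIV "\<lambda>t. g (x + t *\<^sub>R v)" "\<lambda>t h. h *\<^sub>R ?D (x + t *\<^sub>R v)"])
        (use lin B in \<open>auto simp: has_vector_derivative_def mult.commute[of B] intro!: onorm_le mult_left_mono\<close>)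
    then have "norm (g (x + e n *\<^sub>R v) - g x) / e n \<le> B"
      using e[of n] by (simp add: field_simps)
    moreover have "norm (h n x) = norm (g (x + e n *\<^sub>R v) - g x) / e n"
      using e[of n] by (simp add: h_def divide_inverse mult.commute)
    ultimately show ?thesis
      using True by simp
  next
    case False
    have "x + t *\<^sub>R v \<notin> K" if "t \<in> {0..1}" for t
      using False that unfolding K'_def by (force simp: image_iff)
    from this[of 0] this[of "e n"] assms(3) e[of n] have "h n x = 0"
      by (simp add: h_def)
    then show ?thesis using \<open>B > 0\<close> by simp
  qed
  have hint: "(\<integral>x. h n x \<partial>lborel) = 0" for n
  proof -
    have i1: "integrable lborel g"
      using integrable_continuous_compact_support[OF assms(2) continuous_on_subset[OF gc] assms(3)] by simp
    have meas: "g \<in> borel_measurable borel"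
      using gc by (simp add: borel_measurable_continuous_onI)
    let ?c = "e n *\<^sub>R v"
    have i2: "integrable lborel (\<lambda>x. g (?c + x))"
      using integrable_distr_eq[of "(+) ?c" lborel borel g] i1 meas lborel_distr_plus[of ?c] by simp
    have "(\<integral>x. g (?c + x) \<partial>lborel) = (\<integral>x. g x \<partial>lborel)"
      using integral_distr[of "(+) ?c" lborel borel g] meas lborel_distr_plus[of ?c] by simp
    then show ?thesis
      using i1 i2 by (simp add: h_def add.commute[of _ ?c])
  qed
  have "(\<lambda>n. \<integral>x. h n x \<partial>lborel) \<longlonglongrightarrow> (\<integral>x. ?D x \<partial>lborel)"
  proof (rule integral_dominated_convergence[where w="\<lambda>x. B * indicator K' x"])
    show "?D \<in> borel_measurable lborel"
      using Dc by (simp add: borel_measurable_continuous_onI)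
    show "h n \<in> borel_measurable lborel" for n
    proof -
      have "continuous_on UNIV (h n)"
        unfolding h_def[abs_def] by (intro continuous_intros continuous_on_compose2[OF gc]) auto
      then show ?thesis by (simp add: borel_measurable_continuous_onI)
    qed
    show "integrable lborel (\<lambda>x. B * indicator K' x)"
      using borel_integrable_compact[OF K' continuous_on_const[of _ B]] by (simp add: mult.commute)
    show "AE x in lborel. (\<lambda>n. h n x) \<longlonglongrightarrow> ?D x"
    proof (rule AE_I2)
      fix x
      have "((\<lambda>t. (g (x + t *\<^sub>R v) - g x) /\<^sub>R t) \<longlongrightarrow> ?D x) (at 0)"
      proof -
        have "((\<lambda>t. norm (g (x + t *\<^sub>R v) - g x - t *\<^sub>R ?D x) / norm t) \<longlongrightarrow> 0) (at 0)"
          using lin[of x 0] by (simp add: has_vector_derivative_def has_derivative_iff_norm)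
        moreover have "norm (g (x + t *\<^sub>R v) - g x - t *\<^sub>R ?D x) / norm t = norm ((g (x + t *\<^sub>R v) - g x) /\<^sub>R t - ?D x)"
          if "t \<noteq> 0" for t
        proof -
          have "g (x + t *\<^sub>R v) - g x - t *\<^sub>R ?D x = t *\<^sub>R ((g (x + t *\<^sub>R v) - g x) /\<^sub>R t - ?D x)"
            using that by (simp add: scaleR_diff_right)
          then show ?thesis using that by simp
        qed
        then have "\<forall>\<^sub>F t in at 0. norm (g (x + t *\<^sub>R v) - g x - t *\<^sub>R ?D x) / norm t = norm ((g (x + t *\<^sub>R v) - g x) /\<^sub>R t - ?D x)"
          by (simp add: eventually_at_filter)
        ultimately have "((\<lambda>t. norm ((g (x + t *\<^sub>R v) - g x) /\<^sub>R t - ?D x)) \<longlongrightarrow> 0) (at 0)"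
          by (rule Lim_transform_eventually)
        then show ?thesis
          by (rule LIM_zero_cancel[OF tendsto_norm_zero_cancel])
      qed
      moreover have "filterlim e (at 0) sequentially"
        using LIMSEQ_inverse_real_of_nat e(1) by (simp add: filterlim_at e_def[abs_def] inverse_eq_divide)
      ultimately show "(\<lambda>n. h n x) \<longlonglongrightarrow> ?D x"
        unfolding h_def by (rule filterlim_compose)
    qed
  qed (use hbound in auto)
  then show ?thesis
    by (simp add: hint LIMSEQ_const_iff)
qed

text \<open>The product w g extends by zero to a C^1 function of compact support, whose derivatives
  integrate to 0. Only g has to vanish off K; w need not extend beyond S.\<close>

lemma set_integral_by_parts:
  fixes w g :: "'x::euclidean_space \<Rightarrow> 'y::{euclidean_space, real_normed_algebra}"
  assumes "open S" "compact K" "K \<subseteq> S" "Ck_on 1 w S" "Ck_on 1 g S" "\<And>x. x \<in> S - K \<Longrightarrow> g x = 0"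
  shows "set_integrable lborel S (\<lambda>x. w x * frechet_derivative g (at x) v)"
    "set_integrable lborel S (\<lambda>x. frechet_derivative w (at x) v * g x)"
    "set_lebesgue_integral lborel S (\<lambda>x. w x * frechet_derivative g (at x) v) =
     - set_lebesgue_integral lborel S (\<lambda>x. frechet_derivative w (at x) v * g x)"
proof -
  note w = assms(4)[unfolded One_nat_def] and g = assms(5)[unfolded One_nat_def]
  let ?p = "\<lambda>x. if x \<in> S then w x * g x else 0"
  have KS: "open (S - K)"
    using assms(1) compact_imp_closed[OF assms(2)] by (rule open_Diff)
  have p: "Ck_on 1 ?p UNIV"
    by (rule Ck_on_extend_by_zero[OF assms(1-3) Ck_on_mult[OF assms(1,4,5)]]) (simp add: assms(6))
  have p0: "?p x = 0" if "x \<notin> K" for x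
    using assms(6)[of x] that by auto
  have g0: "frechet_derivative g (at x) v = 0" if "x \<in> S - K" for x
    by (rule frechet_derivative_eq_0_outside[OF KS _ that]) (rule assms(6))
  have eq: "indicator S x *\<^sub>R (w x * frechet_derivative g (at x) v) + indicator S x *\<^sub>R (frechet_derivative w (at x) v * g x) = frechet_derivative ?p (at x) v" for x
  proof (cases "x \<in> S")
    case True
    have "((\<lambda>x. w x * g x) has_derivative (\<lambda>v. w x * frechet_derivative g (at x) v + frechet_derivative w (at x) v * g x)) (at x)"
      by (rule has_derivative_mult[OF Ck_on_SucD(1)[OF w True] Ck_on_SucD(1)[OF g True]])
    then have "(?p has_derivative (\<lambda>v. w x * frechet_derivative g (at x) v + frechet_derivative w (at x) v * g x)) (at x)"
      by (rule has_derivative_transform_within_open[OF _ assms(1) True]) simp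
    from frechet_derivative_eq[OF this] show ?thesis
      using True by simp
  next
    case False
    have "frechet_derivative ?p (at x) v = 0"
      by (rule frechet_derivative_eq_0_outside[OF open_Compl[OF compact_imp_closed[OF assms(2)]]])
        (use p0 False assms(3) in auto)
    then show ?thesis using False by simp
  qed
  have int: "integrable lborel (\<lambda>x. indicator S x *\<^sub>R f x)"
    if "continuous_on S f" "\<And>x. x \<in> S - K \<Longrightarrow> f x = 0" for f :: "'x \<Rightarrow> 'y"
  proof (rule integrable_continuous_compact_support[OF assms(2)])
    have "continuous_on K f" by (rule continuous_on_subset[OF that(1) assms(3)])
    then show "continuous_on K (\<lambda>x. indicator S x *\<^sub>R f x)"
      by (rule continuous_on_eq) (use assms(3) in auto)
  qed (use that(2) in \<open>auto simp: indicator_def\<close>)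
  show 1: "set_integrable lborel S (\<lambda>x. w x * frechet_derivative g (at x) v)"
    unfolding set_integrable_def
    by (rule int) (use Ck_on_imp_continuous_on[OF assms(4)] Ck_on_SucD(2)[OF g] g0 in \<open>auto intro!: continuous_intros\<close>)
  show 2: "set_integrable lborel S (\<lambda>x. frechet_derivative w (at x) v * g x)"
    unfolding set_integrable_def
    by (rule int) (use Ck_on_imp_continuous_on[OF assms(5)] Ck_on_SucD(2)[OF w] assms(6) in \<open>auto intro!: continuous_intros\<close>)
  have "set_lebesgue_integral lborel S (\<lambda>x. w x * frechet_derivative g (at x) v) +
     set_lebesgue_integral lborel S (\<lambda>x. frechet_derivative w (at x) v * g x) =
     (\<integral>x. frechet_derivative ?p (at x) v \<partial>lborel)"
    unfolding set_lebesgue_integral_def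
    by (subst Bochner_Integration.integral_add[symmetric, OF 1[unfolded set_integrable_def] 2[unfolded set_integrable_def]])
      (simp only: eq)
  also have "\<dots> = 0"
    by (rule integral_frechet_derivative_eq_0[OF p assms(2) p0])
  finally show "set_lebesgue_integral lborel S (\<lambda>x. w x * frechet_derivative g (at x) v) =
     - set_lebesgue_integral lborel S (\<lambda>x. frechet_derivative w (at x) v * g x)"
    by (simp add: eq_neg_iff_add_eq_0)
qed

lemma wirt_by_parts:
  fixes w g :: "complex^'m::finite \<Rightarrow> complex"
  assumes "open S" "compact K" "K \<subseteq> S" "Ck_on 1 w S" "Ck_on 1 g S" "\<And>x. x \<in> S - K \<Longrightarrow> g x = 0"
  shows "set_lebesgue_integral lborel S (\<lambda>x. w x * wirt_del v g x) =
     - set_lebesgue_integral lborel S (\<lambda>x. wirt_del v w x * g x)"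
    "set_lebesgue_integral lborel S (\<lambda>x. w x * wirt_dbar v g x) =
     - set_lebesgue_integral lborel S (\<lambda>x. wirt_dbar v w x * g x)"
proof -
  note p = set_integral_by_parts[OF assms, of v] and q = set_integral_by_parts[OF assms, of "\<i> *s v"]
  have *: "set_lebesgue_integral lborel S (\<lambda>x. (1/2) * a x + c * b x) =
       (1/2) * set_lebesgue_integral lborel S a + c * set_lebesgue_integral lborel S b"
    if "set_integrable lborel S a" "set_integrable lborel S b" for a b and c :: complex
    using that by (subst set_integral_add) (auto intro: set_integrable_mult_right)
  have e: "w x * wirt_del v g x = (1/2) * (w x * frechet_derivative g (at x) v) + (-\<i>/2) * (w x * frechet_derivative g (at x) (\<i> *s v))"
    "wirt_del v w x * g x = (1/2) * (frechet_derivative w (at x) v * g x) + (-\<i>/2) * (frechet_derivative w (at x) (\<i> *s v) * g x)"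
    "w x * wirt_dbar v g x = (1/2) * (w x * frechet_derivative g (at x) v) + (\<i>/2) * (w x * frechet_derivative g (at x) (\<i> *s v))"
    "wirt_dbar v w x * g x = (1/2) * (frechet_derivative w (at x) v * g x) + (\<i>/2) * (frechet_derivative w (at x) (\<i> *s v) * g x)"
    for x
    by (simp_all add: wirt_del_def wirt_dbar_def field_simps)
  have i: "set_lebesgue_integral lborel S (\<lambda>x. w x * wirt_del v g x) =
       (1/2) * set_lebesgue_integral lborel S (\<lambda>x. w x * frechet_derivative g (at x) v) +
       (-\<i>/2) * set_lebesgue_integral lborel S (\<lambda>x. w x * frechet_derivative g (at x) (\<i> *s v))"
    "set_lebesgue_integral lborel S (\<lambda>x. wirt_del v w x * g x) =
       (1/2) * set_lebesgue_integral lborel S (\<lambda>x. frechet_derivative w (at x) v * g x) +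
       (-\<i>/2) * set_lebesgue_integral lborel S (\<lambda>x. frechet_derivative w (at x) (\<i> *s v) * g x)"
    "set_lebesgue_integral lborel S (\<lambda>x. w x * wirt_dbar v g x) =
       (1/2) * set_lebesgue_integral lborel S (\<lambda>x. w x * frechet_derivative g (at x) v) +
       (\<i>/2) * set_lebesgue_integral lborel S (\<lambda>x. w x * frechet_derivative g (at x) (\<i> *s v))"
    "set_lebesgue_integral lborel S (\<lambda>x. wirt_dbar v w x * g x) =
       (1/2) * set_lebesgue_integral lborel S (\<lambda>x. frechet_derivative w (at x) v * g x) +
       (\<i>/2) * set_lebesgue_integral lborel S (\<lambda>x. frechet_derivative w (at x) (\<i> *s v) * g x)"
    by (simp_all only: e *[OF p(1) q(1)] *[OF p(2) q(2)])
  show "set_lebesgue_integral lborel S (\<lambda>x. w x * wirt_del v g x) =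
     - set_lebesgue_integral lborel S (\<lambda>x. wirt_del v w x * g x)"
    "set_lebesgue_integral lborel S (\<lambda>x. w x * wirt_dbar v g x) =
     - set_lebesgue_integral lborel S (\<lambda>x. wirt_dbar v w x * g x)"
    by (simp_all only: i p(3) q(3) minus_add_distrib mult_minus_right)
qed

text \<open>Two integrations by parts, so the signs cancel. The operators come out in the opposite
  order on w, without any appeal to symmetry of second derivatives.\<close>

lemma wirt_by_parts2:
  fixes w g :: "complex^'m::finite \<Rightarrow> complex"
  assumes "open S" "compact K" "K \<subseteq> S" "Ck_on 2 w S" "Ck_on 2 g S" "\<And>x. x \<in> S - K \<Longrightarrow> g x = 0"
  shows "set_lebesgue_integral lborel S (\<lambda>x. w x * wirt_del v (wirt_dbar v' g) x) =
     set_lebesgue_integral lborel S (\<lambda>x. wirt_dbar v' (wirt_del v w) x * g x)"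
proof -
  note 2 = assms(4,5)[unfolded numeral_2_eq_2] 
  have KS: "open (S - K)"
    using assms(1) compact_imp_closed[OF assms(2)] by (rule open_Diff)
  have g0: "wirt_dbar v' g x = 0" if "x \<in> S - K" for x
    unfolding wirt_dbar_def using frechet_derivative_eq_0_outside[OF KS assms(6) that] by simp
  have w1: "Ck_on 1 w S" "Ck_on 1 (wirt_del v w) S"
    using Ck_on_pred[OF 2(1)] Ck_on_wirt(1)[OF assms(1) 2(1)] by simp_all
  have g1: "Ck_on 1 g S" "Ck_on 1 (wirt_dbar v' g) S"
    using Ck_on_pred[OF 2(2)] Ck_on_wirt(2)[OF assms(1) 2(2)] by simp_all
  show ?thesis
    using wirt_by_parts(1)[OF assms(1-3) w1(1) g1(2) g0, of v]
      wirt_by_parts(2)[OF assms(1-3) w1(2) g1(1) assms(6), of v'] by simp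
qed

section \<open>Local integrability of \<open>log |f|\<close>\<close>

lemma Ck_on_ident: "open S \<Longrightarrow> Ck_on k (\<lambda>x. x) S"
  using Ck_on_linear[OF _ bounded_linear_ident] .

lemma Ck_on_ln: "Ck_on k (ln :: real \<Rightarrow> real) {0<..}"
proof (cases k)
  case 0
  then show ?thesis by (auto intro!: continuous_intros)
next
  case (Suc l)
  show ?thesis unfolding Suc
  proof (rule Ck_on_SucI)
    show "(ln has_derivative (\<lambda>v. v * inverse x)) (at x)" if "x \<in> {0<..}" for x :: real
      using DERIV_ln[of x] that by (simp add: has_field_derivative_def mult.commute[of _ "inverse x"])
    show "Ck_on l (\<lambda>x. v * inverse x :: real) {0<..}" for v
      by (intro Ck_on_mult Ck_on_const Ck_on_inverse Ck_on_ident) auto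
  qed simp
qed

lemma Ck_on_ln_compose:
  assumes "open S" "Ck_on k f S" "\<And>x. x \<in> S \<Longrightarrow> 0 < f x"
  shows "Ck_on k (\<lambda>x. ln (f x) :: real) S"
  by (rule Ck_on_compose[OF assms(1) _ _ Ck_on_ln assms(2)]) (use assms(3) in auto)

lemma axis_imaginary: "axis a \<i> = \<i> *s (axis a 1 :: complex^'m::finite)"
  by (simp add: vec_eq_iff axis_def)

text \<open>Pairing e with i e is what makes the Cauchy-Riemann equations applicable to a real
  Laplacian.\<close>

lemma sum_Basis_complex_vec:
  fixes g :: "complex^'m::finite \<Rightarrow> 'b::comm_monoid_add"
  shows "sum g Basis = (\<Sum>a\<in>UNIV. g (axis a 1) + g (\<i> *s axis a 1))"
proof -
  have "Basis = (\<Union>a\<in>UNIV. {axis a 1, axis a \<i> :: complex^'m})"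
    by (auto simp: Basis_vec_def Basis_complex_def)
  also have "sum g \<dots> = (\<Sum>a\<in>UNIV. sum g {axis a 1, axis a \<i>})"
    by (rule sum.UNION_disjoint) (auto simp: axis_eq_axis)
  also have "\<dots> = (\<Sum>a\<in>UNIV. g (axis a 1) + g (\<i> *s axis a 1))"
    by (simp add: axis_eq_axis axis_imaginary[symmetric])
  finally show ?thesis .
qed

lemma frechet_derivative_log_norm:
  fixes f :: "complex^'m::finite \<Rightarrow> complex"
  assumes "holo_fun_on f S" "x \<in> S" "\<epsilon> > 0"
  shows "((\<lambda>x. ln (f x \<bullet> f x + \<epsilon>)) has_derivative
    (\<lambda>v. 2 * (f x \<bullet> frechet_derivative f (at x) v) / (f x \<bullet> f x + \<epsilon>))) (at x)"
proof -
  have pos: "f x \<bullet> f x + \<epsilon> > 0"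
    using assms(3) by (simp add: add_nonneg_pos)
  note D = holo_fun_onD(1)[OF assms(1,2)]
  have 1: "((\<lambda>x. f x \<bullet> f x + \<epsilon>) has_derivative (\<lambda>v. 2 * (f x \<bullet> frechet_derivative f (at x) v))) (at x)"
    by (rule has_derivative_eq_rhs, rule has_derivative_add_const, rule has_derivative_inner[OF D D])
      (simp add: inner_commute)
  show ?thesis
    by (rule has_derivative_eq_rhs[OF has_derivative_compose[OF 1]], rule DERIV_ln[THEN has_field_derivative_imp_has_derivative, OF pos])
      (simp add: fun_eq_iff divide_inverse mult.commute)
qed

text \<open>In each pair e, i e the second derivatives of f cancel, because the rule D (i e) = i D e
  applied twice changes the sign. With w the derivative of f along e and q = |f|^2 + \<epsilon>, the
  remaining sum is 4 \<epsilon> |w|^2 / q^2.\<close>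

lemma laplacian_log_norm_nonneg:
  fixes f :: "complex^'m::finite \<Rightarrow> complex"
  assumes "open S" "holo_fun_on f S" "x \<in> S" "\<epsilon> > 0"
  defines "U \<equiv> \<lambda>x. ln (f x \<bullet> f x + \<epsilon>)"
  shows "0 \<le> (\<Sum>b\<in>Basis. frechet_derivative (\<lambda>y. frechet_derivative U (at y) b) (at x) b)"
proof -
  let ?D = "\<lambda>v x. frechet_derivative f (at x) v"
  let ?q = "f x \<bullet> f x + \<epsilon>"
  have q: "f y \<bullet> f y + \<epsilon> > 0" for y
    using assms(4) by (simp add: add_nonneg_pos)
  have U: "frechet_derivative U (at y) v = 2 * (f y \<bullet> ?D v y) / (f y \<bullet> f y + \<epsilon>)" if "y \<in> S" for y v
    unfolding U_def using frechet_derivative_eq[OF frechet_derivative_log_norm[OF assms(2) that assms(4)]] by simp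
  have UU: "frechet_derivative (\<lambda>y. frechet_derivative U (at y) e) (at x) e =
     (2 * (?D e x \<bullet> ?D e x) + 2 * (f x \<bullet> frechet_derivative (?D e) (at x) e)) / ?q
     - 4 * (f x \<bullet> ?D e x)\<^sup>2 / ?q\<^sup>2" for e
  proof -
    have h: "holo_fun_on (?D e) S"
      by (rule holo_fun_on_frechet_derivative[OF assms(1,2)])
    note D1 = holo_fun_onD(1)[OF assms(2,3)] and D2 = holo_fun_onD(1)[OF h assms(3)]
    have num: "((\<lambda>y. 2 * (f y \<bullet> ?D e y)) has_derivative
        (\<lambda>v. 2 * (f x \<bullet> frechet_derivative (?D e) (at x) v + ?D v x \<bullet> ?D e x))) (at x)"
      by (intro has_derivative_mult_right has_derivative_inner D1 D2)
    have den: "((\<lambda>y. f y \<bullet> f y + \<epsilon>) has_derivative (\<lambda>v. 2 * (f x \<bullet> ?D v x))) (at x)"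
      by (rule has_derivative_eq_rhs, rule has_derivative_add_const, rule has_derivative_inner[OF D1 D1])
        (simp add: inner_commute)
    have "((\<lambda>y. 2 * (f y \<bullet> ?D e y) / (f y \<bullet> f y + \<epsilon>)) has_derivative
        (\<lambda>v. - (2 * (f x \<bullet> ?D e x)) * (inverse ?q * (2 * (f x \<bullet> ?D v x)) * inverse ?q) +
          2 * (f x \<bullet> frechet_derivative (?D e) (at x) v + ?D v x \<bullet> ?D e x) / ?q)) (at x)"
      using q[of x] by (intro has_derivative_divide num den) simp
    from frechet_derivative_eq[OF this]
    have "frechet_derivative (\<lambda>y. 2 * (f y \<bullet> ?D e y) / (f y \<bullet> f y + \<epsilon>)) (at x) e =
      - (2 * (f x \<bullet> ?D e x)) * (inverse ?q * (2 * (f x \<bullet> ?D e x)) * inverse ?q) +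
          2 * (f x \<bullet> frechet_derivative (?D e) (at x) e + ?D e x \<bullet> ?D e x) / ?q"
      by simp
    moreover have "frechet_derivative (\<lambda>y. frechet_derivative U (at y) e) (at x) =
      frechet_derivative (\<lambda>y. 2 * (f y \<bullet> ?D e y) / (f y \<bullet> f y + \<epsilon>)) (at x)"
      by (rule frechet_derivative_cong_on_open[OF assms(1,3)]) (rule U)
    moreover have "- (2 * a) * (inverse r * (2 * a) * inverse r) + 2 * (c + d) / r
        = (2 * d + 2 * c) / r - 4 * a\<^sup>2 / r\<^sup>2" if "r > 0" for a c d r :: real
      using that by (simp add: field_simps power2_eq_square)
    ultimately show ?thesis
      using q[of x] by simp
  qed
  have "0 \<le> frechet_derivative (\<lambda>y. frechet_derivative U (at y) e) (at x) e +
     frechet_derivative (\<lambda>y. frechet_derivative U (at y) (\<i> *s e)) (at x) (\<i> *s e)" for e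
  proof -
    have 1: "?D (\<i> *s e) x = \<i> * ?D e x"
      by (rule holo_fun_onD(2)[OF assms(2,3)])
    have h: "holo_fun_on (?D e) S"
      by (rule holo_fun_on_frechet_derivative[OF assms(1,2)])
    have "frechet_derivative (?D (\<i> *s e)) (at x) = frechet_derivative (\<lambda>y. \<i> * ?D e y) (at x)"
      by (rule frechet_derivative_cong_on_open[OF assms(1,3)]) (rule holo_fun_onD(2)[OF assms(2)])
    also have "\<dots> = (\<lambda>v. \<i> * frechet_derivative (?D e) (at x) v)"
      by (rule frechet_derivative_eq[OF has_derivative_mult_right[OF holo_fun_onD(1)[OF h assms(3)]]])
    finally have 2: "frechet_derivative (?D (\<i> *s e)) (at x) (\<i> *s e) = - frechet_derivative (?D e) (at x) e"
      using holo_fun_onD(2)[OF h assms(3), of \<i> e] by simp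
    let ?z = "f x" and ?w = "?D e x"
    \<comment> \<open>The vectors w and i w are orthogonal of equal length, so the components of z
      along them account for all of |z|^2.\<close>
    have id: "(?z \<bullet> ?w)\<^sup>2 + (?z \<bullet> (\<i> * ?w))\<^sup>2 = (?z \<bullet> ?z) * (?w \<bullet> ?w)"
      by (simp add: inner_complex_def power2_eq_square algebra_simps)
    have "(?z \<bullet> ?z) * (?w \<bullet> ?w) / ?q\<^sup>2 \<le> (?w \<bullet> ?w) / ?q"
    proof -
      have "(?z \<bullet> ?z) * (?w \<bullet> ?w) \<le> ?q * (?w \<bullet> ?w)"
        by (rule mult_right_mono) (use assms(4) in auto)
      then have "(?z \<bullet> ?z) * (?w \<bullet> ?w) / ?q\<^sup>2 \<le> ?q * (?w \<bullet> ?w) / ?q\<^sup>2"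
        by (rule divide_right_mono) simp
      also have "\<dots> = (?w \<bullet> ?w) / ?q"
        using q[of x] by (simp add: power2_eq_square)
      finally show ?thesis .
    qed
    moreover have "(\<i> * ?w) \<bullet> (\<i> * ?w) = ?w \<bullet> ?w"
      by (simp add: inner_complex_def)
    moreover have "(2 * d + 2 * c) / r - 4 * a\<^sup>2 / r\<^sup>2 + ((2 * d + 2 * (- c)) / r - 4 * b\<^sup>2 / r\<^sup>2)
       = 4 * (d / r - (a\<^sup>2 + b\<^sup>2) / r\<^sup>2)" if "r > 0" for a b c d r :: real
      using that by (simp add: field_simps power2_eq_square)
    ultimately show ?thesis
      unfolding UU 1 2 inner_minus_right using q[of x] by (simp only: id) simp
  qed
  then show ?thesis
    unfolding sum_Basis_complex_vec by (intro sum_nonneg) simp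
qed

text \<open>The weight \<open>\<eta>(v) = (R\<^sup>2 - |v|\<^sup>2)\<^sub>+\<close> satisfies \<open>\<eta>(v) v = - grad (\<eta>\<^sup>2 / 4)\<close>, so that weighted
  radial derivatives integrate to weighted Laplacians.\<close>

definition cone_weight :: "real \<Rightarrow> 'x::euclidean_space \<Rightarrow> real" where
  "cone_weight R v = max 0 (R\<^sup>2 - v \<bullet> v)"

lemma cone_weight_nonneg: "0 \<le> cone_weight R v"
  by (simp add: cone_weight_def)

lemma cone_weight_outside:
  assumes "R > 0" "v \<notin> cball 0 R"
  shows "cone_weight R v = 0"
proof -
  have "R\<^sup>2 \<le> (norm v)\<^sup>2"
    by (rule power_mono) (use assms in auto)
  then show ?thesis
    by (simp add: cone_weight_def dot_square_norm)
qed

lemma continuous_on_cone_weight: "continuous_on S (cone_weight R)"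
  unfolding cone_weight_def[abs_def] by (intro continuous_intros)

text \<open>Squaring removes the kink of max 0 t at t = 0, so this potential of the weight is of
  class C^1, just enough for one integration by parts.\<close>

lemma cone_weight_sq_has_derivative:
  "((\<lambda>v. (cone_weight R v)\<^sup>2 / 4) has_derivative (\<lambda>w. - cone_weight R v * (v \<bullet> w))) (at v)"
proof -
  have sq: "((\<lambda>t. (max 0 t)\<^sup>2) has_field_derivative 2 * max 0 t) (at t)" for t :: real
  proof -
    consider "t > 0" | "t < 0" | "t = 0" by linarith
    then show ?thesis
    proof cases
      case 1
      have "((\<lambda>t. t\<^sup>2) has_field_derivative 2 * max 0 t) (at t)"
        using 1 by (auto intro!: derivative_eq_intros)
      then show ?thesis
        by (rule has_field_derivative_transform_within_open[where S="{0<..}"]) (use 1 in auto)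
    next
      case 2
      have "((\<lambda>t. 0) has_field_derivative 2 * max 0 t) (at t)"
        using 2 by simp
      then show ?thesis
        by (rule has_field_derivative_transform_within_open[where S="{..<0}"]) (use 2 in auto)
    next
      case 3
      have "((\<lambda>y::real. max 0 y) \<longlongrightarrow> max 0 0) (at 0)"
        by (intro tendsto_intros)
      moreover have "\<forall>\<^sub>F y in at 0. max 0 y = ((max 0 y)\<^sup>2 - (max 0 (0::real))\<^sup>2) / (y - 0)"
        by (auto simp: eventually_at_filter max_def power2_eq_square)
      ultimately have "((\<lambda>y. ((max 0 y)\<^sup>2 - (max 0 (0::real))\<^sup>2) / (y - 0)) \<longlongrightarrow> max 0 0) (at 0)"
        by (rule Lim_transform_eventually)
      then show ?thesis
        using 3 by (simp only: has_field_derivative_iff) simp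
    qed
  qed
  have inner: "((\<lambda>v. R\<^sup>2 - v \<bullet> v) has_derivative (\<lambda>w. - 2 * (v \<bullet> w))) (at v)"
    by (auto intro!: derivative_eq_intros simp: inner_commute)
  have "((\<lambda>v. (max 0 (R\<^sup>2 - v \<bullet> v))\<^sup>2) has_derivative (\<lambda>w. 2 * max 0 (R\<^sup>2 - v \<bullet> v) * (- 2 * (v \<bullet> w)))) (at v)"
    by (rule has_derivative_compose[OF inner sq[THEN has_field_derivative_imp_has_derivative]])
  from has_derivative_mult_right[OF this, of "1/4"] show ?thesis
    by (simp add: cone_weight_def)
qed

lemma integral_eq_of_support:
  fixes F :: "'x::euclidean_space \<Rightarrow> 'y::euclidean_space"
  assumes "K \<subseteq> S" "K \<subseteq> T" "\<And>x. x \<notin> K \<Longrightarrow> F x = 0"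
  shows "integral S F = integral T F"
proof -
  have "(if x \<in> S then F x else 0) = (if x \<in> T then F x else 0)" for x
    using assms(1,2) assms(3)[of x] by (cases "x \<in> K") auto
  then show ?thesis
    using integral_restrict_UNIV[of S F] integral_restrict_UNIV[of T F] by simp
qed

lemma set_integral_sum:
  fixes f :: "'i \<Rightarrow> 'x \<Rightarrow> 'y::{banach, second_countable_topology}"
  assumes "\<And>i. i \<in> I \<Longrightarrow> set_integrable M S (f i)"
  shows "set_lebesgue_integral M S (\<lambda>x. \<Sum>i\<in>I. f i x) = (\<Sum>i\<in>I. set_lebesgue_integral M S (f i))"
  unfolding set_lebesgue_integral_def scaleR_sum_right
  by (rule Bochner_Integration.integral_sum) (use assms in \<open>simp add: set_integrable_def\<close>)

text \<open>Expanding the radial derivative in the basis turns the integrand into minus the inner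
  product of grad V and grad \<psi>; integration by parts leaves the Laplacian of V against \<psi>
  \<ge> 0. The domain of integration is flexible because the weight vanishes outside the
  ball.\<close>

lemma weighted_radial_derivative_nonneg:
  fixes g :: "complex^'m::finite \<Rightarrow> complex"
  assumes "open S" "holo_fun_on g S" "R > 0" "cball 0 R \<subseteq> S" "cball 0 R \<subseteq> B" "\<epsilon> > 0"
  defines "V \<equiv> \<lambda>x. ln (g x \<bullet> g x + \<epsilon>)"
  shows "0 \<le> integral B (\<lambda>v. cone_weight R v * frechet_derivative V (at v) v)"
proof -
  let ?K = "cball 0 R :: (complex^'m) set"
  define \<psi> :: "complex^'m \<Rightarrow> real" where "\<psi> = (\<lambda>v. (cone_weight R v)\<^sup>2 / 4)"
  let ?DD = "\<lambda>b x. frechet_derivative (\<lambda>y. frechet_derivative V (at y) b) (at x) b"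
  have pos: "0 < g x \<bullet> g x + \<epsilon>" for x
    using assms(6) by (simp add: add_nonneg_pos)
  have V: "Ck_on (Suc 1) V S"
    unfolding V_def
    by (intro Ck_on_ln_compose Ck_on_add Ck_on_const Ck_on_bilinear[OF _ bounded_bilinear_inner]
        holo_fun_on_imp_Ck_on assms(1,2) pos)
  have \<psi>1: "Ck_on 1 \<psi> S"
    unfolding One_nat_def \<psi>_def
    by (rule Ck_on_SucI[OF assms(1) cone_weight_sq_has_derivative])
      (auto intro!: continuous_intros continuous_on_cone_weight)
  have \<psi>D: "frechet_derivative \<psi> (at v) b = - cone_weight R v * (v \<bullet> b)" for v b
    unfolding \<psi>_def frechet_derivative_eq[OF cone_weight_sq_has_derivative] ..
  have \<psi>0: "\<psi> x = 0" if "x \<in> S - ?K" for x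
    using cone_weight_outside[OF assms(3), of x] that by (simp add: \<psi>_def)
  note IBP = set_integral_by_parts[OF assms(1) compact_cball assms(4) Ck_on_SucD(2)[OF V] \<psi>1 \<psi>0]
  let ?F = "\<lambda>v. cone_weight R v * frechet_derivative V (at v) v"
  have F: "?F v = - (\<Sum>b\<in>Basis. frechet_derivative V (at v) b * frechet_derivative \<psi> (at v) b)" if "v \<in> S" for v
  proof -
    have lin: "linear (frechet_derivative V (at v))"
      using Ck_on_SucD(1)[OF V that] has_derivative_linear by blast
    have "frechet_derivative V (at v) v = frechet_derivative V (at v) (\<Sum>b\<in>Basis. (v \<bullet> b) *\<^sub>R b)"
      by (simp add: euclidean_representation)
    also have "\<dots> = (\<Sum>b\<in>Basis. (v \<bullet> b) * frechet_derivative V (at v) b)"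
      by (simp add: linear_sum[OF lin] linear_cmul[OF lin])
    finally show ?thesis
      by (simp add: \<psi>D sum_distrib_left mult_ac flip: sum_negf)
  qed
  have int: "set_integrable lborel S (\<lambda>v. (\<Sum>b\<in>Basis. frechet_derivative V (at v) b * frechet_derivative \<psi> (at v) b))"
    using IBP(1) unfolding set_integrable_def scaleR_sum_right by (intro Bochner_Integration.integrable_sum)
  have "integral B ?F = integral S ?F"
    by (rule integral_eq_of_support[of ?K]) (use assms(4,5) cone_weight_outside[OF assms(3)] in auto)
  also have "\<dots> = integral S (\<lambda>v. - (\<Sum>b\<in>Basis. frechet_derivative V (at v) b * frechet_derivative \<psi> (at v) b))"
    by (rule integral_cong) (rule F)
  also have "\<dots> = - set_lebesgue_integral lborel S (\<lambda>v. (\<Sum>b\<in>Basis. frechet_derivative V (at v) b * frechet_derivative \<psi> (at v) b))"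
    unfolding integral_neg set_borel_integral_eq_integral(2)[OF int] ..
  also have "\<dots> = - (\<Sum>b\<in>Basis. set_lebesgue_integral lborel S (\<lambda>v. frechet_derivative V (at v) b * frechet_derivative \<psi> (at v) b))"
    by (subst set_integral_sum) (rule IBP(1), simp_all)
  also have "\<dots> = (\<Sum>b\<in>Basis. set_lebesgue_integral lborel S (\<lambda>v. ?DD b v * \<psi> v))"
    by (simp only: IBP(3) sum_negf minus_minus)
  also have "\<dots> = set_lebesgue_integral lborel S (\<lambda>v. \<Sum>b\<in>Basis. ?DD b v * \<psi> v)"
    by (subst set_integral_sum) (rule IBP(2), simp_all)
  also have "\<dots> \<ge> 0"
    unfolding set_lebesgue_integral_def
  proof (rule Bochner_Integration.integral_nonneg)
    fix v
    have "0 \<le> (\<Sum>b\<in>Basis. ?DD b v) * \<psi> v" if "v \<in> S"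
      using laplacian_log_norm_nonneg[OF assms(1,2) that assms(6)] unfolding V_def
      by (rule mult_nonneg_nonneg) (simp add: \<psi>_def)
    then show "0 \<le> indicator S v *\<^sub>R (\<Sum>b\<in>Basis. ?DD b v * \<psi> v)"
      unfolding sum_distrib_right by (simp add: indicator_def)
  qed
  finally show ?thesis .
qed

text \<open>Averages are taken over a box containing the ball of radius R, since differentiation
  under the integral is carried out over boxes; the weight vanishes on the part outside the
  ball.\<close>

abbreviation sym_box :: "real \<Rightarrow> 'x::euclidean_space set" where
  "sym_box R \<equiv> cbox (- (R *\<^sub>R One)) (R *\<^sub>R One)"

lemma mem_sym_box: "v \<in> sym_box R \<longleftrightarrow> (\<forall>b\<in>Basis. \<bar>v \<bullet> b\<bar> \<le> R)"
  by (auto simp: mem_box abs_le_iff)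

lemma cball_subset_sym_box: "cball 0 R \<subseteq> sym_box R"
  using Basis_le_norm order_trans by (fastforce simp: mem_sym_box)

lemma norm_le_of_mem_sym_box:
  fixes v :: "'x::euclidean_space"
  assumes "v \<in> sym_box R"
  shows "norm v \<le> R * DIM('x)"
proof -
  have "norm v \<le> (\<Sum>b\<in>Basis. \<bar>v \<bullet> b\<bar>)"
    by (rule norm_le_l1)
  also have "\<dots> \<le> (\<Sum>b\<in>(Basis :: 'x set). R)"
    by (rule sum_mono) (use assms mem_sym_box in blast)
  finally show ?thesis by (simp add: mult.commute)
qed

text \<open>The average M r over the box shrunk by the factor r towards a interpolates between r =
  0, where it is the value at a times the mass of the weight, and r = 1. Its derivative is 1/r times
  the weighted radial derivative of the rescaled function, hence nonnegative.\<close>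

lemma log_norm_weighted_mean:
  fixes f :: "complex^'m::finite \<Rightarrow> complex"
  assumes "open W" "holo_fun_on f W" "R > 0" "\<epsilon> > 0" "\<And>v. v \<in> sym_box R \<Longrightarrow> a + v \<in> W"
  shows "ln (f a \<bullet> f a + \<epsilon>) * integral (sym_box R) (cone_weight R :: complex^'m \<Rightarrow> real) \<le>
    integral (sym_box R) (\<lambda>v. cone_weight R v * ln (f (a + v) \<bullet> f (a + v) + \<epsilon>))"
proof -
  let ?B = "sym_box R :: (complex^'m) set"
  let ?\<eta> = "cone_weight R :: complex^'m \<Rightarrow> real"
  define U where "U x = ln (f x \<bullet> f x + \<epsilon>)" for x
  let ?D = "\<lambda>x. frechet_derivative U (at x)"
  define M where "M r = integral ?B (\<lambda>v. ?\<eta> v * U (a + r *\<^sub>R v))" for r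
  have pos: "0 < f x \<bullet> f x + \<epsilon>" for x
    using assms(4) by (simp add: add_nonneg_pos)
  have U: "Ck_on (Suc 0) U W"
    unfolding U_def[abs_def]
    by (intro Ck_on_ln_compose Ck_on_add Ck_on_const Ck_on_bilinear[OF _ bounded_bilinear_inner]
        holo_fun_on_imp_Ck_on assms(1,2) pos)
  have Uc: "continuous_on W U" using Ck_on_imp_continuous_on[OF U] .
  have Dc: "continuous_on W (\<lambda>x. ?D x v)" for v using Ck_on_SucD(2)[OF U] by simp
  have lin: "linear (?D x)" if "x \<in> W" for x
    using Ck_on_SucD(1)[OF U that] by (rule has_derivative_linear)
  have mem: "a + r *\<^sub>R v \<in> W" if "v \<in> ?B" "r \<in> {0..1}" for r v
  proof (rule assms(5))
    have "\<bar>r * (v \<bullet> b)\<bar> \<le> R" if "b \<in> Basis" for b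
    proof -
      have "\<bar>r\<bar> * \<bar>v \<bullet> b\<bar> \<le> 1 * R"
        by (rule mult_mono) (use \<open>v \<in> ?B\<close> \<open>r \<in> {0..1}\<close> that assms(3) in \<open>auto simp: mem_sym_box\<close>)
      then show ?thesis by (simp add: abs_mult)
    qed
    then show "r *\<^sub>R v \<in> ?B"
      unfolding mem_sym_box by simp
  qed
  have chain: "((\<lambda>r. U (a + r *\<^sub>R v)) has_field_derivative ?D (a + r *\<^sub>R v) v) (at r)"
    if "a + r *\<^sub>R v \<in> W" for r v
  proof -
    have "((\<lambda>r. a + r *\<^sub>R v) has_derivative (\<lambda>r. r *\<^sub>R v)) (at r)"
      by (auto intro!: derivative_eq_intros)
    from has_derivative_compose[OF this Ck_on_SucD(1)[OF U that]]
    show ?thesis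
      unfolding has_field_derivative_def
      by (rule has_derivative_eq_rhs) (simp add: fun_eq_iff linear_cmul[OF lin[OF that]])
  qed
  have expand: "?D x v = (\<Sum>b\<in>Basis. (v \<bullet> b) * ?D x b)" if "x \<in> W" for x v
    by (subst euclidean_representation[of v, symmetric])
      (simp only: linear_sum[OF lin[OF that]] linear_cmul[OF lin[OF that]] real_scaleR_def)
  \<comment> \<open>The direction v varies together with the base point, so joint continuity is read
    off from the expansion in the fixed basis directions.\<close>
  have Dcont: "continuous_on ({0..1} \<times> ?B) (\<lambda>(r, v). ?\<eta> v * ?D (a + r *\<^sub>R v) v)"
  proof -
    have "continuous_on ({0..1} \<times> ?B) (\<lambda>p. \<Sum>b\<in>Basis. (snd p \<bullet> b) * ?D (a + fst p *\<^sub>R snd p) b)"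
      by (intro continuous_intros continuous_on_compose2[OF Dc]) (auto intro!: mem)
    then have "continuous_on ({0..1} \<times> ?B) (\<lambda>p. ?D (a + fst p *\<^sub>R snd p) (snd p))"
      by (rule continuous_on_eq) (rule expand[symmetric], auto intro!: mem)
    then show ?thesis
      unfolding split_def
      by (intro continuous_intros continuous_on_compose2[OF continuous_on_cone_weight[of UNIV]]) auto
  qed
  have MD: "(M has_field_derivative integral ?B (\<lambda>v. ?\<eta> v * ?D (a + r *\<^sub>R v) v)) (at r within {0..1})"
    if "r \<in> {0..1}" for r
    unfolding M_def[abs_def]
  proof (rule leibniz_rule_field_derivative)
    fix r :: real and v assume rv: "r \<in> {0..1}" "v \<in> ?B"
    show "((\<lambda>r. ?\<eta> v * U (a + r *\<^sub>R v)) has_field_derivative ?\<eta> v * ?D (a + r *\<^sub>R v) v) (at r within {0..1})"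
      by (rule DERIV_cmult, rule has_field_derivative_at_within, rule chain, rule mem[OF rv(2,1)])
  next
    fix r :: real assume r: "r \<in> {0..1}"
    show "(\<lambda>v. ?\<eta> v * U (a + r *\<^sub>R v)) integrable_on ?B"
      by (rule integrable_continuous, intro continuous_intros continuous_on_cone_weight continuous_on_compose2[OF Uc])
        (use r in \<open>auto intro!: mem\<close>)
  qed (use that Dcont in auto)
  have "M 0 \<le> M 1"
  proof (rule DERIV_nonneg_imp_increasing_open[of 0 1 M])
    show "continuous_on {0..1} M"
      using MD by (rule DERIV_continuous_on)
    fix r :: real assume r: "0 < r" "r < 1"
    let ?g = "\<lambda>v. f (a + r *\<^sub>R v)"
    let ?S = "(\<lambda>v. a + r *\<^sub>R v) -` W"
    have S: "open ?S"
      by (rule open_vimage[OF assms(1)]) (intro continuous_intros)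
    have "holo_map_on (\<lambda>v. a + r *\<^sub>R v) ?S"
      unfolding holo_map_on_def
    proof
      fix i
      have "holo_fun_on (\<lambda>v. a $ i + of_real r * v $ i) ?S"
        by (intro holo_fun_on_add holo_fun_on_mult holo_fun_on_const holo_fun_on_nth)
      then show "holo_fun_on (\<lambda>v. (a + r *\<^sub>R v) $ i) ?S"
        unfolding vector_add_component vector_scaleR_component unfolding scaleR_conv_of_real .
    qed
    then have g: "holo_fun_on ?g ?S"
      by (rule holo_fun_on_compose[OF assms(2)]) auto
    have K: "cball 0 R \<subseteq> ?S"
      using cball_subset_sym_box[of R] mem r by fastforce
    have Vd: "frechet_derivative (\<lambda>v. ln (?g v \<bullet> ?g v + \<epsilon>)) (at v) v = r * ?D (a + r *\<^sub>R v) v"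
      if "v \<in> ?S" for v
    proof -
      have v: "a + r *\<^sub>R v \<in> W" using that by simp
      have "((\<lambda>v. a + r *\<^sub>R v) has_derivative (\<lambda>w. r *\<^sub>R w)) (at v)"
        by (auto intro!: derivative_eq_intros)
      from has_derivative_compose[OF this Ck_on_SucD(1)[OF U v]]
      have "((\<lambda>v. ln (?g v \<bullet> ?g v + \<epsilon>)) has_derivative (\<lambda>w. r * ?D (a + r *\<^sub>R v) w)) (at v)"
        unfolding U_def[symmetric] by (simp add: linear_cmul[OF lin[OF v]])
      from frechet_derivative_eq[OF this] show ?thesis by simp
    qed
    have "0 \<le> integral ?B (\<lambda>v. ?\<eta> v * frechet_derivative (\<lambda>v. ln (?g v \<bullet> ?g v + \<epsilon>)) (at v) v)"
      by (rule weighted_radial_derivative_nonneg[OF S g assms(3) K cball_subset_sym_box assms(4)])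
    also have "\<dots> = integral ?B (\<lambda>v. r * (?\<eta> v * ?D (a + r *\<^sub>R v) v))"
    proof (rule integral_cong)
      fix v assume "v \<in> ?B"
      then have "v \<in> ?S" using mem r by simp
      from Vd[OF this] show "?\<eta> v * frechet_derivative (\<lambda>v. ln (?g v \<bullet> ?g v + \<epsilon>)) (at v) v = r * (?\<eta> v * ?D (a + r *\<^sub>R v) v)"
        by simp
    qed
    finally have "0 \<le> r * integral ?B (\<lambda>v. ?\<eta> v * ?D (a + r *\<^sub>R v) v)"
      by simp
    then have "0 \<le> integral ?B (\<lambda>v. ?\<eta> v * ?D (a + r *\<^sub>R v) v)"
      using r by (simp add: zero_le_mult_iff)
    moreover have "(M has_field_derivative integral ?B (\<lambda>v. ?\<eta> v * ?D (a + r *\<^sub>R v) v)) (at r)"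
      using MD[of r] r at_within_Icc_at[of 0 r 1] by simp
    ultimately show "\<exists>y. (M has_field_derivative y) (at r) \<and> 0 \<le> y" by blast
  qed simp
  then show ?thesis
    by (simp add: M_def U_def mult.commute)
qed

text \<open>As \<epsilon> = 1/(n+1) decreases, the nonnegative functions \<open>g n\<close>
  increase, while the mean inequality at a bounds their integrals by \<open>Kc\<close>, which does
  not depend on n because f a \<noteq> 0. Finiteness of the supremum almost everywhere forces the
  zeros in the ball to form a null set, and monotone convergence then gives the
  integrability.\<close>

lemma log_norm_weighted_integrable:
  fixes f :: "complex^'m::finite \<Rightarrow> complex"
  assumes "open W" "holo_fun_on f W" "R > 0" "\<And>v. v \<in> sym_box R \<Longrightarrow> a + v \<in> W" "f a \<noteq> 0"
  obtains C where "\<And>v. v \<in> sym_box R \<Longrightarrow> ln (f (a + v) \<bullet> f (a + v)) \<le> C"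
    "integrable lborel (\<lambda>v. indicator (sym_box R) v * (cone_weight R v * (C - ln (f (a + v) \<bullet> f (a + v)))))"
    "AE v in lborel. v \<in> ball 0 R \<longrightarrow> f (a + v) \<noteq> 0"
proof -
  let ?B = "sym_box R :: (complex^'m) set"
  let ?\<eta> = "cone_weight R :: complex^'m \<Rightarrow> real"
  define q where "q v = f (a + v) \<bullet> f (a + v)" for v
  define e where "e n = 1 / real (Suc n)" for n
  have e: "0 < e n" "e n \<le> 1" for n by (simp_all add: e_def)
  have q0: "0 \<le> q v" for v by (simp add: q_def)
  have qc: "continuous_on ?B q"
    unfolding q_def
    by (intro continuous_intros continuous_on_compose2[OF holo_fun_on_imp_continuous_on[OF assms(2)]])
      (auto intro!: assms(4))
  have "bounded (q ` ?B)"
    by (intro compact_imp_bounded compact_continuous_image qc compact_cbox)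
  then obtain C0 where C0: "C0 > 0" "\<And>v. v \<in> ?B \<Longrightarrow> q v \<le> C0"
    unfolding bounded_pos by fastforce
  \<comment> \<open>The added 1 majorises every e n. It also makes C positive, which is needed at
    zeros of f, where ln 0 = 0 by convention.\<close>
  define C where "C = ln (C0 + 1)"
  have C: "ln (q v + e n) \<le> C" if "v \<in> ?B" for v n
    unfolding C_def using C0(2)[OF that] e[of n] q0[of v] by simp
  have C': "ln (q v) \<le> C" if "v \<in> ?B" for v
  proof (cases "q v = 0")
    case True
    then show ?thesis using C0(1) by (simp add: C_def)
  next
    case False
    then show ?thesis unfolding C_def using C0(2)[OF that] q0[of v] by simp
  qed
  define g where "g n v = indicator ?B v * (?\<eta> v * (C - ln (q v + e n)))" for n v
  have g0: "0 \<le> g n v" for n v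
    using C[of v n] by (cases "v \<in> ?B") (auto simp: g_def cone_weight_nonneg)
  have gc: "continuous_on ?B (\<lambda>v. ?\<eta> v * (C - ln (q v + e n)))" for n
    using e(1)[of n] q0
    by (intro continuous_intros continuous_on_cone_weight qc) (metis add_nonneg_pos less_irrefl)
  have gi: "integrable lborel (g n)" for n
    using borel_integrable_compact[OF compact_cbox gc[of n]] by (simp add: g_def[abs_def])
  have \<eta>i: "?\<eta> integrable_on ?B"
    by (rule integrable_continuous[OF continuous_on_cone_weight])
  define Kc where "Kc = (C - ln (q 0)) * integral ?B ?\<eta>"
  have q00: "q 0 > 0" using assms(5) by (simp add: q_def)
  have gK: "(\<integral>v. g n v \<partial>lborel) \<le> Kc" for n
  proof -
    have si: "set_integrable lborel ?B (\<lambda>v. ?\<eta> v * (C - ln (q v + e n)))"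
      using gi[of n] by (simp add: set_integrable_def g_def[abs_def])
    have "(\<integral>v. g n v \<partial>lborel) = integral ?B (\<lambda>v. ?\<eta> v * (C - ln (q v + e n)))"
      using set_borel_integral_eq_integral(2)[OF si] by (simp add: set_lebesgue_integral_def g_def[abs_def])
    also have "\<dots> = integral ?B (\<lambda>v. C * ?\<eta> v - ?\<eta> v * ln (q v + e n))"
      by (rule integral_cong) (simp add: algebra_simps)
    also have "\<dots> = integral ?B (\<lambda>v. C * ?\<eta> v) - integral ?B (\<lambda>v. ?\<eta> v * ln (q v + e n))"
    proof (rule integral_diff)
      show "(\<lambda>v. C * ?\<eta> v) integrable_on ?B"
        by (rule integrable_continuous) (intro continuous_intros continuous_on_cone_weight)
      show "(\<lambda>v. ?\<eta> v * ln (q v + e n)) integrable_on ?B"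
        using e(1)[of n] q0
        by (intro integrable_continuous continuous_intros continuous_on_cone_weight qc) (metis add_nonneg_pos less_irrefl)
    qed
    also have "\<dots> = C * integral ?B ?\<eta> - integral ?B (\<lambda>v. ?\<eta> v * ln (q v + e n))"
      by (simp only: integral_mult_right)
    also have "\<dots> \<le> C * integral ?B ?\<eta> - ln (q 0 + e n) * integral ?B ?\<eta>"
      using log_norm_weighted_mean[OF assms(1-3) e(1)[of n] assms(4)] by (simp add: q_def)
    also have "\<dots> \<le> C * integral ?B ?\<eta> - ln (q 0) * integral ?B ?\<eta>"
    proof -
      have "ln (q 0) \<le> ln (q 0 + e n)"
        using q00 e[of n] by simp
      moreover have "0 \<le> integral ?B ?\<eta>"
        by (rule integral_nonneg[OF \<eta>i]) (rule cone_weight_nonneg)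
      ultimately show ?thesis
        by (simp add: mult_right_mono)
    qed
    also have "\<dots> = Kc" by (simp add: Kc_def left_diff_distrib)
    finally show ?thesis .
  qed
  have emono: "e m \<le> e n" if "n \<le> m" for n m
    using that by (simp add: e_def field_simps)
  have gmono: "g n v \<le> g m v" if "n \<le> m" for n m v
  proof -
    have "ln (q v + e m) \<le> ln (q v + e n)"
      using emono[OF that] e[of m] q0[of v] by simp
    then show ?thesis
      unfolding g_def by (intro mult_left_mono diff_left_mono) (auto simp: cone_weight_nonneg)
  qed
  have Kc0: "0 \<le> Kc"
    using gK[of 0] Bochner_Integration.integral_nonneg[of lborel "g 0"] g0 by fastforce
  have "(\<integral>\<^sup>+ v. (SUP n. ennreal (g n v)) \<partial>lborel) = (SUP n. \<integral>\<^sup>+ v. ennreal (g n v) \<partial>lborel)"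
    by (rule nn_integral_monotone_convergence_SUP)
      (use gmono gi in \<open>auto simp: incseq_def le_fun_def intro!: ennreal_leI borel_measurable_integrable\<close>)
  also have "\<dots> \<le> ennreal Kc"
  proof (rule SUP_least)
    fix n
    show "(\<integral>\<^sup>+ v. ennreal (g n v) \<partial>lborel) \<le> ennreal Kc"
      using nn_integral_eq_integral[OF gi[of n]] g0 gK[of n] by (simp add: ennreal_leI)
  qed
  finally have fin: "(\<integral>\<^sup>+ v. (SUP n. ennreal (g n v)) \<partial>lborel) \<noteq> \<infinity>"
    using ennreal_less_top[of Kc] by (simp add: top.not_eq_extremum le_less_trans)
  have "AE v in lborel. (SUP n. ennreal (g n v)) \<noteq> \<infinity>"
    by (rule nn_integral_PInf_AE[OF _ fin])
      (use gi in \<open>auto intro!: borel_measurable_SUP borel_measurable_integrable\<close>)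
  then have nz: "AE v in lborel. v \<in> ball 0 R \<longrightarrow> q v \<noteq> 0"
  proof eventually_elim
    case (elim v)
    show ?case
    proof (intro impI notI)
      assume v: "v \<in> ball 0 R" and qv: "q v = 0"
      then have vB: "v \<in> ?B" using cball_subset_sym_box[of R] by auto
      have "(norm v)\<^sup>2 < R\<^sup>2"
        by (rule power_strict_mono) (use v in auto)
      then have \<eta>v: "?\<eta> v > 0"
        by (simp add: cone_weight_def dot_square_norm)
      have "ennreal (g n v) < top" for n by simp
      obtain b where b: "b \<ge> 0" "(SUP n. ennreal (g n v)) = ennreal b"
        using elim by (cases "SUP n. ennreal (g n v)") auto
      have le: "g n v \<le> b" for n
      proof -
        have "ennreal (g n v) \<le> ennreal b"
          unfolding b(2)[symmetric] by (rule SUP_upper) simp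
        then show ?thesis using b(1) by (simp add: ennreal_le_iff)
      qed
      \<comment> \<open>At a zero the regularised logarithm is -ln (n+1), so \<open>g n v\<close>
        grows beyond any bound.\<close>
      have gn: "g n v = ?\<eta> v * (C + ln (real (Suc n)))" for n
        using vB qv by (simp add: g_def e_def ln_div)
      obtain n where n: "real n > exp (b / ?\<eta> v - C)"
        using reals_Archimedean2 by blast
      then have "exp (b / ?\<eta> v - C) < real (Suc n)" by simp
      then have "ln (exp (b / ?\<eta> v - C)) < ln (real (Suc n))"
        by (subst ln_less_cancel_iff) simp_all
      then have "g n v > b"
        unfolding gn using \<eta>v by (simp add: field_simps del: of_nat_Suc)
      with le[of n] show False by simp
    qed
  qed
  have "integrable lborel (\<lambda>v. indicator ?B v * (?\<eta> v * (C - ln (q v))))"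
  proof (rule integrable_monotone_convergence[where f=g])
    show "AE v in lborel. mono (\<lambda>n. g n v)"
      using gmono by (simp add: mono_def)
    have "incseq (\<lambda>n. \<integral>v. g n v \<partial>lborel)"
      unfolding incseq_def using gmono gi by (auto intro!: integral_mono)
    then obtain L where "(\<lambda>n. \<integral>v. g n v \<partial>lborel) \<longlonglongrightarrow> L"
      using incseq_convergent[of _ Kc] gK by blast
    then show "(\<lambda>n. \<integral>v. g n v \<partial>lborel) \<longlonglongrightarrow> lim (\<lambda>n. \<integral>v. g n v \<partial>lborel)"
      by (simp add: limI)
    have "(\<lambda>v. indicator ?B v *\<^sub>R q v) \<in> borel_measurable borel"
      by (rule borel_measurable_continuous_on_indicator[OF _ qc]) simp
    \<comment> \<open>The indicator is repeated inside the logarithm because q is known to be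
      measurable only on the box; outside it the outer indicator hides the change.\<close>
    then have "(\<lambda>v. indicator ?B v * (?\<eta> v * (C - ln (indicator ?B v *\<^sub>R q v)))) \<in> borel_measurable borel"
      using borel_measurable_continuous_onI[OF continuous_on_cone_weight[of UNIV R]]
      by measurable
    moreover have "(\<lambda>v. indicator ?B v * (?\<eta> v * (C - ln (indicator ?B v *\<^sub>R q v)))) = (\<lambda>v. indicator ?B v * (?\<eta> v * (C - ln (q v))))"
      by (auto simp: fun_eq_iff indicator_def)
    ultimately show "(\<lambda>v. indicator ?B v * (?\<eta> v * (C - ln (q v)))) \<in> borel_measurable lborel"
      by simp
    show "AE v in lborel. (\<lambda>n. g n v) \<longlonglongrightarrow> indicator ?B v * (?\<eta> v * (C - ln (q v)))"
      using nz
    proof eventually_elim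
      case (elim v)
      show ?case
      proof (cases "v \<in> ball 0 R")
        case True
        have "e \<longlonglongrightarrow> 0"
          using LIMSEQ_inverse_real_of_nat by (simp add: e_def[abs_def] inverse_eq_divide)
        then have "(\<lambda>n. q v + e n) \<longlonglongrightarrow> q v + 0"
          by (intro tendsto_intros)
        then show ?thesis
          unfolding g_def using elim True by (intro tendsto_intros) auto
      next
        case False
        then have "?\<eta> v = 0"
          using cone_weight_outside[OF assms(3), of v] by (cases "norm v = R") (auto simp: cone_weight_def dot_square_norm)
        then show ?thesis by (simp add: g_def)
      qed
    qed
  qed (rule gi)
  then show ?thesis
    using that[of C] C' nz by (simp add: q_def)
qed

section \<open>From the weighted estimate around a nonzero value to local integrability\<close>

lemma integrable_lborel_translate:
  fixes F :: "'x::euclidean_space \<Rightarrow> 'y::{banach, second_countable_topology}"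
  assumes "integrable lborel (\<lambda>v. F (a + v))"
  shows "integrable lborel F"
proof -
  have "(\<lambda>x. F (a + (- a + x))) \<in> borel_measurable lborel"
    using measurable_compose[OF _ borel_measurable_integrable[OF assms], of "\<lambda>x. - a + x" lborel] by simp
  then have m: "F \<in> borel_measurable borel" by simp
  show ?thesis
    using integrable_distr_eq[of "(+) a" lborel borel F] assms m lborel_distr_plus[of a] by simp
qed

lemma AE_lborel_translate:
  fixes a :: "'x::euclidean_space"
  assumes "AE v in lborel. P (a + v)"
  shows "AE x in lborel. P x"
proof -
  have "AE x in distr lborel borel ((+) a). P x"
    using assms
  proof (elim AE_E)
    fix N assume N: "{v \<in> space lborel. \<not> P (a + v)} \<subseteq> N" "emeasure lborel N = 0" "N \<in> sets lborel"
    let ?M = "(\<lambda>x. x - a) -` N"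
    have im: "?M \<in> sets borel"
      using N(3) by (intro measurable_sets_borel[of _ borel]) auto
    have "emeasure (distr lborel borel ((+) a)) ?M = emeasure lborel ((+) a -` ?M \<inter> space lborel)"
      using im by (intro emeasure_distr) auto
    also have "(+) a -` ?M \<inter> space lborel = N"
      by auto
    finally have "emeasure (distr lborel borel ((+) a)) ?M = 0"
      using N(2) by simp
    moreover have "{x \<in> space (distr lborel borel ((+) a)). \<not> P x} \<subseteq> ?M"
      using subsetD[OF N(1), of "x - a" for x] by auto
    ultimately show ?thesis
      using im by (intro AE_I) auto
  qed
  then show ?thesis unfolding lborel_distr_plus .
qed

text \<open>The point x0 may be a zero, so the estimate is centred at a nearby a with f a \<noteq>
  0. A ball around x0 lies inside a ball around a on which the weight is bounded below, and there
  the weight can be divided out.\<close>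

lemma log_norm_locally_integrable:
  fixes f :: "complex^'m::finite \<Rightarrow> complex"
  assumes "open W" "holo_fun_on f W" "x0 \<in> W" "\<And>N. open N \<Longrightarrow> x0 \<in> N \<Longrightarrow> \<exists>y\<in>N. f y \<noteq> 0"
  obtains r where "r > 0" "cball x0 r \<subseteq> W"
    "set_integrable lborel (cball x0 r) (\<lambda>x. ln ((cmod (f x))\<^sup>2))"
    "AE x in lborel. x \<in> cball x0 r \<longrightarrow> f x \<noteq> 0"
proof -
  let ?d = "real DIM(complex^'m)"
  have d: "?d \<ge> 1" by (metis DIM_positive One_nat_def Suc_leI of_nat_1 of_nat_le_iff)
  obtain e where e: "e > 0" "ball x0 e \<subseteq> W"
    using assms(1,3) open_contains_ball by blast
  \<comment> \<open>Points of the box have norm at most R times the real dimension, that is e/2, so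
    the box around a stays in \<open>ball x0 e\<close>.\<close>
  define R where "R = e / (2 * ?d)"
  have R: "R > 0" "R * ?d = e / 2" "R \<le> e / 2"
    using e(1) d by (auto simp: R_def field_simps)
  obtain a where a: "a \<in> ball x0 (R / 4)" "f a \<noteq> 0"
    using assms(4)[of "ball x0 (R / 4)"] R(1) by auto
  have box: "a + v \<in> W" if "v \<in> sym_box R" for v
  proof -
    have "norm v \<le> e / 2"
      using norm_le_of_mem_sym_box[OF that] R(2) by simp
    then have "norm ((a - x0) + v) < e"
      using norm_triangle_ineq[of "a - x0" v] a(1) R by (simp add: dist_norm norm_minus_commute)
    then show ?thesis
      using e(2) by (auto simp: subset_iff dist_norm norm_minus_commute algebra_simps)
  qed
  obtain C where C: "\<And>v. v \<in> sym_box R \<Longrightarrow> ln (f (a + v) \<bullet> f (a + v)) \<le> C"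
    "integrable lborel (\<lambda>v. indicator (sym_box R) v * (cone_weight R v * (C - ln (f (a + v) \<bullet> f (a + v)))))"
    "AE v in lborel. v \<in> ball 0 R \<longrightarrow> f (a + v) \<noteq> 0"
    by (rule log_norm_weighted_integrable[OF assms(1,2) R(1) box a(2)], assumption) (rule that, assumption+)
  have sub: "cball x0 (R / 4) \<subseteq> cball a (R / 2)"
  proof
    fix x assume "x \<in> cball x0 (R / 4)"
    then show "x \<in> cball a (R / 2)"
      using a(1) dist_triangle[of a x x0] by (simp add: dist_commute)
  qed
  show ?thesis
  proof
    show "R / 4 > 0" using R(1) by simp
    show W: "cball x0 (R / 4) \<subseteq> W"
    proof
      fix x assume "x \<in> cball x0 (R / 4)"
      then have "x \<in> ball x0 e" using R(1,3) e(1) by auto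
      then show "x \<in> W" using e(2) by blast
    qed
    have "AE x in lborel. - a + x \<in> ball 0 R \<longrightarrow> f x \<noteq> 0"
      by (rule AE_lborel_translate[of _ a]) (use C(3) in simp)
    then show "AE x in lborel. x \<in> cball x0 (R / 4) \<longrightarrow> f x \<noteq> 0"
    proof eventually_elim
      case (elim x)
      show ?case
      proof
        assume "x \<in> cball x0 (R / 4)"
        then have "dist a x \<le> R / 2" using sub by auto
        then have "- a + x \<in> ball 0 R" using R(1) by (simp add: dist_norm norm_minus_commute)
        with elim show "f x \<noteq> 0" by simp
      qed
    qed
    let ?G = "\<lambda>x. indicator (sym_box R) (- a + x) * (cone_weight R (- a + x) * (C - ln (f x \<bullet> f x)))"
    have G: "integrable lborel ?G"
      by (rule integrable_lborel_translate[of _ a]) (use C(2) in simp)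
    \<comment> \<open>The minimum R^2 - (R/2)^2 of the weight on the ball of radius R/2 about
      a.\<close>
    define c where "c = 3 / 4 * R\<^sup>2"
    have c: "c > 0" using R(1) by (simp add: c_def)
    have fc: "continuous_on (cball x0 (R / 4)) f"
      using continuous_on_subset[OF holo_fun_on_imp_continuous_on[OF assms(2)] W] .
    show "set_integrable lborel (cball x0 (R / 4)) (\<lambda>x. ln ((cmod (f x))\<^sup>2))"
      unfolding set_integrable_def
    proof (rule Bochner_Integration.integrable_bound)
      show "integrable lborel (\<lambda>x. indicator (cball x0 (R / 4)) x *\<^sub>R \<bar>C\<bar> + ?G x / c)"
        by (intro Bochner_Integration.integrable_add borel_integrable_compact integrable_divide G) (auto intro!: continuous_intros)
      have m: "(\<lambda>x. indicator (cball x0 (R / 4)) x *\<^sub>R f x) \<in> borel_measurable borel"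
        by (rule borel_measurable_continuous_on_indicator[OF _ fc]) simp
      have "(\<lambda>x. indicator (cball x0 (R / 4)) x *\<^sub>R ln ((cmod (indicator (cball x0 (R / 4)) x *\<^sub>R f x))\<^sup>2)) \<in> borel_measurable borel"
        by (intro measurable_compose[OF m borel_measurable_norm] borel_measurable_scaleR borel_measurable_indicator borel_measurable_ln borel_measurable_power) simp
      moreover have "(\<lambda>x. indicator (cball x0 (R / 4)) x *\<^sub>R ln ((cmod (indicator (cball x0 (R / 4)) x *\<^sub>R f x))\<^sup>2)) =
          (\<lambda>x. indicator (cball x0 (R / 4)) x *\<^sub>R ln ((cmod (f x))\<^sup>2))"
        by (auto simp: fun_eq_iff indicator_def)
      ultimately show "(\<lambda>x. indicator (cball x0 (R / 4)) x *\<^sub>R ln ((cmod (f x))\<^sup>2)) \<in> borel_measurable lborel"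
        by simp
      show "AE x in lborel. norm (indicator (cball x0 (R / 4)) x *\<^sub>R ln ((cmod (f x))\<^sup>2)) \<le>
          norm (indicator (cball x0 (R / 4)) x *\<^sub>R \<bar>C\<bar> + ?G x / c)"
      proof (rule AE_I2)
        fix x
        let ?l = "ln ((cmod (f x))\<^sup>2)"
        have l: "ln (f x \<bullet> f x) = ?l" by (simp add: dot_square_norm)
        have G0: "0 \<le> ?G x"
          using C(1)[of "- a + x"] by (cases "- a + x \<in> sym_box R") (auto simp: cone_weight_nonneg)
        show "norm (indicator (cball x0 (R / 4)) x *\<^sub>R ?l) \<le> norm (indicator (cball x0 (R / 4)) x *\<^sub>R \<bar>C\<bar> + ?G x / c)"
        proof (cases "x \<in> cball x0 (R / 4)")
          case True
          then have "dist a x \<le> R / 2" using sub by auto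
          then have n: "norm (- a + x) \<le> R / 2" by (simp add: dist_norm norm_minus_commute)
          then have B: "- a + x \<in> sym_box R"
            using cball_subset_sym_box[of R] R(1) by auto
          have "(norm (- a + x))\<^sup>2 \<le> (R / 2)\<^sup>2"
            by (rule power_mono[OF n]) simp
          then have "c \<le> R\<^sup>2 - (norm (- a + x))\<^sup>2"
            unfolding c_def by (simp add: power_divide)
          then have "c \<le> cone_weight R (- a + x)"
            unfolding cone_weight_def dot_square_norm by simp
          moreover have "?l \<le> C" using C(1)[OF B] l by simp
          ultimately have "c * (C - ?l) \<le> ?G x"
            using B l by (simp add: mult_right_mono)
          then have "C - ?l \<le> ?G x / c"
            using c by (simp add: field_simps)
          moreover have "0 \<le> ?G x / c" using G0 c by simp
          ultimately have "\<bar>?l\<bar> \<le> \<bar>C\<bar> + ?G x / c"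
            using \<open>?l \<le> C\<close> by linarith
          then show ?thesis using True by simp
        next
          case False
          then show ?thesis by simp
        qed
      qed
    qed
  qed
qed

section \<open>Alternating forms and determinants\<close>

text \<open>The condition that \<open>smooth_form\<close> imposes at each point, separated from the
  base point; values on lists of other lengths stay unconstrained.\<close>

definition alt_form :: "nat \<Rightarrow> ('v::real_vector list \<Rightarrow> complex) \<Rightarrow> bool" where
  "alt_form d \<alpha> \<longleftrightarrow> (\<forall>vs. length vs = d \<longrightarrow>
     (\<forall>l<d. linear (\<lambda>v. \<alpha> (vs[l := v]))) \<and>
     (\<forall>l<d. \<forall>l'<d. l \<noteq> l' \<and> vs ! l = vs ! l' \<longrightarrow> \<alpha> vs = 0))"

lemma alt_formD:
  assumes "alt_form d \<alpha>" "length vs = d"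
  shows "l < d \<Longrightarrow> linear (\<lambda>v. \<alpha> (vs[l := v]))"
    "l < d \<Longrightarrow> l' < d \<Longrightarrow> l \<noteq> l' \<Longrightarrow> vs ! l = vs ! l' \<Longrightarrow> \<alpha> vs = 0"
  using assms unfolding alt_form_def by blast+

abbreviation del_nth :: "nat \<Rightarrow> 'v list \<Rightarrow> 'v list" where
  "del_nth l vs \<equiv> take l vs @ drop (Suc l) vs"

lemma nth_del_nth:
  assumes "l < length vs" "i < length vs - 1"
  shows "del_nth l vs ! i = (if i < l then vs ! i else vs ! Suc i)"
  using assms by (auto simp: nth_append min_def)

lemma del_nth_update:
  assumes "l < length vs" "i < length vs" "i \<noteq> l"
  shows "del_nth l (vs[i := v]) = (del_nth l vs)[(if i < l then i else i - 1) := v]"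
proof (rule nth_equalityI)
  fix j assume "j < length (del_nth l (vs[i := v]))"
  then have j: "j < length vs - 1" using assms by simp
  show "del_nth l (vs[i := v]) ! j = (del_nth l vs)[(if i < l then i else i - 1) := v] ! j"
    using assms j nth_del_nth[of l "vs[i := v]" j] nth_del_nth[of l vs j]
    by (auto simp: nth_list_update)
qed (use assms in auto)

text \<open>Polarisation: expand the vanishing value with a + b in both slots.\<close>

lemma alt_form_swap:
  assumes "alt_form d \<alpha>" "length vs = d" "i < d" "j < d" "i \<noteq> j"
  shows "\<alpha> (vs[i := vs ! j, j := vs ! i]) = - \<alpha> vs"
proof -
  define f where "f a b = \<alpha> (vs[i := a, j := b])" for a b
  have l1: "linear (\<lambda>a. f a b)" for b
  proof -
    have "f a b = \<alpha> ((vs[j := b])[i := a])" for a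
      unfolding f_def using assms(5) by (simp add: list_update_swap)
    then show ?thesis
      using alt_formD(1)[OF assms(1), of "vs[j := b]" i] assms by simp
  qed
  have l2: "linear (\<lambda>b. f a b)" for a
    unfolding f_def using alt_formD(1)[OF assms(1), of "vs[i := a]" j] assms by simp
  have z: "f a a = 0" for a
    unfolding f_def by (rule alt_formD(2)[OF assms(1), of _ i j]) (use assms in auto)
  let ?a = "vs ! i" and ?b = "vs ! j"
  have "0 = f (?a + ?b) (?a + ?b)" using z by simp
  also have "\<dots> = f ?a ?a + f ?a ?b + (f ?b ?a + f ?b ?b)"
    by (simp add: linear_add[OF l1] linear_add[OF l2])
  finally have "f ?b ?a = - f ?a ?b"
    using z by (simp add: eq_neg_iff_add_eq_0 add.commute)
  then show ?thesis
    by (simp add: f_def)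
qed

text \<open>Deleting the later copy instead of the earlier one moves the repeated entry past the k
  entries in between. The induction exchanges the later copy with its left neighbour, which brings
  the two copies closer by one place.\<close>

lemma alt_form_del_eq_entries:
  assumes "alt_form d \<alpha>" "length vs = Suc d" "l + Suc k < Suc d" "vs ! l = vs ! (l + Suc k)"
  shows "\<alpha> (del_nth l vs) = (-1) ^ k * \<alpha> (del_nth (l + Suc k) vs)"
  using assms(2-)
proof (induction k arbitrary: vs)
  case 0
  have "del_nth l vs = del_nth (l + Suc 0) vs"
  proof (rule nth_equalityI)
    fix i assume "i < length (del_nth l vs)"
    then have i: "i < length vs - 1" using 0 by simp
    show "del_nth l vs ! i = del_nth (l + Suc 0) vs ! i"
      using nth_del_nth[of l vs i] nth_del_nth[of "l + Suc 0" vs i] 0 i by (auto simp: less_Suc_eq)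
  qed (use 0 in auto)
  then show ?case by simp
next
  case (Suc k)
  let ?p = "l + Suc k" and ?q = "l + Suc (Suc k)"
  let ?ws = "vs[?p := vs ! ?q, ?q := vs ! ?p]"
  have len: "length vs = Suc d" "?q < Suc d" using Suc.prems by auto
  have IH: "\<alpha> (del_nth l ?ws) = (-1) ^ k * \<alpha> (del_nth ?p ?ws)"
    by (rule Suc.IH) (use Suc.prems in \<open>auto simp: nth_list_update\<close>)
  have 1: "del_nth l ?ws = (del_nth l vs)[l + k := del_nth l vs ! ?p, ?p := del_nth l vs ! (l + k)]"
  proof -
    have "del_nth l vs ! ?p = vs ! ?q" "del_nth l vs ! (l + k) = vs ! ?p"
      using nth_del_nth[of l vs ?p] nth_del_nth[of l vs "l + k"] len by auto
    moreover have "del_nth l ?ws = (del_nth l vs)[l + k := vs ! ?q, ?p := vs ! ?p]"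
      using del_nth_update[of l "vs[?p := vs ! ?q]" ?q "vs ! ?p"] del_nth_update[of l vs ?p "vs ! ?q"] len
      by simp
    ultimately show ?thesis by simp
  qed
  have 2: "del_nth ?p ?ws = del_nth ?q vs"
  proof (rule nth_equalityI)
    fix i assume "i < length (del_nth ?p ?ws)"
    then have i: "i < length vs - 1" using len by simp
    show "del_nth ?p ?ws ! i = del_nth ?q vs ! i"
      using nth_del_nth[of ?p ?ws i] nth_del_nth[of ?q vs i] len i
      by (cases "i = ?p") (auto simp: nth_list_update)
  qed (use len in auto)
  have neg: "\<alpha> (del_nth l ?ws) = - \<alpha> (del_nth l vs)"
    unfolding 1 by (rule alt_form_swap[OF assms(1)]) (use len in auto)
  have "- \<alpha> (del_nth l vs) = (-1) ^ k * \<alpha> (del_nth ?q vs)"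
    by (rule trans[OF sym[OF neg] IH[unfolded 2]])
  then have "\<alpha> (del_nth l vs) = - ((-1) ^ k * \<alpha> (del_nth ?q vs))"
    by (metis minus_minus)
  then show ?case
    unfolding power_Suc by (simp only: mult.assoc mult_minus1 mult_minus_left mult_1_left)
qed

lemma linear_complex_mult: "linear f \<Longrightarrow> linear (\<lambda>v. c * f v :: complex)"
  by (auto intro!: linearI simp: linear_add linear_cmul algebra_simps)

text \<open>One antisymmetrisation step, where the remaining form may depend linearly on the removed
  vector; \<open>levi_wedge\<close> uses it twice. If the entries a < b agree, every term except
  those removing one of them contains a repeated pair, and the last two terms cancel.\<close>

lemma alt_form_wedge:
  assumes "\<And>v. alt_form d (\<beta> v)" "\<And>ws. length ws = d \<Longrightarrow> linear (\<lambda>v. \<beta> v ws)"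
  shows "alt_form (Suc d) (\<lambda>vs. \<Sum>l<length vs. (-1) ^ l * \<beta> (vs ! l) (del_nth l vs))"
  unfolding alt_form_def
proof (intro allI impI conjI)
  fix vs :: "'a list" and i
  assume len: "length vs = Suc d" and i: "i < Suc d"
  have "linear (\<lambda>v. (-1) ^ l * \<beta> (vs[i := v] ! l) (del_nth l (vs[i := v])))" if l: "l < Suc d" for l
  proof (cases "l = i")
    case True
    have "linear (\<lambda>v. (-1) ^ l * \<beta> v (del_nth i vs))"
      by (intro linear_complex_mult assms(2)) (use len i in simp)
    then show ?thesis
      using True len i by simp
  next
    case False
    let ?j = "if i < l then i else i - 1"
    have "?j < d" using False i l by auto
    then have "linear (\<lambda>v. (-1) ^ l * \<beta> (vs ! l) ((del_nth l vs)[?j := v]))"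
      by (intro linear_complex_mult alt_formD(1)[OF assms(1)]) (use len l in auto)
    moreover have "(-1) ^ l * \<beta> (vs[i := v] ! l) (del_nth l (vs[i := v])) = (-1) ^ l * \<beta> (vs ! l) ((del_nth l vs)[?j := v])" for v
      by (subst del_nth_update) (use False len i l in auto)
    ultimately show ?thesis by simp
  qed
  then have "linear (\<lambda>v. \<Sum>l\<in>{..<Suc d}. (-1) ^ l * \<beta> (vs[i := v] ! l) (del_nth l (vs[i := v])))"
    by (intro linear_compose_sum) auto
  then show "linear (\<lambda>v. \<Sum>l<length (vs[i := v]). (-1) ^ l * \<beta> (vs[i := v] ! l) (del_nth l (vs[i := v])))"
    using len by simp
next
  fix vs :: "'a list" and i j
  assume len: "length vs = Suc d" and i: "i < Suc d" and j: "j < Suc d" and ij: "i \<noteq> j \<and> vs ! i = vs ! j"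
  have key: "(\<Sum>l<length vs. (-1) ^ l * \<beta> (vs ! l) (del_nth l vs)) = 0"
    if "a < b" "b < Suc d" "vs ! a = vs ! b" for a b
  proof -
    let ?t = "\<lambda>l. (-1) ^ l * \<beta> (vs ! l) (del_nth l vs)"
    have "?t l = 0" if l: "l < Suc d" "l \<noteq> a" "l \<noteq> b" for l
    proof -
      let ?a = "if a < l then a else a - 1" and ?b = "if b < l then b else b - 1"
      have "?a < d" "?b < d" "?a \<noteq> ?b"
        using \<open>a < b\<close> \<open>b < Suc d\<close> l by (auto split: if_splits)
      moreover have "del_nth l vs ! ?a = vs ! a" "del_nth l vs ! ?b = vs ! b"
        using nth_del_nth[of l vs ?a] nth_del_nth[of l vs ?b] that l len \<open>a < b\<close> \<open>b < Suc d\<close> by (auto split: if_splits)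
      ultimately have "\<beta> (vs ! l) (del_nth l vs) = 0"
        using alt_formD(2)[OF assms(1), of "del_nth l vs" ?a ?b] len l \<open>vs ! a = vs ! b\<close> by simp
      then show ?thesis by simp
    qed
    then have "(\<Sum>l<length vs. ?t l) = (\<Sum>l\<in>{a, b}. ?t l)"
      using that len by (intro sum.mono_neutral_right) auto
    also have "\<dots> = ?t a + ?t b" using that by simp
    also have "\<dots> = 0"
    proof -
      obtain k where k: "b = a + Suc k"
        using \<open>a < b\<close> less_imp_Suc_add by fastforce
      have "\<beta> (vs ! a) (del_nth a vs) = (-1) ^ k * \<beta> (vs ! a) (del_nth b vs)"
        unfolding k by (rule alt_form_del_eq_entries[OF assms(1) len]) (use that k in auto)
      then show ?thesis
        using that(3) by (simp add: k power_add)
    qed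
    finally show ?thesis .
  qed
  show "(\<Sum>l<length vs. (-1) ^ l * \<beta> (vs ! l) (del_nth l vs)) = 0"
    using key[of i j] key[of j i] i j ij by (metis linorder_neqE_nat)
qed

lemma alt_form_compose_linear:
  assumes "alt_form d \<alpha>" "linear G"
  shows "alt_form d (\<lambda>vs. \<alpha> (map G vs))"
  unfolding alt_form_def
proof (intro allI impI conjI)
  fix vs :: "'b list" and l assume vs: "length vs = d" "l < d"
  have "linear (\<lambda>v. \<alpha> ((map G vs)[l := v]))"
    by (rule alt_formD(1)[OF assms(1)]) (use vs in auto)
  from linear_compose[OF assms(2) this] show "linear (\<lambda>v. \<alpha> (map G (vs[l := v])))"
    by (simp add: o_def map_update)
next
  fix vs :: "'b list" and l l' assume "length vs = d" "l < d" "l' < d" "l \<noteq> l' \<and> vs ! l = vs ! l'"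
  then show "\<alpha> (map G vs) = 0"
    by (intro alt_formD(2)[OF assms(1), of _ l l']) auto
qed

text \<open>Putting the vanishing combination into slot j, every summand but the j-th repeats an
  entry.\<close>

lemma alt_form_dependent:
  assumes "alt_form d \<alpha>" "length vs = d" "(\<Sum>l<d. c l *\<^sub>R vs ! l) = 0" "j < d" "c j \<noteq> 0"
  shows "\<alpha> vs = 0"
proof -
  have lin: "linear (\<lambda>v. \<alpha> (vs[j := v]))"
    by (rule alt_formD(1)[OF assms(1,2,4)])
  have "0 = \<alpha> (vs[j := (\<Sum>l<d. c l *\<^sub>R vs ! l)])"
    unfolding assms(3) using linear_0[OF lin] by simp
  also have "\<dots> = (\<Sum>l<d. c l *\<^sub>R \<alpha> (vs[j := vs ! l]))"
    by (simp add: linear_sum[OF lin] linear_cmul[OF lin])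
  also have "\<dots> = (\<Sum>l\<in>{j}. c l *\<^sub>R \<alpha> (vs[j := vs ! l]))"
  proof (rule sum.mono_neutral_right)
    show "\<forall>l\<in>{..<d} - {j}. c l *\<^sub>R \<alpha> (vs[j := vs ! l]) = 0"
    proof
      fix l assume "l \<in> {..<d} - {j}"
      then have "\<alpha> (vs[j := vs ! l]) = 0"
        by (intro alt_formD(2)[OF assms(1), of _ j l]) (use assms in auto)
      then show "c l *\<^sub>R \<alpha> (vs[j := vs ! l]) = 0" by simp
    qed
  qed (use assms in auto)
  finally show ?thesis using assms(5) by simp
qed

text \<open>The induction is on the number of slots already scaled, so that each step uses linearity
  in a single slot.\<close>

lemma alt_form_scale_prefix:
  assumes "alt_form d \<alpha>" "n \<le> d"
  shows "\<alpha> (map (\<lambda>j. if j < n then a j *\<^sub>R v j else v j) [0..<d]) =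
    of_real (\<Prod>j<n. a j) * \<alpha> (map v [0..<d])"
  using assms(2)
proof (induction n)
  case 0
  then show ?case by simp
next
  case (Suc n)
  let ?L = "\<lambda>n. map (\<lambda>j. if j < n then a j *\<^sub>R v j else v j) [0..<d]"
  have lin: "linear (\<lambda>w. \<alpha> ((?L n)[n := w]))"
    by (rule alt_formD(1)[OF assms(1)]) (use Suc.prems in auto)
  have 1: "?L (Suc n) = (?L n)[n := a n *\<^sub>R v n]"
    by (rule nth_equalityI) (use Suc.prems in \<open>auto simp: nth_list_update less_Suc_eq\<close>)
  have 2: "?L n = (?L n)[n := v n]"
    by (rule nth_equalityI) (use Suc.prems in \<open>auto simp: nth_list_update\<close>)
  have "\<alpha> (?L (Suc n)) = a n *\<^sub>R \<alpha> ((?L n)[n := v n])"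
    unfolding 1 by (rule linear_cmul[OF lin])
  also have "\<dots> = a n *\<^sub>R \<alpha> (?L n)"
    using 2 by simp
  finally show ?case
    using Suc by (simp add: scaleR_conv_of_real)
qed

lemma sum_nth_distinct: "distinct L \<Longrightarrow> (\<Sum>l<length L. g (L ! l)) = sum g (set L)"
  by (rule sum.reindex_bij_betw[OF bij_betw_nth]) auto

lemma prod_nth_distinct: "distinct L \<Longrightarrow> (\<Prod>l<length L. g (L ! l)) = prod g (set L)"
  by (rule prod.reindex_bij_betw[OF bij_betw_nth]) auto

text \<open>Both sides are multiplicative in the matrix, the left one because an alternating form
  composed with a matrix is again alternating. This reduces the rule to elementary matrices. The
  list L fixes an order of the index type, since forms take lists of vectors.\<close>

lemma alt_form_det:
  fixes A :: "real^'k::finite^'k"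
  assumes "distinct L" "set L = UNIV" "alt_form CARD('k) \<alpha>"
  shows "\<alpha> (map (\<lambda>i. A *v axis i 1) L) = of_real (det A) * \<alpha> (map (\<lambda>i. axis i 1) L)"
  using assms(3)
proof (induction A arbitrary: \<alpha> rule: induct_matrix_elementary_alt)
  case (1 A B)
  have "alt_form CARD('k) (\<lambda>vs. \<alpha> (map ((*v) A) vs))"
    by (rule alt_form_compose_linear[OF 1(3) matrix_vector_mul_linear])
  from 1(2)[OF this] 1(1)[OF 1(3)] show ?case
    by (simp add: o_def matrix_vector_mul_assoc det_mul)
next
  case (2 A i)
  have len: "length L = CARD('k)"
    using assms(1,2) distinct_card by metis
  have "det A = 0" using det_zero_row(2)[OF 2(1)] .
  then have "\<not> inj ((*v) A)"
    using det_nz_iff_inj[OF matrix_vector_mul_linear[of A]] by simp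
  \<comment> \<open>A kernel vector is a linear relation between the columns, on which an
    alternating form vanishes.\<close>
  then obtain x where x: "A *v x = 0" "x \<noteq> 0"
    using linear_injective_0[OF matrix_vector_mul_linear[of A]] by blast
  then obtain j where j: "x $ j \<noteq> 0" by (auto simp: vec_eq_iff)
  obtain p where p: "p < length L" "L ! p = j"
    using assms(2) by (metis UNIV_I in_set_conv_nth)
  have "\<alpha> (map (\<lambda>i. A *v axis i 1) L) = 0"
  proof (rule alt_form_dependent[OF 2(2), where c="\<lambda>l. x $ (L ! l)" and j=p])
    have "(\<Sum>l<CARD('k). x $ (L ! l) *\<^sub>R map (\<lambda>i. A *v axis i 1) L ! l) = (\<Sum>l<length L. x $ (L ! l) *\<^sub>R (A *v axis (L ! l) 1))"
      unfolding len[symmetric] by (rule sum.cong) auto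
    also have "\<dots> = (\<Sum>i\<in>UNIV. x $ i *\<^sub>R (A *v axis i 1))"
      using sum_nth_distinct[OF assms(1), of "\<lambda>i. x $ i *\<^sub>R (A *v axis i 1)"] assms(2) by simp
    also have "\<dots> = A *v (\<Sum>i\<in>UNIV. x $ i *\<^sub>R axis i 1)"
      by (simp add: linear_sum[OF matrix_vector_mul_linear] linear_cmul[OF matrix_vector_mul_linear])
    also have "(\<Sum>i\<in>UNIV. x $ i *\<^sub>R axis i 1) = x"
      by (simp add: vec_eq_iff axis_def if_distrib cong: if_cong)
    finally show "(\<Sum>l<CARD('k). x $ (L ! l) *\<^sub>R map (\<lambda>i. A *v axis i 1) L ! l) = 0"
      using x(1) by simp
  qed (use len p j in auto)
  with \<open>det A = 0\<close> show ?case by simp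
next
  case (3 A)
  have len: "length L = CARD('k)"
    using assms(1,2) distinct_card by metis
  have "A *v axis i 1 = A $ i $ i *\<^sub>R axis i 1" for i
    unfolding matrix_vector_mult_basis using 3(1) by (auto simp: vec_eq_iff column_def axis_def)
  then have "map (\<lambda>i. A *v axis i 1) L = map (\<lambda>j. if j < CARD('k) then A $ (L ! j) $ (L ! j) *\<^sub>R axis (L ! j) 1 else axis (L ! j) 1) [0..<CARD('k)]"
    by (intro nth_equalityI) (auto simp: len)
  then have "\<alpha> (map (\<lambda>i. A *v axis i 1) L) = of_real (\<Prod>j<CARD('k). A $ (L ! j) $ (L ! j)) * \<alpha> (map (\<lambda>j. axis (L ! j) 1) [0..<CARD('k)])"
    using alt_form_scale_prefix[OF 3(2), of "CARD('k)" "\<lambda>j. A $ (L ! j) $ (L ! j)" "\<lambda>j. axis (L ! j) 1"] by simp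
  moreover have "map (\<lambda>j. axis (L ! j) 1 :: real^'k) [0..<CARD('k)] = map (\<lambda>i. axis i 1) L"
    by (intro nth_equalityI) (auto simp: len)
  moreover have "(\<Prod>j<CARD('k). A $ (L ! j) $ (L ! j)) = det A"
    using prod_nth_distinct[OF assms(1), of "\<lambda>i. A $ i $ i"] 3(1) len assms(2) by (simp add: det_diagonal)
  ultimately show ?case by simp
next
  case (4 m n)
  have len: "length L = CARD('k)"
    using assms(1,2) distinct_card by metis
  let ?S = "(\<chi> i j. mat 1 $ i $ Transposition.transpose m n j) :: real^'k^'k"
  let ?E = "map (\<lambda>i. axis i 1 :: real^'k) L"
  obtain p q where pq: "p < length L" "L ! p = m" "q < length L" "L ! q = n"
    using assms(2) by (metis UNIV_I in_set_conv_nth)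
  then have "p \<noteq> q" using 4(1) by auto
  have "?S *v axis j 1 = axis (Transposition.transpose m n j) 1" for j
    unfolding matrix_vector_mult_basis
    by (auto simp: vec_eq_iff column_def axis_def mat_def Transposition.transpose_def)
  then have "map (\<lambda>i. ?S *v axis i 1) L = ?E[p := ?E ! q, q := ?E ! p]"
    using pq assms(1) \<open>p \<noteq> q\<close>
    by (intro nth_equalityI) (auto simp: nth_list_update Transposition.transpose_def nth_eq_iff_index_eq)
  then have "\<alpha> (map (\<lambda>i. ?S *v axis i 1) L) = - \<alpha> ?E"
    using alt_form_swap[OF 4(2), of ?E p q] pq len \<open>p \<noteq> q\<close> by simp
  moreover have "det ?S = - 1"
    using det_permute_columns[of "Transposition.transpose m n" "mat 1 :: real^'k^'k"] 4(1)
    by (simp add: permutes_swap_id sign_swap_id)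
  ultimately show ?case by simp
next
  case (5 m n)
  have len: "length L = CARD('k)"
    using assms(1,2) distinct_card by metis
  let ?S = "(\<chi> i j. of_bool (i = m \<and> j = n \<or> i = j)) :: real^'k^'k"
  let ?E = "map (\<lambda>i. axis i 1 :: real^'k) L"
  obtain p q where pq: "p < length L" "L ! p = m" "q < length L" "L ! q = n"
    using assms(2) by (metis UNIV_I in_set_conv_nth)
  then have "p \<noteq> q" using 5(1) by auto
  have "?S *v axis j 1 = axis j 1 + (if j = n then axis m 1 else 0)" for j
    unfolding matrix_vector_mult_basis using 5(1) by (auto simp: vec_eq_iff column_def axis_def)
  then have "map (\<lambda>i. ?S *v axis i 1) L = ?E[q := ?E ! q + ?E ! p]"
    using pq assms(1)
    by (intro nth_equalityI) (auto simp: nth_list_update nth_eq_iff_index_eq)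
  moreover have lin: "linear (\<lambda>v. \<alpha> (?E[q := v]))"
    by (rule alt_formD(1)[OF 5(2)]) (use pq len in auto)
  ultimately have "\<alpha> (map (\<lambda>i. ?S *v axis i 1) L) = \<alpha> (?E[q := ?E ! q]) + \<alpha> (?E[q := ?E ! p])"
    by (simp only: linear_add[OF lin])
  also have "\<alpha> (?E[q := ?E ! p]) = 0"
    by (rule alt_formD(2)[OF 5(2), of _ p q]) (use pq len \<open>p \<noteq> q\<close> in auto)
  finally have a: "\<alpha> (map (\<lambda>i. ?S *v axis i 1) L) = \<alpha> ?E" by simp
  have d: "det ?S = 1"
  proof -
    have "?S = (\<chi> k. if k = m then row m (mat 1) + 1 *s row n (mat 1) else row k (mat 1))"
      using 5(1) by (auto simp: vec_eq_iff row_def mat_def)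
    then show ?thesis
      using det_row_operation[OF 5(1), of "mat 1 :: real^'k^'k" 1] by simp
  qed
  show ?case unfolding d of_real_1 mult_1_left by (rule a)
qed

section \<open>Real coordinates on complex space\<close>

text \<open>The change of variables theorem of the library needs a well-ordered index type.\<close>

typedef (overloaded) 'm idx = "{..<2 * CARD('m::finite)}"
  by (rule exI[of _ 0]) simp

instantiation idx :: (finite) wellorder
begin

definition "i \<le> j \<longleftrightarrow> Rep_idx i \<le> Rep_idx (j :: 'a idx)"
definition "i < j \<longleftrightarrow> Rep_idx i < Rep_idx (j :: 'a idx)"

instance
proof
  fix x y z :: "'a idx"
  show "x < y \<longleftrightarrow> x \<le> y \<and> \<not> y \<le> x"
    unfolding less_idx_def less_eq_idx_def by (rule less_le_not_le)
  show "x \<le> x"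
    unfolding less_eq_idx_def by (rule order_refl)
  show "x \<le> y \<or> y \<le> x"
    unfolding less_eq_idx_def by (rule linear)
  show "x \<le> z" if "x \<le> y" "y \<le> z"
    using that unfolding less_eq_idx_def by (rule order_trans)
  show "x = y" if "x \<le> y" "y \<le> x"
    using that unfolding less_eq_idx_def by (simp flip: Rep_idx_inject)
next
  fix P :: "'a idx \<Rightarrow> bool" and a :: "'a idx"
  assume *: "\<And>x. (\<And>y. y < x \<Longrightarrow> P y) \<Longrightarrow> P x"
  show "P a"
    by (induction a rule: measure_induct_rule[of Rep_idx]) (rule *, simp add: less_idx_def)
qed

end

lemma bij_betw_Rep_idx: "bij_betw Rep_idx (UNIV :: 'm::finite idx set) {..<2 * CARD('m)}"
  by (simp add: bij_betw_def inj_def Rep_idx_inject type_definition.Rep_range[OF type_definition_idx])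

instance idx :: (finite) finite
proof
  show "finite (UNIV :: 'a idx set)"
    using bij_betw_finite[OF bij_betw_Rep_idx] by simp
qed

lemma card_idx: "CARD('m::finite idx) = 2 * CARD('m)"
  using bij_betw_same_card[OF bij_betw_Rep_idx] by simp

definition idx_list :: "'m::finite idx list" where
  "idx_list = map Abs_idx [0..<2 * CARD('m)]"

lemma idx_list:
  "distinct (idx_list :: 'm::finite idx list)" "set (idx_list :: 'm idx list) = UNIV"
  "length (idx_list :: 'm idx list) = 2 * CARD('m)"
  "i < 2 * CARD('m) \<Longrightarrow> Rep_idx ((idx_list :: 'm idx list) ! i) = i"
proof -
  show "distinct (idx_list :: 'm idx list)"
    unfolding idx_list_def distinct_map by (auto simp: inj_on_def Abs_idx_inject)
  show "set (idx_list :: 'm idx list) = UNIV"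
    unfolding idx_list_def using type_definition.Abs_image[OF type_definition_idx]
    by (simp add: lessThan_atLeast0)
qed (auto simp: idx_list_def Abs_idx_inverse)

lemma std_frame:
  "length (std_frame :: (complex^'m::finite) list) = 2 * CARD('m)"
  "distinct (std_frame :: (complex^'m) list)" "set (std_frame :: (complex^'m) list) = Basis"
proof -
  define as where "as = (SOME as. distinct as \<and> set as = (UNIV :: 'm set))"
  have as: "distinct as" "set as = UNIV"
    using someI_ex[OF finite_distinct_list[OF finite_class.finite_UNIV]] unfolding as_def conj_commute[of "distinct _"]
    by (auto simp: conj_commute)
  have sf: "std_frame = concat (map (\<lambda>a. [axis a 1, axis a \<i> :: complex^'m]) as)"
    unfolding std_frame_def as_def ..
  have len: "length (concat (map (\<lambda>a. [axis a 1, axis a \<i> :: complex^'m]) xs)) = 2 * length xs" for xs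
    by (induction xs) auto
  show l: "length (std_frame :: (complex^'m) list) = 2 * CARD('m)"
    unfolding sf len using as distinct_card by metis
  show s: "set (std_frame :: (complex^'m) list) = Basis"
    unfolding sf using as(2) by (auto simp: Basis_vec_def Basis_complex_def)
  show "distinct (std_frame :: (complex^'m) list)"
    by (rule card_distinct) (simp add: l s)
qed

text \<open>The coordinates follow \<open>std_frame\<close>, an orthonormal basis, so that a form
  evaluated on \<open>std_frame\<close> is its value on the coordinate vectors and Lebesgue measure
  is preserved.\<close>

definition cx :: "real^'m::finite idx \<Rightarrow> complex^'m" where
  "cx x = (\<Sum>i\<in>UNIV. x $ i *\<^sub>R std_frame ! Rep_idx i)"

definition rl :: "complex^'m::finite \<Rightarrow> real^'m idx" where
  "rl z = (\<chi> i. z \<bullet> std_frame ! Rep_idx i)"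

lemma bij_betw_std_frame: "bij_betw (\<lambda>i::'m::finite idx. std_frame ! Rep_idx i :: complex^'m) UNIV Basis"
proof -
  have "bij_betw ((!) (std_frame :: (complex^'m) list)) {..<2 * CARD('m)} Basis"
    using bij_betw_nth[OF std_frame(2)] std_frame by (metis)
  from bij_betw_trans[OF bij_betw_Rep_idx this] show ?thesis by (simp add: o_def)
qed

lemma std_frame_inner:
  fixes i j :: "'m::finite idx"
  shows "(std_frame ! Rep_idx i :: complex^'m) \<bullet> std_frame ! Rep_idx j = (if i = j then 1 else 0)"
proof -
  have "inj (\<lambda>i::'m idx. std_frame ! Rep_idx i :: complex^'m)" "\<And>i::'m idx. (std_frame ! Rep_idx i :: complex^'m) \<in> Basis"
    using bij_betw_std_frame[where 'm='m] by (auto simp: bij_betw_def)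
  then show ?thesis
    by (auto simp: inner_Basis inj_def)
qed

lemma rl_cx [simp]: "rl (cx x) = x"
  by (simp add: rl_def cx_def vec_eq_iff inner_sum_left std_frame_inner if_distrib cong: if_cong)

lemma cx_rl [simp]: "cx (rl z) = z"
proof -
  have "cx (rl z) = (\<Sum>b\<in>Basis. (z \<bullet> b) *\<^sub>R b)"
    unfolding cx_def rl_def vec_lambda_beta
    by (rule sum.reindex_bij_betw[OF bij_betw_std_frame, of "\<lambda>b. (z \<bullet> b) *\<^sub>R b"])
  then show ?thesis by (simp add: euclidean_representation)
qed

lemma linear_cx: "linear cx" and linear_rl: "linear rl"
  by (auto intro!: linearI simp: cx_def rl_def vec_eq_iff sum.distrib scaleR_left_distrib scaleR_sum_right inner_add_left)

lemma cx_axis: "cx (axis i 1) = std_frame ! Rep_idx i"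
  by (simp add: cx_def axis_def if_distrib[of "\<lambda>x. x *\<^sub>R _"] cong: if_cong)

lemma map_cx_axis: "map (\<lambda>i. cx (axis i 1)) (idx_list :: 'm::finite idx list) = std_frame"
  by (rule nth_equalityI) (auto simp: cx_axis idx_list std_frame)

definition real_det :: "(complex^'m::finite \<Rightarrow> complex^'m) \<Rightarrow> real" where
  "real_det G = det (matrix (rl \<circ> G \<circ> cx))"

text \<open>This is \<open>alt_form_det\<close> in the coordinates \<open>cx\<close>, in which
  \<open>std_frame\<close> is the standard basis.\<close>

lemma alt_form_real_det:
  fixes G :: "complex^'m::finite \<Rightarrow> complex^'m"
  assumes "alt_form (2 * CARD('m)) \<alpha>" "linear G"
  shows "\<alpha> (map G std_frame) = of_real (real_det G) * \<alpha> std_frame"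
proof -
  let ?L = "idx_list :: 'm idx list"
  let ?A = "matrix (rl \<circ> G \<circ> cx)"
  have lin: "linear (rl \<circ> G \<circ> cx)"
    by (intro linear_compose linear_cx linear_rl assms(2))
  have "alt_form CARD('m idx) (\<lambda>vs. \<alpha> (map cx vs))"
    unfolding card_idx by (rule alt_form_compose_linear[OF assms(1) linear_cx])
  from alt_form_det[OF idx_list(1,2) this, of ?A]
  have "\<alpha> (map (\<lambda>i. cx (?A *v axis i 1)) ?L) = of_real (real_det G) * \<alpha> (map (\<lambda>i. cx (axis i 1)) ?L)"
    by (simp add: o_def real_det_def)
  moreover have "cx (?A *v axis i 1) = G (cx (axis i 1))" for i
    using fun_cong[OF matrix_vector_mul(2)[OF lin], of "axis i 1"] by simp
  ultimately have "\<alpha> (map G (map (\<lambda>i. cx (axis i 1)) ?L)) = of_real (real_det G) * \<alpha> (map (\<lambda>i. cx (axis i 1)) ?L)"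
    by (simp add: o_def)
  then show ?thesis
    unfolding map_cx_axis .
qed

lemma bounded_linear_cx: "bounded_linear cx" and bounded_linear_rl: "bounded_linear rl"
  using linear_cx linear_rl linear_conv_bounded_linear by blast+

lemma real_det_nz_iff_inj:
  assumes "linear G"
  shows "real_det G \<noteq> 0 \<longleftrightarrow> inj G"
proof -
  have "inj (rl \<circ> G \<circ> cx) \<longleftrightarrow> inj G"
  proof
    assume i: "inj (rl \<circ> G \<circ> cx)"
    show "inj G"
    proof (rule injI)
      fix x y assume "G x = G y"
      then have "(rl \<circ> G \<circ> cx) (rl x) = (rl \<circ> G \<circ> cx) (rl y)" by simp
      then have "rl x = rl y" using i by (rule injD[rotated])
      then have "cx (rl x) = cx (rl y)" by simp
      then show "x = y" by simp
    qed
  next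
    assume i: "inj G"
    show "inj (rl \<circ> G \<circ> cx)"
    proof (rule injI)
      fix x y assume "(rl \<circ> G \<circ> cx) x = (rl \<circ> G \<circ> cx) y"
      then have "cx (rl (G (cx x))) = cx (rl (G (cx y)))" by simp
      then have "cx x = cx y" using i by (auto dest: injD)
      then have "rl (cx x) = rl (cx y)" by simp
      then show "x = y" by simp
    qed
  qed
  moreover have "linear (rl \<circ> G \<circ> cx)"
    by (intro linear_compose linear_cx linear_rl assms)
  ultimately show ?thesis
    unfolding real_det_def using det_nz_iff_inj by blast
qed

text \<open>The complex linear maps \<open>(1 - z) id + z G\<close> are invertible for \<open>z\<close> outside a finite set,
  whose complement is connected.\<close>

lemma real_det_complex_linear_nonneg:
  fixes G :: "complex^'m::finite \<Rightarrow> complex^'m"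
  assumes "linear G" "\<And>c v. G (c *s v) = c *s G v"
  shows "0 \<le> real_det G"
proof (rule ccontr)
  assume neg: "\<not> 0 \<le> real_det G"
  define H where "H z v = (1 - z) *s v + z *s G v" for z v
  \<comment> \<open>The entries of (1 - z) id + z G are polynomials in z of degree at most one, so
    its complex determinant is a polynomial q. It is not the zero polynomial, because the map is the
    identity at z = 0.\<close>
  define P where "P = (\<chi> i j. [:of_bool (i = j), G (axis j 1) $ i - of_bool (i = j):] :: complex poly^'m^'m)"
  define A where "A z = (\<chi> i j. poly (P $ i $ j) z)" for z
  define q where "q = det P"
  have linH: "linear (H z)" for z
    by (rule linearI) (simp_all add: H_def linear_add[OF assms(1)] linear_cmul[OF assms(1)] vector_smult_add vector_smult_scaleR algebra_simps)
  have qz: "poly q z = det (A z)" for z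
    by (simp add: q_def A_def det_def poly_sum poly_prod)
  have G: "G v = (\<chi> i. \<Sum>j\<in>UNIV. G (axis j 1) $ i * v $ j)" for v
  proof -
    have v: "v = (\<Sum>a\<in>UNIV. (v $ a) *s axis a 1)"
      by (simp add: vec_eq_iff axis_def if_distrib cong: if_cong)
    have "G v = (\<Sum>a\<in>UNIV. v $ a *s G (axis a 1))"
      by (subst v) (simp only: linear_sum[OF assms(1)] assms(2))
    then show ?thesis by (simp add: vec_eq_iff mult.commute)
  qed
  have AH: "A z *v v = H z v" for z v
  proof -
    have "(A z *v v) $ i = H z v $ i" for i
    proof -
      have "(A z *v v) $ i = (\<Sum>j\<in>UNIV. of_bool (i = j) * v $ j + z * (G (axis j 1) $ i * v $ j) - z * (of_bool (i = j) * v $ j))"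
        unfolding matrix_vector_mult_def A_def P_def by (simp add: algebra_simps)
      also have "\<dots> = v $ i + z * (\<Sum>j\<in>UNIV. G (axis j 1) $ i * v $ j) - z * v $ i"
        by (simp add: sum.distrib sum_subtractf sum_distrib_left flip: sum_distrib_left)
      also have "\<dots> = H z v $ i"
        unfolding H_def by (subst (2) G) (simp add: algebra_simps)
      finally show ?thesis .
    qed
    then show ?thesis by (simp add: vec_eq_iff)
  qed
  have det_iff: "poly q z \<noteq> 0 \<longleftrightarrow> real_det (H z) \<noteq> 0" for z
  proof -
    have "poly q z \<noteq> 0 \<longleftrightarrow> invertible (A z)"
      unfolding qz invertible_det_nz ..
    also have "\<dots> \<longleftrightarrow> inj ((*v) (A z))"
      unfolding invertible_left_inverse matrix_left_invertible_injective ..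
    also have "(*v) (A z) = H z" using AH by (simp add: fun_eq_iff)
    finally show ?thesis using real_det_nz_iff_inj[OF linH] by simp
  qed
  have H0: "H 0 = id" and H1: "H 1 = G" by (simp_all add: H_def fun_eq_iff)
  have "rl \<circ> id \<circ> cx = (id :: real^'m idx \<Rightarrow> _)" by (simp add: fun_eq_iff)
  then have D0: "real_det (H 0) = 1"
    unfolding H0 real_det_def by (simp add: matrix_id_mat_1)
  then have "q \<noteq> 0" using det_iff[of 0] by auto
  then have fin: "finite {z. poly q z = 0}" by (rule poly_roots_finite)
  have conn: "connected (UNIV - {z. poly q z = 0})"
    by (rule connected_open_delete_finite) (use fin in auto)
  have cont: "continuous_on UNIV (\<lambda>z. real_det (H z))"
    unfolding real_det_def matrix_def det_def H_def o_def rl_def vec_lambda_beta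
    by (intro continuous_intros bounded_linear.continuous_on[OF bounded_linear_inner_left])
  have "connected ((\<lambda>z. real_det (H z)) ` (UNIV - {z. poly q z = 0}))"
    by (rule connected_continuous_image[OF continuous_on_subset[OF cont] conn]) simp
  moreover have "real_det (H 1) \<in> (\<lambda>z. real_det (H z)) ` (UNIV - {z. poly q z = 0})"
    using det_iff[of 1] neg H1 by auto
  moreover have "real_det (H 0) \<in> (\<lambda>z. real_det (H z)) ` (UNIV - {z. poly q z = 0})"
    using det_iff[of 0] D0 by auto
  \<comment> \<open>The value 1 at z = 0 and the supposedly negative value at z = 1 lie in a
    connected image, so 0 would be attained at a point where q does not vanish.\<close>
  ultimately have "0 \<in> (\<lambda>z. real_det (H z)) ` (UNIV - {z. poly q z = 0})"
    by (rule connectedD_interval) (use neg H1 D0 in auto)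
  then obtain z where "0 = real_det (H z)" "z \<in> UNIV - {z. poly q z = 0}" by (rule imageE)
  then show False using det_iff[of z] by simp
qed

section \<open>Holomorphic change of variables\<close>

lemma lborel_cx: "distr lborel borel cx = (lborel :: (complex^'m::finite) measure)"
proof (rule lborel_eqI[symmetric])
  fix l u :: "complex^'m" assume lu: "\<And>b. b \<in> Basis \<Longrightarrow> l \<bullet> b \<le> u \<bullet> b"
  have meas: "cx \<in> borel_measurable borel"
    by (intro borel_measurable_continuous_onI linear_continuous_on bounded_linear_cx)
  have inner: "cx x \<bullet> std_frame ! Rep_idx i = x $ i" for x and i :: "'m idx"
    using arg_cong[OF rl_cx[of x], of "\<lambda>y. y $ i"] by (simp only: rl_def vec_lambda_beta)
  have B: "Basis = range (\<lambda>i::'m idx. std_frame ! Rep_idx i :: complex^'m)"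
    using bij_betw_std_frame by (metis bij_betw_imp_surj_on)
  \<comment> \<open>Lebesgue measure is determined by its values on boxes, and boxes correspond to
    boxes because the frame consists of the basis vectors.\<close>
  have box: "cx -` box l u = box (rl l) (rl u)"
  proof (rule set_eqI)
    fix x :: "real^'m idx"
    have "cx x \<in> box l u \<longleftrightarrow> (\<forall>i. l \<bullet> std_frame ! Rep_idx i < x $ i \<and> x $ i < u \<bullet> std_frame ! Rep_idx i)"
      by (simp add: mem_box B inner)
    also have "\<dots> \<longleftrightarrow> x \<in> box (rl l) (rl u)"
      by (simp add: mem_box_cart rl_def)
    finally show "x \<in> cx -` box l u \<longleftrightarrow> x \<in> box (rl l) (rl u)" by simp
  qed
  have bB: "bij_betw (\<lambda>i::'m idx. axis i (1::real)) UNIV Basis"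
    by (auto simp: bij_betw_def inj_on_def axis_eq_axis Basis_vec_def)
  have lu': "rl l $ i \<le> rl u $ i" for i
    unfolding rl_def vec_lambda_beta by (rule lu) (use B in blast)
  have "emeasure (distr lborel borel cx) (box l u) = emeasure lborel (box (rl l) (rl u))"
    using meas by (subst emeasure_distr) (auto simp: box)
  also have "\<dots> = (\<Prod>b\<in>Basis. (rl u - rl l) \<bullet> b)"
    using lu' by (intro emeasure_lborel_box) (auto simp: Basis_vec_def inner_axis)
  also have "(\<Prod>b\<in>Basis. (rl u - rl l) \<bullet> b) = (\<Prod>i\<in>UNIV. (rl u - rl l) \<bullet> axis i 1)"
    by (rule prod.reindex_bij_betw[OF bB, symmetric])
  also have "\<dots> = (\<Prod>i\<in>(UNIV :: 'm idx set). (u - l) \<bullet> std_frame ! Rep_idx i)"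
    by (simp add: inner_axis rl_def inner_diff_left)
  also have "\<dots> = (\<Prod>b\<in>Basis. (u - l) \<bullet> b)"
    by (rule prod.reindex_bij_betw[OF bij_betw_std_frame])
  finally show "emeasure (distr lborel borel cx) (box l u) = (\<Prod>b\<in>Basis. (u - l) \<bullet> b)" .
qed simp

lemma set_integral_cx:
  fixes f :: "complex^'m::finite \<Rightarrow> 'y::{banach, second_countable_topology}"
  assumes "set_integrable lborel T f"
  shows "set_integrable lborel (cx -` T) (\<lambda>x. f (cx x))"
    "set_lebesgue_integral lborel (cx -` T) (\<lambda>x. f (cx x)) = set_lebesgue_integral lborel T f"
proof -
  have meas: "cx \<in> borel_measurable borel"
    by (intro borel_measurable_continuous_onI linear_continuous_on bounded_linear_cx)
  have i: "integrable lborel (\<lambda>x. indicator T x *\<^sub>R f x)"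
    using assms by (simp add: set_integrable_def)
  then have m: "(\<lambda>x. indicator T x *\<^sub>R f x) \<in> borel_measurable borel"
    by (auto dest: borel_measurable_integrable)
  have ind: "indicator (cx -` T) x = (indicator T (cx x) :: real)" for x
    by (simp add: indicator_def)
  show "set_integrable lborel (cx -` T) (\<lambda>x. f (cx x))"
    unfolding set_integrable_def ind
    using integrable_distr_eq[of cx lborel borel "\<lambda>x. indicator T x *\<^sub>R f x"] meas m i by (simp add: lborel_cx)
  show "set_lebesgue_integral lborel (cx -` T) (\<lambda>x. f (cx x)) = set_lebesgue_integral lborel T f"
    unfolding set_lebesgue_integral_def ind
  proof -
    have "cx \<in> measurable lborel borel" using meas by simp
    from integral_distr[OF this m] show "(\<integral>x. indicator T (cx x) *\<^sub>R f (cx x) \<partial>lborel) = (\<integral>x. indicator T x *\<^sub>R f x \<partial>lborel)"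
      unfolding lborel_cx by (rule sym)
  qed
qed

lemma set_integrable_lborel_imp_absolutely_integrable:
  fixes f :: "'x::euclidean_space \<Rightarrow> 'y::euclidean_space"
  assumes "set_integrable lborel S f"
  shows "f absolutely_integrable_on S"
  using assms unfolding set_integrable_def
  by (subst integrable_completion) (auto dest: borel_measurable_integrable)

lemma integral_change_of_variables_complex:
  fixes f :: "real^'k::{finite,wellorder} \<Rightarrow> complex" and g :: "real^'k::_ \<Rightarrow> real^'k::_"
  assumes "S \<in> sets lebesgue" "\<And>x. x \<in> S \<Longrightarrow> (g has_derivative g' x) (at x within S)" "inj_on g S"
    "f absolutely_integrable_on (g ` S)" "(\<lambda>x. \<bar>det (matrix (g' x))\<bar> *\<^sub>R f (g x)) absolutely_integrable_on S"
  shows "integral (g ` S) f = integral S (\<lambda>x. \<bar>det (matrix (g' x))\<bar> *\<^sub>R f (g x))"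
proof -
  \<comment> \<open>The change of variables theorem is applied to functions with values in a real
    coordinate space, with real and imaginary part as components.\<close>
  define V :: "complex \<Rightarrow> real^2" where "V z = (\<chi> i. if i = 1 then Re z else Im z)" for z
  have "linear V"
    by (rule linearI) (auto simp: V_def vec_eq_iff)
  then have V: "bounded_linear V" using linear_conv_bounded_linear by blast
  have inj: "z = w" if "V z = V w" for z w
  proof -
    from that have "V z $ 1 = V w $ 1" "V z $ 2 = V w $ 2" by simp_all
    then show ?thesis by (simp add: V_def complex_eq_iff)
  qed
  have i1: "(\<lambda>x. V (f x)) absolutely_integrable_on (g ` S)"
    using absolutely_integrable_linear[OF assms(4) V] by (simp add: o_def)
  have "V (integral (g ` S) f) = integral (g ` S) (\<lambda>x. V (f x))"
    using integral_linear[OF set_lebesgue_integral_eq_integral(1)[OF assms(4)] V] by (simp add: o_def)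
  also have "\<dots> = integral S (\<lambda>x. \<bar>det (matrix (g' x))\<bar> *\<^sub>R V (f (g x)))"
    by (rule integral_change_of_variables[OF assms(1-3)]) (use i1 in auto)
  also have "\<dots> = integral S (\<lambda>x. V (\<bar>det (matrix (g' x))\<bar> *\<^sub>R f (g x)))"
    by (simp add: linear_cmul[OF \<open>linear V\<close>])
  also have "\<dots> = V (integral S (\<lambda>x. \<bar>det (matrix (g' x))\<bar> *\<^sub>R f (g x)))"
    using integral_linear[OF set_lebesgue_integral_eq_integral(1)[OF assms(5)] V] by (simp add: o_def)
  finally show ?thesis by (rule inj)
qed

text \<open>The derivative of F is complex linear, so its real determinant is nonnegative and the
  absolute value in the change of variables disappears. Here the complex orientation is used: forms
  of top degree transform with the determinant itself.\<close>

lemma holo_change_of_variables: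
  fixes F :: "complex^'m::finite \<Rightarrow> complex^'m" and f :: "complex^'m \<Rightarrow> complex"
  assumes "holo_map_on F S" "inj_on F S" "S \<in> sets borel" "set_integrable lborel (F ` S) f"
    "set_integrable lborel S (\<lambda>x. of_real (real_det (frechet_derivative F (at x))) * f (F x))"
  shows "set_lebesgue_integral lborel (F ` S) f =
    set_lebesgue_integral lborel S (\<lambda>x. of_real (real_det (frechet_derivative F (at x))) * f (F x))"
proof -
  let ?F' = "\<lambda>x. frechet_derivative F (at x)"
  let ?S = "cx -` S" and ?g = "\<lambda>x. rl (F (cx x))" and ?g' = "\<lambda>x. rl \<circ> ?F' (cx x) \<circ> cx"
  have J: "\<bar>det (matrix (?g' x))\<bar> = real_det (?F' (cx x))" if "x \<in> ?S" for x
  proof -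
    have "linear (?F' (cx x))"
      using holo_map_onD(1)[OF assms(1), of "cx x"] that has_derivative_linear by auto
    then have "0 \<le> real_det (?F' (cx x))"
      by (rule real_det_complex_linear_nonneg) (use holo_map_onD(2)[OF assms(1)] that in auto)
    then show ?thesis by (simp add: real_det_def)
  qed
  have im: "?g ` ?S = cx -` (F ` S)"
  proof -
    have "y \<in> ?g ` ?S" if "cx y = F x" "x \<in> S" for x y
      by (rule image_eqI[of _ _ "rl x"]) (use that in \<open>auto simp flip: that(1)\<close>)
    then show ?thesis by auto
  qed
  have der: "(?g has_derivative ?g' x) (at x within ?S)" if "x \<in> ?S" for x
  proof -
    have 1: "(F has_derivative ?F' (cx x)) (at (cx x))"
      using holo_map_onD(1)[OF assms(1)] that by simp
    have 2: "(cx has_derivative cx) (at x within ?S)" "(rl has_derivative rl) (at (F (cx x)))"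
      by (intro bounded_linear_imp_has_derivative bounded_linear_cx bounded_linear_rl)+
    from has_derivative_compose[OF has_derivative_compose[OF 2(1) 1] 2(2)]
    show ?thesis by (simp add: o_def)
  qed
  have inj: "inj_on ?g ?S"
  proof (rule inj_onI)
    fix x y assume "x \<in> ?S" "y \<in> ?S" "?g x = ?g y"
    then have "cx (?g x) = cx (?g y)" by simp
    then have "cx x = cx y" using \<open>x \<in> ?S\<close> \<open>y \<in> ?S\<close> assms(2) by (auto dest: inj_onD)
    then have "rl (cx x) = rl (cx y)" by simp
    then show "x = y" by simp
  qed
  have S: "?S \<in> sets lebesgue"
  proof -
    have "cx \<in> borel_measurable borel"
      by (intro borel_measurable_continuous_onI linear_continuous_on bounded_linear_cx)
    then have "?S \<in> sets borel" using assms(3) measurable_sets_borel by blast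
    then show ?thesis by simp
  qed
  note i1 = set_integral_cx[OF assms(4)] and i2 = set_integral_cx[OF assms(5)]
  have "set_lebesgue_integral lborel (F ` S) f = set_lebesgue_integral lborel (?g ` ?S) (\<lambda>x. f (cx x))"
    unfolding im i1(2) ..
  also have "\<dots> = integral (?g ` ?S) (\<lambda>x. f (cx x))"
    using set_borel_integral_eq_integral(2)[OF i1(1)] unfolding im .
  also have "\<dots> = integral ?S (\<lambda>x. \<bar>det (matrix (?g' x))\<bar> *\<^sub>R f (cx (?g x)))"
  proof (rule integral_change_of_variables_complex[OF S der inj])
    show "(\<lambda>x. f (cx x)) absolutely_integrable_on ?g ` ?S"
      unfolding im by (rule set_integrable_lborel_imp_absolutely_integrable[OF i1(1)])
    have "(\<lambda>x. of_real (real_det (?F' (cx x))) * f (F (cx x))) absolutely_integrable_on ?S"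
      by (rule set_integrable_lborel_imp_absolutely_integrable[OF i2(1)])
    moreover have "set_integrable lebesgue ?S (\<lambda>x. of_real (real_det (?F' (cx x))) * f (F (cx x)))
      \<longleftrightarrow> set_integrable lebesgue ?S (\<lambda>x. \<bar>det (matrix (?g' x))\<bar> *\<^sub>R f (cx (?g x)))"
      by (rule set_integrable_cong) (simp_all add: J scaleR_conv_of_real)
    ultimately show "(\<lambda>x. \<bar>det (matrix (?g' x))\<bar> *\<^sub>R f (cx (?g x))) absolutely_integrable_on ?S"
      by simp
  qed
  also have "\<dots> = integral ?S (\<lambda>x. of_real (real_det (?F' (cx x))) * f (F (cx x)))"
    by (rule integral_cong) (simp add: J scaleR_conv_of_real)
  also have "\<dots> = set_lebesgue_integral lborel ?S (\<lambda>x. of_real (real_det (?F' (cx x))) * f (F (cx x)))"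
    using set_borel_integral_eq_integral(2)[OF i2(1)] by simp
  also have "\<dots> = set_lebesgue_integral lborel S (\<lambda>x. of_real (real_det (?F' x)) * f (F x))"
    by (rule i2(2))
  finally show ?thesis .
qed

section \<open>The Levi form and integration by parts for \<open>ddbar\<close>\<close>

lemma Ck_on_imp_differentiable:
  assumes "Ck_on (Suc k) f S" "x \<in> S"
  shows "f differentiable (at x)"
  using assms by simp

text \<open>The derivative of F commutes with multiplication by i, so composition with F does not
  mix the two types of derivative.\<close>

lemma wirt_compose_holo:
  assumes "holo_map_on F S" "x \<in> S" "g differentiable (at (F x))"
  shows "wirt_del v (\<lambda>x. g (F x)) x = wirt_del (frechet_derivative F (at x) v) g (F x)"
    "wirt_dbar v (\<lambda>x. g (F x)) x = wirt_dbar (frechet_derivative F (at x) v) g (F x)"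
proof -
  note D = has_derivative_compose[OF holo_map_onD(1)[OF assms(1,2)] assms(3)[unfolded frechet_derivative_works]]
  show "wirt_del v (\<lambda>x. g (F x)) x = wirt_del (frechet_derivative F (at x) v) g (F x)"
    by (subst wirt_eqI(1)[OF D]) (simp only: wirt_del_def holo_map_onD(2)[OF assms(1,2)])
  show "wirt_dbar v (\<lambda>x. g (F x)) x = wirt_dbar (frechet_derivative F (at x) v) g (F x)"
    by (subst wirt_eqI(2)[OF D]) (simp only: wirt_dbar_def holo_map_onD(2)[OF assms(1,2)])
qed

text \<open>Second derivatives of F never enter: the components of F'(y) v are holomorphic in y and
  are annihilated by \<open>wirt_dbar\<close>. So the Levi form of a function pulls back like a
  tensor.\<close>

lemma levi_form_compose_holo:
  assumes "open S" "open S'" "holo_map_on F S" "F ` S \<subseteq> S'" "Ck_on 2 g S'" "x \<in> S"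
  shows "wirt_dbar v' (wirt_del v (\<lambda>x. g (F x))) x =
    wirt_dbar (frechet_derivative F (at x) v') (wirt_del (frechet_derivative F (at x) v) g) (F x)"
proof -
  have g2: "Ck_on (Suc 1) g S'" using assms(5) by (simp add: numeral_2_eq_2)
  have gd: "g differentiable (at y)" if "y \<in> S'" for y
    using Ck_on_imp_differentiable[OF g2 that] .
  let ?G = "\<lambda>a. wirt_del (axis a 1) g" and ?h = "\<lambda>a y. frechet_derivative (\<lambda>x. F x $ a) (at y) v"
  have Gd: "?G a differentiable (at y)" if "y \<in> S'" for a y
    by (rule Ck_on_imp_differentiable[OF Ck_on_wirt(1)[OF assms(2) g2, unfolded One_nat_def] that])
  have FS: "F y \<in> S'" if "y \<in> S" for y using assms(4) that by auto
  have h: "holo_fun_on (?h a) S" for a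
    by (rule holo_fun_on_frechet_derivative[OF assms(1)]) (use assms(3) in \<open>simp add: holo_map_on_def\<close>)
  have hd: "?h a differentiable (at x)" for a
    using holo_fun_onD(1)[OF h assms(6)] by (rule differentiableI)
  have GFd: "(\<lambda>y. ?G a (F y)) differentiable (at x)" for a
    using differentiable_chain_at[OF differentiableI[OF holo_map_onD(1)[OF assms(3,6)]] Gd[OF FS[OF assms(6)], of a]]
    by (simp add: o_def)
  have 1: "wirt_del v (\<lambda>x. g (F x)) y = (\<Sum>a\<in>UNIV. ?h a y * ?G a (F y))" if "y \<in> S" for y
  proof -
    have "wirt_del v (\<lambda>x. g (F x)) y = wirt_del (frechet_derivative F (at y) v) g (F y)"
      by (rule wirt_compose_holo(1)[OF assms(3) that gd[OF FS[OF that]]])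
    also have "\<dots> = (\<Sum>a\<in>UNIV. frechet_derivative F (at y) v $ a * ?G a (F y))"
      by (rule wirt_axis_expansion(1)[OF gd[OF FS[OF that]]])
    finally show ?thesis
      by (simp only: holo_map_onD(3)[OF assms(3) that])
  qed
  have "wirt_dbar v' (wirt_del v (\<lambda>x. g (F x))) x = wirt_dbar v' (\<lambda>y. \<Sum>a\<in>UNIV. ?h a y * ?G a (F y)) x"
    by (rule wirt_cong(2)[OF assms(1,6)]) (rule 1)
  also have "\<dots> = (\<Sum>a\<in>UNIV. wirt_dbar v' (\<lambda>y. ?h a y * ?G a (F y)) x)"
    by (rule wirt_sum(2)) (rule differentiable_mult[OF hd GFd])
  also have "\<dots> = (\<Sum>a\<in>UNIV. ?h a x * wirt_dbar (frechet_derivative F (at x) v') (?G a) (F x))"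
    by (simp only: wirt_mult(2)[OF hd GFd] wirt_holo(2)[OF h assms(6)]
        wirt_compose_holo(2)[OF assms(3,6) Gd[OF FS[OF assms(6)]]] mult_zero_left add_0)
  also have "\<dots> = (\<Sum>a\<in>UNIV. wirt_dbar (frechet_derivative F (at x) v') (\<lambda>y. ?h a x * ?G a y) (F x))"
    by (simp only: wirt_cmult(2)[OF Gd[OF FS[OF assms(6)]]])
  also have "\<dots> = wirt_dbar (frechet_derivative F (at x) v') (\<lambda>y. \<Sum>a\<in>UNIV. ?h a x * ?G a y) (F x)"
    by (rule wirt_sum(2)[symmetric]) (rule differentiable_mult[OF differentiable_const Gd[OF FS[OF assms(6)]]])
  also have "\<dots> = wirt_dbar (frechet_derivative F (at x) v') (wirt_del (frechet_derivative F (at x) v) g) (F x)"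
  proof (rule wirt_cong(2)[OF assms(2) FS[OF assms(6)]])
    fix y assume "y \<in> S'"
    show "(\<Sum>a\<in>UNIV. ?h a x * ?G a y) = wirt_del (frechet_derivative F (at x) v) g y"
      using wirt_axis_expansion(1)[OF gd[OF \<open>y \<in> S'\<close>], of "frechet_derivative F (at x) v"]
      by (simp only: holo_map_onD(3)[OF assms(3,6)])
  qed
  finally show ?thesis .
qed

lemma linear_levi_form:
  assumes "open S" "Ck_on 2 g S" "x \<in> S"
  shows "linear (\<lambda>v. wirt_dbar v' (wirt_del v g) x)" "linear (\<lambda>v'. wirt_dbar v' (wirt_del v g) x)"
proof -
  have g2: "Ck_on (Suc 1) g S" using assms(2) by (simp add: numeral_2_eq_2)
  have gd: "g differentiable (at y)" if "y \<in> S" for y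
    using Ck_on_imp_differentiable[OF g2 that] .
  have d: "wirt_del v g differentiable (at x)" for v
    by (rule Ck_on_imp_differentiable[OF Ck_on_wirt(1)[OF assms(1) g2, unfolded One_nat_def] assms(3)])
  show "linear (\<lambda>v'. wirt_dbar v' (wirt_del v g) x)"
    by (rule linear_wirt(2)[OF d])
  show "linear (\<lambda>v. wirt_dbar v' (wirt_del v g) x)"
  proof (rule linearI)
    fix v w
    have "wirt_dbar v' (wirt_del (v + w) g) x = wirt_dbar v' (\<lambda>y. wirt_del v g y + wirt_del w g y) x"
      by (rule wirt_cong(2)[OF assms(1,3)]) (rule linear_add[OF linear_wirt(1)[OF gd]])
    then show "wirt_dbar v' (wirt_del (v + w) g) x = wirt_dbar v' (wirt_del v g) x + wirt_dbar v' (wirt_del w g) x"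
      unfolding wirt_add(2)[OF d d] .
  next
    fix r v
    have "wirt_dbar v' (wirt_del (r *\<^sub>R v) g) x = wirt_dbar v' (\<lambda>y. of_real r * wirt_del v g y) x"
      by (rule wirt_cong(2)[OF assms(1,3)]) (rule trans[OF linear_cmul[OF linear_wirt(1)[OF gd]] scaleR_conv_of_real])
    then show "wirt_dbar v' (wirt_del (r *\<^sub>R v) g) x = r *\<^sub>R wirt_dbar v' (wirt_del v g) x"
      unfolding wirt_cmult(2)[OF d] scaleR_conv_of_real .
  qed
qed

text \<open>The wedge product of the Levi form of \<open>w\<close> at \<open>x\<close> with \<open>\<alpha>\<close>.\<close>

definition levi_wedge :: "(complex^'m::finite \<Rightarrow> complex) \<Rightarrow> complex^'m \<Rightarrow> ((complex^'m) list \<Rightarrow> complex) \<Rightarrow> (complex^'m) list \<Rightarrow> complex" where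
  "levi_wedge w x \<alpha> vs = (\<Sum>l<length vs. (-1) ^ l * (\<Sum>j<length (del_nth l vs). (-1) ^ j *
     (wirt_dbar (del_nth l vs ! j) (wirt_del (vs ! l) w) x * \<alpha> (del_nth j (del_nth l vs)))))"

lemma alt_form_cmult: "alt_form d \<alpha> \<Longrightarrow> alt_form d (\<lambda>vs. c * \<alpha> vs)"
  unfolding alt_form_def by (auto intro: linear_complex_mult)

lemma linear_complex_mult_right: "linear f \<Longrightarrow> linear (\<lambda>v. f v * c :: complex)"
  using linear_complex_mult[of f c] by (simp add: mult.commute)

text \<open>Two applications of \<open>alt_form_wedge\<close>: the inner one for a fixed first
  vector, the outer one in that vector.\<close>

lemma alt_form_levi_wedge:
  assumes "open S" "Ck_on 2 w S" "x \<in> S" "alt_form d \<alpha>"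
  shows "alt_form (Suc (Suc d)) (levi_wedge w x \<alpha>)"
  unfolding levi_wedge_def[abs_def]
proof (rule alt_form_wedge)
  fix v
  show "alt_form (Suc d) (\<lambda>ws. \<Sum>j<length ws. (- 1) ^ j * (wirt_dbar (ws ! j) (wirt_del v w) x * \<alpha> (del_nth j ws)))"
    by (rule alt_form_wedge)
      (intro alt_form_cmult assms(4), intro linear_complex_mult_right linear_levi_form(2)[OF assms(1-3)])
next
  fix ws :: "(complex^'a) list"
  show "linear (\<lambda>v. \<Sum>j<length ws. (- 1) ^ j * (wirt_dbar (ws ! j) (wirt_del v w) x * \<alpha> (del_nth j ws)))"
    by (intro linear_compose_sum ballI linear_complex_mult linear_complex_mult_right linear_levi_form(1)[OF assms(1-3)])
qed

lemma map_del_nth: "map f (del_nth l vs) = del_nth l (map f vs)"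
  by (simp add: take_map drop_map)

text \<open>The second factor is not differentiated, so only its values at the single point F x are
  pulled back; the rest is \<open>levi_form_compose_holo\<close> term by term.\<close>

lemma levi_wedge_compose_holo:
  assumes "open S" "open S'" "holo_map_on F S" "F ` S \<subseteq> S'" "Ck_on 2 g S'" "x \<in> S"
  shows "levi_wedge (\<lambda>x. g (F x)) x (\<lambda>us. \<alpha> (map (frechet_derivative F (at x)) us)) vs =
    levi_wedge g (F x) \<alpha> (map (frechet_derivative F (at x)) vs)"
proof -
  let ?D = "frechet_derivative F (at x)"
  have "(\<Sum>j<length (del_nth l vs). (-1) ^ j *
     (wirt_dbar (del_nth l vs ! j) (wirt_del (vs ! l) (\<lambda>x. g (F x))) x * \<alpha> (map ?D (del_nth j (del_nth l vs))))) =
    (\<Sum>j<length (del_nth l (map ?D vs)). (-1) ^ j *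
     (wirt_dbar (del_nth l (map ?D vs) ! j) (wirt_del (map ?D vs ! l) g) (F x) * \<alpha> (del_nth j (del_nth l (map ?D vs)))))"
    if "l < length vs" for l
  proof (rule sum.cong)
    fix j assume "j \<in> {..<length (del_nth l (map ?D vs))}"
    then have j: "j < length (del_nth l vs)" by simp
    have 1: "del_nth l (map ?D vs) ! j = ?D (del_nth l vs ! j)"
      unfolding map_del_nth[symmetric] using j by (simp only: nth_map)
    have 2: "map ?D vs ! l = ?D (vs ! l)" using that by simp
    show "(-1) ^ j * (wirt_dbar (del_nth l vs ! j) (wirt_del (vs ! l) (\<lambda>x. g (F x))) x * \<alpha> (map ?D (del_nth j (del_nth l vs)))) =
      (-1) ^ j * (wirt_dbar (del_nth l (map ?D vs) ! j) (wirt_del (map ?D vs ! l) g) (F x) * \<alpha> (del_nth j (del_nth l (map ?D vs))))"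
      unfolding levi_form_compose_holo[OF assms] 1 2 map_del_nth ..
  qed simp
  then show ?thesis
    unfolding levi_wedge_def by simp
qed

lemma Ck_on_cmult:
  assumes "open S" "Ck_on k f S"
  shows "Ck_on k (\<lambda>x. c * f x :: complex) S"
  by (rule Ck_on_mult[OF assms(1) Ck_on_const assms(2)])

lemma ddbar_expansion:
  assumes "open S" "x \<in> S" "\<And>us. length us = d \<Longrightarrow> Ck_on 2 (\<lambda>y. \<alpha> y us) S" "length vs = Suc (Suc d)"
  shows "ddbar \<alpha> x vs = (\<Sum>l<length vs. (-1) ^ l * (\<Sum>j<length (del_nth l vs). (-1) ^ j *
     wirt_del (vs ! l) (wirt_dbar (del_nth l vs ! j) (\<lambda>y. \<alpha> y (del_nth j (del_nth l vs)))) x))"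
  unfolding ddbar_def form_del_def
proof (rule sum.cong)
  fix l assume "l \<in> {..<length vs}"
  then have l: "l < length vs" by simp
  let ?t = "\<lambda>j y. wirt_dbar (del_nth l vs ! j) (\<lambda>y. \<alpha> y (del_nth j (del_nth l vs))) y"
  have d: "?t j differentiable (at x)" if "j < length (del_nth l vs)" for j
  proof -
    have "Ck_on (Suc 1) (\<lambda>y. \<alpha> y (del_nth j (del_nth l vs))) S"
      using assms(3)[of "del_nth j (del_nth l vs)"] that l assms(4) by (simp add: numeral_2_eq_2)
    from Ck_on_wirt(2)[OF assms(1) this, unfolded One_nat_def] show ?thesis
      by (rule Ck_on_imp_differentiable[OF _ assms(2)])
  qed
  have "wirt_del (vs ! l) (\<lambda>y. form_dbar \<alpha> y (del_nth l vs)) x = (\<Sum>j<length (del_nth l vs). wirt_del (vs ! l) (\<lambda>y. (-1) ^ j * ?t j y) x)"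
    unfolding form_dbar_def
    by (rule wirt_sum(1)) (intro differentiable_mult differentiable_const d, simp)
  also have "\<dots> = (\<Sum>j<length (del_nth l vs). (-1) ^ j * wirt_del (vs ! l) (?t j) x)"
    by (rule sum.cong) (simp_all only: lessThan_iff wirt_cmult(1)[OF d])
  finally show "(-1) ^ l * wirt_del (vs ! l) (\<lambda>y. form_dbar \<alpha> y (del_nth l vs)) x = (-1) ^ l * (\<Sum>j<length (del_nth l vs). (-1) ^ j *
     wirt_del (vs ! l) (?t j) x)" by simp
qed simp

lemma Ck_on_ddbar:
  assumes "open S" "\<And>us. length us = d \<Longrightarrow> Ck_on 2 (\<lambda>y. \<alpha> y us) S" "length vs = Suc (Suc d)"
  shows "continuous_on S (\<lambda>x. ddbar \<alpha> x vs)"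
proof -
  have "continuous_on S (\<lambda>x. wirt_del (vs ! l) (wirt_dbar (del_nth l vs ! j) (\<lambda>y. \<alpha> y (del_nth j (del_nth l vs)))) x)"
    if "l < length vs" "j < length (del_nth l vs)" for l j
  proof -
    have "Ck_on (Suc (Suc 0)) (\<lambda>y. \<alpha> y (del_nth j (del_nth l vs))) S"
      using assms(2)[of "del_nth j (del_nth l vs)"] that assms(3) by (simp add: numeral_2_eq_2)
    from Ck_on_wirt(1)[OF assms(1) Ck_on_wirt(2)[OF assms(1) this]] show ?thesis by simp
  qed
  then have "continuous_on S (\<lambda>x. \<Sum>l<length vs. (-1) ^ l * (\<Sum>j<length (del_nth l vs). (-1) ^ j *
     wirt_del (vs ! l) (wirt_dbar (del_nth l vs ! j) (\<lambda>y. \<alpha> y (del_nth j (del_nth l vs)))) x))"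
    by (intro continuous_on_sum continuous_on_mult continuous_on_const) auto
  then show ?thesis
    by (rule continuous_on_eq) (rule ddbar_expansion[OF assms(1) _ assms(2,3), symmetric], assumption+)
qed

lemma set_integrable_compact_support:
  fixes f :: "'x::euclidean_space \<Rightarrow> 'y::{banach, second_countable_topology}"
  assumes "compact K" "K \<subseteq> S" "continuous_on S f" "\<And>x. x \<in> S - K \<Longrightarrow> f x = 0"
  shows "set_integrable lborel S f"
  unfolding set_integrable_def
proof (rule integrable_continuous_compact_support[OF assms(1)])
  have "continuous_on K f" by (rule continuous_on_subset[OF assms(3,2)])
  then show "continuous_on K (\<lambda>x. indicator S x *\<^sub>R f x)"
    by (rule continuous_on_eq) (use assms(2) in auto)
  show "indicator S x *\<^sub>R f x = 0" if "x \<notin> K" for x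
    using assms(4)[of x] that by (simp add: indicator_def)
qed

lemma wirt_const_fun: "wirt_del v (\<lambda>x. c) = (\<lambda>x. 0)" "wirt_dbar v (\<lambda>x. c) = (\<lambda>x. 0)"
  by (simp_all add: fun_eq_iff)

text \<open>The variant in which the factor w, on which no derivative stands at first, carries the
  compact support.\<close>

lemma wirt_by_parts2':
  fixes w g :: "complex^'m::finite \<Rightarrow> complex"
  assumes "open S" "compact K" "K \<subseteq> S" "Ck_on 2 w S" "Ck_on 2 g S" "\<And>x. x \<in> S - K \<Longrightarrow> w x = 0"
  shows "set_lebesgue_integral lborel S (\<lambda>x. w x * wirt_del v (wirt_dbar v' g) x) =
     set_lebesgue_integral lborel S (\<lambda>x. wirt_dbar v' (wirt_del v w) x * g x)"
proof -
  note 2 = assms(4,5)[unfolded numeral_2_eq_2]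
  have KS: "open (S - K)"
    using assms(1) compact_imp_closed[OF assms(2)] by (rule open_Diff)
  have w0: "wirt_del v w x = 0" if "x \<in> S - K" for x
    unfolding wirt_del_def using frechet_derivative_eq_0_outside[OF KS assms(6) that] by simp
  have w1: "Ck_on 1 w S" "Ck_on 1 (wirt_del v w) S"
    using Ck_on_pred[OF 2(1)] Ck_on_wirt(1)[OF assms(1) 2(1)] by simp_all
  have g1: "Ck_on 1 g S" "Ck_on 1 (wirt_dbar v' g) S"
    using Ck_on_pred[OF 2(2)] Ck_on_wirt(2)[OF assms(1) 2(2)] by simp_all
  show ?thesis
    using wirt_by_parts(1)[OF assms(1-3) g1(2) w1(1) assms(6), of v]
      wirt_by_parts(2)[OF assms(1-3) g1(1) w1(2) w0, of v'] by (simp add: mult.commute)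
qed

text \<open>Each term of the double antisymmetrisation is integrated by parts separately. Either
  factor may carry the compact support: the test function does in the transformation law, the form
  does in Stokes' theorem.\<close>

lemma ddbar_by_parts:
  fixes w :: "complex^'m::finite \<Rightarrow> complex"
  assumes "open S" "compact K" "K \<subseteq> S" "Ck_on 2 w S" "\<And>us. length us = d \<Longrightarrow> Ck_on 2 (\<lambda>y. \<alpha> y us) S"
    "length vs = Suc (Suc d)"
    "(\<forall>x\<in>S - K. w x = 0) \<or> (\<forall>us. length us = d \<longrightarrow> (\<forall>x\<in>S - K. \<alpha> x us = 0))"
  shows "set_integrable lborel S (\<lambda>x. w x * ddbar \<alpha> x vs)"
    "set_integrable lborel S (\<lambda>x. levi_wedge w x (\<alpha> x) vs)"
    "set_lebesgue_integral lborel S (\<lambda>x. w x * ddbar \<alpha> x vs) =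
     set_lebesgue_integral lborel S (\<lambda>x. levi_wedge w x (\<alpha> x) vs)"
proof -
  define s where "s l j x = wirt_del (vs ! l) (wirt_dbar (del_nth l vs ! j) (\<lambda>y. \<alpha> y (del_nth j (del_nth l vs)))) x" for l j x
  define t where "t l j x = wirt_dbar (del_nth l vs ! j) (wirt_del (vs ! l) w) x * \<alpha> x (del_nth j (del_nth l vs))" for l j x
  have KS: "open (S - K)"
    using assms(1) compact_imp_closed[OF assms(2)] by (rule open_Diff)
  have st: "set_integrable lborel S (\<lambda>x. w x * s l j x)" "set_integrable lborel S (t l j)"
      "set_lebesgue_integral lborel S (\<lambda>x. w x * s l j x) = set_lebesgue_integral lborel S (t l j)"
    if lj: "l < length vs" "j < length (del_nth l vs)" for l j
  proof -
    let ?us = "del_nth j (del_nth l vs)"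
    have len: "length ?us = d" using lj assms(6) by simp
    have g: "Ck_on 2 (\<lambda>y. \<alpha> y ?us) S" by (rule assms(5)[OF len])
    note 2 = assms(4)[unfolded numeral_2_eq_2] g[unfolded numeral_2_eq_2]
    have cs: "continuous_on S (s l j)"
      unfolding s_def[abs_def] using Ck_on_wirt(1)[OF assms(1) Ck_on_wirt(2)[OF assms(1) 2(2)]] by simp
    have ct: "continuous_on S (\<lambda>x. wirt_dbar (del_nth l vs ! j) (wirt_del (vs ! l) w) x)"
      using Ck_on_wirt(2)[OF assms(1) Ck_on_wirt(1)[OF assms(1) 2(1)]] by simp
    \<comment> \<open>Whichever factor vanishes off K, so do its derivatives there, because S - K is
      open.\<close>
    have z: "w x * s l j x = 0 \<and> t l j x = 0" if x: "x \<in> S - K" for x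
      using assms(7)
    proof
      assume w0: "\<forall>x\<in>S - K. w x = 0"
      have "wirt_dbar (del_nth l vs ! j) (wirt_del (vs ! l) w) x = wirt_dbar (del_nth l vs ! j) (wirt_del (vs ! l) (\<lambda>x. 0)) x"
        by (rule wirt_cong(2)[OF KS x], rule wirt_cong(1)[OF KS]) (use w0 in auto)
      then show ?thesis using w0 x by (simp add: t_def wirt_const_fun)
    next
      assume "\<forall>us. length us = d \<longrightarrow> (\<forall>x\<in>S - K. \<alpha> x us = 0)"
      then have a0: "\<alpha> x ?us = 0" if "x \<in> S - K" for x using len that by blast
      have "s l j x = wirt_del (vs ! l) (wirt_dbar (del_nth l vs ! j) (\<lambda>y. 0)) x"
        unfolding s_def by (rule wirt_cong(1)[OF KS x], rule wirt_cong(2)[OF KS]) (use a0 in auto)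
      then show ?thesis using a0[OF x] by (simp add: t_def wirt_const_fun)
    qed
    show "set_integrable lborel S (\<lambda>x. w x * s l j x)"
      by (rule set_integrable_compact_support[OF assms(2,3)])
        (use z Ck_on_imp_continuous_on[OF assms(4)] cs in \<open>auto intro!: continuous_on_mult\<close>)
    show "set_integrable lborel S (t l j)"
      by (rule set_integrable_compact_support[OF assms(2,3)])
        (use z Ck_on_imp_continuous_on[OF g] ct in \<open>auto simp: t_def[abs_def] intro!: continuous_on_mult\<close>)
    show "set_lebesgue_integral lborel S (\<lambda>x. w x * s l j x) = set_lebesgue_integral lborel S (t l j)"
      unfolding s_def t_def using assms(7)
    proof
      assume w0: "\<forall>x\<in>S - K. w x = 0"
      show "set_lebesgue_integral lborel S (\<lambda>x. w x * wirt_del (vs ! l) (wirt_dbar (del_nth l vs ! j) (\<lambda>y. \<alpha> y ?us)) x) =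
        set_lebesgue_integral lborel S (\<lambda>x. wirt_dbar (del_nth l vs ! j) (wirt_del (vs ! l) w) x * \<alpha> x ?us)"
        by (rule wirt_by_parts2'[OF assms(1-4) g]) (use w0 in blast)
    next
      assume a0: "\<forall>us. length us = d \<longrightarrow> (\<forall>x\<in>S - K. \<alpha> x us = 0)"
      show "set_lebesgue_integral lborel S (\<lambda>x. w x * wirt_del (vs ! l) (wirt_dbar (del_nth l vs ! j) (\<lambda>y. \<alpha> y ?us)) x) =
        set_lebesgue_integral lborel S (\<lambda>x. wirt_dbar (del_nth l vs ! j) (wirt_del (vs ! l) w) x * \<alpha> x ?us)"
        by (rule wirt_by_parts2[OF assms(1-4) g]) (use a0 len in blast)
    qed
  qed
  \<comment> \<open>The double sum is flattened to pairs (l, j) so that linearity of the integral is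
    applied only once.\<close>
  let ?I = "Sigma {..<length vs} (\<lambda>l. {..<length (del_nth l vs)})"
  let ?e = "\<lambda>l j. (-1) ^ l * (-1) ^ j :: complex"
  have S1: "w x * ddbar \<alpha> x vs = (\<Sum>(l, j)\<in>?I. ?e l j * (w x * s l j x))" if "x \<in> S" for x
  proof -
    have "ddbar \<alpha> x vs = (\<Sum>l<length vs. (-1) ^ l * (\<Sum>j<length (del_nth l vs). (-1) ^ j * s l j x))"
      unfolding s_def by (rule ddbar_expansion[OF assms(1) that assms(5,6)])
    then show ?thesis
      by (subst sum.Sigma[symmetric]) (simp_all add: sum_distrib_left mult_ac)
  qed
  have S2: "levi_wedge w x (\<alpha> x) vs = (\<Sum>(l, j)\<in>?I. ?e l j * t l j x)" for x
    unfolding levi_wedge_def t_def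
    by (subst sum.Sigma[symmetric]) (simp_all add: sum_distrib_left mult_ac)
  have i1: "set_integrable lborel S (\<lambda>x. \<Sum>(l, j)\<in>?I. ?e l j * (w x * s l j x))"
    unfolding set_integrable_def scaleR_sum_right split_def
    by (intro Bochner_Integration.integrable_sum, unfold set_integrable_def[symmetric], intro set_integrable_mult_right st(1)) auto
  have i2: "set_integrable lborel S (\<lambda>x. \<Sum>(l, j)\<in>?I. ?e l j * t l j x)"
    unfolding set_integrable_def scaleR_sum_right split_def
    by (intro Bochner_Integration.integrable_sum, unfold set_integrable_def[symmetric], intro set_integrable_mult_right st(2)) auto
  have "set_integrable lborel S (\<lambda>x. w x * ddbar \<alpha> x vs) \<longleftrightarrow> set_integrable lborel S (\<lambda>x. \<Sum>(l, j)\<in>?I. ?e l j * (w x * s l j x))"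
    by (rule set_integrable_cong) (simp_all only: S1)
  then show "set_integrable lborel S (\<lambda>x. w x * ddbar \<alpha> x vs)" using i1 by simp
  show "set_integrable lborel S (\<lambda>x. levi_wedge w x (\<alpha> x) vs)" unfolding S2 by (rule i2)
  have "set_lebesgue_integral lborel S (\<lambda>x. w x * ddbar \<alpha> x vs) = set_lebesgue_integral lborel S (\<lambda>x. \<Sum>(l, j)\<in>?I. ?e l j * (w x * s l j x))"
    using assms(1) by (intro set_lebesgue_integral_cong) (auto simp: S1)
  also have "\<dots> = (\<Sum>(l, j)\<in>?I. ?e l j * set_lebesgue_integral lborel S (\<lambda>x. w x * s l j x))"
    unfolding split_def
    by (subst set_integral_sum) (auto intro!: set_integrable_mult_right st(1))
  also have "\<dots> = (\<Sum>(l, j)\<in>?I. ?e l j * set_lebesgue_integral lborel S (t l j))"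
    by (rule sum.cong) (auto simp: st(3))
  also have "\<dots> = set_lebesgue_integral lborel S (\<lambda>x. \<Sum>(l, j)\<in>?I. ?e l j * t l j x)"
    unfolding split_def
    by (subst set_integral_sum) (auto intro!: set_integrable_mult_right st(2))
  finally show "set_lebesgue_integral lborel S (\<lambda>x. w x * ddbar \<alpha> x vs) =
     set_lebesgue_integral lborel S (\<lambda>x. levi_wedge w x (\<alpha> x) vs)"
    unfolding S2 .
qed

section \<open>Charts, partitions of unity and integration on a compact complex manifold\<close>

locale compact_cplx_mfd =
  fixes A :: "('a::t2_space, 'm::finite) chart set"
  assumes mfd: "compact_complex_manifold A"
begin

lemma chart:
  assumes "c \<in> A"
  shows "open (fst c)" "open (snd c ` fst c)" "continuous_on (fst c) (snd c)"
    "continuous_on (snd c ` fst c) (chart_inv c)" "inj_on (snd c) (fst c)"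
    "\<And>p. p \<in> fst c \<Longrightarrow> chart_inv c (snd c p) = p"
    "\<And>y. y \<in> snd c ` fst c \<Longrightarrow> snd c (chart_inv c y) = y"
    "\<And>y. y \<in> snd c ` fst c \<Longrightarrow> chart_inv c y \<in> fst c"
  using mfd assms unfolding compact_complex_manifold_def complex_atlas_def homeomorphism_def
  by (auto simp: inj_on_def) metis

lemma chart_cover: "\<exists>c\<in>A. p \<in> fst c"
proof -
  have "p \<in> \<Union>(fst ` A)"
    using mfd unfolding compact_complex_manifold_def complex_atlas_def by simp
  then show ?thesis by blast
qed

lemma compact_mfd: "compact (UNIV :: 'a set)" and connected_mfd: "connected (UNIV :: 'a set)"
  using mfd unfolding compact_complex_manifold_def by auto

lemma chart_image:
  assumes "c \<in> A"
  shows "snd c ` (fst c \<inter> V) = {y \<in> snd c ` fst c. chart_inv c y \<in> V}"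
  using chart(6-8)[OF assms] by auto

lemma open_chart_image:
  assumes "c \<in> A" "open V"
  shows "open (snd c ` (fst c \<inter> V))"
proof -
  have "open (snd c ` fst c \<inter> chart_inv c -` V)"
    by (rule continuous_open_preimage[OF chart(4,2)[OF assms(1)] assms(2)])
  moreover have "snd c ` (fst c \<inter> V) = snd c ` fst c \<inter> chart_inv c -` V"
    using chart_image[OF assms(1)] by auto
  ultimately show ?thesis by simp
qed

lemma open_chart_inv_image:
  assumes "c \<in> A" "open T" "T \<subseteq> snd c ` fst c"
  shows "open (chart_inv c ` T)"
proof -
  have "open (fst c \<inter> snd c -` T)"
    by (rule continuous_open_preimage[OF chart(3,1)[OF assms(1)] assms(2)])
  moreover have "chart_inv c ` T = fst c \<inter> snd c -` T"
    using chart(6-8)[OF assms(1)] assms(3) by (force simp: image_iff subset_iff)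
  ultimately show ?thesis by simp
qed

lemma compact_chart_inv_image:
  assumes "c \<in> A" "compact K" "K \<subseteq> snd c ` fst c"
  shows "compact (chart_inv c ` K)" "chart_inv c ` K \<subseteq> fst c"
  using compact_continuous_image[OF continuous_on_subset[OF chart(4)[OF assms(1)] assms(3)] assms(2)]
    chart(8)[OF assms(1)] assms(3) by auto

lemma compact_chart_image:
  assumes "c \<in> A" "compact K" "K \<subseteq> fst c"
  shows "compact (snd c ` K)"
  by (rule compact_continuous_image[OF continuous_on_subset[OF chart(3)[OF assms(1)] assms(3)] assms(2)])

text \<open>The inverse chart is continuous on an open set and hence Borel measurable, and the image
  in question is a preimage under it.\<close>

lemma borel_chart_image:
  assumes "c \<in> A" "B \<in> sets borel"
  shows "snd c ` (fst c \<inter> B) \<in> sets borel"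
proof -
  have "chart_inv c \<in> borel_measurable (restrict_space borel (snd c ` fst c))"
    by (rule borel_measurable_continuous_on_restrict[OF chart(4)[OF assms(1)]])
  from measurable_sets[OF this assms(2)]
  have "chart_inv c -` B \<inter> snd c ` fst c \<in> sets (restrict_space borel (snd c ` fst c))"
    by (simp add: space_restrict_space)
  then have "chart_inv c -` B \<inter> snd c ` fst c \<in> sets borel"
    using chart(2)[OF assms(1)] by (simp add: sets_restrict_space_iff)
  moreover have "snd c ` (fst c \<inter> B) = chart_inv c -` B \<inter> snd c ` fst c"
    using chart_image[OF assms(1)] by auto
  ultimately show ?thesis by simp
qed

lemma transition_holo:
  assumes "c \<in> A" "c' \<in> A"
  shows "holo_map_on (snd c' \<circ> chart_inv c) (snd c ` (fst c \<inter> fst c'))"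
  using mfd assms unfolding compact_complex_manifold_def complex_atlas_def by blast

lemma transition_image:
  assumes "c \<in> A" "c' \<in> A"
  shows "(snd c' \<circ> chart_inv c) ` (snd c ` (fst c \<inter> (fst c' \<inter> V))) = snd c' ` (fst c' \<inter> (fst c \<inter> V))"
proof -
  have "(snd c' \<circ> chart_inv c) ` (snd c ` (fst c \<inter> (fst c' \<inter> V))) = (\<lambda>p. snd c' p) ` (fst c \<inter> (fst c' \<inter> V))"
    unfolding image_image by (rule image_cong) (auto simp: chart(6)[OF assms(1)])
  then show ?thesis by (simp add: Int_left_commute)
qed

lemma transition_inj:
  assumes "c \<in> A" "c' \<in> A"
  shows "inj_on (snd c' \<circ> chart_inv c) (snd c ` (fst c \<inter> fst c'))"
  by (rule inj_onI) (use chart(6)[OF assms(1)] chart(5)[OF assms(2)] in \<open>auto dest: inj_onD\<close>)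

lemma chart_ball:
  assumes "open V" "p \<in> V"
  obtains c r where "c \<in> A" "r > 0" "p \<in> fst c" "cball (snd c p) r \<subseteq> snd c ` (fst c \<inter> V)"
proof -
  obtain c where c: "c \<in> A" "p \<in> fst c" using chart_cover by blast
  then have "snd c p \<in> snd c ` (fst c \<inter> V)" using assms by auto
  then obtain r where "r > 0" "cball (snd c p) r \<subseteq> snd c ` (fst c \<inter> V)"
    using open_contains_cball open_chart_image[OF c(1) assms(1)] by blast
  then show ?thesis using that c by blast
qed

lemma chart_ball_nbhd:
  assumes "c \<in> A" "r > 0" "p \<in> fst c" "cball (snd c p) r \<subseteq> snd c ` (fst c \<inter> V)"
  shows "open (chart_inv c ` ball (snd c p) r)" "p \<in> chart_inv c ` ball (snd c p) r"
    "compact (chart_inv c ` cball (snd c p) r)" "chart_inv c ` cball (snd c p) r \<subseteq> fst c \<inter> V"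
    "chart_inv c ` ball (snd c p) r \<subseteq> chart_inv c ` cball (snd c p) r"
proof -
  have sub: "cball (snd c p) r \<subseteq> snd c ` fst c" using assms(4) by auto
  then have sub': "ball (snd c p) r \<subseteq> snd c ` fst c" by auto
  show "open (chart_inv c ` ball (snd c p) r)"
    by (rule open_chart_inv_image[OF assms(1) open_ball sub'])
  show "p \<in> chart_inv c ` ball (snd c p) r"
    using assms(2) chart(6)[OF assms(1,3)] by (metis centre_in_ball imageI)
  show "compact (chart_inv c ` cball (snd c p) r)"
    by (rule compact_chart_inv_image(1)[OF assms(1) compact_cball sub])
  show "chart_inv c ` cball (snd c p) r \<subseteq> fst c \<inter> V"
    using assms(4) chart(6)[OF assms(1)] by force
  show "chart_inv c ` ball (snd c p) r \<subseteq> chart_inv c ` cball (snd c p) r"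
    by (rule image_mono) auto
qed

text \<open>The finite subcover is numbered so that it can serve in disjoint sequences and in sums
  over initial segments.\<close>

lemma finite_subcover_sequence:
  assumes "\<And>p. open (W p)" "\<And>p::'a. p \<in> W p"
  shows "\<exists>(N :: nat) f. (\<Union>l<N. W (f l)) = UNIV"
proof -
  obtain T where T: "finite T" "UNIV \<subseteq> (\<Union>p\<in>T. W p)"
    using compactE_image[OF compact_mfd, of UNIV W] assms by (metis UNIV_I UN_I subsetI)
  obtain f :: "nat \<Rightarrow> 'a" where f: "f ` {..<card T} = T"
    using ex_bij_betw_nat_finite[OF T(1)] by (auto simp: bij_betw_def atLeast0LessThan)
  have "(\<Union>l<card T. W (f l)) = (\<Union>p\<in>f ` {..<card T}. W p)" by auto
  then have "(\<Union>l<card T. W (f l)) = UNIV" using T(2) f by auto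
  then show ?thesis by blast
qed

text \<open>Finitely many coordinate balls with compact closures inside chart domains cover the
  manifold, and taking differences along the sequence makes the cover disjoint. This gives the
  choice inside \<open>mfd_integral\<close> its meaning.\<close>

lemma ex_chart_partition: "\<exists>P. chart_partition A P"
proof -
  have "\<exists>c r. c \<in> A \<and> r > 0 \<and> p \<in> fst c \<and> cball (snd c p) r \<subseteq> snd c ` (fst c \<inter> UNIV)" for p
    by (rule chart_ball[OF open_UNIV UNIV_I, of p]) blast
  then obtain c r where cr: "\<And>p. c p \<in> A" "\<And>p. r p > 0" "\<And>p. p \<in> fst (c p)"
    "\<And>p. cball (snd (c p) p) (r p) \<subseteq> snd (c p) ` (fst (c p) \<inter> UNIV)"
    by metis
  define W where "W p = chart_inv (c p) ` ball (snd (c p) p) (r p)" for p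
  note nb = chart_ball_nbhd[OF cr]
  have "\<exists>(N :: nat) f. (\<Union>l<N. W (f l)) = UNIV"
    by (rule finite_subcover_sequence) (simp_all only: W_def nb(1,2))
  then obtain N :: nat and f where N: "(\<Union>l<N. W (f l)) = UNIV" by blast
  \<comment> \<open>\<open>disjointed\<close> works on infinite sequences, so the finite cover is
    padded with empty sets.\<close>
  define V where "V l = (if (l::nat) < N then W (f l) else {})" for l
  define P where "P = (\<lambda>l. (c (f l), disjointed V l)) ` {..<N}"
  have oV: "open (V l)" for l by (simp add: V_def W_def nb(1))
  have "(\<Union>l<N. disjointed V l) = UNIV"
  proof -
    have "(\<Union>l. V l) = UNIV" using N by (auto simp: V_def set_eq_iff) 
    then have "(\<Union>l. disjointed V l) = UNIV" by (simp add: UN_disjointed_eq)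
    moreover have "(\<Union>l. disjointed V l) \<subseteq> (\<Union>l<N. disjointed V l)"
    proof
      fix x assume "x \<in> (\<Union>l. disjointed V l)"
      then obtain l where l: "x \<in> disjointed V l" by blast
      then have "x \<in> V l" by (rule subsetD[OF disjointed_subset])
      then have "l < N" by (simp add: V_def split: if_splits)
      with l show "x \<in> (\<Union>l<N. disjointed V l)" by blast
    qed
    ultimately show ?thesis by blast
  qed
  then have "\<Union>(snd ` P) = UNIV" by (simp add: P_def image_image)
  moreover have "disjoint_family_on snd P"
    unfolding disjoint_family_on_def
  proof (intro ballI impI)
    fix x y assume "x \<in> P" "y \<in> P" "x \<noteq> y"
    then obtain l l' where "x = (c (f l), disjointed V l)" "y = (c (f l'), disjointed V l')" "l \<noteq> l'"
      unfolding P_def by auto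
    then show "snd x \<inter> snd y = {}"
      using disjoint_family_disjointed[of V] by (auto simp: disjoint_family_on_def)
  qed
  moreover have "c (f l) \<in> A \<and> disjointed V l \<in> sets borel \<and> (\<exists>K. compact K \<and> disjointed V l \<subseteq> K \<and> K \<subseteq> fst (c (f l)))" if "l < N" for l
  proof (intro conjI exI)
    show "disjointed V l \<in> sets borel"
      unfolding disjointed_def using oV by (intro sets.Diff sets.finite_UN) auto
    show "disjointed V l \<subseteq> chart_inv (c (f l)) ` cball (snd (c (f l)) (f l)) (r (f l))"
      using disjointed_subset[of V l] nb(5)[of "f l"] that by (auto simp: V_def W_def)
    show "chart_inv (c (f l)) ` cball (snd (c (f l)) (f l)) (r (f l)) \<subseteq> fst (c (f l))"
      using nb(4) by auto
  qed (rule cr(1), rule nb(3))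
  then have "\<forall>(c, B)\<in>P. c \<in> A \<and> B \<in> sets borel \<and> (\<exists>K. compact K \<and> B \<subseteq> K \<and> K \<subseteq> fst c)"
    unfolding P_def by simp
  moreover have "finite P" unfolding P_def by simp
  ultimately have "chart_partition A P"
    unfolding chart_partition_def by simp
  then show ?thesis by blast
qed

section \<open>Bump functions and partitions of unity on the manifold\<close>

definition bump_mfd :: "('a, 'm) chart \<Rightarrow> complex^'m \<Rightarrow> real \<Rightarrow> 'a \<Rightarrow> real" where
  "bump_mfd c a r p = (if p \<in> fst c then bump a r (snd c p) else 0)"

lemma bump_mfd_nonneg: "0 \<le> bump_mfd c a r p"
  by (simp add: bump_mfd_def bump_nonneg)

lemma bump_mfd_support:
  assumes "c \<in> A" "r > 0" "cball a r \<subseteq> snd c ` fst c"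
  shows "{p. bump_mfd c a r p \<noteq> 0} = chart_inv c ` ball a r"
proof -
  have "bump a r y \<noteq> 0 \<longleftrightarrow> y \<in> ball a r" for y
    using bump_pos_iff[OF assms(2), of a y] bump_nonneg[of a r y] by linarith
  then have "{p. bump_mfd c a r p \<noteq> 0} = {p \<in> fst c. snd c p \<in> ball a r}"
    by (auto simp: bump_mfd_def)
  also have "\<dots> = chart_inv c ` ball a r"
  proof -
    have "ball a r \<subseteq> snd c ` fst c" using assms(3) by (meson ball_subset_cball order_trans)
    then show ?thesis
      using chart(6-8)[OF assms(1)] by (force simp: image_iff subset_iff)
  qed
  finally show ?thesis .
qed

text \<open>Near points of the chart domain the bump is a composition with a transition map. Near
  the other points it is zero, because the image of the closed ball is compact, hence closed by the
  Hausdorff property.\<close>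

lemma smooth_bump_mfd:
  assumes "c \<in> A" "r > 0" "cball a r \<subseteq> snd c ` fst c"
  shows "smooth_on_mfd A UNIV (bump_mfd c a r)"
  unfolding smooth_on_mfd_def smooth_fun_on_def
proof (intro ballI allI, rule Ck_on_locally)
  fix c' k y assume c': "c' \<in> A" and y: "y \<in> snd c' ` (fst c' \<inter> UNIV)"
  let ?K = "chart_inv c ` cball a r"
  show "\<exists>T. open T \<and> y \<in> T \<and> Ck_on k (bump_mfd c a r \<circ> chart_inv c') T"
  proof (cases "chart_inv c' y \<in> fst c")
    case True
    let ?T = "snd c' ` (fst c' \<inter> fst c)"
    have T: "open ?T" by (rule open_chart_image[OF c' chart(1)[OF assms(1)]])
    have yT: "y \<in> ?T" using y True chart_image[OF c'] by auto
    have "Ck_on k (\<lambda>x. bump a r ((snd c \<circ> chart_inv c') x)) ?T"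
      by (rule Ck_on_compose[OF T open_UNIV _ Ck_on_bump holo_map_on_imp_Ck_on[OF T transition_holo[OF c' assms(1)]]]) simp
    moreover have "Ck_on k (\<lambda>x. bump a r ((snd c \<circ> chart_inv c') x)) ?T \<longleftrightarrow> Ck_on k (bump_mfd c a r \<circ> chart_inv c') ?T"
      by (rule Ck_on_cong[OF T]) (auto simp: bump_mfd_def chart(6)[OF c'])
    ultimately show ?thesis using T yT by blast
  next
    case False
    have K: "closed ?K" "?K \<subseteq> fst c"
      using compact_chart_inv_image[OF assms(1) compact_cball assms(3)] compact_imp_closed by auto
    let ?T = "snd c' ` (fst c' \<inter> - ?K)"
    have T: "open ?T" by (rule open_chart_image[OF c']) (use K(1) in \<open>simp add: open_Compl\<close>)
    have yT: "y \<in> ?T" using y False K(2) chart_image[OF c'] by auto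
    have z: "(bump_mfd c a r \<circ> chart_inv c') x = 0" if "x \<in> ?T" for x
    proof -
      have "chart_inv c' x \<notin> ?K" using that chart(6)[OF c'] by auto
      then have "chart_inv c' x \<notin> chart_inv c ` ball a r" by (meson ball_subset_cball image_mono subsetD)
      then show ?thesis using bump_mfd_support[OF assms] by auto
    qed
    have "Ck_on k (bump_mfd c a r \<circ> chart_inv c') ?T"
      using Ck_on_cong[OF T, of "bump_mfd c a r \<circ> chart_inv c'" "\<lambda>x. 0"] z Ck_on_const by blast
    then show ?thesis using T yT by blast
  qed
qed

text \<open>Finitely many bumps have a positive sum and are divided by it. Their closed supports lie
  in images of closed coordinate balls, which were chosen inside the sets W p.\<close>

lemma partition_of_unity:
  assumes "\<And>p. open (W p)" "\<And>p::'a. p \<in> W p"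
  obtains N :: nat and \<rho> :: "nat \<Rightarrow> 'a \<Rightarrow> real" and f :: "nat \<Rightarrow> 'a"
  where "\<And>l. l < N \<Longrightarrow> smooth_on_mfd A UNIV (\<rho> l)"
    "\<And>l. l < N \<Longrightarrow> closure {p. \<rho> l p \<noteq> 0} \<subseteq> W (f l)" "\<And>p. (\<Sum>l<N. \<rho> l p) = 1"
proof -
  have "\<exists>c r. c \<in> A \<and> r > 0 \<and> p \<in> fst c \<and> cball (snd c p) r \<subseteq> snd c ` (fst c \<inter> W p)" for p
    by (rule chart_ball[OF assms]) blast
  then obtain c r where cr: "\<And>p. c p \<in> A" "\<And>p. r p > 0" "\<And>p. p \<in> fst (c p)"
    "\<And>p. cball (snd (c p) p) (r p) \<subseteq> snd (c p) ` (fst (c p) \<inter> W p)"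
    by metis
  have cr': "cball (snd (c p) p) (r p) \<subseteq> snd (c p) ` fst (c p)" for p
    using cr(4)[of p] by auto
  note nb = chart_ball_nbhd[OF cr]
  define V where "V p = chart_inv (c p) ` ball (snd (c p) p) (r p)" for p
  have "\<exists>(N :: nat) f. (\<Union>l<N. V (f l)) = UNIV"
    by (rule finite_subcover_sequence) (simp_all only: V_def nb(1,2))
  then obtain N :: nat and f where N: "(\<Union>l<N. V (f l)) = UNIV" by blast
  define b where "b l = bump_mfd (c (f l)) (snd (c (f l)) (f l)) (r (f l))" for l
  have bs: "{p. b l p \<noteq> 0} = V (f l)" for l
    unfolding b_def V_def by (rule bump_mfd_support[OF cr(1,2) cr'])
  define B where "B p = (\<Sum>l<N. b l p)" for p
  have Bpos: "B p > 0" for p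
  proof -
    obtain l where "l < N" "p \<in> V (f l)" using N by auto
    then have "b l p > 0" using bs[of l] bump_mfd_nonneg[of "c (f l)" "snd (c (f l)) (f l)" "r (f l)" p]
      unfolding b_def by (smt (verit) mem_Collect_eq)
    then show ?thesis unfolding B_def
      using \<open>l < N\<close> by (intro sum_pos2[of _ l]) (auto simp: b_def bump_mfd_nonneg)
  qed
  define \<rho> where "\<rho> l p = b l p * inverse (B p)" for l p
  show ?thesis
  proof
    fix l assume "l < N"
    have b_smooth: "Ck_on k (b j \<circ> chart_inv c') (snd c' ` (fst c' \<inter> UNIV))" if "c' \<in> A" for j k c'
      using smooth_bump_mfd[OF cr(1,2) cr', of "f j"] that unfolding b_def smooth_on_mfd_def smooth_fun_on_def by blast
    show "smooth_on_mfd A UNIV (\<rho> l)"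
      unfolding smooth_on_mfd_def smooth_fun_on_def
    proof (intro ballI allI)
      fix c' k assume c': "c' \<in> A"
      let ?S = "snd c' ` (fst c' \<inter> UNIV)"
      have S: "open ?S" by (rule open_chart_image[OF c' open_UNIV])
      have "Ck_on k (\<lambda>x. (b l \<circ> chart_inv c') x * inverse (\<Sum>j<N. (b j \<circ> chart_inv c') x)) ?S"
        by (intro Ck_on_mult Ck_on_inverse Ck_on_sum S b_smooth c') (use Bpos in \<open>simp add: B_def less_imp_neq[THEN not_sym]\<close>)
      then show "Ck_on k (\<rho> l \<circ> chart_inv c') ?S"
        by (simp add: \<rho>_def[abs_def] B_def o_def)
    qed
    have "{p. \<rho> l p \<noteq> 0} \<subseteq> chart_inv (c (f l)) ` cball (snd (c (f l)) (f l)) (r (f l))"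
    proof -
      have "{p. \<rho> l p \<noteq> 0} \<subseteq> V (f l)" unfolding bs[symmetric] \<rho>_def by auto
      then show ?thesis using nb(5)[of "f l"] unfolding V_def by (rule order_trans)
    qed
    then have "closure {p. \<rho> l p \<noteq> 0} \<subseteq> chart_inv (c (f l)) ` cball (snd (c (f l)) (f l)) (r (f l))"
      by (rule closure_minimal[OF _ compact_imp_closed[OF nb(3)]])
    then show "closure {p. \<rho> l p \<noteq> 0} \<subseteq> W (f l)" using nb(4)[of "f l"] by blast
  next
    fix p
    have "(\<Sum>l<N. \<rho> l p) = B p * inverse (B p)"
      unfolding \<rho>_def B_def sum_distrib_right ..
    then show "(\<Sum>l<N. \<rho> l p) = 1" using Bpos[of p] by simp
  qed
qed

end

section \<open>Transformation of \<open>ddbar\<close> under a change of charts\<close>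

lemma levi_wedge_cong:
  assumes "open S" "x \<in> S" "\<And>y. y \<in> S \<Longrightarrow> w y = w' y" "\<And>us. length us = d \<Longrightarrow> \<alpha> us = \<alpha>' us"
    "length vs = Suc (Suc d)"
  shows "levi_wedge w x \<alpha> vs = levi_wedge w' x \<alpha>' vs"
  unfolding levi_wedge_def
proof (intro sum.cong arg_cong2[where f="(*)"] refl)
  fix l j assume l: "l \<in> {..<length vs}" and j: "j \<in> {..<length (del_nth l vs)}"
  show "wirt_dbar (del_nth l vs ! j) (wirt_del (vs ! l) w) x = wirt_dbar (del_nth l vs ! j) (wirt_del (vs ! l) w') x"
    by (rule wirt_cong(2)[OF assms(1,2)], rule wirt_cong(1)[OF assms(1)]) (use assms(3) in auto)
  show "\<alpha> (del_nth j (del_nth l vs)) = \<alpha>' (del_nth j (del_nth l vs))"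
    by (rule assms(4)) (use l j assms(5) in simp)
qed

lemma ddbar_eq_0_on_open:
  assumes "open T" "x \<in> T" "\<And>y us. y \<in> T \<Longrightarrow> length us = d \<Longrightarrow> \<alpha> y us = 0" "length vs = Suc (Suc d)"
  shows "ddbar \<alpha> x vs = 0"
proof -
  have Ck: "Ck_on 2 (\<lambda>y. \<alpha> y us) T" if "length us = d" for us
    using Ck_on_cong[OF assms(1), of "\<lambda>y. \<alpha> y us" "\<lambda>y. 0"] assms(3) that Ck_on_const by blast
  have z: "wirt_del (vs ! l) (wirt_dbar (del_nth l vs ! j) (\<lambda>y. \<alpha> y (del_nth j (del_nth l vs)))) x = 0"
    if "l < length vs" "j < length (del_nth l vs)" for l j
  proof -
    have len: "length (del_nth j (del_nth l vs)) = d" using that assms(4) by simp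
    have "wirt_del (vs ! l) (wirt_dbar (del_nth l vs ! j) (\<lambda>y. \<alpha> y (del_nth j (del_nth l vs)))) x =
      wirt_del (vs ! l) (wirt_dbar (del_nth l vs ! j) (\<lambda>y. 0)) x"
      by (rule wirt_cong(1)[OF assms(1,2)], rule wirt_cong(2)[OF assms(1)]) (use assms(3) len in auto)
    then show ?thesis by (simp add: wirt_const_fun)
  qed
  have "(\<Sum>j<length (del_nth l vs). (-1) ^ j *
     wirt_del (vs ! l) (wirt_dbar (del_nth l vs ! j) (\<lambda>y. \<alpha> y (del_nth j (del_nth l vs)))) x) = 0" if "l < length vs" for l
    by (rule sum.neutral, rule ballI) (use z[OF that] in \<open>simp only: lessThan_iff mult_zero_right\<close>)
  then have zz: "(\<Sum>l<length vs. (-1) ^ l * (\<Sum>j<length (del_nth l vs). (-1) ^ j *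
     wirt_del (vs ! l) (wirt_dbar (del_nth l vs ! j) (\<lambda>y. \<alpha> y (del_nth j (del_nth l vs)))) x)) = 0"
    by (intro sum.neutral ballI) (simp only: lessThan_iff mult_zero_right)
  show ?thesis
    by (rule trans[OF ddbar_expansion[OF assms(1,2) Ck assms(4)] zz])
qed

lemma continuous_on_real_det:
  assumes "open S" "holo_map_on F S"
  shows "continuous_on S (\<lambda>x. real_det (frechet_derivative F (at x)))"
proof -
  have "Ck_on (Suc 0) F S" by (rule holo_map_on_imp_Ck_on[OF assms])
  from Ck_on_SucD(2)[OF this] have "continuous_on S (\<lambda>x. frechet_derivative F (at x) v)" for v by simp
  then show ?thesis
    unfolding real_det_def matrix_def det_def o_def rl_def vec_lambda_beta
    by (intro continuous_intros)
qed

text \<open>The fundamental lemma of the calculus of variations: if f x were not 0, then Re (cnj (f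
  x) f) would be positive near x, and so would be its integral against a small bump at x.\<close>

lemma continuous_eq_0_of_bump_integrals:
  fixes f :: "'x::euclidean_space \<Rightarrow> complex"
  assumes "open S" "continuous_on S f" "x \<in> S"
    "\<And>r. r > 0 \<Longrightarrow> cball x r \<subseteq> S \<Longrightarrow> set_lebesgue_integral lborel S (\<lambda>y. of_real (bump x r y) * f y) = 0"
  shows "f x = 0"
proof (rule ccontr)
  assume nz: "f x \<noteq> 0"
  let ?g = "\<lambda>y. Re (cnj (f x) * f y)"
  have gx: "?g x > 0"
    using nz by (simp add: complex_mult_cnj mult.commute[of "cnj _"] sum_power2_gt_zero_iff complex_neq_0)
  have gc: "continuous_on S ?g"
    by (intro continuous_intros assms(2))
  have "open (S \<inter> ?g -` {0<..})"
    by (rule continuous_open_preimage[OF gc assms(1)]) simp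
  then obtain r where r: "r > 0" "cball x r \<subseteq> S \<inter> ?g -` {0<..}"
    using open_contains_cball assms(3) gx by blast
  then have sub: "cball x r \<subseteq> S" by auto
  have b0: "bump x r y = 0" if "y \<in> S - cball x r" for y
    using bump_eq_0[OF r(1), of y x] that by auto
  have bc: "continuous_on T (bump x r)" for T
    using continuous_on_subset[OF Ck_on_imp_continuous_on[OF Ck_on_bump]] by blast
  have i: "set_integrable lborel S (\<lambda>y. of_real (bump x r y) * f y)"
    by (rule set_integrable_compact_support[OF compact_cball sub])
      (use b0 in \<open>auto intro!: continuous_intros bc assms(2)\<close>)
  have i': "set_integrable lborel S (\<lambda>y. bump x r y * ?g y)"
    by (rule set_integrable_compact_support[OF compact_cball sub])
      (use b0 in \<open>auto intro!: continuous_intros bc assms(2)\<close>)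
  have "set_lebesgue_integral lborel S (\<lambda>y. bump x r y * ?g y) =
      Re (set_lebesgue_integral lborel S (\<lambda>y. cnj (f x) * (of_real (bump x r y) * f y)))"
  proof -
    have "integrable lborel (\<lambda>y. indicator S y *\<^sub>R (cnj (f x) * (of_real (bump x r y) * f y)))"
      using set_integrable_mult_right[of "cnj (f x)", OF i] by (simp add: set_integrable_def)
    from integral_Re[OF this] show ?thesis
      unfolding set_lebesgue_integral_def by (simp add: algebra_simps)
  qed
  also have "\<dots> = 0"
    unfolding set_integral_mult_right assms(4)[OF r(1) sub] by simp
  finally have 0: "(\<integral>y. indicator S y *\<^sub>R (bump x r y * ?g y) \<partial>lborel) = 0"
    unfolding set_lebesgue_integral_def .
  have nn: "0 \<le> indicator S y *\<^sub>R (bump x r y * ?g y)" for y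
  proof (cases "y \<in> cball x r")
    case True
    then have "?g y > 0" using r(2) by auto
    then show ?thesis using bump_nonneg[of x r y] by simp
  next
    case False
    then show ?thesis using bump_eq_0[OF r(1), of y x] by auto
  qed
  have "AE y in lborel. indicator S y *\<^sub>R (bump x r y * ?g y) = 0"
    using integral_nonneg_eq_0_iff_AE[OF i'[unfolded set_integrable_def]] nn 0 by simp
  then have "AE y in lborel. y \<notin> ball x r"
  proof eventually_elim
    case (elim y)
    show ?case
    proof
      assume y: "y \<in> ball x r"
      then have "y \<in> S \<inter> ?g -` {0<..}" by (intro subsetD[OF r(2)]) simp
      then have "y \<in> S" "?g y > 0" by auto
      moreover have "bump x r y > 0" using bump_pos_iff[OF r(1)] y by blast
      ultimately have "y \<in> S" "?g y > 0" "bump x r y > 0" by auto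
      with elim show False by simp
    qed
  qed
  then have "ball x r \<in> null_sets lborel"
    by (subst AE_iff_null_sets) auto
  then have "negligible (ball x r)"
    by (simp add: negligible_iff_null_sets null_sets_completionI)
  then show False
    using open_not_negligible[of "ball x r"] r(1) by simp
qed

context compact_cplx_mfd
begin

lemma smooth_formD:
  assumes "smooth_form A d \<phi>" "c \<in> A"
  shows "length us = d \<Longrightarrow> Ck_on k (\<lambda>y. \<phi> c y us) (snd c ` fst c)"
    "y \<in> snd c ` fst c \<Longrightarrow> alt_form d (\<phi> c y)"
    "c' \<in> A \<Longrightarrow> x \<in> snd c ` (fst c \<inter> fst c') \<Longrightarrow> length us = d \<Longrightarrow>
       \<phi> c x us = \<phi> c' ((snd c' \<circ> chart_inv c) x) (map (frechet_derivative (snd c' \<circ> chart_inv c) (at x)) us)"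
proof -
  show "length us = d \<Longrightarrow> Ck_on k (\<lambda>y. \<phi> c y us) (snd c ` fst c)"
    using assms unfolding smooth_form_def smooth_fun_on_def by simp
  show "alt_form d (\<phi> c y)" if y: "y \<in> snd c ` fst c"
    unfolding alt_form_def
  proof (intro allI impI)
    fix us :: "(complex^'m) list" assume "length us = d"
    then have "\<forall>y\<in>snd c ` fst c. (\<forall>l<d. linear (\<lambda>v. \<phi> c y (us[l := v]))) \<and>
        (\<forall>l<d. \<forall>l'<d. l \<noteq> l' \<and> us ! l = us ! l' \<longrightarrow> \<phi> c y us = 0)"
      using assms unfolding smooth_form_def by blast
    then show "(\<forall>l<d. linear (\<lambda>v. \<phi> c y (us[l := v]))) \<and>
        (\<forall>l<d. \<forall>l'<d. l \<noteq> l' \<and> us ! l = us ! l' \<longrightarrow> \<phi> c y us = 0)"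
      using y by blast
  qed
  assume c': "c' \<in> A" and x: "x \<in> snd c ` (fst c \<inter> fst c')" and us: "length us = d"
  then obtain p where p: "p \<in> fst c \<inter> fst c'" "x = snd c p" by blast
  have "\<phi> c (snd c p) us = \<phi> c' (snd c' p) (map (frechet_derivative (snd c' \<circ> chart_inv c) (at (snd c p))) us)"
    using assms c' p(1) us unfolding smooth_form_def by blast
  then show "\<phi> c x us = \<phi> c' ((snd c' \<circ> chart_inv c) x) (map (frechet_derivative (snd c' \<circ> chart_inv c) (at x)) us)"
    using p chart(6)[OF assms(2)] by simp
qed

text \<open>Tested against a bump on the overlap, \<open>ddbar\<close> of the form becomes the Levi
  form of the bump wedged with the undifferentiated form. This product transforms by pullback, and
  alternation turns the pullback on \<open>std_frame\<close> into the real determinant. A change of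
  variables then compares the two weak statements.\<close>

lemma ddbar_transition:
  assumes "smooth_form A d \<phi>" "Suc (Suc d) = 2 * CARD('m)" "c \<in> A" "c' \<in> A" "x \<in> snd c ` (fst c \<inter> fst c')"
  defines "F \<equiv> snd c' \<circ> chart_inv c"
  shows "ddbar (\<phi> c) x std_frame =
    of_real (real_det (frechet_derivative F (at x))) * ddbar (\<phi> c') (F x) std_frame"
proof -
  let ?S = "snd c ` (fst c \<inter> fst c')" and ?S' = "snd c' ` (fst c' \<inter> fst c)"
  let ?e = "std_frame :: (complex^'m) list"
  define G where "G = snd c \<circ> chart_inv c'"
  let ?J = "\<lambda>x. of_real (real_det (frechet_derivative F (at x))) :: complex"
  have len: "length ?e = Suc (Suc d)" using std_frame(1) assms(2) by simp
  have S: "open ?S" and S': "open ?S'"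
    by (rule open_chart_image chart(1) assms(3,4))+
  have F: "holo_map_on F ?S" and G: "holo_map_on G ?S'"
    unfolding F_def G_def using transition_holo assms(3,4) by blast+
  have FS: "F ` ?S = ?S'"
    using transition_image[OF assms(3,4), of UNIV] unfolding F_def by simp
  have GF: "G (F y) = y" if "y \<in> ?S" for y
    using that chart(6)[OF assms(3)] chart(6)[OF assms(4)] unfolding F_def G_def by auto
  have inj: "inj_on F ?S" unfolding F_def by (rule transition_inj[OF assms(3,4)])
  have cS: "?S \<subseteq> snd c ` fst c" and cS': "?S' \<subseteq> snd c' ` fst c'" by auto
  have Ck: "Ck_on 2 (\<lambda>y. \<phi> c y us) ?S" "Ck_on 2 (\<lambda>y. \<phi> c' y us) ?S'" if "length us = d" for us
    using smooth_formD(1)[OF assms(1) _ that] assms(3,4) cS cS' Ck_on_subset by blast+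
  have Fc: "continuous_on ?S F" by (rule Ck_on_imp_continuous_on[OF holo_map_on_imp_Ck_on[OF S F]])
  have Jc: "continuous_on ?S ?J" by (intro continuous_intros continuous_on_real_det[OF S F])
  have d1: "continuous_on ?S (\<lambda>y. ddbar (\<phi> c) y ?e)" by (rule Ck_on_ddbar[OF S Ck(1) len])
  have d2: "continuous_on ?S (\<lambda>y. ddbar (\<phi> c') (F y) ?e)"
    by (rule continuous_on_compose2[OF Ck_on_ddbar[OF S' Ck(2) len] Fc]) (use FS in auto)
  let ?f = "\<lambda>y. ddbar (\<phi> c) y ?e - ?J y * ddbar (\<phi> c') (F y) ?e"
  have "?f x = 0"
  proof (rule continuous_eq_0_of_bump_integrals[OF S _ assms(5)])
    show "continuous_on ?S ?f" by (intro continuous_intros d1 d2 Jc)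
    fix r :: real assume r: "r > 0" "cball x r \<subseteq> ?S"
    let ?K = "cball x r" and ?K' = "F ` cball x r"
    define \<eta> where "\<eta> y = complex_of_real (bump x r y)" for y
    \<comment> \<open>The same bump, read in the other chart.\<close>
    define \<eta>' where "\<eta>' y = \<eta> (G y)" for y
    have \<eta>: "Ck_on 2 \<eta> T" if "open T" for T
      unfolding \<eta>_def[abs_def]
      by (rule Ck_on_bounded_linear[OF that bounded_linear_of_real Ck_on_subset[OF Ck_on_bump]]) simp
    have \<eta>': "Ck_on 2 \<eta>' ?S'"
      unfolding \<eta>'_def[abs_def]
      by (rule Ck_on_compose[OF S' open_UNIV _ \<eta>[OF open_UNIV] holo_map_on_imp_Ck_on[OF S' G]]) simp
    have K': "compact ?K'" "?K' \<subseteq> ?S'"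
      using compact_continuous_image[OF continuous_on_subset[OF Fc r(2)] compact_cball] image_mono[OF r(2), of F]
      unfolding FS by auto
    have \<eta>0: "\<forall>y\<in>?S - ?K. \<eta> y = 0"
      using bump_eq_0[OF r(1), of _ x] unfolding \<eta>_def by auto
    have \<eta>'0: "\<forall>y\<in>?S' - ?K'. \<eta>' y = 0"
    proof
      fix y assume y: "y \<in> ?S' - ?K'"
      then obtain z where z: "z \<in> ?S" "y = F z" using FS by blast
      then have "z \<in> ?S - ?K" using y by auto
      then show "\<eta>' y = 0" unfolding \<eta>'_def z(2) GF[OF z(1)] using \<eta>0 by blast
    qed
    note P = ddbar_by_parts[OF S compact_cball r(2) \<eta>[OF S] Ck(1) len disjI1[OF \<eta>0]]
    note P' = ddbar_by_parts[OF S' K' \<eta>' Ck(2) len disjI1[OF \<eta>'0]]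
    have \<eta>F: "\<eta> y = \<eta>' (F y)" if "y \<in> ?S" for y
      unfolding \<eta>'_def GF[OF that] ..
    have nat: "levi_wedge \<eta> y (\<phi> c y) ?e = ?J y * levi_wedge \<eta>' (F y) (\<phi> c' (F y)) ?e" if y: "y \<in> ?S" for y
    proof -
      let ?D = "frechet_derivative F (at y)"
      have Fy: "F y \<in> ?S'" using FS y by blast
      have "levi_wedge \<eta> y (\<phi> c y) ?e = levi_wedge (\<lambda>y. \<eta>' (F y)) y (\<lambda>us. \<phi> c' (F y) (map ?D us)) ?e"
        by (rule levi_wedge_cong[OF S y \<eta>F _ len])
          (use smooth_formD(3)[OF assms(1,3,4) y] in \<open>simp_all only: F_def\<close>)
      also have "\<dots> = levi_wedge \<eta>' (F y) (\<phi> c' (F y)) (map ?D ?e)"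
        by (rule levi_wedge_compose_holo[OF S S' F _ \<eta>' y]) (use FS in simp)
      also have "\<dots> = ?J y * levi_wedge \<eta>' (F y) (\<phi> c' (F y)) ?e"
      proof (rule alt_form_real_det)
        show "linear ?D" using holo_map_onD(1)[OF F y] by (rule has_derivative_linear)
        have "alt_form d (\<phi> c' (F y))" using smooth_formD(2)[OF assms(1,4)] Fy cS' by blast
        then show "alt_form (2 * CARD('m)) (levi_wedge \<eta>' (F y) (\<phi> c' (F y)))"
          unfolding assms(2)[symmetric] by (rule alt_form_levi_wedge[OF S' \<eta>' Fy])
      qed
      finally show ?thesis .
    qed
    have Sb: "?S \<in> sets borel" using S by simp
    have i1: "set_integrable lborel ?S (\<lambda>y. ?J y * levi_wedge \<eta>' (F y) (\<phi> c' (F y)) ?e)"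
    proof -
      have "set_integrable lborel ?S (\<lambda>y. levi_wedge \<eta> y (\<phi> c y) ?e) \<longleftrightarrow> set_integrable lborel ?S (\<lambda>y. ?J y * levi_wedge \<eta>' (F y) (\<phi> c' (F y)) ?e)"
        by (rule set_integrable_cong) (simp_all only: nat)
      then show ?thesis using P(2) by simp
    qed
    have i2: "set_integrable lborel ?S (\<lambda>y. ?J y * (\<eta>' (F y) * ddbar (\<phi> c') (F y) ?e))"
    proof (rule set_integrable_compact_support[OF compact_cball r(2)])
      have "continuous_on ?S (\<lambda>y. \<eta>' (F y))"
        by (rule continuous_on_compose2[OF Ck_on_imp_continuous_on[OF \<eta>'] Fc]) (use FS in simp)
      then show "continuous_on ?S (\<lambda>y. ?J y * (\<eta>' (F y) * ddbar (\<phi> c') (F y) ?e))"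
        by (intro continuous_intros d2 Jc)
      show "?J y * (\<eta>' (F y) * ddbar (\<phi> c') (F y) ?e) = 0" if "y \<in> ?S - ?K" for y
        using \<eta>F[of y] \<eta>0 that by simp
    qed
    \<comment> \<open>The chain is: by parts in the first chart, naturality, change of variables, by
      parts backwards in the second chart, change of variables backwards.\<close>
    have "set_lebesgue_integral lborel ?S (\<lambda>y. \<eta> y * ddbar (\<phi> c) y ?e) =
      set_lebesgue_integral lborel ?S (\<lambda>y. levi_wedge \<eta> y (\<phi> c y) ?e)"
      by (rule P(3))
    also have "\<dots> = set_lebesgue_integral lborel ?S (\<lambda>y. ?J y * levi_wedge \<eta>' (F y) (\<phi> c' (F y)) ?e)"
      by (rule set_lebesgue_integral_cong, use S in simp, intro allI impI, rule nat)
    also have "\<dots> = set_lebesgue_integral lborel (F ` ?S) (\<lambda>y. levi_wedge \<eta>' y (\<phi> c' y) ?e)"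
      by (rule holo_change_of_variables[symmetric, OF F inj Sb _ i1], unfold FS) (rule P'(2))
    also have "\<dots> = set_lebesgue_integral lborel (F ` ?S) (\<lambda>y. \<eta>' y * ddbar (\<phi> c') y ?e)"
      unfolding FS by (rule P'(3)[symmetric])
    also have "\<dots> = set_lebesgue_integral lborel ?S (\<lambda>y. ?J y * (\<eta>' (F y) * ddbar (\<phi> c') (F y) ?e))"
      by (rule holo_change_of_variables[OF F inj Sb _ i2], unfold FS) (rule P'(1))
    finally have eq: "set_lebesgue_integral lborel ?S (\<lambda>y. \<eta> y * ddbar (\<phi> c) y ?e) =
      set_lebesgue_integral lborel ?S (\<lambda>y. ?J y * (\<eta>' (F y) * ddbar (\<phi> c') (F y) ?e))" .
    have "set_lebesgue_integral lborel ?S (\<lambda>y. of_real (bump x r y) * ?f y) =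
      set_lebesgue_integral lborel ?S (\<lambda>y. \<eta> y * ddbar (\<phi> c) y ?e - ?J y * (\<eta>' (F y) * ddbar (\<phi> c') (F y) ?e))"
    proof (rule set_lebesgue_integral_cong)
      show "\<forall>y. y \<in> ?S \<longrightarrow> of_real (bump x r y) * ?f y = \<eta> y * ddbar (\<phi> c) y ?e - ?J y * (\<eta>' (F y) * ddbar (\<phi> c') (F y) ?e)"
      proof (intro allI impI)
        fix y assume "y \<in> ?S"
        then show "of_real (bump x r y) * ?f y = \<eta> y * ddbar (\<phi> c) y ?e - ?J y * (\<eta>' (F y) * ddbar (\<phi> c') (F y) ?e)"
          unfolding \<eta>F[OF \<open>y \<in> ?S\<close>, symmetric] by (simp add: \<eta>_def algebra_simps)
      qed
    qed (use S in simp)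
    also have "\<dots> = 0"
    proof -
      have "set_integrable lborel ?S (\<lambda>y. \<eta> y * ddbar (\<phi> c) y ?e)" by (rule P(1))
      from set_integral_diff(2)[OF this i2] eq show ?thesis by simp
    qed
    finally show "set_lebesgue_integral lborel ?S (\<lambda>y. of_real (bump x r y) * ?f y) = 0" .
  qed
  then show ?thesis by simp
qed

end

section \<open>Linearity of \<open>ddbar\<close>\<close>

lemma wirt2_sum:
  assumes "open S" "x \<in> S" "\<And>i. i \<in> I \<Longrightarrow> Ck_on 2 (f i) S"
  shows "wirt_del v (wirt_dbar v' (\<lambda>y. \<Sum>i\<in>I. a i * f i y)) x = (\<Sum>i\<in>I. a i * wirt_del v (wirt_dbar v' (f i)) x)"
proof -
  have C: "Ck_on (Suc (Suc 0)) (f i) S" if "i \<in> I" for i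
    using assms(3)[OF that] by (simp add: numeral_2_eq_2)
  have d1: "f i differentiable (at y)" if "i \<in> I" "y \<in> S" for i y
    by (rule Ck_on_imp_differentiable[OF C[OF that(1)] that(2)])
  have d2: "wirt_dbar v' (f i) differentiable (at x)" if "i \<in> I" for i
    by (rule Ck_on_imp_differentiable[OF Ck_on_wirt(2)[OF assms(1) C[OF that]] assms(2)])
  have "wirt_dbar v' (\<lambda>y. \<Sum>i\<in>I. a i * f i y) y = (\<Sum>i\<in>I. a i * wirt_dbar v' (f i) y)" if "y \<in> S" for y
  proof -
    have "wirt_dbar v' (\<lambda>y. \<Sum>i\<in>I. a i * f i y) y = (\<Sum>i\<in>I. wirt_dbar v' (\<lambda>y. a i * f i y) y)"
      by (rule wirt_sum(2)) (intro differentiable_mult differentiable_const d1 that)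
    also have "\<dots> = (\<Sum>i\<in>I. a i * wirt_dbar v' (f i) y)"
      by (rule sum.cong[OF refl]) (rule wirt_cmult(2)[OF d1[OF _ that]])
    finally show ?thesis .
  qed
  then have "wirt_del v (wirt_dbar v' (\<lambda>y. \<Sum>i\<in>I. a i * f i y)) x = wirt_del v (\<lambda>y. \<Sum>i\<in>I. a i * wirt_dbar v' (f i) y) x"
    by (intro wirt_cong(1)[OF assms(1,2)])
  also have "\<dots> = (\<Sum>i\<in>I. wirt_del v (\<lambda>y. a i * wirt_dbar v' (f i) y) x)"
    by (rule wirt_sum(1)) (intro differentiable_mult differentiable_const d2)
  also have "\<dots> = (\<Sum>i\<in>I. a i * wirt_del v (wirt_dbar v' (f i)) x)"
    by (rule sum.cong[OF refl]) (rule wirt_cmult(1)[OF d2])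
  finally show ?thesis .
qed

lemma ddbar_sum:
  assumes "open S" "x \<in> S" "\<And>i us. i \<in> I \<Longrightarrow> length us = d \<Longrightarrow> Ck_on 2 (\<lambda>y. \<alpha> i y us) S"
    "length vs = Suc (Suc d)" "\<And>y us. y \<in> S \<Longrightarrow> length us = d \<Longrightarrow> \<beta> y us = (\<Sum>i\<in>I. a i * \<alpha> i y us)"
  shows "ddbar \<beta> x vs = (\<Sum>i\<in>I. a i * ddbar (\<alpha> i) x vs)"
proof -
  define t where "t i l j = wirt_del (vs ! l) (wirt_dbar (del_nth l vs ! j) (\<lambda>y. \<alpha> i y (del_nth j (del_nth l vs)))) x" for i l j
  have Cb: "Ck_on 2 (\<lambda>y. \<beta> y us) S" if us: "length us = d" for us
  proof -
    have "Ck_on 2 (\<lambda>y. \<Sum>i\<in>I. a i * \<alpha> i y us) S"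
      by (intro Ck_on_sum Ck_on_cmult assms(1) assms(3) us)
    then show ?thesis
      using Ck_on_cong[OF assms(1), of "\<lambda>y. \<beta> y us" "\<lambda>y. \<Sum>i\<in>I. a i * \<alpha> i y us"] assms(5)[OF _ us] by blast
  qed
  have e: "ddbar (\<alpha> i) x vs = (\<Sum>l<length vs. (-1) ^ l * (\<Sum>j<length (del_nth l vs). (-1) ^ j * t i l j))"
    if "i \<in> I" for i
    unfolding t_def by (rule ddbar_expansion[OF assms(1,2) assms(3)[OF that] assms(4)])
  have tb: "wirt_del (vs ! l) (wirt_dbar (del_nth l vs ! j) (\<lambda>y. \<beta> y (del_nth j (del_nth l vs)))) x = (\<Sum>i\<in>I. a i * t i l j)"
    if "l < length vs" "j < length (del_nth l vs)" for l j
  proof -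
    let ?us = "del_nth j (del_nth l vs)"
    have us: "length ?us = d" using that assms(4) by simp
    have "wirt_del (vs ! l) (wirt_dbar (del_nth l vs ! j) (\<lambda>y. \<beta> y ?us)) x =
       wirt_del (vs ! l) (wirt_dbar (del_nth l vs ! j) (\<lambda>y. \<Sum>i\<in>I. a i * \<alpha> i y ?us)) x"
      by (rule wirt_cong(1)[OF assms(1,2)], rule wirt_cong(2)[OF assms(1)], assumption, rule assms(5)[OF _ us])
    also have "\<dots> = (\<Sum>i\<in>I. a i * t i l j)"
      unfolding t_def by (rule wirt2_sum[OF assms(1,2)]) (rule assms(3)[OF _ us])
    finally show ?thesis .
  qed
  have "ddbar \<beta> x vs = (\<Sum>l<length vs. (-1) ^ l * (\<Sum>j<length (del_nth l vs). (-1) ^ j *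
      wirt_del (vs ! l) (wirt_dbar (del_nth l vs ! j) (\<lambda>y. \<beta> y (del_nth j (del_nth l vs)))) x))"
    by (rule ddbar_expansion[OF assms(1,2) Cb assms(4)])
  also have "\<dots> = (\<Sum>l<length vs. (-1) ^ l * (\<Sum>j<length (del_nth l vs). (-1) ^ j * (\<Sum>i\<in>I. a i * t i l j)))"
  proof (rule sum.cong[OF refl])
    fix l assume l: "l \<in> {..<length vs}"
    have "(\<Sum>j<length (del_nth l vs). (-1) ^ j *
        wirt_del (vs ! l) (wirt_dbar (del_nth l vs ! j) (\<lambda>y. \<beta> y (del_nth j (del_nth l vs)))) x) =
      (\<Sum>j<length (del_nth l vs). (-1) ^ j * (\<Sum>i\<in>I. a i * t i l j))"
    proof (rule sum.cong[OF refl])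
      fix j assume j: "j \<in> {..<length (del_nth l vs)}"
      show "(-1) ^ j * wirt_del (vs ! l) (wirt_dbar (del_nth l vs ! j) (\<lambda>y. \<beta> y (del_nth j (del_nth l vs)))) x =
        (-1) ^ j * (\<Sum>i\<in>I. a i * t i l j)"
        by (subst tb) (use l j in \<open>simp_all only: lessThan_iff\<close>)
    qed
    then show "(-1) ^ l * (\<Sum>j<length (del_nth l vs). (-1) ^ j *
        wirt_del (vs ! l) (wirt_dbar (del_nth l vs ! j) (\<lambda>y. \<beta> y (del_nth j (del_nth l vs)))) x) =
      (-1) ^ l * (\<Sum>j<length (del_nth l vs). (-1) ^ j * (\<Sum>i\<in>I. a i * t i l j))"
      by (simp only:)
  qed
  also have "\<dots> = (\<Sum>l<length vs. \<Sum>i\<in>I. \<Sum>j<length (del_nth l vs). (-1) ^ l * ((-1) ^ j * (a i * t i l j)))"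
    unfolding sum_distrib_left by (intro sum.cong[OF refl] sum.swap)
  also have "\<dots> = (\<Sum>i\<in>I. \<Sum>l<length vs. \<Sum>j<length (del_nth l vs). (-1) ^ l * ((-1) ^ j * (a i * t i l j)))"
    by (rule sum.swap)
  also have "\<dots> = (\<Sum>i\<in>I. a i * (\<Sum>l<length vs. (-1) ^ l * (\<Sum>j<length (del_nth l vs). (-1) ^ j * t i l j)))"
    unfolding sum_distrib_left by (simp add: mult_ac)
  also have "\<dots> = (\<Sum>i\<in>I. a i * ddbar (\<alpha> i) x vs)"
    by (rule sum.cong[OF refl], subst e) (assumption, rule refl)
  finally show ?thesis .
qed

definition mult_form :: "('a \<Rightarrow> real) \<Rightarrow> ('a, 'm::finite) mform \<Rightarrow> ('a, 'm) mform" where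
  "mult_form \<rho> \<phi> c y vs = of_real (\<rho> (chart_inv c y)) * \<phi> c y vs"

text \<open>A closed bound Z for the support is easier to carry through products than
  \<open>form_support\<close>, which is the least such bound.\<close>

definition vanishes_off :: "('a, 'm::finite) chart set \<Rightarrow> nat \<Rightarrow> 'a set \<Rightarrow> ('a, 'm) mform \<Rightarrow> bool" where
  "vanishes_off A d Z \<phi> \<longleftrightarrow> (\<forall>c\<in>A. \<forall>p\<in>fst c. p \<notin> Z \<longrightarrow> (\<forall>us. length us = d \<longrightarrow> \<phi> c (snd c p) us = 0))"

lemma vanishes_off_form_support: "vanishes_off A d (form_support A d \<phi>) \<phi>"
  unfolding vanishes_off_def
proof (intro ballI impI allI, rule ccontr)
  fix c p us
  assume "c \<in> A" "p \<in> fst c" "p \<notin> form_support A d \<phi>" "length us = d" "\<phi> c (snd c p) us \<noteq> 0"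
  then have "p \<in> {p. \<exists>c\<in>A. p \<in> fst c \<and> (\<exists>vs. length vs = d \<and> \<phi> c (snd c p) vs \<noteq> 0)}"
    by (intro CollectI bexI[of _ c] conjI exI[of _ us])
  then have "p \<in> form_support A d \<phi>"
    unfolding form_support_def by (rule subsetD[OF closure_subset])
  with \<open>p \<notin> form_support A d \<phi>\<close> show False ..
qed

lemma closed_form_support: "closed (form_support A d \<phi>)"
  by (simp add: form_support_def)

lemma form_support_subset: "closed Z \<Longrightarrow> vanishes_off A d Z \<phi> \<Longrightarrow> form_support A d \<phi> \<subseteq> Z"
  unfolding form_support_def
proof (rule closure_minimal, rule subsetI, rule ccontr)
  fix p assume v: "vanishes_off A d Z \<phi>" and "p \<notin> Z"
    and "p \<in> {p. \<exists>c\<in>A. p \<in> fst c \<and> (\<exists>vs. length vs = d \<and> \<phi> c (snd c p) vs \<noteq> 0)}"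
  then show False unfolding vanishes_off_def by simp metis
qed

section \<open>Cutting off forms and pairing them with functions\<close>

context compact_cplx_mfd
begin

lemma vanishes_offD:
  assumes "vanishes_off A d Z \<phi>" "c \<in> A" "y \<in> snd c ` fst c" "chart_inv c y \<notin> Z" "length us = d"
  shows "\<phi> c y us = 0"
  using assms chart(6)[OF assms(2)] unfolding vanishes_off_def by auto

lemma ddbar_vanishes_off:
  assumes "vanishes_off A d Z \<phi>" "closed Z" "c \<in> A" "y \<in> snd c ` fst c" "chart_inv c y \<notin> Z" "length vs = Suc (Suc d)"
  shows "ddbar (\<phi> c) y vs = 0"
proof (rule ddbar_eq_0_on_open[of "snd c ` (fst c \<inter> - Z)"])
  show "open (snd c ` (fst c \<inter> - Z))"
    by (rule open_chart_image[OF assms(3)]) (use assms(2) in \<open>simp add: open_Compl\<close>)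
  show "y \<in> snd c ` (fst c \<inter> - Z)"
    using assms(4,5) chart_image[OF assms(3)] by auto
  show "\<phi> c z us = 0" if "z \<in> snd c ` (fst c \<inter> - Z)" "length us = d" for z us
    by (rule vanishes_offD[OF assms(1,3)]) (use that chart(6)[OF assms(3)] in auto)
qed (rule assms(6))

lemma smooth_form_mult:
  assumes "smooth_on_mfd A UNIV \<rho>" "smooth_form A d \<phi>"
  shows "smooth_form A d (mult_form \<rho> \<phi>)"
  unfolding smooth_form_def
proof (intro conjI ballI allI impI)
  fix c and us :: "(complex^'m) list" assume c: "c \<in> A" and us: "length us = d"
  have o: "open (snd c ` fst c)" by (rule chart(2)[OF c])
  have "Ck_on k (\<rho> \<circ> chart_inv c) (snd c ` fst c)" for k
    using assms(1) c unfolding smooth_on_mfd_def smooth_fun_on_def by simp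
  then have "Ck_on k (\<lambda>y. complex_of_real ((\<rho> \<circ> chart_inv c) y)) (snd c ` fst c)" for k
    by (rule Ck_on_bounded_linear[OF o bounded_linear_of_real])
  then have "Ck_on k (\<lambda>y. complex_of_real ((\<rho> \<circ> chart_inv c) y) * \<phi> c y us) (snd c ` fst c)" for k
    by (intro Ck_on_mult[OF o] smooth_formD(1)[OF assms(2) c us])
  then show "smooth_fun_on (\<lambda>y. mult_form \<rho> \<phi> c y us) (snd c ` fst c)"
    unfolding smooth_fun_on_def mult_form_def by simp
  fix y l assume y: "y \<in> snd c ` fst c" and l: "l < d"
  note alt = alt_formD[OF smooth_formD(2)[OF assms(2) c y] us]
  show "linear (\<lambda>v. mult_form \<rho> \<phi> c y (us[l := v]))"
    unfolding mult_form_def by (rule linear_complex_mult[OF alt(1)[OF l]])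
  fix l' assume "l' < d" "l \<noteq> l' \<and> us ! l = us ! l'"
  then show "mult_form \<rho> \<phi> c y us = 0"
    unfolding mult_form_def using alt(2)[OF l] by simp
next
  fix c c' p and us :: "(complex^'m) list"
  assume c: "c \<in> A" "c' \<in> A" and p: "p \<in> fst c \<inter> fst c'" and us: "length us = d"
  have "\<phi> c (snd c p) us = \<phi> c' (snd c' p) (map (frechet_derivative (snd c' \<circ> chart_inv c) (at (snd c p))) us)"
    using assms(2) c p us unfolding smooth_form_def by blast
  then show "mult_form \<rho> \<phi> c (snd c p) us = mult_form \<rho> \<phi> c' (snd c' p) (map (frechet_derivative (snd c' \<circ> chart_inv c) (at (snd c p))) us)"
    using p chart(6)[OF c(1)] chart(6)[OF c(2)] by (simp add: mult_form_def)
qed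

lemma test_form_mult:
  assumes "smooth_on_mfd A UNIV \<rho>" "test_form A \<phi>"
  shows "test_form A (mult_form \<rho> \<phi>)"
  using assms smooth_form_mult unfolding test_form_def smooth_form_pq_def by (simp add: mult_form_def)

lemma vanishes_off_mult:
  assumes "vanishes_off A d Z \<phi>"
  shows "vanishes_off A d (closure {p. \<rho> p \<noteq> 0} \<inter> Z) (mult_form \<rho> \<phi>)"
  unfolding vanishes_off_def
proof (intro ballI impI allI)
  fix c p and us :: "(complex^'m) list"
  assume c: "c \<in> A" and p: "p \<in> fst c" "p \<notin> closure {p. \<rho> p \<noteq> 0} \<inter> Z" and us: "length us = d"
  then have "\<rho> p = 0 \<or> \<phi> c (snd c p) us = 0"
    using assms subsetD[OF closure_subset, of p "{p. \<rho> p \<noteq> 0}"] unfolding vanishes_off_def by simp metis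
  then show "mult_form \<rho> \<phi> c (snd c p) us = 0"
    using chart(6)[OF c p(1)] by (auto simp: mult_form_def)
qed

text \<open>The value of the current ddbar u on \<phi>, with the derivatives placed on \<phi> as in
  \<open>is_ddbar_current\<close>.\<close>

definition pair :: "('a \<Rightarrow> complex) \<Rightarrow> ('a, 'm) mform \<Rightarrow> complex" where
  "pair u \<phi> = mfd_integral A (\<lambda>c y vs. u (chart_inv c y) * ddbar (\<phi> c) y vs)"

definition loc_int :: "'a set \<Rightarrow> ('a \<Rightarrow> complex) \<Rightarrow> bool" where
  "loc_int V u \<longleftrightarrow> (\<forall>c\<in>A. \<forall>K. compact K \<and> K \<subseteq> snd c ` (fst c \<inter> V) \<longrightarrow> set_integrable lborel K (\<lambda>y. u (chart_inv c y)))"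

text \<open>The choice made inside \<open>mfd_integral\<close>, kept as one constant so that
  different integrals are compared over the same partition.\<close>

definition pieces :: "(('a, 'm) chart \<times> 'a set) set" where
  "pieces = (SOME P. chart_partition A P)"

lemma chart_partition_pieces: "chart_partition A pieces"
  unfolding pieces_def using ex_chart_partition by (rule someI_ex)

lemma pieces:
  assumes "(c, B) \<in> pieces"
  shows "c \<in> A" "B \<in> sets borel" "B \<subseteq> fst c" "\<exists>K. compact K \<and> B \<subseteq> K \<and> K \<subseteq> fst c"
  using chart_partition_pieces assms unfolding chart_partition_def by blast+

lemma pair_eq_sum:
  "pair u \<phi> = (\<Sum>(c, B)\<in>pieces. set_lebesgue_integral lborel (snd c ` B) (\<lambda>y. u (chart_inv c y) * ddbar (\<phi> c) y std_frame))"
  unfolding pair_def mfd_integral_def pieces_def ..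

text \<open>The piece B may leave the set V on which u is locally integrable, but off Z the factor
  \<open>ddbar\<close> vanishes. So the integral is confined to the compact set \<open>K2\<close>,
  the image of K \<inter> Z, where that factor is bounded and u is integrable.\<close>

lemma piece_integrable:
  assumes "smooth_form A d \<phi>" "Suc (Suc d) = 2 * CARD('m)" "closed Z" "vanishes_off A d Z \<phi>" "Z \<subseteq> V" "loc_int V u"
    "(c, B) \<in> pieces"
  shows "set_integrable lborel (snd c ` B) (\<lambda>y. u (chart_inv c y) * ddbar (\<phi> c) y std_frame)"
proof -
  let ?g = "\<lambda>y. ddbar (\<phi> c) y (std_frame :: (complex^'m) list)"
  note cB = pieces[OF assms(7)]
  have len: "length (std_frame :: (complex^'m) list) = Suc (Suc d)" using std_frame(1) assms(2) by simp
  obtain K where K: "compact K" "B \<subseteq> K" "K \<subseteq> fst c" using cB(4) by blast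
  define K2 where "K2 = snd c ` (K \<inter> Z)"
  have K2: "compact K2"
    unfolding K2_def by (rule compact_chart_image[OF cB(1)]) (use K assms(3) in auto)
  have K2V: "K2 \<subseteq> snd c ` (fst c \<inter> V)" and K2c: "K2 \<subseteq> snd c ` fst c" unfolding K2_def using K(3) assms(5) by auto
  have gc: "continuous_on (snd c ` fst c) ?g"
    by (rule Ck_on_ddbar[OF chart(2)[OF cB(1)] smooth_formD(1)[OF assms(1) cB(1)] len])
  have gK: "continuous_on K2 ?g" by (rule continuous_on_subset[OF gc K2c])
  have "bounded (?g ` K2)" by (rule compact_imp_bounded[OF compact_continuous_image[OF gK K2]])
  then obtain M where M: "M > 0" "\<And>y. y \<in> K2 \<Longrightarrow> norm (?g y) \<le> M" unfolding bounded_pos by auto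
  have u: "integrable lborel (\<lambda>y. indicator K2 y *\<^sub>R u (chart_inv c y))"
    using assms(6) cB(1) K2 K2V unfolding loc_int_def set_integrable_def by blast
  have gm: "(\<lambda>y. indicator K2 y *\<^sub>R ?g y) \<in> borel_measurable lborel"
    using borel_measurable_integrable[OF borel_integrable_compact[OF K2 gK]] .
  have i: "set_integrable lborel K2 (\<lambda>y. u (chart_inv c y) * ?g y)"
    unfolding set_integrable_def
  proof (rule Bochner_Integration.integrable_bound)
    show "integrable lborel (\<lambda>y. M *\<^sub>R (indicator K2 y *\<^sub>R u (chart_inv c y)))"
      by (rule integrable_scaleR_right[OF u])
    have "(\<lambda>y. (indicator K2 y *\<^sub>R u (chart_inv c y)) * (indicator K2 y *\<^sub>R ?g y)) \<in> borel_measurable lborel"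
      by (rule borel_measurable_times[OF borel_measurable_integrable[OF u] gm])
    also have "(\<lambda>y. (indicator K2 y *\<^sub>R u (chart_inv c y)) * (indicator K2 y *\<^sub>R ?g y)) = (\<lambda>y. indicator K2 y *\<^sub>R (u (chart_inv c y) * ?g y))"
      by (auto simp: indicator_def fun_eq_iff)
    finally show "(\<lambda>y. indicator K2 y *\<^sub>R (u (chart_inv c y) * ?g y)) \<in> borel_measurable lborel" .
    show "AE y in lborel. norm (indicator K2 y *\<^sub>R (u (chart_inv c y) * ?g y)) \<le> norm (M *\<^sub>R (indicator K2 y *\<^sub>R u (chart_inv c y)))"
    proof (rule AE_I2)
      fix y
      show "norm (indicator K2 y *\<^sub>R (u (chart_inv c y) * ?g y)) \<le> norm (M *\<^sub>R (indicator K2 y *\<^sub>R u (chart_inv c y)))"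
      proof (cases "y \<in> K2")
        case True
        then have "norm (u (chart_inv c y)) * norm (?g y) \<le> norm (u (chart_inv c y)) * M"
          by (intro mult_left_mono M(2)) auto
        then show ?thesis using True M(1) by (simp add: norm_mult mult.commute[of M])
      qed simp
    qed
  qed
  have Bb: "snd c ` B \<in> sets borel"
    using borel_chart_image[OF cB(1,2)] cB(3) by (simp add: Int_absorb1)
  have "set_integrable lborel (snd c ` B \<inter> K2) (\<lambda>y. u (chart_inv c y) * ?g y)"
    by (rule set_integrable_subset[OF i])
      (use sets.Int[OF Bb borel_closed[OF compact_imp_closed[OF K2]]] in simp_all)
  moreover have "indicator (snd c ` B \<inter> K2) y *\<^sub>R (u (chart_inv c y) * ?g y) = indicator (snd c ` B) y *\<^sub>R (u (chart_inv c y) * ?g y)" for y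
  proof (cases "y \<in> snd c ` B \<and> y \<notin> K2")
    case True
    then obtain p where p: "p \<in> B" "y = snd c p" by blast
    then have pc: "p \<in> fst c" "p \<in> K" using cB(3) K by auto
    have "p \<notin> Z" using True p pc unfolding K2_def by blast
    then have "?g y = 0"
      by (intro ddbar_vanishes_off[OF assms(4,3) cB(1) _ _ len]) (use p pc chart(6)[OF cB(1)] in auto)
    then show ?thesis by simp
  qed (auto simp: indicator_def)
  ultimately show ?thesis unfolding set_integrable_def by simp
qed

lemma pair_sum:
  assumes "\<And>i. i \<in> I \<Longrightarrow> smooth_form A d (\<phi> i)" "Suc (Suc d) = 2 * CARD('m)" "\<And>i. i \<in> I \<Longrightarrow> closed (Z i)"
    "\<And>i. i \<in> I \<Longrightarrow> vanishes_off A d (Z i) (\<phi> i)" "\<And>i. i \<in> I \<Longrightarrow> Z i \<subseteq> V" "loc_int V u"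
    "\<And>c y us. c \<in> A \<Longrightarrow> y \<in> snd c ` fst c \<Longrightarrow> length us = d \<Longrightarrow> \<psi> c y us = (\<Sum>i\<in>I. a i * \<phi> i c y us)"
  shows "pair u \<psi> = (\<Sum>i\<in>I. a i * pair u (\<phi> i))"
proof -
  let ?e = "std_frame :: (complex^'m) list"
  have len: "length ?e = Suc (Suc d)" using std_frame(1) assms(2) by simp
  have "set_lebesgue_integral lborel (snd c ` B) (\<lambda>y. u (chart_inv c y) * ddbar (\<psi> c) y ?e) =
      (\<Sum>i\<in>I. a i * set_lebesgue_integral lborel (snd c ` B) (\<lambda>y. u (chart_inv c y) * ddbar (\<phi> i c) y ?e))"
    if cB: "(c, B) \<in> pieces" for c B
  proof -
    note c = pieces[OF cB]
    have Bb: "snd c ` B \<in> sets lborel"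
      using borel_chart_image[OF c(1,2)] c(3) by (simp add: Int_absorb1)
    have dd: "ddbar (\<psi> c) y ?e = (\<Sum>i\<in>I. a i * ddbar (\<phi> i c) y ?e)" if "y \<in> snd c ` fst c" for y
      by (rule ddbar_sum[OF chart(2)[OF c(1)] that _ len])
        (rule smooth_formD(1)[OF assms(1) c(1)], assumption+, rule assms(7)[OF c(1)])
    have int: "set_integrable lborel (snd c ` B) (\<lambda>y. u (chart_inv c y) * ddbar (\<phi> i c) y ?e)" if "i \<in> I" for i
      by (rule piece_integrable[OF assms(1)[OF that] assms(2) assms(3)[OF that] assms(4)[OF that] assms(5)[OF that] assms(6) cB])
    have "set_lebesgue_integral lborel (snd c ` B) (\<lambda>y. u (chart_inv c y) * ddbar (\<psi> c) y ?e) =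
      set_lebesgue_integral lborel (snd c ` B) (\<lambda>y. \<Sum>i\<in>I. a i * (u (chart_inv c y) * ddbar (\<phi> i c) y ?e))"
    proof (rule set_lebesgue_integral_cong[OF Bb], intro allI impI)
      fix y assume "y \<in> snd c ` B"
      then have "y \<in> snd c ` fst c" using c(3) by auto
      then show "u (chart_inv c y) * ddbar (\<psi> c) y ?e = (\<Sum>i\<in>I. a i * (u (chart_inv c y) * ddbar (\<phi> i c) y ?e))"
        by (simp add: dd sum_distrib_left mult_ac)
    qed
    also have "\<dots> = (\<Sum>i\<in>I. set_lebesgue_integral lborel (snd c ` B) (\<lambda>y. a i * (u (chart_inv c y) * ddbar (\<phi> i c) y ?e)))"
      by (rule set_integral_sum) (rule set_integrable_mult_right[OF int])
    finally show ?thesis by simp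
  qed
  then have "pair u \<psi> = (\<Sum>(c, B)\<in>pieces. \<Sum>i\<in>I. a i * set_lebesgue_integral lborel (snd c ` B) (\<lambda>y. u (chart_inv c y) * ddbar (\<phi> i c) y ?e))"
    unfolding pair_eq_sum by (intro sum.cong) auto
  also have "\<dots> = (\<Sum>i\<in>I. a i * pair u (\<phi> i))"
    unfolding pair_eq_sum split_def sum_distrib_left by (rule sum.swap)
  finally show ?thesis .
qed

end

section \<open>Pluriharmonic functions and Stokes' theorem\<close>

lemma holo_map_on_subset: "holo_map_on F S \<Longrightarrow> T \<subseteq> S \<Longrightarrow> holo_map_on F T"
  unfolding holo_map_on_def by (intro allI) (rule holo_fun_on_subset, erule spec)

text \<open>Re f is half of f + cnj f. The operator \<open>wirt_del\<close> annihilates the second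
  summand and sends the first to a holomorphic function, which \<open>wirt_dbar\<close>
  annihilates.\<close>

lemma levi_form_Re_holo:
  assumes "open S" "holo_fun_on f S" "x \<in> S"
  shows "wirt_dbar v' (wirt_del v (\<lambda>y. complex_of_real (Re (f y)))) x = 0"
proof -
  have d: "f differentiable (at y)" if "y \<in> S" for y
    by (rule differentiableI[OF holo_fun_onD(1)[OF assms(2) that]])
  have dc: "(\<lambda>y. cnj (f y)) differentiable (at y)" if "y \<in> S" for y
    by (rule differentiableI[OF has_derivative_cnj[OF holo_fun_onD(1)[OF assms(2) that]]])
  have e: "(\<lambda>y. complex_of_real (Re (f y))) = (\<lambda>y. 1/2 * (f y + cnj (f y)))"
    by (simp add: fun_eq_iff complex_add_cnj)
  have "wirt_del v (\<lambda>y. complex_of_real (Re (f y))) y = 1/2 * frechet_derivative f (at y) v" if y: "y \<in> S" for y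
  proof -
    have "wirt_del v (\<lambda>y. 1/2 * (f y + cnj (f y))) y = 1/2 * (wirt_del v f y + wirt_del v (\<lambda>y. cnj (f y)) y)"
      by (subst wirt_cmult(1)[OF differentiable_add[OF d[OF y] dc[OF y]]], subst wirt_add(1)[OF d[OF y] dc[OF y]]) (rule refl)
    then show ?thesis
      unfolding e wirt_del_cnj_holo[OF assms(2) y] wirt_holo(1)[OF assms(2) y] by simp
  qed
  then have "wirt_dbar v' (wirt_del v (\<lambda>y. complex_of_real (Re (f y)))) x =
      wirt_dbar v' (\<lambda>y. 1/2 * frechet_derivative f (at y) v) x"
    by (intro wirt_cong(2)[OF assms(1,3)])
  also have "\<dots> = 0"
    by (rule wirt_holo(2)[OF holo_fun_on_mult[OF holo_fun_on_const holo_fun_on_frechet_derivative[OF assms(1,2)]] assms(3)])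
  finally show ?thesis .
qed

context compact_cplx_mfd
begin

lemma loc_int_continuous:
  assumes "continuous_on V u"
  shows "loc_int V u"
  unfolding loc_int_def
proof (intro ballI allI impI)
  fix c K assume c: "c \<in> A" and K: "compact K \<and> K \<subseteq> snd c ` (fst c \<inter> V)"
  have "continuous_on K (chart_inv c)"
    by (rule continuous_on_subset[OF chart(4)[OF c]]) (use K in auto)
  moreover have "chart_inv c ` K \<subseteq> V"
    using K chart_image[OF c, of V] by auto
  ultimately have "continuous_on K (\<lambda>y. u (chart_inv c y))"
    by (intro continuous_on_compose2[OF assms])
  then show "set_integrable lborel K (\<lambda>y. u (chart_inv c y))"
    unfolding set_integrable_def by (intro borel_integrable_compact) (use K in auto)
qed

lemma loc_int_add: "loc_int V u \<Longrightarrow> loc_int V u' \<Longrightarrow> loc_int V (\<lambda>p. u p + u' p)"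
  unfolding loc_int_def by (simp add: set_integral_add(1))

text \<open>Pluriharmonicity is encoded as being locally the real part of a holomorphic function in
  some chart, the form in which ln |g|^2 presents itself for holomorphic g without zeros.\<close>

definition pluriharmonic_on :: "'a set \<Rightarrow> ('a \<Rightarrow> real) \<Rightarrow> bool" where
  "pluriharmonic_on V u \<longleftrightarrow> (\<forall>p\<in>V. \<exists>c\<in>A. \<exists>N f. open N \<and> p \<in> N \<and> N \<subseteq> fst c \<inter> V \<and>
     holo_fun_on f (snd c ` N) \<and> (\<forall>q\<in>N. u q = Re (f (snd c q))))"

lemma pluriharmonic_onE:
  assumes "pluriharmonic_on V u" "p \<in> V"
  obtains c N f where "c \<in> A" "open N" "p \<in> N" "N \<subseteq> fst c \<inter> V" "holo_fun_on f (snd c ` N)"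
    "\<forall>q\<in>N. u q = Re (f (snd c q))"
  using bspec[OF assms(1)[unfolded pluriharmonic_on_def] assms(2)]
  by (elim bexE exE conjE) (rule that, assumption+)

lemma continuous_on_Re_holo_chart:
  assumes "c \<in> A" "N \<subseteq> fst c" "holo_fun_on f (snd c ` N)" "\<And>q. q \<in> N \<Longrightarrow> u q = Re (f (snd c q))"
  shows "continuous_on N u"
proof -
  have "continuous_on N (\<lambda>q. f (snd c q))"
    by (rule continuous_on_compose2[OF holo_fun_on_imp_continuous_on[OF assms(3)]
          continuous_on_subset[OF chart(3)[OF assms(1)] assms(2)]]) simp
  then have "continuous_on N (\<lambda>q. Re (f (snd c q)))" by (rule continuous_on_Re)
  then show ?thesis by (rule continuous_on_eq) (simp add: assms(4))
qed

lemma pluriharmonic_on_continuous: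
  assumes "pluriharmonic_on V u"
  shows "continuous_on V u"
proof (rule continuous_at_imp_continuous_on, rule ballI)
  fix p assume "p \<in> V"
  then obtain c N f where h: "c \<in> A" "open N" "p \<in> N" "N \<subseteq> fst c \<inter> V" "holo_fun_on f (snd c ` N)"
    "\<forall>q\<in>N. u q = Re (f (snd c q))"
    by (rule pluriharmonic_onE[OF assms])
  have "continuous_on N u"
    by (rule continuous_on_Re_holo_chart[OF h(1) _ h(5)]) (use h in \<open>simp_all only: le_inf_iff\<close>)
  then show "isCont u p" using h(2,3) continuous_on_eq_continuous_at by blast
qed

lemma pluriharmonic_on_const: "pluriharmonic_on V (\<lambda>p. a)" if "open V"
  unfolding pluriharmonic_on_def
proof
  fix p assume "p \<in> V"
  moreover obtain c where "c \<in> A" "p \<in> fst c" using chart_cover by blast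
  ultimately show "\<exists>c\<in>A. \<exists>N f. open N \<and> p \<in> N \<and> N \<subseteq> fst c \<inter> V \<and>
      holo_fun_on f (snd c ` N) \<and> (\<forall>q\<in>N. a = Re (f (snd c q)))"
    using open_Int[OF chart(1) that]
    by (intro bexI[of _ c] exI[of _ "fst c \<inter> V"] exI[of _ "\<lambda>y. of_real a"]) (simp_all add: holo_fun_on_const)
qed

text \<open>The form vanishes outside N, so each piece may be cut down to N and transported into the
  chart \<open>c0\<close> by \<open>ddbar_transition\<close>; there the images reassemble to the
  image of N. Integration by parts in this one chart leaves the Levi form of a pluriharmonic
  function, which is 0.\<close>

lemma stokes_local:
  assumes c0: "c0 \<in> A" and N: "open N" "N \<subseteq> fst c0"
    and f: "holo_fun_on f (snd c0 ` N)" "\<And>q. q \<in> N \<Longrightarrow> u q = Re (f (snd c0 q))"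
    and Z: "closed Z" "Z \<subseteq> N"
    and \<phi>: "smooth_form A d \<phi>" "Suc (Suc d) = 2 * CARD('m)" "vanishes_off A d Z \<phi>"
  shows "pair (\<lambda>p. of_real (u p)) \<phi> = 0"
proof -
  let ?e = "std_frame :: (complex^'m) list" and ?S = "snd c0 ` N" and ?K = "snd c0 ` Z"
  let ?U = "\<lambda>p. complex_of_real (u p)"
  define w where "w y = complex_of_real (Re (f y))" for y
  define g where "g y = w y * ddbar (\<phi> c0) y ?e" for y
  have len: "length ?e = Suc (Suc d)" using std_frame(1) \<phi>(2) by simp
  have S: "open ?S" using open_chart_image[OF c0 N(1)] N(2) by (simp add: Int_absorb1)
  have Sc: "?S \<subseteq> snd c0 ` fst c0" using N(2) by auto
  have cZ: "compact Z" using compact_Int_closed[OF compact_mfd Z(1)] by simp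
  have K: "compact ?K" by (rule compact_chart_image[OF c0 cZ]) (use Z N in auto)
  have KS: "?K \<subseteq> ?S" using Z(2) by auto
  have "Ck_on 2 (\<lambda>y. Re (f y)) ?S"
    by (rule Ck_on_bounded_linear[OF S bounded_linear_Re holo_fun_on_imp_Ck_on[OF S f(1)]])
  then have w: "Ck_on 2 w ?S"
    unfolding w_def[abs_def] by (rule Ck_on_bounded_linear[OF S bounded_linear_of_real])
  have wu: "w (snd c0 q) = ?U q" if "q \<in> N" for q using f(2)[OF that] by (simp add: w_def)
  have off: "\<forall>us. length us = d \<longrightarrow> (\<forall>x\<in>?S - ?K. \<phi> c0 x us = 0)"
  proof (intro allI impI ballI)
    fix us :: "(complex^'m) list" and x assume us: "length us = d" and x: "x \<in> ?S - ?K"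
    then obtain q where q: "q \<in> N" "x = snd c0 q" by blast
    then have "chart_inv c0 x \<notin> Z" using x chart(6)[OF c0] N(2) by auto
    then show "\<phi> c0 x us = 0" by (intro vanishes_offD[OF \<phi>(3) c0 _ _ us]) (use x Sc in auto)
  qed
  have Ck: "Ck_on 2 (\<lambda>y. \<phi> c0 y us) ?S" if "length us = d" for us
    by (rule Ck_on_subset[OF smooth_formD(1)[OF \<phi>(1) c0 that] Sc])
  note P = ddbar_by_parts[OF S K KS w Ck len disjI2[OF off]]
  have gi: "set_integrable lborel ?S g" unfolding g_def[abs_def] by (rule P(1))
  have "set_lebesgue_integral lborel ?S g = set_lebesgue_integral lborel ?S (\<lambda>y. levi_wedge w y (\<phi> c0 y) ?e)"
    unfolding g_def[abs_def] by (rule P(3))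
  also have "\<dots> = set_lebesgue_integral lborel ?S (\<lambda>y. 0)"
  proof (rule set_lebesgue_integral_cong, use S in simp, intro allI impI)
    fix y assume y: "y \<in> ?S"
    have "wirt_dbar v' (wirt_del v w) y = 0" for v v'
      unfolding w_def[abs_def] by (rule levi_form_Re_holo[OF S f(1) y])
    then show "levi_wedge w y (\<phi> c0 y) ?e = 0" unfolding levi_wedge_def by simp
  qed
  finally have total: "set_lebesgue_integral lborel ?S g = 0" by simp
  have Uc: "loc_int N ?U"
    by (rule loc_int_continuous, rule continuous_on_of_real, rule continuous_on_Re_holo_chart[OF c0 N(2) f(1)], rule f(2))
  have piece: "set_lebesgue_integral lborel (snd c ` B) (\<lambda>y. ?U (chart_inv c y) * ddbar (\<phi> c) y ?e) =
      set_lebesgue_integral lborel (snd c0 ` (B \<inter> N)) g"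
    and pb: "snd c0 ` (B \<inter> N) \<in> sets borel" if cB: "(c, B) \<in> pieces" for c B
  proof -
    note c = pieces[OF cB]
    let ?X = "snd c ` (B \<inter> N)" and ?F = "snd c0 \<circ> chart_inv c"
    let ?G = "\<lambda>y. ?U (chart_inv c y) * ddbar (\<phi> c) y ?e"
    let ?J = "\<lambda>y. complex_of_real (real_det (frechet_derivative ?F (at y)))"
    have Nb: "N \<in> sets borel" using N(1) by simp
    have X: "?X \<in> sets borel"
      using borel_chart_image[OF c(1) sets.Int[OF c(2) Nb]] c(3) by (simp add: Int_absorb1 le_infI1)
    show FX: "snd c0 ` (B \<inter> N) \<in> sets borel"
      using borel_chart_image[OF c0 sets.Int[OF c(2) Nb]] N(2) by (simp add: Int_absorb1 le_infI2)
    have FXe: "?F ` ?X = snd c0 ` (B \<inter> N)"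
      unfolding image_image by (rule image_cong[OF refl]) (use c(3) chart(6)[OF c(1)] in auto)
    have Xc: "?X \<subseteq> snd c ` (fst c \<inter> fst c0)" using c(3) N(2) by auto
    have F: "holo_map_on ?F ?X"
      by (rule holo_map_on_subset[OF transition_holo[OF c(1) c0] Xc])
    have inj: "inj_on ?F ?X" by (rule inj_on_subset[OF transition_inj[OF c(1) c0] Xc])
    have GJ: "?G y = ?J y * g (?F y)" if "y \<in> ?X" for y
    proof -
      obtain q where q: "q \<in> B" "q \<in> N" "y = snd c q" using \<open>y \<in> ?X\<close> by blast
      have qi: "chart_inv c y = q" using q c(3) chart(6)[OF c(1)] by auto
      have "y \<in> snd c ` (fst c \<inter> fst c0)" using \<open>y \<in> ?X\<close> Xc by blast
      from ddbar_transition[OF \<phi>(1,2) c(1) c0 this]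
      show ?thesis unfolding g_def by (simp add: qi wu[OF q(2)] mult_ac)
    qed
    have iB: "set_integrable lborel (snd c ` B) ?G"
      by (rule piece_integrable[OF \<phi>(1,2) Z(1) \<phi>(3) Z(2) Uc cB])
    have iX: "set_integrable lborel ?X ?G"
      by (rule set_integrable_subset[OF iB]) (use X in auto)
    have i1: "set_integrable lborel ?X (\<lambda>y. ?J y * g (?F y))"
    proof -
      have "set_integrable lborel ?X ?G \<longleftrightarrow> set_integrable lborel ?X (\<lambda>y. ?J y * g (?F y))"
        by (rule set_integrable_cong) (simp_all only: GJ)
      then show ?thesis using iX by (simp only:)
    qed
    have i2: "set_integrable lborel (?F ` ?X) g"
      unfolding FXe by (rule set_integrable_subset[OF gi]) (use FX in auto)
    \<comment> \<open>Points of the piece outside N lie off Z, where \<open>ddbar\<close> of the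
      form vanishes.\<close>
    have ind: "indicator (snd c ` B) y *\<^sub>R ?G y = indicator ?X y *\<^sub>R ?G y" for y
    proof (cases "y \<in> snd c ` B \<and> y \<notin> ?X")
      case True
      then obtain p where p: "p \<in> B" "y = snd c p" by blast
      then have pc: "p \<in> fst c" using c(3) by auto
      have "p \<notin> Z" using True p Z(2) by blast
      then have "ddbar (\<phi> c) y ?e = 0"
        by (intro ddbar_vanishes_off[OF \<phi>(3) Z(1) c(1) _ _ len]) (use p pc chart(6)[OF c(1)] in auto)
      then show ?thesis by simp
    next
      case False
      then have "y \<in> snd c ` B \<longleftrightarrow> y \<in> ?X" by blast
      then show ?thesis by (simp add: indicator_def)
    qed
    have "set_lebesgue_integral lborel (snd c ` B) ?G = set_lebesgue_integral lborel ?X ?G"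
      by (simp only: set_lebesgue_integral_def ind)
    also have "\<dots> = set_lebesgue_integral lborel ?X (\<lambda>y. ?J y * g (?F y))"
      by (rule set_lebesgue_integral_cong, use X in simp, intro allI impI, rule GJ)
    also have "\<dots> = set_lebesgue_integral lborel (?F ` ?X) g"
      by (rule holo_change_of_variables[symmetric, OF F inj X i2 i1])
    finally show "set_lebesgue_integral lborel (snd c ` B) ?G = set_lebesgue_integral lborel (snd c0 ` (B \<inter> N)) g"
      unfolding FXe .
  qed
  have P: "finite pieces" "disjoint_family_on snd pieces" "\<Union>(snd ` pieces) = UNIV"
    using chart_partition_pieces unfolding chart_partition_def by auto
  have "pair ?U \<phi> = (\<Sum>x\<in>pieces. set_lebesgue_integral lborel (snd c0 ` (snd x \<inter> N)) g)"
    unfolding pair_eq_sum split_def by (rule sum.cong[OF refl], rule piece) simp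
  also have "\<dots> = set_lebesgue_integral lborel (\<Union>x\<in>pieces. snd c0 ` (snd x \<inter> N)) g"
  proof (rule set_integral_finite_Union[symmetric, OF P(1)])
    have ij: "inj_on (snd c0) N" by (rule inj_on_subset[OF chart(5)[OF c0] N(2)])
    show "disjoint_family_on (\<lambda>x. snd c0 ` (snd x \<inter> N)) pieces"
      unfolding disjoint_family_on_def
    proof (intro ballI impI)
      fix x y assume xy: "x \<in> pieces" "y \<in> pieces" "x \<noteq> y"
      have "snd c0 ` (snd x \<inter> N) \<inter> snd c0 ` (snd y \<inter> N) = snd c0 ` ((snd x \<inter> N) \<inter> (snd y \<inter> N))"
        by (rule inj_on_image_Int[symmetric, OF ij]) auto
      also have "(snd x \<inter> N) \<inter> (snd y \<inter> N) = {}"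
        using P(2) xy unfolding disjoint_family_on_def by blast
      finally show "snd c0 ` (snd x \<inter> N) \<inter> snd c0 ` (snd y \<inter> N) = {}" by simp
    qed
    show b: "snd c0 ` (snd x \<inter> N) \<in> sets lborel" if "x \<in> pieces" for x
      using pb[of "fst x" "snd x"] that by simp
    show "set_integrable lborel (snd c0 ` (snd x \<inter> N)) g" if "x \<in> pieces" for x
      by (rule set_integrable_subset[OF gi b[OF that]]) auto
  qed
  also have "(\<Union>x\<in>pieces. snd c0 ` (snd x \<inter> N)) = ?S"
    using P(3) unfolding image_UN[symmetric] by auto
  finally show ?thesis using total by simp
qed

text \<open>A partition of unity cuts the form so finely that each part either lives where u is the
  real part of one holomorphic function or is zero.\<close>

lemma stokes:
  assumes V: "open V" "pluriharmonic_on V u" and Z: "closed Z" "Z \<subseteq> V"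
    and \<phi>: "smooth_form A d \<phi>" "Suc (Suc d) = 2 * CARD('m)" "vanishes_off A d Z \<phi>"
  shows "pair (\<lambda>p. of_real (u p)) \<phi> = 0"
proof -
  let ?U = "\<lambda>p. complex_of_real (u p)"
  let ?Q = "\<lambda>W. \<exists>c\<in>A. \<exists>f. W \<inter> Z \<subseteq> W \<and> (W \<inter> Z = {} \<or> W \<subseteq> fst c \<inter> V \<and> holo_fun_on f (snd c ` W) \<and> (\<forall>q\<in>W. u q = Re (f (snd c q))))"
  have "\<exists>W. open W \<and> p \<in> W \<and> ?Q W" for p
  proof (cases "p \<in> Z")
    case True
    then have "p \<in> V" using Z(2) by auto
    then obtain c N f where h: "c \<in> A" "open N" "p \<in> N" "N \<subseteq> fst c \<inter> V" "holo_fun_on f (snd c ` N)"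
      "\<forall>q\<in>N. u q = Re (f (snd c q))"
      by (rule pluriharmonic_onE[OF V(2)])
    then have "?Q N" by (intro bexI[of _ c] exI[of _ f]) simp_all
    then show ?thesis using h(2,3) by blast
  next
    case False
    obtain c where "c \<in> A" using chart_cover by blast
    \<comment> \<open>Points off Z only need a neighbourhood missing Z, since the form cut off there
      is identically zero.\<close>
    then have "?Q (- Z)" by (intro bexI[of _ c]) simp_all
    then show ?thesis using False Z(1) by (intro exI[of _ "- Z"]) (simp add: open_Compl)
  qed
  then obtain W where W: "\<And>p. open (W p)" "\<And>p. p \<in> W p" "\<And>p. ?Q (W p)" by metis
  obtain n :: nat and \<rho> and g :: "nat \<Rightarrow> 'a" where \<rho>: "\<And>l. l < n \<Longrightarrow> smooth_on_mfd A UNIV (\<rho> l)"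
    "\<And>l. l < n \<Longrightarrow> closure {p. \<rho> l p \<noteq> 0} \<subseteq> W (g l)" "\<And>p. (\<Sum>l<n. \<rho> l p) = 1"
    by (rule partition_of_unity[OF W(1,2)]) (rule that, assumption+)
  define Y where "Y l = closure {p. \<rho> l p \<noteq> 0} \<inter> Z" for l
  have Y: "closed (Y l)" "Y l \<subseteq> V" "vanishes_off A d (Y l) (mult_form (\<rho> l) \<phi>)" for l
    unfolding Y_def using Z vanishes_off_mult[OF \<phi>(3)] by auto
  have sm: "smooth_form A d (mult_form (\<rho> l) \<phi>)" if "l < n" for l
    by (rule smooth_form_mult[OF \<rho>(1)[OF that] \<phi>(1)])
  have Ui: "loc_int V ?U"
    by (rule loc_int_continuous, rule continuous_on_of_real, rule pluriharmonic_on_continuous[OF V(2)])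
  have "pair ?U \<phi> = (\<Sum>l<n. 1 * pair ?U (mult_form (\<rho> l) \<phi>))"
  proof (rule pair_sum[OF _ \<phi>(2) Y(1,3,2) Ui])
    show "smooth_form A d (mult_form (\<rho> l) \<phi>)" if "l \<in> {..<n}" for l using sm that by simp
    fix c y and us :: "(complex^'m) list"
    have "(\<Sum>l<n. 1 * mult_form (\<rho> l) \<phi> c y us) = of_real (\<Sum>l<n. \<rho> l (chart_inv c y)) * \<phi> c y us"
      unfolding mult_form_def of_real_sum sum_distrib_right by simp
    then show "\<phi> c y us = (\<Sum>l<n. 1 * mult_form (\<rho> l) \<phi> c y us)" unfolding \<rho>(3) by simp
  qed
  also have "\<dots> = (\<Sum>l<n. 0)"
  proof (rule sum.cong[OF refl])
    fix l assume "l \<in> {..<n}"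
    then have l: "l < n" by simp
    obtain c f where cf: "c \<in> A" "W (g l) \<inter> Z = {} \<or> W (g l) \<subseteq> fst c \<inter> V \<and> holo_fun_on f (snd c ` W (g l)) \<and> (\<forall>q\<in>W (g l). u q = Re (f (snd c q)))"
      using W(3)[of "g l"] by blast
    have YW: "Y l \<subseteq> W (g l) \<inter> Z" unfolding Y_def using \<rho>(2)[OF l] by auto
    from cf(2) have "pair ?U (mult_form (\<rho> l) \<phi>) = 0"
    proof
      assume "W (g l) \<inter> Z = {}"
      then have "Y l \<subseteq> {}" using YW by blast
      then show ?thesis
        by (intro stokes_local[OF cf(1) open_empty _ _ _ Y(1) _ sm[OF l] \<phi>(2) Y(3), of "\<lambda>y. 0" u]) (auto intro: holo_fun_on_const)
    next
      assume h: "W (g l) \<subseteq> fst c \<inter> V \<and> holo_fun_on f (snd c ` W (g l)) \<and> (\<forall>q\<in>W (g l). u q = Re (f (snd c q)))"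
      show ?thesis
        by (rule stokes_local[OF cf(1) W(1) _ _ _ Y(1) _ sm[OF l] \<phi>(2) Y(3), of "g l" f u]) (use h YW in auto)
    qed
    then show "1 * pair ?U (mult_form (\<rho> l) \<phi>) = 0" by simp
  qed
  finally show ?thesis by simp
qed

end

section \<open>Currents with local potentials\<close>

context compact_cplx_mfd
begin

text \<open>Null sets of the manifold are those that are null in every chart, so no measure on the
  manifold itself has to be singled out.\<close>

definition ae_on :: "'a set \<Rightarrow> ('a \<Rightarrow> bool) \<Rightarrow> bool" where
  "ae_on V P \<longleftrightarrow> (\<forall>c\<in>A. AE y in lborel. y \<in> snd c ` (fst c \<inter> V) \<longrightarrow> P (chart_inv c y))"

lemma ae_on_mono:
  assumes "ae_on V P" "\<And>p. p \<in> V \<Longrightarrow> P p \<Longrightarrow> Q p"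
  shows "ae_on V Q"
  unfolding ae_on_def
proof
  fix c assume c: "c \<in> A"
  then have "AE y in lborel. y \<in> snd c ` (fst c \<inter> V) \<longrightarrow> P (chart_inv c y)"
    using assms(1) unfolding ae_on_def by (rule bspec[rotated])
  then show "AE y in lborel. y \<in> snd c ` (fst c \<inter> V) \<longrightarrow> Q (chart_inv c y)"
  proof eventually_elim
    case (elim y)
    show ?case
    proof
      assume y: "y \<in> snd c ` (fst c \<inter> V)"
      then have "chart_inv c y \<in> V" using chart_image[OF c, of V] by auto
      then show "Q (chart_inv c y)" using elim y assms(2) by auto
    qed
  qed
qed

text \<open>Points off Z are harmless because there the second argument of Q is 0. By the choice of
  Q the lemma serves for equality, convergence and domination of integrands.\<close>

lemma AE_piece:
  assumes "vanishes_off A d Z \<phi>" "closed Z" "Z \<subseteq> V" "Suc (Suc d) = 2 * CARD('m)" "(c, B) \<in> pieces" "ae_on V P"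
    "\<And>p g. p \<in> Z \<Longrightarrow> P p \<Longrightarrow> Q p g" "\<And>p. Q p 0"
  shows "AE y in lborel. y \<in> snd c ` B \<longrightarrow> Q (chart_inv c y) (ddbar (\<phi> c) y std_frame)"
proof -
  note cB = pieces[OF assms(5)]
  have len: "length (std_frame :: (complex^'m) list) = Suc (Suc d)" using std_frame(1) assms(4) by simp
  have "AE y in lborel. y \<in> snd c ` (fst c \<inter> V) \<longrightarrow> P (chart_inv c y)"
    using assms(6) cB(1) unfolding ae_on_def by (rule bspec)
  then show ?thesis
  proof eventually_elim
    case (elim y)
    show ?case
    proof
      assume "y \<in> snd c ` B"
      then obtain p where p: "p \<in> B" "y = snd c p" by blast
      then have pc: "p \<in> fst c" "chart_inv c y = p" using cB(3) chart(6)[OF cB(1)] by auto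
      show "Q (chart_inv c y) (ddbar (\<phi> c) y std_frame)"
      proof (cases "p \<in> Z")
        case True
        then have "y \<in> snd c ` (fst c \<inter> V)" using p pc assms(3) by blast
        then have "P p" using elim pc(2) by simp
        then show ?thesis unfolding pc(2) by (rule assms(7)[OF True])
      next
        case False
        have "ddbar (\<phi> c) y std_frame = 0"
          by (rule ddbar_vanishes_off[OF assms(1,2) cB(1) _ _ len]) (use p pc False in simp_all)
        then show ?thesis using assms(8) by simp
      qed
    qed
  qed
qed

lemma pair_cong_AE:
  assumes \<phi>: "smooth_form A d \<phi>" "Suc (Suc d) = 2 * CARD('m)" "closed Z" "vanishes_off A d Z \<phi>" "Z \<subseteq> V"
    and u: "loc_int V u" "loc_int V u'" "ae_on V (\<lambda>p. u p = u' p)"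
  shows "pair u \<phi> = pair u' \<phi>"
proof -
  have "set_lebesgue_integral lborel (snd c ` B) (\<lambda>y. u (chart_inv c y) * ddbar (\<phi> c) y std_frame) =
      set_lebesgue_integral lborel (snd c ` B) (\<lambda>y. u' (chart_inv c y) * ddbar (\<phi> c) y std_frame)"
    if cB: "(c, B) \<in> pieces" for c B
    unfolding set_lebesgue_integral_def
  proof (rule integral_cong_AE)
    note pi = piece_integrable[OF \<phi> _ cB, unfolded set_integrable_def]
    show "(\<lambda>y. indicator (snd c ` B) y *\<^sub>R (u (chart_inv c y) * ddbar (\<phi> c) y std_frame)) \<in> borel_measurable lborel"
      by (rule borel_measurable_integrable[OF pi[OF u(1)]])
    show "(\<lambda>y. indicator (snd c ` B) y *\<^sub>R (u' (chart_inv c y) * ddbar (\<phi> c) y std_frame)) \<in> borel_measurable lborel"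
      by (rule borel_measurable_integrable[OF pi[OF u(2)]])
    have "AE y in lborel. y \<in> snd c ` B \<longrightarrow> u (chart_inv c y) * ddbar (\<phi> c) y std_frame = u' (chart_inv c y) * ddbar (\<phi> c) y std_frame"
      by (rule AE_piece[OF \<phi>(4,3,5,2) cB u(3), where Q = "\<lambda>p g. u p * g = u' p * g"]) simp_all
    then show "AE y in lborel. indicator (snd c ` B) y *\<^sub>R (u (chart_inv c y) * ddbar (\<phi> c) y std_frame) =
       indicator (snd c ` B) y *\<^sub>R (u' (chart_inv c y) * ddbar (\<phi> c) y std_frame)"
      by eventually_elim (simp split: split_indicator)
  qed
  then show ?thesis
    unfolding pair_eq_sum split_def by (intro sum.cong[OF refl]) simp
qed

lemma pair_add:
  assumes \<phi>: "smooth_form A d \<phi>" "Suc (Suc d) = 2 * CARD('m)" "closed Z" "vanishes_off A d Z \<phi>" "Z \<subseteq> V"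
    and u: "loc_int V u" "loc_int V u'"
  shows "pair (\<lambda>p. u p + u' p) \<phi> = pair u \<phi> + pair u' \<phi>"
proof -
  have "set_lebesgue_integral lborel (snd c ` B) (\<lambda>y. (u (chart_inv c y) + u' (chart_inv c y)) * ddbar (\<phi> c) y std_frame) =
      set_lebesgue_integral lborel (snd c ` B) (\<lambda>y. u (chart_inv c y) * ddbar (\<phi> c) y std_frame) +
      set_lebesgue_integral lborel (snd c ` B) (\<lambda>y. u' (chart_inv c y) * ddbar (\<phi> c) y std_frame)"
    if cB: "(c, B) \<in> pieces" for c B
    unfolding distrib_right
    by (rule set_integral_add(2)[OF piece_integrable[OF \<phi> u(1) cB] piece_integrable[OF \<phi> u(2) cB]])
  then show ?thesis
    unfolding pair_eq_sum split_def sum.distrib[symmetric] by (intro sum.cong[OF refl]) simp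
qed

text \<open>Stokes' theorem enters the rest of the argument only here, for additive constants and
  for the differences of potentials in two frames.\<close>

lemma pair_eq_mod_pluriharmonic:
  assumes \<phi>: "smooth_form A d \<phi>" "Suc (Suc d) = 2 * CARD('m)" "closed Z" "vanishes_off A d Z \<phi>" "Z \<subseteq> V"
    and V: "open V" and h: "pluriharmonic_on V h"
    and u: "loc_int V (\<lambda>p. of_real (u p))" "loc_int V (\<lambda>p. of_real (u' p))" "ae_on V (\<lambda>p. u p = u' p + h p)"
  shows "pair (\<lambda>p. of_real (u p)) \<phi> = pair (\<lambda>p. of_real (u' p)) \<phi>"
proof -
  have hi: "loc_int V (\<lambda>p. of_real (h p))"
    by (rule loc_int_continuous, rule continuous_on_of_real, rule pluriharmonic_on_continuous[OF h])
  have "pair (\<lambda>p. of_real (u p)) \<phi> = pair (\<lambda>p. of_real (u' p) + of_real (h p)) \<phi>"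
    by (rule pair_cong_AE[OF \<phi> u(1) loc_int_add[OF u(2) hi]]) (rule ae_on_mono[OF u(3)], simp)
  also have "\<dots> = pair (\<lambda>p. of_real (u' p)) \<phi> + pair (\<lambda>p. of_real (h p)) \<phi>"
    by (rule pair_add[OF \<phi> u(2) hi])
  also have "pair (\<lambda>p. of_real (h p)) \<phi> = 0"
    by (rule stokes[OF V h \<phi>(3,5,1,2,4)])
  finally show ?thesis by simp
qed

text \<open>The constants \<open>a t\<close> may diverge but do not change the pairing, so they are
  subtracted before dominated convergence is applied. The majorant is (|v| + C) |ddbar \<phi>|,
  integrable on each piece.\<close>

lemma pair_tendsto:
  fixes u :: "real \<Rightarrow> 'a \<Rightarrow> real"
  assumes \<phi>: "smooth_form A d \<phi>" "Suc (Suc d) = 2 * CARD('m)" "closed Z" "vanishes_off A d Z \<phi>" "Z \<subseteq> V"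
    and V: "open V"
    and u: "\<And>t. loc_int V (\<lambda>p. of_real (u t p))" "loc_int V (\<lambda>p. of_real (v p))"
    and P: "ae_on V P"
    and lim: "\<And>p. p \<in> Z \<Longrightarrow> P p \<Longrightarrow> ((\<lambda>t. u t p - a t) \<longlongrightarrow> v p) at_top"
    and bound: "\<And>p t. p \<in> Z \<Longrightarrow> P p \<Longrightarrow> t \<ge> 0 \<Longrightarrow> \<bar>u t p - a t\<bar> \<le> \<bar>v p\<bar> + C"
  shows "((\<lambda>t. pair (\<lambda>p. of_real (u t p)) \<phi>) \<longlongrightarrow> pair (\<lambda>p. of_real (v p)) \<phi>) at_top"
proof -
  let ?e = "std_frame :: (complex^'m) list"
  have const: "loc_int V (\<lambda>p. b)" for b by (rule loc_int_continuous) (rule continuous_on_const)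
  have ua: "loc_int V (\<lambda>p. complex_of_real (u t p - a t))" for t
    using loc_int_add[OF u(1) const[of "- complex_of_real (a t)"], of t] by simp
  have e: "pair (\<lambda>p. of_real (u t p)) \<phi> = pair (\<lambda>p. of_real (u t p - a t)) \<phi>" for t
    by (rule pair_eq_mod_pluriharmonic[OF \<phi> V pluriharmonic_on_const[OF V, of "a t"] u(1) ua])
      (rule ae_on_mono[OF P], simp)
  have key: "((\<lambda>t. set_lebesgue_integral lborel (snd c ` B) (\<lambda>y. of_real (u t (chart_inv c y) - a t) * ddbar (\<phi> c) y ?e)) \<longlongrightarrow>
      set_lebesgue_integral lborel (snd c ` B) (\<lambda>y. of_real (v (chart_inv c y)) * ddbar (\<phi> c) y ?e)) at_top"
    if cB: "(c, B) \<in> pieces" for c B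
    unfolding set_lebesgue_integral_def
  proof (rule integral_dominated_convergence_at_top)
    let ?I = "\<lambda>y. indicator (snd c ` B) y :: real" and ?g = "\<lambda>y. ddbar (\<phi> c) y ?e"
    let ?w = "\<lambda>y. norm (?I y *\<^sub>R (of_real (v (chart_inv c y)) * ?g y)) + C * norm (?I y *\<^sub>R (1 * ?g y))"
    note pi = piece_integrable[OF \<phi> _ cB, unfolded set_integrable_def]
    show "(\<lambda>y. ?I y *\<^sub>R (of_real (v (chart_inv c y)) * ?g y)) \<in> borel_measurable lborel"
      by (rule borel_measurable_integrable[OF pi[OF u(2)]])
    show "(\<lambda>y. ?I y *\<^sub>R (of_real (u t (chart_inv c y) - a t) * ?g y)) \<in> borel_measurable lborel" for t
      by (rule borel_measurable_integrable[OF pi[OF ua]])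
    show "integrable lborel ?w"
      by (intro Bochner_Integration.integrable_add integrable_norm integrable_mult_right pi u(2) const)
    have "AE y in lborel. y \<in> snd c ` B \<longrightarrow> ((\<lambda>t. of_real (u t (chart_inv c y) - a t) * ?g y) \<longlongrightarrow> of_real (v (chart_inv c y)) * ?g y) at_top"
      by (rule AE_piece[OF \<phi>(4,3,5,2) cB P, where Q = "\<lambda>p g. ((\<lambda>t. of_real (u t p - a t) * g) \<longlongrightarrow> of_real (v p) * g) at_top"])
        (intro tendsto_mult tendsto_of_real tendsto_const lim, assumption+, simp)
    then show "AE y in lborel. ((\<lambda>t. ?I y *\<^sub>R (of_real (u t (chart_inv c y) - a t) * ?g y)) \<longlongrightarrow> ?I y *\<^sub>R (of_real (v (chart_inv c y)) * ?g y)) at_top"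
      by eventually_elim (auto split: split_indicator)
    have b: "AE y in lborel. y \<in> snd c ` B \<longrightarrow> (\<forall>t\<ge>0. norm (of_real (u t (chart_inv c y) - a t) * ?g y) \<le> norm (of_real (v (chart_inv c y)) * ?g y) + C * norm (?g y))"
    proof (rule AE_piece[OF \<phi>(4,3,5,2) cB P, where Q = "\<lambda>p g. \<forall>t\<ge>0. norm (complex_of_real (u t p - a t) * g) \<le> norm (complex_of_real (v p) * g) + C * norm g"])
      fix p and g :: complex assume p: "p \<in> Z" "P p"
      show "\<forall>t\<ge>0. norm (complex_of_real (u t p - a t) * g) \<le> norm (complex_of_real (v p) * g) + C * norm g"
      proof (intro allI impI)
        fix t :: real assume "t \<ge> 0"
        from mult_right_mono[OF bound[OF p this] norm_ge_zero[of g]]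
        show "norm (complex_of_real (u t p - a t) * g) \<le> norm (complex_of_real (v p) * g) + C * norm g"
          by (simp only: norm_mult norm_of_real distrib_right)
      qed
    qed simp
    have "AE y in lborel. norm (?I y *\<^sub>R (of_real (u t (chart_inv c y) - a t) * ?g y)) \<le> ?w y" if "t \<ge> 0" for t
      using b
    proof eventually_elim
      case (elim y)
      then show ?case using that by (cases "y \<in> snd c ` B") simp_all
    qed
    then show "\<forall>\<^sub>F t in at_top. AE y in lborel. norm (?I y *\<^sub>R (of_real (u t (chart_inv c y) - a t) * ?g y)) \<le> ?w y"
      by (intro eventually_mono[OF eventually_ge_at_top[of 0]])
  qed
  have "((\<lambda>t. pair (\<lambda>p. of_real (u t p - a t)) \<phi>) \<longlongrightarrow> pair (\<lambda>p. of_real (v p)) \<phi>) at_top"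
    unfolding pair_eq_sum split_def by (rule tendsto_sum, rule key) simp
  then show ?thesis by (subst e)
qed

section \<open>Currents assembled from local potentials\<close>

lemma test_formD:
  assumes "test_form A \<phi>"
  shows "smooth_form A (2 * (CARD('m) - 1)) \<phi>"
  using assms unfolding test_form_def smooth_form_pq_def by (simp add: mult_2)

lemma dim_test: "Suc (Suc (2 * (CARD('m) - 1))) = 2 * CARD('m)"
proof -
  have "CARD('m) > 0" by simp
  then show ?thesis by linarith
qed

lemma smooth_on_mfd_sum:
  assumes "\<And>l. l \<in> I \<Longrightarrow> smooth_on_mfd A UNIV (\<rho> l)"
  shows "smooth_on_mfd A UNIV (\<lambda>p. \<Sum>l\<in>I. \<rho> l p)"
  unfolding smooth_on_mfd_def smooth_fun_on_def
proof (intro ballI allI)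
  fix c k assume c: "c \<in> A"
  have "Ck_on k (\<lambda>y. \<Sum>l\<in>I. (\<rho> l \<circ> chart_inv c) y) (snd c ` (fst c \<inter> UNIV))"
    by (rule Ck_on_sum[OF open_chart_image[OF c open_UNIV]])
      (use assms c in \<open>simp add: smooth_on_mfd_def smooth_fun_on_def o_def\<close>)
  then show "Ck_on k ((\<lambda>p. \<Sum>l\<in>I. \<rho> l p) \<circ> chart_inv c) (snd c ` (fst c \<inter> UNIV))"
    by (simp add: o_def)
qed

lemma loc_int_potential:
  assumes "loc_integrable_potential A L u"
  shows "loc_int (frame_dom L i) (\<lambda>p. of_real (u i p))"
  unfolding loc_int_def
proof (intro ballI allI impI)
  fix c K assume "c \<in> A" "compact K \<and> K \<subseteq> snd c ` (fst c \<inter> frame_dom L i)"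
  then have "set_integrable lborel K (\<lambda>y. u i (chart_inv c y))"
    using assms unfolding loc_integrable_potential_def by simp
  then have "integrable lborel (\<lambda>y. complex_of_real (indicator K y *\<^sub>R u i (chart_inv c y)))"
    unfolding set_integrable_def by (rule integrable_of_real)
  then show "set_integrable lborel K (\<lambda>y. complex_of_real (u i (chart_inv c y)))"
    unfolding set_integrable_def by (simp add: scaleR_conv_of_real)
qed

lemma loc_int_subset: "loc_int V u \<Longrightarrow> W \<subseteq> V \<Longrightarrow> loc_int W u"
  unfolding loc_int_def by (meson Int_mono image_mono order_refl order_trans)

lemma frame_partition:
  assumes "\<And>i. open (frame_dom L i)" "(\<Union>i. frame_dom L i) = (UNIV :: 'a set)"
  shows "\<exists>(n :: nat) \<rho> i. (\<forall>l<n. smooth_on_mfd A UNIV (\<rho> l)) \<and>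
    (\<forall>l<n. closure {p. \<rho> l p \<noteq> 0} \<subseteq> frame_dom L (i l)) \<and> (\<forall>p. (\<Sum>l<n. \<rho> l p) = 1)"
proof -
  have "\<exists>i. p \<in> frame_dom L i" for p
  proof -
    have "p \<in> (\<Union>i. frame_dom L i)" using assms(2) by simp
    then show ?thesis by (rule UN_E) (rule exI)
  qed
  then obtain j where j: "\<And>p. p \<in> frame_dom L (j p)" by metis
  obtain n :: nat and \<rho> and g :: "nat \<Rightarrow> 'a" where \<rho>: "\<And>l. l < n \<Longrightarrow> smooth_on_mfd A UNIV (\<rho> l)"
    "\<And>l. l < n \<Longrightarrow> closure {p. \<rho> l p \<noteq> 0} \<subseteq> frame_dom L (j (g l))" "\<And>p. (\<Sum>l<n. \<rho> l p) = 1"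
    by (rule partition_of_unity[of "\<lambda>p. frame_dom L (j p)", OF assms(1) j]) (rule that, assumption+)
  show ?thesis
    by (rule exI[of _ n], rule exI[of _ \<rho>], rule exI[of _ "\<lambda>l. j (g l)"]) (simp add: \<rho>)
qed

lemma vanishes_off_mult_closure: "vanishes_off A d (closure {p. \<rho> p \<noteq> 0}) (mult_form \<rho> \<phi>)"
  using vanishes_off_mult[of d UNIV \<phi> \<rho>] by (simp add: vanishes_off_def)

lemma current_eq_sum:
  assumes T: "is_ddbar_current A L u T" and \<phi>: "test_form A \<phi>"
    and \<rho>: "\<forall>l<n. smooth_on_mfd A UNIV (\<rho> l)" "\<forall>l<n. closure {p. \<rho> l p \<noteq> 0} \<subseteq> frame_dom L (i l)" "\<forall>p. (\<Sum>l<(n::nat). \<rho> l p) = 1"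
  shows "T \<phi> = (\<Sum>l<n. pair (\<lambda>p. of_real (u (i l) p)) (mult_form (\<rho> l) \<phi>))"
proof -
  have lin: "T (\<lambda>c y vs. a * \<phi> c y vs + b * \<psi> c y vs) = a * T \<phi> + b * T \<psi>" if "test_form A \<phi>" "test_form A \<psi>" for \<phi> \<psi> a b
    using T that unfolding is_ddbar_current_def by simp
  \<comment> \<open>Only binary linearity is at hand, so the sum is built up one term at a time; the
    coefficients 0 and 0 cover the empty sum.\<close>
  have part: "T (mult_form (\<lambda>p. \<Sum>l<m. \<rho> l p) \<phi>) = (\<Sum>l<m. T (mult_form (\<rho> l) \<phi>))" if "m \<le> n" for m
    using that
  proof (induction m)
    case 0
    show ?case using lin[OF \<phi> \<phi>, of 0 0] by (simp add: mult_form_def[abs_def])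
  next
    case (Suc m)
    have 1: "test_form A (mult_form (\<lambda>p. \<Sum>l<m. \<rho> l p) \<phi>)"
      by (rule test_form_mult[OF smooth_on_mfd_sum \<phi>]) (use \<rho>(1) Suc.prems in simp)
    have 2: "test_form A (mult_form (\<rho> m) \<phi>)"
      by (rule test_form_mult[OF _ \<phi>]) (use \<rho>(1) Suc.prems in simp)
    have "mult_form (\<lambda>p. \<Sum>l<Suc m. \<rho> l p) \<phi> =
        (\<lambda>c y vs. 1 * mult_form (\<lambda>p. \<Sum>l<m. \<rho> l p) \<phi> c y vs + 1 * mult_form (\<rho> m) \<phi> c y vs)"
      by (simp add: mult_form_def fun_eq_iff distrib_right)
    then show ?case using lin[OF 1 2, of 1 1] Suc by simp
  qed
  have "mult_form (\<lambda>p. \<Sum>l<n. \<rho> l p) \<phi> = \<phi>"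
    using \<rho>(3) by (simp add: mult_form_def fun_eq_iff)
  then have "T \<phi> = (\<Sum>l<n. T (mult_form (\<rho> l) \<phi>))" using part[of n] by simp
  also have "\<dots> = (\<Sum>l<n. pair (\<lambda>p. of_real (u (i l) p)) (mult_form (\<rho> l) \<phi>))"
  proof (rule sum.cong[OF refl])
    fix l assume "l \<in> {..<n}"
    then have l: "l < n" by simp
    have "test_form A (mult_form (\<rho> l) \<phi>)" by (rule test_form_mult[OF _ \<phi>]) (use \<rho>(1) l in simp)
    moreover have "form_support A (2 * (CARD('m) - 1)) (mult_form (\<rho> l) \<phi>) \<subseteq> frame_dom L (i l)"
      by (rule order_trans[OF form_support_subset[OF closed_closure vanishes_off_mult_closure]]) (use \<rho>(2) l in simp)
    ultimately show "T (mult_form (\<rho> l) \<phi>) = pair (\<lambda>p. of_real (u (i l) p)) (mult_form (\<rho> l) \<phi>)"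
      using T unfolding is_ddbar_current_def pair_def by simp
  qed
  finally show ?thesis .
qed

text \<open>The sum over a fixed partition of unity serves as the definition of T. On a form
  supported in a single frame j the potentials of the other frames may be replaced by that of j,
  since their differences are pluriharmonic almost everywhere.\<close>

lemma ex_ddbar_current:
  assumes cov: "\<And>i. open (frame_dom L i)" "(\<Union>i. frame_dom L i) = (UNIV :: 'a set)"
    and u: "loc_integrable_potential A L u"
    and compat: "\<And>i j. \<exists>h. pluriharmonic_on (frame_dom L i \<inter> frame_dom L j) h \<and>
       ae_on (frame_dom L i \<inter> frame_dom L j) (\<lambda>p. u i p = u j p + h p)"
  shows "\<exists>T. is_ddbar_current A L u T"
proof -
  obtain n :: nat and \<rho> i where \<rho>: "\<forall>l<n. smooth_on_mfd A UNIV (\<rho> l)"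
    "\<forall>l<n. closure {p. \<rho> l p \<noteq> 0} \<subseteq> frame_dom L (i l)" "\<forall>p. (\<Sum>l<n. \<rho> l p) = 1"
    using frame_partition[OF cov] by (elim exE conjE) (rule that, assumption+)
  let ?u = "\<lambda>i p. complex_of_real (u i p)" and ?d = "2 * (CARD('m) - 1)"
  define T where "T \<phi> = (\<Sum>l<n. pair (?u (i l)) (mult_form (\<rho> l) \<phi>))" for \<phi>
  note ui = loc_int_potential[OF u]
  have "T (\<lambda>c y vs. a * \<phi> c y vs + b * \<psi> c y vs) = a * T \<phi> + b * T \<psi>" if t: "test_form A \<phi>" "test_form A \<psi>" for \<phi> \<psi> a b
  proof -
    have "pair (?u (i l)) (mult_form (\<rho> l) (\<lambda>c y vs. a * \<phi> c y vs + b * \<psi> c y vs)) =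
        a * pair (?u (i l)) (mult_form (\<rho> l) \<phi>) + b * pair (?u (i l)) (mult_form (\<rho> l) \<psi>)" if l: "l < n" for l
    proof -
      \<comment> \<open>The binary combination is written as a sum over the two truth values to fit
        \<open>pair_sum\<close>.\<close>
      have "pair (?u (i l)) (mult_form (\<rho> l) (\<lambda>c y vs. a * \<phi> c y vs + b * \<psi> c y vs)) =
        (\<Sum>z\<in>{True, False}. (if z then a else b) * pair (?u (i l)) (mult_form (\<rho> l) (if z then \<phi> else \<psi>)))"
      proof (rule pair_sum[OF _ dim_test closed_closure vanishes_off_mult_closure _ ui])
        show "smooth_form A ?d (mult_form (\<rho> l) (if z then \<phi> else \<psi>))" for z
          by (rule smooth_form_mult) (use \<rho>(1) l test_formD t in simp_all)
        show "closure {p. \<rho> l p \<noteq> 0} \<subseteq> frame_dom L (i l)" using \<rho>(2) l by simp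
      qed (simp add: mult_form_def algebra_simps)
      then show ?thesis by simp
    qed
    then have "T (\<lambda>c y vs. a * \<phi> c y vs + b * \<psi> c y vs) = (\<Sum>l<n. a * pair (?u (i l)) (mult_form (\<rho> l) \<phi>) + b * pair (?u (i l)) (mult_form (\<rho> l) \<psi>))"
      unfolding T_def by (intro sum.cong[OF refl]) simp
    then show ?thesis unfolding T_def by (simp add: sum.distrib sum_distrib_left)
  qed
  moreover have "T \<phi> = pair (?u j) \<phi>" if \<phi>: "test_form A \<phi>" and supp: "form_support A ?d \<phi> \<subseteq> frame_dom L j" for j \<phi>
  proof -
    let ?Z = "\<lambda>l. closure {p. \<rho> l p \<noteq> 0} \<inter> form_support A ?d \<phi>"
    have sm: "smooth_form A ?d (mult_form (\<rho> l) \<phi>)" if "l < n" for l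
      by (rule smooth_form_mult[OF _ test_formD[OF \<phi>]]) (use \<rho>(1) that in simp)
    have Z: "closed (?Z l)" "vanishes_off A ?d (?Z l) (mult_form (\<rho> l) \<phi>)" for l
      using closed_form_support vanishes_off_mult[OF vanishes_off_form_support] by auto
    have "T \<phi> = (\<Sum>l<n. 1 * pair (?u j) (mult_form (\<rho> l) \<phi>))"
      unfolding T_def
    proof (rule sum.cong[OF refl])
      fix l assume "l \<in> {..<n}"
      then have l: "l < n" by simp
      let ?V = "frame_dom L (i l) \<inter> frame_dom L j"
      obtain h where h: "pluriharmonic_on ?V h" "ae_on ?V (\<lambda>p. u (i l) p = u j p + h p)"
        using compat by blast
      have "pair (?u (i l)) (mult_form (\<rho> l) \<phi>) = pair (?u j) (mult_form (\<rho> l) \<phi>)"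
        by (rule pair_eq_mod_pluriharmonic[OF sm[OF l] dim_test Z _ _ h(1) loc_int_subset[OF ui] loc_int_subset[OF ui] h(2)])
          (use \<rho>(2) l supp cov(1) in auto)
      then show "pair (?u (i l)) (mult_form (\<rho> l) \<phi>) = 1 * pair (?u j) (mult_form (\<rho> l) \<phi>)" by simp
    qed
    also have "\<dots> = pair (?u j) \<phi>"
    proof (rule pair_sum[symmetric, OF _ dim_test Z _ ui])
      show "smooth_form A ?d (mult_form (\<rho> l) \<phi>)" if "l \<in> {..<n}" for l using sm that by simp
      show "?Z l \<subseteq> frame_dom L j" for l using supp by auto
      fix c y and us :: "(complex^'m) list"
      have "(\<Sum>l<n. 1 * mult_form (\<rho> l) \<phi> c y us) = of_real (\<Sum>l<n. \<rho> l (chart_inv c y)) * \<phi> c y us"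
        unfolding mult_form_def of_real_sum sum_distrib_right by simp
      then show "\<phi> c y us = (\<Sum>l<n. 1 * mult_form (\<rho> l) \<phi> c y us)" using \<rho>(3) by simp
    qed
    finally show ?thesis .
  qed
  ultimately have "is_ddbar_current A L u T"
    using u unfolding is_ddbar_current_def pair_def by simp
  then show ?thesis by (rule exI[of _ T])
qed

text \<open>One partition of unity serves all t, so the limit is taken in finitely many pairings.
  The majorant is asked for on each closed Z inside a frame domain, which is compact, because
  uniform bounds on the whole domain cannot be expected.\<close>

lemma ddbar_tendsto_weaklyI:
  fixes u :: "real \<Rightarrow> 'i \<Rightarrow> 'a \<Rightarrow> real"
  assumes cov: "\<And>i. open (frame_dom L i)" "(\<Union>i. frame_dom L i) = (UNIV :: 'a set)"
    and u: "\<And>t. \<exists>T. is_ddbar_current A L (u t) T" and v: "\<exists>T. is_ddbar_current A L v T"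
    and P: "\<And>i. ae_on (frame_dom L i) (P i)"
    and lim: "\<And>i p. p \<in> frame_dom L i \<Longrightarrow> P i p \<Longrightarrow> ((\<lambda>t. u t i p - a t) \<longlongrightarrow> v i p) at_top"
    and bound: "\<And>i Z. closed Z \<Longrightarrow> Z \<subseteq> frame_dom L i \<Longrightarrow> \<exists>C. \<forall>p\<in>Z. P i p \<longrightarrow> (\<forall>t\<ge>0. \<bar>u t i p - a t\<bar> \<le> \<bar>v i p\<bar> + C)"
  shows "ddbar_tendsto_weakly A L u v"
  unfolding ddbar_tendsto_weakly_def
proof (intro conjI allI impI u v)
  fix T T' \<phi> assume TT: "(\<forall>t\<ge>0. is_ddbar_current A L (u t) (T t)) \<and> is_ddbar_current A L v T'" and \<phi>: "test_form A \<phi>"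
  obtain n :: nat and \<rho> i where \<rho>: "\<forall>l<n. smooth_on_mfd A UNIV (\<rho> l)"
    "\<forall>l<n. closure {p. \<rho> l p \<noteq> 0} \<subseteq> frame_dom L (i l)" "\<forall>p. (\<Sum>l<n. \<rho> l p) = 1"
    using frame_partition[OF cov] by (elim exE conjE) (rule that, assumption+)
  have ui: "loc_int (frame_dom L j) (\<lambda>p. of_real (u t j p))" for t j
    using u[of t] unfolding is_ddbar_current_def by (elim exE conjE) (rule loc_int_potential)
  have vi: "loc_int (frame_dom L j) (\<lambda>p. of_real (v j p))" for j
    using v unfolding is_ddbar_current_def by (elim exE conjE) (rule loc_int_potential)
  have "((\<lambda>t. pair (\<lambda>p. of_real (u t (i l) p)) (mult_form (\<rho> l) \<phi>)) \<longlongrightarrow> pair (\<lambda>p. of_real (v (i l) p)) (mult_form (\<rho> l) \<phi>)) at_top"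
    if l: "l \<in> {..<n}" for l
  proof -
    have sm: "smooth_form A (2 * (CARD('m) - 1)) (mult_form (\<rho> l) \<phi>)"
      by (rule smooth_form_mult[OF _ test_formD[OF \<phi>]]) (use \<rho>(1) l in simp)
    have Z: "closure {p. \<rho> l p \<noteq> 0} \<subseteq> frame_dom L (i l)" using \<rho>(2) l by simp
    obtain C where C: "\<forall>p\<in>closure {p. \<rho> l p \<noteq> 0}. P (i l) p \<longrightarrow> (\<forall>t\<ge>0. \<bar>u t (i l) p - a t\<bar> \<le> \<bar>v (i l) p\<bar> + C)"
      using bound[OF closed_closure Z] by (rule exE)
    show ?thesis
      by (rule pair_tendsto[OF sm dim_test closed_closure vanishes_off_mult_closure Z cov(1) ui vi P])
        (use lim Z C in auto)
  qed
  then have "((\<lambda>t. \<Sum>l<n. pair (\<lambda>p. of_real (u t (i l) p)) (mult_form (\<rho> l) \<phi>)) \<longlongrightarrow> T' \<phi>) at_top"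
    unfolding current_eq_sum[OF conjunct2[OF TT] \<phi> \<rho>] by (rule tendsto_sum)
  moreover have "\<forall>\<^sub>F t in at_top. (\<Sum>l<n. pair (\<lambda>p. of_real (u t (i l) p)) (mult_form (\<rho> l) \<phi>)) = T t \<phi>"
  proof (rule eventually_mono[OF eventually_ge_at_top[of 0]])
    fix t :: real assume "0 \<le> t"
    then have "is_ddbar_current A L (u t) (T t)" using TT by simp
    from current_eq_sum[OF this \<phi> \<rho>] show "(\<Sum>l<n. pair (\<lambda>p. of_real (u t (i l) p)) (mult_form (\<rho> l) \<phi>)) = T t \<phi>" ..
  qed
  ultimately show "((\<lambda>t. T t \<phi>) \<longlongrightarrow> T' \<phi>) at_top"
    by (rule Lim_transform_eventually)
qed

end

section \<open>Sections and their logarithmic potentials\<close>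

text \<open>Restriction to the complex line through y and a point of T gives a one-variable function
  vanishing on a nonempty open set; convexity of S keeps the relevant part of the line
  connected.\<close>

lemma holo_fun_on_identity:
  fixes f :: "complex^'m::finite \<Rightarrow> complex"
  assumes "holo_fun_on f S" "open S" "convex S" "open T" "T \<subseteq> S" "T \<noteq> {}" "\<And>y. y \<in> T \<Longrightarrow> f y = 0" "y \<in> S"
  shows "f y = 0"
proof -
  obtain a where a: "a \<in> T" using assms(6) by blast
  let ?l = "\<lambda>z. a + z *s (y - a)"
  have lc: "continuous_on UNIV ?l"
    by (intro continuous_intros bounded_linear.continuous_on[OF bounded_linear_vector_smult_left])
  have op: "open (?l -` X)" if "open X" for X
    using open_vimage[OF that lc] .
  have "convex (?l -` S)"
  proof (rule convexI)
    fix z1 z2 and u v :: real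
    assume h: "z1 \<in> ?l -` S" "z2 \<in> ?l -` S" "0 \<le> u" "0 \<le> v" "u + v = 1"
    have "?l (u *\<^sub>R z1 + v *\<^sub>R z2) = u *\<^sub>R ?l z1 + v *\<^sub>R ?l z2"
    proof -
      have "a = u *\<^sub>R a + v *\<^sub>R a" using h(5) by (metis scaleR_add_left scaleR_one)
      moreover have "(u *\<^sub>R z1 + v *\<^sub>R z2) *s (y - a) = u *\<^sub>R (z1 *s (y - a)) + v *\<^sub>R (z2 *s (y - a))"
        by (simp add: vec_eq_iff scaleR_conv_of_real[where 'a=complex] algebra_simps)
      ultimately show ?thesis by (simp add: scaleR_add_right)
    qed
    then show "u *\<^sub>R z1 + v *\<^sub>R z2 \<in> ?l -` S"
      using convexD[OF assms(3), of "?l z1" "?l z2" u v] h by simp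
  qed
  then have conn: "connected (?l -` S)" by (rule convex_connected)
  have "(\<lambda>z. f (?l z)) holomorphic_on (?l -` S)"
    unfolding holomorphic_on_open[OF op[OF assms(2)]]
    using holo_fun_on_line[OF assms(1)] by (meson vimageD)
  then have "f (?l 1) = 0"
  proof (rule analytic_continuation_open[of "?l -` T" "?l -` S" "\<lambda>z. f (?l z)" "\<lambda>z. 0", rotated 5])
    have "0 \<in> ?l -` T" using a by simp
    then show "?l -` T \<noteq> {}" by blast
    show "1 \<in> ?l -` S" using assms(8) by simp
  qed (use op assms conn in \<open>auto intro: holomorphic_on_const\<close>)
  then show ?thesis by simp
qed

text \<open>The common shape of \<open>bergman_ray\<close>, \<open>log_sum_potential\<close> and
  \<open>zero_potential\<close>, so that integrability and existence of the current are shown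
  once.\<close>

definition weighted_potential :: "nat \<Rightarrow> 'j set \<Rightarrow> ('j \<Rightarrow> real) \<Rightarrow> ('j \<Rightarrow> ('a, 'i) sect) \<Rightarrow> 'i \<Rightarrow> 'a \<Rightarrow> real" where
  "weighted_potential k J w \<sigma> i p = ln (\<Sum>j\<in>J. w j * (cmod (\<sigma> j i p))\<^sup>2) / real k"

lemma (in compact_cplx_mfd) continuous_on_charts:
  fixes f :: "'a \<Rightarrow> 'y::topological_space"
  assumes "open V" "\<And>c. c \<in> A \<Longrightarrow> continuous_on (snd c ` (fst c \<inter> V)) (f \<circ> chart_inv c)"
  shows "continuous_on V f"
proof (rule continuous_at_imp_continuous_on, rule ballI)
  fix p assume p: "p \<in> V"
  obtain c where c: "c \<in> A" "p \<in> fst c" using chart_cover by blast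
  have "continuous_on (fst c \<inter> V) (\<lambda>q. (f \<circ> chart_inv c) (snd c q))"
    by (rule continuous_on_compose2[OF assms(2)[OF c(1)] continuous_on_subset[OF chart(3)[OF c(1)]]]) auto
  then have "continuous_on (fst c \<inter> V) f"
    by (rule continuous_on_eq) (simp add: chart(6)[OF c(1)])
  moreover have "open (fst c \<inter> V)" using chart(1)[OF c(1)] assms(1) by (rule open_Int)
  ultimately show "isCont f p" using p c continuous_on_eq_continuous_at by blast
qed

locale polarized_mfd = compact_cplx_mfd A for A :: "('a::t2_space, 'm::finite) chart set" +
  fixes L :: "('a, 'i) line_bundle" and k :: nat
  assumes line: "holo_line_bundle A L" and k: "1 \<le> k"
begin

abbreviation "fdom i \<equiv> frame_dom L i"

lemma open_fdom: "open (fdom i)" and fdom_cover: "(\<Union>i. fdom i) = UNIV"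
  and transition_holo_on: "holo_on_mfd A (fdom i \<inter> fdom j) (transition L i j)"
  and transition_nz: "p \<in> fdom i \<inter> fdom j \<Longrightarrow> transition L i j p \<noteq> 0"
  using line unfolding holo_line_bundle_def by blast+

lemma ex_fdom: "\<exists>i. p \<in> fdom i"
proof -
  have "p \<in> (\<Union>i. fdom i)" using fdom_cover by simp
  then show ?thesis by (rule UN_E) (rule exI)
qed

abbreviation "Sect \<equiv> H0 A (bundle_power L k)"

lemma SectD:
  assumes "\<sigma> \<in> Sect"
  shows "c \<in> A \<Longrightarrow> holo_fun_on (\<sigma> i \<circ> chart_inv c) (snd c ` (fst c \<inter> fdom i))"
    "p \<in> fdom i \<Longrightarrow> p \<in> fdom j \<Longrightarrow> \<sigma> i p = transition L i j p ^ k * \<sigma> j p"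
    "p \<notin> fdom i \<Longrightarrow> \<sigma> i p = 0"
proof -
  have fd: "frame_dom (bundle_power L k) = frame_dom L"
    "transition (bundle_power L k) = (\<lambda>i j p. transition L i j p ^ k)"
    by (simp_all add: bundle_power_def)
  note H = assms[unfolded H0_def mem_Collect_eq fd]
  show "holo_fun_on (\<sigma> i \<circ> chart_inv c) (snd c ` (fst c \<inter> fdom i))" if "c \<in> A"
    by (rule bspec[OF conjunct1[OF H, THEN spec[of _ i], unfolded holo_on_mfd_def] that])
  show "\<sigma> i p = transition L i j p ^ k * \<sigma> j p" if "p \<in> fdom i" "p \<in> fdom j"
    by (rule bspec[OF spec[OF spec[OF conjunct1[OF conjunct2[OF H]], of i], of j] IntI[OF that]])
  show "\<sigma> i p = 0" if "p \<notin> fdom i"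
    by (rule mp[OF spec[OF spec[OF conjunct2[OF conjunct2[OF H]], of i], of p] that])
qed

lemma Sect_continuous: "\<sigma> \<in> Sect \<Longrightarrow> continuous_on (fdom i) (\<sigma> i)"
  by (rule continuous_on_charts[OF open_fdom]) (rule holo_fun_on_imp_continuous_on[OF SectD(1)])

text \<open>The set E of points near which the section vanishes is open by construction and closed
  by the identity theorem in a coordinate ball; connectedness makes it the whole manifold.\<close>

lemma Sect_nonvanishing:
  assumes \<sigma>: "\<sigma> \<in> Sect" "\<sigma> \<noteq> (\<lambda>i p. 0)" and V: "open V" "V \<noteq> {}" "V \<subseteq> fdom i"
  shows "\<exists>p\<in>V. \<sigma> i p \<noteq> 0"
proof (rule ccontr)
  assume "\<not> (\<exists>p\<in>V. \<sigma> i p \<noteq> 0)"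
  then have z: "\<And>p. p \<in> V \<Longrightarrow> \<sigma> i p = 0" by blast
  \<comment> \<open>A zero does not depend on the frame: the coefficients differ by a transition
    factor, or are 0 by convention outside the frame domain.\<close>
  have spread: "\<sigma> j p = 0" if "p \<in> fdom l" "\<sigma> l p = 0" for p l j
    using SectD(2)[OF \<sigma>(1), of p j l] SectD(3)[OF \<sigma>(1), of p j] that by (cases "p \<in> fdom j") simp_all
  define E where "E = \<Union>{N. open N \<and> (\<forall>q\<in>N. \<forall>j. \<sigma> j q = 0)}"
  have oE: "open E" unfolding E_def by (rule open_Union) simp
  have E0: "\<sigma> j q = 0" if "q \<in> E" for j q using that unfolding E_def by blast
  have EI: "N \<subseteq> E" if "open N" "\<And>q j. q \<in> N \<Longrightarrow> \<sigma> j q = 0" for N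
    unfolding E_def by (rule Union_upper) (simp add: that)
  have "V \<subseteq> E" by (rule EI[OF V(1)]) (use z spread V(3) in blast)
  then have "E \<noteq> {}" using V(2) by blast
  have "closure E \<subseteq> E"
  proof
    fix p assume p: "p \<in> closure E"
    obtain l where l: "p \<in> fdom l" using ex_fdom by blast
    obtain c r where cr: "c \<in> A" "r > 0" "p \<in> fst c" "cball (snd c p) r \<subseteq> snd c ` (fst c \<inter> fdom l)"
      by (rule chart_ball[OF open_fdom l]) (rule that, assumption+)
    let ?N = "chart_inv c ` ball (snd c p) r"
    note nb = chart_ball_nbhd[OF cr]
    have NE: "?N \<inter> E \<noteq> {}"
      using open_Int_closure_eq_empty[OF nb(1), of E] nb(2) p by blast
    have bs: "ball (snd c p) r \<subseteq> snd c ` (fst c \<inter> fdom l)" using cr(4) ball_subset_cball by blast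
    have Nc: "?N \<subseteq> fst c \<inter> fdom l" using nb(4,5) by blast
    let ?T = "snd c ` (fst c \<inter> (?N \<inter> E))"
    have T: "open ?T" by (rule open_chart_image[OF cr(1) open_Int[OF nb(1) oE]])
    have Tb: "?T \<subseteq> ball (snd c p) r"
    proof
      fix y assume "y \<in> ?T"
      then obtain x where x: "x \<in> ball (snd c p) r" "y = snd c (chart_inv c x)" by blast
      moreover have "x \<in> snd c ` fst c" using x(1) bs by auto
      ultimately show "y \<in> ball (snd c p) r" using chart(7)[OF cr(1)] by simp
    qed
    have "(\<sigma> l \<circ> chart_inv c) y = 0" if "y \<in> ball (snd c p) r" for y
    proof (rule holo_fun_on_identity[OF holo_fun_on_subset[OF SectD(1)[OF \<sigma>(1) cr(1)] bs] open_ball convex_ball T Tb _ _ that])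
      show "?T \<noteq> {}" using NE Nc by blast
      fix y assume "y \<in> ?T"
      then obtain q where "q \<in> fst c" "q \<in> E" "y = snd c q" by blast
      then show "(\<sigma> l \<circ> chart_inv c) y = 0" using E0 chart(6)[OF cr(1)] by simp
    qed
    then have "\<sigma> l q = 0" if "q \<in> ?N" for q using that by auto
    then have "?N \<subseteq> E" using nb(1) Nc spread by (intro EI) blast+
    then show "p \<in> E" using nb(2) by blast
  qed
  then have cE: "closed E" using closure_subset closed_closure by (metis subset_antisym)
  have "E = UNIV"
    using connected_mfd oE cE \<open>E \<noteq> {}\<close> unfolding connected_clopen by simp blast
  then have "\<sigma> = (\<lambda>i p. 0)" using E0 by (intro ext) simp
  with \<sigma>(2) show False by simp
qed

text \<open>The section is not identically zero near x, which follows from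
  \<open>Sect_nonvanishing\<close> after carrying a neighbourhood of x back to the manifold.\<close>

lemma Sect_log_integrable_local:
  assumes \<sigma>: "\<sigma> \<in> Sect" "\<sigma> \<noteq> (\<lambda>i p. 0)" and c: "c \<in> A" and x: "x \<in> snd c ` (fst c \<inter> fdom i)"
  shows "\<exists>r>0. set_integrable lborel (cball x r) (\<lambda>x. ln ((cmod (\<sigma> i (chart_inv c x)))\<^sup>2)) \<and>
    (AE y in lborel. y \<in> cball x r \<longrightarrow> \<sigma> i (chart_inv c y) \<noteq> 0)"
proof -
  let ?S = "snd c ` (fst c \<inter> fdom i)"
  have S: "open ?S" by (rule open_chart_image[OF c open_fdom])
  have nz: "\<exists>y\<in>N. (\<sigma> i \<circ> chart_inv c) y \<noteq> 0" if N: "open N" "x \<in> N" for N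
  proof -
    have "\<exists>p\<in>chart_inv c ` (N \<inter> ?S). \<sigma> i p \<noteq> 0"
    proof (rule Sect_nonvanishing[OF \<sigma>])
      show "open (chart_inv c ` (N \<inter> ?S))"
        by (rule open_chart_inv_image[OF c open_Int[OF N(1) S]]) auto
      show "chart_inv c ` (N \<inter> ?S) \<noteq> {}" using N(2) x by blast
      show "chart_inv c ` (N \<inter> ?S) \<subseteq> fdom i" using chart_image[OF c, of "fdom i"] by auto
    qed
    then show ?thesis by auto
  qed
  show ?thesis
  proof (rule log_norm_locally_integrable[OF S SectD(1)[OF \<sigma>(1) c] x])
    show "\<exists>y\<in>N. (\<sigma> i \<circ> chart_inv c) y \<noteq> 0" if "open N" "x \<in> N" for N
      by (rule nz[OF that])
  next
    fix r assume "r > 0" "set_integrable lborel (cball x r) (\<lambda>x. ln ((cmod ((\<sigma> i \<circ> chart_inv c) x))\<^sup>2))"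
      "AE y in lborel. y \<in> cball x r \<longrightarrow> (\<sigma> i \<circ> chart_inv c) y \<noteq> 0"
    then show ?thesis unfolding o_def by (intro exI[of _ r] conjI)
  qed
qed

text \<open>A locally negligible set is negligible, so the local statement about the zeros
  suffices.\<close>

lemma Sect_ae_nonzero:
  assumes \<sigma>: "\<sigma> \<in> Sect" "\<sigma> \<noteq> (\<lambda>i p. 0)"
  shows "ae_on (fdom i) (\<lambda>p. \<sigma> i p \<noteq> 0)"
  unfolding ae_on_def
proof
  fix c assume c: "c \<in> A"
  let ?S = "snd c ` (fst c \<inter> fdom i)"
  let ?N = "{y \<in> ?S. \<sigma> i (chart_inv c y) = 0}"
  have "negligible ?N"
    unfolding locally_negligible_alt[of ?N]
  proof
    fix x assume x: "x \<in> ?N"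
    then obtain r where r: "r > 0" "AE y in lborel. y \<in> cball x r \<longrightarrow> \<sigma> i (chart_inv c y) \<noteq> 0"
      using Sect_log_integrable_local[OF \<sigma> c, of x i] by blast
    obtain M where M: "\<And>y. y \<in> space lborel - M \<Longrightarrow> y \<in> cball x r \<longrightarrow> \<sigma> i (chart_inv c y) \<noteq> 0" "M \<in> null_sets lborel"
      using AE_E3[OF r(2)] by blast
    have "negligible M"
      using M(2) by (simp add: negligible_iff_null_sets null_sets_completionI)
    moreover have "?N \<inter> ball x r \<subseteq> M"
    proof (rule subsetI, rule ccontr)
      fix y assume y: "y \<in> ?N \<inter> ball x r" "y \<notin> M"
      then have "y \<in> cball x r" by simp
      then have "\<sigma> i (chart_inv c y) \<noteq> 0" using M(1)[of y] y(2) by simp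
      with y(1) show False by blast
    qed
    ultimately have "negligible (?N \<inter> ball x r)" by (rule negligible_subset)
    moreover have "openin (top_of_set ?N) (?N \<inter> ball x r)" by (rule openin_open_Int) simp
    ultimately show "\<exists>U. openin (top_of_set ?N) U \<and> x \<in> U \<and> negligible U" using x r(1)
      by (intro exI[of _ "?N \<inter> ball x r"]) simp
  qed
  then have "AE y in lebesgue. y \<notin> ?N"
    unfolding negligible_iff_null_sets by (rule AE_not_in)
  then have "AE y in lborel. y \<notin> ?N" unfolding AE_completion_iff .
  then show "AE y in lborel. y \<in> ?S \<longrightarrow> \<sigma> i (chart_inv c y) \<noteq> 0" by eventually_elim simp
qed

text \<open>Finitely many balls from the local statement cover K.\<close>

lemma Sect_log_integrable:
  assumes \<sigma>: "\<sigma> \<in> Sect" "\<sigma> \<noteq> (\<lambda>i p. 0)" and c: "c \<in> A" and K: "compact K" "K \<subseteq> snd c ` (fst c \<inter> fdom i)"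
  shows "set_integrable lborel K (\<lambda>x. ln ((cmod (\<sigma> i (chart_inv c x)))\<^sup>2))"
proof -
  have "\<exists>r. x \<in> K \<longrightarrow> r > 0 \<and> set_integrable lborel (cball x r) (\<lambda>x. ln ((cmod (\<sigma> i (chart_inv c x)))\<^sup>2))" for x
    using Sect_log_integrable_local[OF \<sigma> c, of x i] K(2) by blast
  then obtain r where r: "\<And>x. x \<in> K \<Longrightarrow> r x > 0"
    "\<And>x. x \<in> K \<Longrightarrow> set_integrable lborel (cball x (r x)) (\<lambda>x. ln ((cmod (\<sigma> i (chart_inv c x)))\<^sup>2))"
    by metis
  have "K \<subseteq> (\<Union>x\<in>K. ball x (r x))" using r(1) by force
  then obtain F where F: "F \<subseteq> K" "finite F" "K \<subseteq> (\<Union>x\<in>F. ball x (r x))"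
    by (rule compactE_image[OF K(1), rotated]) (rule that, assumption+, simp)
  have "set_integrable lborel (\<Union>x\<in>F. cball x (r x)) (\<lambda>x. ln ((cmod (\<sigma> i (chart_inv c x)))\<^sup>2))"
    by (rule set_integrable_UN[OF F(2)]) (use F(1) r(2) in auto)
  then show ?thesis
    by (rule set_integrable_subset) (use F(3) K(1) in \<open>force intro: borel_compact\<close>)+
qed

lemma pluriharmonic_on_log_norm:
  assumes V: "open V" and g: "holo_on_mfd A V g" "\<And>p. p \<in> V \<Longrightarrow> g p \<noteq> 0"
  shows "pluriharmonic_on V (\<lambda>p. ln ((cmod (g p))\<^sup>2))"
  unfolding pluriharmonic_on_def
proof
  fix p assume p: "p \<in> V"
  obtain c where c: "c \<in> A" "p \<in> fst c" using chart_cover by blast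
  let ?S = "snd c ` (fst c \<inter> V)" and ?B = "ball (g p) (cmod (g p))"
  \<comment> \<open>On the ball of radius |g p| about g p the quotient z / g p has positive real
    part, so the principal branch of the logarithm is holomorphic there. The added constant makes
    the real part equal to ln |z|^2.\<close>
  let ?G = "\<lambda>z. 2 * Ln (z / g p) + of_real (2 * ln (cmod (g p)))"
  have S: "open ?S" by (rule open_chart_image[OF c(1) V])
  have f: "holo_fun_on (g \<circ> chart_inv c) ?S" using g(1) c(1) unfolding holo_on_mfd_def by simp
  have gp: "g p \<noteq> 0" by (rule g(2)[OF p])
  let ?T = "?S \<inter> (g \<circ> chart_inv c) -` ?B"
  have T: "open ?T" by (rule continuous_open_preimage[OF holo_fun_on_imp_continuous_on[OF f] S open_ball])
  have Re: "Re (z / g p) > 0" if "z \<in> ?B" for z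
  proof -
    have "cmod (1 - z / g p) = cmod (g p - z) / cmod (g p)" using gp by (simp add: norm_divide[symmetric] diff_divide_distrib)
    also have "\<dots> < 1" using that gp by (simp add: dist_norm)
    finally have "Re (1 - z / g p) < 1" using complex_Re_le_cmod[of "1 - z / g p"] by linarith
    then show ?thesis by simp
  qed
  have G: "?G holomorphic_on ?B"
  proof (intro holomorphic_intros)
    show "z / g p \<notin> \<real>\<^sub>\<le>\<^sub>0" if "z \<in> ?B" for z
      using Re[OF that] by (auto simp: complex_nonpos_Reals_iff)
  qed (rule gp)
  let ?N = "chart_inv c ` ?T"
  have N: "open ?N" by (rule open_chart_inv_image[OF c(1) T]) auto
  have Nc: "?N \<subseteq> fst c \<inter> V" using chart(8)[OF c(1)] chart_image[OF c(1), of V] by auto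
  have pN: "p \<in> ?N"
  proof (rule image_eqI)
    show "p = chart_inv c (snd c p)" using chart(6)[OF c] by simp
    show "snd c p \<in> ?T" using p c chart(6)[OF c] gp by auto
  qed
  have sN: "snd c ` ?N \<subseteq> ?T"
  proof
    fix y assume "y \<in> snd c ` ?N"
    then obtain x where x: "x \<in> ?T" "y = snd c (chart_inv c x)" by blast
    then have "x \<in> snd c ` fst c" by auto
    then show "y \<in> ?T" using x chart(7)[OF c(1)] by simp
  qed
  have "holo_fun_on (\<lambda>y. ?G ((g \<circ> chart_inv c) y)) (snd c ` ?N)"
  proof (rule holo_fun_on_outer_compose[OF holo_fun_on_subset[OF f] G open_ball])
    show "snd c ` ?N \<subseteq> ?S" by (rule order_trans[OF sN Int_lower1])
    show "(g \<circ> chart_inv c) ` (snd c ` ?N) \<subseteq> ?B"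
    proof (rule image_subsetI)
      fix y assume "y \<in> snd c ` ?N"
      then have "y \<in> ?T" by (rule subsetD[OF sN])
      then show "(g \<circ> chart_inv c) y \<in> ?B" by (rule IntD2[THEN vimageD])
    qed
  qed
  moreover have "ln ((cmod (g q))\<^sup>2) = Re (?G ((g \<circ> chart_inv c) (snd c q)))" if q: "q \<in> ?N" for q
  proof -
    have qi: "chart_inv c (snd c q) = q" using q Nc chart(6)[OF c(1)] by auto
    have qV: "q \<in> V" using q Nc by auto
    have "g q / g p \<noteq> 0" using g(2)[OF qV] gp by simp
    then have "Re (?G (g q)) = 2 * ln (cmod (g q / g p)) + 2 * ln (cmod (g p))" by simp
    also have "\<dots> = 2 * ln (cmod (g q))"
      using g(2)[OF qV] gp by (simp add: norm_divide ln_div)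
    also have "\<dots> = ln ((cmod (g q))\<^sup>2)" using g(2)[OF qV] by (simp add: ln_realpow)
    finally show ?thesis using qi by simp
  qed
  ultimately show "\<exists>c\<in>A. \<exists>N f. open N \<and> p \<in> N \<and> N \<subseteq> fst c \<inter> V \<and> holo_fun_on f (snd c ` N) \<and>
      (\<forall>q\<in>N. ln ((cmod (g q))\<^sup>2) = Re (f (snd c q)))"
    by (intro bexI[OF _ c(1)] exI[of _ ?N] exI[of _ "\<lambda>y. ?G ((g \<circ> chart_inv c) y)"] conjI N pN Nc ballI)
qed

end

section \<open>Potentials of weighted sums of sections, and the limit of the ray\<close>

context polarized_mfd
begin

lemma weighted_sum_bound:
  assumes "finite J" "\<And>j. j \<in> J \<Longrightarrow> \<sigma> j \<in> Sect" "compact Z" "Z \<subseteq> fdom i"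
  shows "\<exists>M\<ge>1. \<forall>p\<in>Z. (\<Sum>j\<in>J. w j * (cmod (\<sigma> j i p))\<^sup>2) \<le> M"
proof -
  have "continuous_on (fdom i) (\<lambda>p. \<Sum>j\<in>J. w j * (cmod (\<sigma> j i p))\<^sup>2)"
    by (intro continuous_on_sum continuous_on_mult continuous_on_const continuous_on_power continuous_on_norm Sect_continuous assms(2))
  then have "continuous_on Z (\<lambda>p. \<Sum>j\<in>J. w j * (cmod (\<sigma> j i p))\<^sup>2)"
    by (rule continuous_on_subset[OF _ assms(4)])
  then have "bounded ((\<lambda>p. \<Sum>j\<in>J. w j * (cmod (\<sigma> j i p))\<^sup>2) ` Z)"
    by (rule compact_imp_bounded[OF compact_continuous_image[OF _ assms(3)]])
  then have "\<exists>M. \<forall>p\<in>Z. norm (\<Sum>j\<in>J. w j * (cmod (\<sigma> j i p))\<^sup>2) \<le> M"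
    by (simp only: bounded_iff ball_simps)
  then obtain M where M: "\<forall>p\<in>Z. norm (\<Sum>j\<in>J. w j * (cmod (\<sigma> j i p))\<^sup>2) \<le> M"
    by (rule exE)
  show ?thesis
  \<comment> \<open>The lower bound 1 makes ln M nonnegative in later estimates.\<close>
  proof (intro exI[of _ "max 1 M"] conjI ballI)
    fix p assume "p \<in> Z"
    then have "norm (\<Sum>j\<in>J. w j * (cmod (\<sigma> j i p))\<^sup>2) \<le> M" by (rule bspec[OF M])
    then show "(\<Sum>j\<in>J. w j * (cmod (\<sigma> j i p))\<^sup>2) \<le> max 1 M"
      unfolding real_norm_def by linarith
  qed simp
qed

lemma weighted_sum_pos:
  assumes "finite J" "\<And>j. j \<in> J \<Longrightarrow> w j > 0" "l \<in> J" "z l \<noteq> (0::complex)"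
  shows "0 < (\<Sum>j\<in>J. w j * (cmod (z j))\<^sup>2)" "w l * (cmod (z l))\<^sup>2 \<le> (\<Sum>j\<in>J. w j * (cmod (z j))\<^sup>2)"
proof -
  have nn: "0 \<le> w j * (cmod (z j))\<^sup>2" if "j \<in> J" for j
    using assms(2)[OF that] by simp
  show le: "w l * (cmod (z l))\<^sup>2 \<le> (\<Sum>j\<in>J. w j * (cmod (z j))\<^sup>2)"
    by (rule member_le_sum[OF assms(3)]) (use nn assms(1) in auto)
  have "0 < w l * (cmod (z l))\<^sup>2" using assms(2)[OF assms(3)] assms(4) by simp
  then show "0 < (\<Sum>j\<in>J. w j * (cmod (z j))\<^sup>2)" using le by linarith
qed

lemma ae_on_subset: "ae_on V P \<Longrightarrow> W \<subseteq> V \<Longrightarrow> ae_on W P"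
  unfolding ae_on_def
proof
  fix c assume h: "\<forall>c\<in>A. AE y in lborel. y \<in> snd c ` (fst c \<inter> V) \<longrightarrow> P (chart_inv c y)" "W \<subseteq> V" "c \<in> A"
  have "AE y in lborel. y \<in> snd c ` (fst c \<inter> V) \<longrightarrow> P (chart_inv c y)" by (rule bspec[OF h(1,3)])
  then show "AE y in lborel. y \<in> snd c ` (fst c \<inter> W) \<longrightarrow> P (chart_inv c y)"
    by eventually_elim (use h(2) in blast)
qed

text \<open>On K the sum lies between its l-th term and a constant M, so its logarithm is controlled
  by constants and the integrable logarithm of the single nonzero section \<sigma> l.\<close>

lemma weighted_potential_loc_integrable:
  assumes J: "finite J" "\<And>j. j \<in> J \<Longrightarrow> \<sigma> j \<in> Sect" "\<And>j. j \<in> J \<Longrightarrow> w j > 0" "l \<in> J" "\<sigma> l \<noteq> (\<lambda>i p. 0)"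
  shows "loc_integrable_potential A L (weighted_potential k J w \<sigma>)"
  unfolding loc_integrable_potential_def
proof (intro ballI allI impI)
  fix c i K assume c: "c \<in> A" and K: "compact K \<and> K \<subseteq> snd c ` (fst c \<inter> fdom i)"
  let ?S = "snd c ` (fst c \<inter> fdom i)"
  define G where "G y = (\<Sum>j\<in>J. w j * (cmod (\<sigma> j i (chart_inv c y)))\<^sup>2)" for y
  let ?Z = "chart_inv c ` K"
  have Kc: "K \<subseteq> snd c ` fst c" using K by auto
  have Z: "compact ?Z" by (rule compact_chart_inv_image(1)[OF c conjunct1[OF K] Kc])
  have Zi: "?Z \<subseteq> fdom i" using K chart_image[OF c, of "fdom i"] by auto
  have Gc: "continuous_on K G"
    unfolding G_def
    by (intro continuous_on_sum continuous_on_mult continuous_on_const continuous_on_power continuous_on_norm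
        continuous_on_compose2[OF Sect_continuous[OF J(2)] continuous_on_subset[OF chart(4)[OF c] Kc] Zi])
  obtain M where M: "M \<ge> 1" "\<forall>p\<in>?Z. (\<Sum>j\<in>J. w j * (cmod (\<sigma> j i p))\<^sup>2) \<le> M"
  proof -
    have "\<exists>M\<ge>1. \<forall>p\<in>?Z. (\<Sum>j\<in>J. w j * (cmod (\<sigma> j i p))\<^sup>2) \<le> M"
      by (rule weighted_sum_bound[OF J(1) _ Z Zi]) (rule J(2))
    then show ?thesis by (elim exE conjE) (rule that)
  qed
  have si: "set_integrable lborel K (\<lambda>x. ln ((cmod (\<sigma> l i (chart_inv c x)))\<^sup>2))"
    by (rule Sect_log_integrable[OF J(2)[OF J(4)] J(5) c]) (use K in auto)
  have ci: "set_integrable lborel K (\<lambda>x. \<bar>ln (w l)\<bar> + ln M)"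
    unfolding set_integrable_def by (rule borel_integrable_compact) (use K in auto)
  have "set_integrable lborel K (\<lambda>y. ln (G y))"
    unfolding set_integrable_def
  proof (rule Bochner_Integration.integrable_bound)
    show "integrable lborel (\<lambda>y. norm (indicator K y *\<^sub>R ln ((cmod (\<sigma> l i (chart_inv c y)))\<^sup>2)) + indicator K y *\<^sub>R (\<bar>ln (w l)\<bar> + ln M))"
      by (rule Bochner_Integration.integrable_add[OF integrable_norm[OF si[unfolded set_integrable_def]] ci[unfolded set_integrable_def]])
    have "(\<lambda>y. indicator K y *\<^sub>R G y) \<in> borel_measurable lborel"
      using borel_measurable_integrable[OF borel_integrable_compact[OF conjunct1[OF K] Gc]] .
    then have "(\<lambda>y. ln (indicator K y *\<^sub>R G y)) \<in> borel_measurable lborel"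
      by (rule borel_measurable_ln)
    also have "(\<lambda>y. ln (indicator K y *\<^sub>R G y)) = (\<lambda>y. indicator K y *\<^sub>R ln (G y))"
      by (rule ext) (simp split: split_indicator)
    finally show "(\<lambda>y. indicator K y *\<^sub>R ln (G y)) \<in> borel_measurable lborel" .
    have "AE y in lborel. y \<in> ?S \<longrightarrow> \<sigma> l i (chart_inv c y) \<noteq> 0"
      using Sect_ae_nonzero[OF J(2)[OF J(4)] J(5), of i] c unfolding ae_on_def by (rule bspec)
    then show "AE y in lborel. norm (indicator K y *\<^sub>R ln (G y)) \<le>
        norm (norm (indicator K y *\<^sub>R ln ((cmod (\<sigma> l i (chart_inv c y)))\<^sup>2)) + indicator K y *\<^sub>R (\<bar>ln (w l)\<bar> + ln M))"
    proof eventually_elim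
      case (elim y)
      show ?case
      proof (cases "y \<in> K")
        case True
        then have "y \<in> ?S" using K by blast
        then have nz: "\<sigma> l i (chart_inv c y) \<noteq> 0" using elim by blast
        note pos = weighted_sum_pos[of J w l "\<lambda>j. \<sigma> j i (chart_inv c y)", OF J(1,3,4) nz, folded G_def]
        have wl: "w l > 0" using J(3,4) by blast
        have 1: "ln (w l) + ln ((cmod (\<sigma> l i (chart_inv c y)))\<^sup>2) \<le> ln (G y)"
        proof -
          have "ln (w l) + ln ((cmod (\<sigma> l i (chart_inv c y)))\<^sup>2) = ln (w l * (cmod (\<sigma> l i (chart_inv c y)))\<^sup>2)"
            using wl nz by (simp add: ln_mult)
          also have "\<dots> \<le> ln (G y)" using wl nz pos by (intro ln_mono) auto
          finally show ?thesis .
        qed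
        have "G y \<le> M" using M(2) True unfolding G_def by blast
        then have "ln (G y) \<le> ln M" using pos(1) by (intro ln_mono) auto
        moreover have "ln M \<ge> 0" using M(1) by simp
        ultimately show ?thesis using 1 True by simp
      qed simp
    qed
  qed
  then have "set_integrable lborel K (\<lambda>y. ln (G y) / real k)"
    by (rule set_integrable_divide)
  then show "set_integrable lborel K (\<lambda>y. weighted_potential k J w \<sigma> i (chart_inv c y))"
    unfolding weighted_potential_def G_def .
qed

text \<open>Between two frames the sum is multiplied by |g|^(2k), g being the transition function of
  L. After division by k the potentials differ by ln |g|^2, which is pluriharmonic.\<close>

lemma weighted_potential_current:
  assumes J: "finite J" "\<And>j. j \<in> J \<Longrightarrow> \<sigma> j \<in> Sect" "\<And>j. j \<in> J \<Longrightarrow> w j > 0" "l \<in> J" "\<sigma> l \<noteq> (\<lambda>i p. 0)"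
  shows "\<exists>T. is_ddbar_current A L (weighted_potential k J w \<sigma>) T"
proof (rule ex_ddbar_current[OF open_fdom fdom_cover weighted_potential_loc_integrable[of J \<sigma> w l, OF J]])
  fix i i'
  let ?V = "fdom i \<inter> fdom i'" and ?h = "\<lambda>p. ln ((cmod (transition L i i' p))\<^sup>2)"
  have "pluriharmonic_on ?V ?h"
    by (rule pluriharmonic_on_log_norm[OF open_Int[OF open_fdom open_fdom] transition_holo_on transition_nz])
  moreover have "ae_on ?V (\<lambda>p. weighted_potential k J w \<sigma> i p = weighted_potential k J w \<sigma> i' p + ?h p)"
  proof (rule ae_on_mono[OF ae_on_subset[OF Sect_ae_nonzero[OF J(2)[OF J(4)] J(5), of i'] Int_lower2]])
    fix p assume p: "p \<in> ?V" and nz: "\<sigma> l i' p \<noteq> 0"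
    let ?g = "transition L i i' p" and ?G = "\<Sum>j\<in>J. w j * (cmod (\<sigma> j i' p))\<^sup>2"
    have g: "?g \<noteq> 0" by (rule transition_nz[OF p])
    have pos: "0 < ?G" by (rule weighted_sum_pos(1)[of J w l "\<lambda>j. \<sigma> j i' p", OF J(1,3,4) nz])
    have "(\<Sum>j\<in>J. w j * (cmod (\<sigma> j i p))\<^sup>2) = (\<Sum>j\<in>J. ((cmod ?g)\<^sup>2) ^ k * (w j * (cmod (\<sigma> j i' p))\<^sup>2))"
    proof (rule sum.cong[OF refl])
      fix j assume "j \<in> J"
      then have "\<sigma> j i p = ?g ^ k * \<sigma> j i' p" by (intro SectD(2)[OF J(2)]) (use p in auto)
      then show "w j * (cmod (\<sigma> j i p))\<^sup>2 = ((cmod ?g)\<^sup>2) ^ k * (w j * (cmod (\<sigma> j i' p))\<^sup>2)"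
        by (simp add: norm_mult norm_power power_mult_distrib power_mult[symmetric] mult_ac)
    qed
    also have "\<dots> = ((cmod ?g)\<^sup>2) ^ k * ?G" by (rule sum_distrib_left[symmetric])
    finally have "ln (\<Sum>j\<in>J. w j * (cmod (\<sigma> j i p))\<^sup>2) = real k * ?h p + ln ?G"
      using g pos by (simp add: ln_mult ln_realpow)
    then show "weighted_potential k J w \<sigma> i p = weighted_potential k J w \<sigma> i' p + ?h p"
      unfolding weighted_potential_def using k by (simp add: add_divide_distrib)
  qed
  ultimately show "\<exists>h. pluriharmonic_on ?V h \<and> ae_on ?V (\<lambda>p. weighted_potential k J w \<sigma> i p = weighted_potential k J w \<sigma> i' p + h p)"
    by (intro exI[of _ ?h] conjI)
qed

text \<open>
  After subtracting the constant \<open>t \<lambda>\<^sub>m\<^sub>a\<^sub>x / k\<close>, the potentials decrease to the potential of the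
  sections of top weight; the latter is locally integrable, so the limit may be taken under the
  integral. The factor \<open>b\<close> absorbs rescalings of the limiting sections.
\<close>

lemma ray_tendsto_weakly:
  fixes \<tau> :: "'n::finite \<Rightarrow> ('a, 'i) sect" and \<Lambda> :: "'n \<Rightarrow> real"
  assumes \<tau>: "\<And>j. \<tau> j \<in> Sect" and top: "Top = {j. \<Lambda> j = m}" "\<And>j. \<Lambda> j \<le> m" "l \<in> Top" "\<tau> l \<noteq> (\<lambda>i p. 0)"
    and J: "finite J" "\<And>j. j \<in> J \<Longrightarrow> \<sigma> j \<in> Sect" "l' \<in> J" "\<sigma> l' \<noteq> (\<lambda>i p. 0)"
    and b: "b > 0" "\<And>i p. (\<Sum>j\<in>J. (cmod (\<sigma> j i p))\<^sup>2) = b * (\<Sum>j\<in>Top. (cmod (\<tau> j i p))\<^sup>2)"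
  shows "ddbar_tendsto_weakly A L (\<lambda>t. weighted_potential k UNIV (\<lambda>j. exp (t * \<Lambda> j)) \<tau>)
    (weighted_potential k J (\<lambda>j. 1) \<sigma>)"
proof (rule ddbar_tendsto_weaklyI[OF open_fdom fdom_cover])
  show "\<exists>T. is_ddbar_current A L (weighted_potential k UNIV (\<lambda>j. exp (t * \<Lambda> j)) \<tau>) T" for t
    by (rule weighted_potential_current[of UNIV \<tau> _ l, OF finite \<tau> _ UNIV_I top(4)]) simp
  show "\<exists>T. is_ddbar_current A L (weighted_potential k J (\<lambda>j. 1) \<sigma>) T"
    by (rule weighted_potential_current[of J \<sigma> _ l', OF J(1,2) _ J(3,4)]) simp_all
  show "ae_on (fdom i) (\<lambda>p. \<tau> l i p \<noteq> 0)" for i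
    by (rule Sect_ae_nonzero[OF \<tau> top(4)])
  \<comment> \<open>The first term removes the growth caused by the highest weight m; the second
    shifts the limit by ln b / k, from the potential of the top sections \<tau> to that of
    \<sigma>.\<close>
  define a where "a t = (t * m - ln b) / real k" for t
  define E where "E t i p = (\<Sum>j\<in>UNIV. exp (t * (\<Lambda> j - m)) * (cmod (\<tau> j i p))\<^sup>2)" for t i p
  define E' where "E' i p = (\<Sum>j\<in>Top. (cmod (\<tau> j i p))\<^sup>2)" for i p
  have E'pos: "0 < E' i p" if "\<tau> l i p \<noteq> 0" for i p
    using weighted_sum_pos(1)[of Top "\<lambda>_. 1" l "\<lambda>j. \<tau> j i p", OF _ _ top(3) that] by (simp add: E'_def)
  have Epos: "0 < E t i p" if "\<tau> l i p \<noteq> 0" for t i p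
    using weighted_sum_pos(1)[of UNIV "\<lambda>j. exp (t * (\<Lambda> j - m))" l "\<lambda>j. \<tau> j i p", OF _ _ UNIV_I that] by (simp add: E_def)
  have u: "weighted_potential k UNIV (\<lambda>j. exp (t * \<Lambda> j)) \<tau> i p - a t = (ln (E t i p) + ln b) / real k"
    if nz: "\<tau> l i p \<noteq> 0" for t i p
  proof -
    have "(\<Sum>j\<in>UNIV. exp (t * \<Lambda> j) * (cmod (\<tau> j i p))\<^sup>2) = exp (t * m) * E t i p"
      unfolding E_def sum_distrib_left
      by (rule sum.cong[OF refl]) (simp add: mult.assoc[symmetric] exp_add[symmetric] algebra_simps)
    then show ?thesis
      unfolding weighted_potential_def a_def using Epos[OF nz, of t] by (simp add: ln_mult diff_divide_distrib add_divide_distrib)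
  qed
  have v: "weighted_potential k J (\<lambda>j. 1) \<sigma> i p = (ln (E' i p) + ln b) / real k" if nz: "\<tau> l i p \<noteq> 0" for i p
    unfolding weighted_potential_def using b E'pos[OF nz] by (simp add: E'_def ln_mult add_divide_distrib)
  show "((\<lambda>t. weighted_potential k UNIV (\<lambda>j. exp (t * \<Lambda> j)) \<tau> i p - a t) \<longlongrightarrow> weighted_potential k J (\<lambda>j. 1) \<sigma> i p) at_top"
    if "p \<in> fdom i" and nz: "\<tau> l i p \<noteq> 0" for i p
  proof -
    have e: "((\<lambda>t. exp (t * (\<Lambda> j - m))) \<longlongrightarrow> (if j \<in> Top then 1 else 0)) at_top" for j
    proof (cases "j \<in> Top")
      case True
      then show ?thesis by (simp add: top(1))
    next
      case False
      then have "\<Lambda> j - m < 0" using top(1) top(2)[of j] by simp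
      then have "filterlim (\<lambda>t. (\<Lambda> j - m) * t) at_bot at_top"
        by (rule filterlim_tendsto_neg_mult_at_bot[OF tendsto_const _ filterlim_ident])
      then have "filterlim (\<lambda>t. t * (\<Lambda> j - m)) at_bot at_top" by (simp only: mult.commute)
      then show ?thesis using False by (simp add: filterlim_compose[OF exp_at_bot])
    qed
    have "((\<lambda>t. E t i p) \<longlongrightarrow> (\<Sum>j\<in>UNIV. (if j \<in> Top then 1 else 0) * (cmod (\<tau> j i p))\<^sup>2)) at_top"
      unfolding E_def by (intro tendsto_sum tendsto_mult e tendsto_const)
    also have "(\<Sum>j\<in>UNIV. (if j \<in> Top then 1 else 0) * (cmod (\<tau> j i p))\<^sup>2) = E' i p"
      unfolding E'_def by (rule sum.mono_neutral_cong_right) auto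
    finally have "((\<lambda>t. E t i p) \<longlongrightarrow> E' i p) at_top" .
    then have "((\<lambda>t. (ln (E t i p) + ln b) / real k) \<longlongrightarrow> (ln (E' i p) + ln b) / real k) at_top"
      using E'pos[OF nz] k by (intro tendsto_divide tendsto_add tendsto_ln tendsto_const) auto
    then show ?thesis unfolding u[OF nz] v[OF nz] .
  qed
  fix i Z assume Z: "closed Z" "Z \<subseteq> fdom i"
  have cZ: "compact Z" using compact_Int_closed[OF compact_mfd Z(1)] by simp
  obtain M where M: "M \<ge> 1" "\<forall>p\<in>Z. (\<Sum>j\<in>UNIV. 1 * (cmod (\<tau> j i p))\<^sup>2) \<le> M"
    using weighted_sum_bound[where J=UNIV and \<sigma>=\<tau> and w="\<lambda>_. 1" and Z=Z and i=i, OF finite \<tau> cZ Z(2)] by (elim exE conjE) (rule that)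
  show "\<exists>C. \<forall>p\<in>Z. \<tau> l i p \<noteq> 0 \<longrightarrow> (\<forall>t\<ge>0. \<bar>weighted_potential k UNIV (\<lambda>j. exp (t * \<Lambda> j)) \<tau> i p - a t\<bar> \<le>
      \<bar>weighted_potential k J (\<lambda>j. 1) \<sigma> i p\<bar> + C)"
  proof (intro exI[of _ "(ln M + \<bar>ln b\<bar>) / real k"] ballI impI allI)
    fix p t assume p: "p \<in> Z" and nz: "\<tau> l i p \<noteq> 0" and t: "(0::real) \<le> t"
    \<comment> \<open>For t \<ge> 0 the renormalised sum E lies between its limit E', made of the
      terms of top weight, and the sum with all factors replaced by 1. The lower bound is the limit
      itself and the upper one is bounded on Z; together they give the majorant.\<close>
    have "E' i p \<le> E t i p"
    proof -
      have "E' i p = (\<Sum>j\<in>Top. exp (t * (\<Lambda> j - m)) * (cmod (\<tau> j i p))\<^sup>2)"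
        unfolding E'_def by (rule sum.cong) (simp_all add: top(1))
      also have "\<dots> \<le> E t i p" unfolding E_def by (rule sum_mono2) auto
      finally show ?thesis .
    qed
    then have 1: "ln (E' i p) \<le> ln (E t i p)" using E'pos[OF nz] by (intro ln_mono) auto
    have "E t i p \<le> (\<Sum>j\<in>UNIV. 1 * (cmod (\<tau> j i p))\<^sup>2)"
      unfolding E_def
    proof (rule sum_mono, rule mult_right_mono)
      fix j
      have "t * (\<Lambda> j - m) \<le> 0" using t top(2)[of j] by (simp add: mult_nonneg_nonpos)
      then show "exp (t * (\<Lambda> j - m)) \<le> 1" by simp
    qed simp
    also have "\<dots> \<le> M" using M(2) p by blast
    finally have 2: "ln (E t i p) \<le> ln M" using Epos[OF nz, of t] by (intro ln_mono) auto
    have "\<bar>ln (E t i p) + ln b\<bar> \<le> \<bar>ln (E' i p) + ln b\<bar> + (ln M + \<bar>ln b\<bar>)"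
      using 1 2 ln_ge_zero[OF M(1)] by linarith
    then have "\<bar>ln (E t i p) + ln b\<bar> / real k \<le> (\<bar>ln (E' i p) + ln b\<bar> + (ln M + \<bar>ln b\<bar>)) / real k"
      using k by (intro divide_right_mono) auto
    then show "\<bar>weighted_potential k UNIV (\<lambda>j. exp (t * \<Lambda> j)) \<tau> i p - a t\<bar> \<le>
      \<bar>weighted_potential k J (\<lambda>j. 1) \<sigma> i p\<bar> + (ln M + \<bar>ln b\<bar>) / real k"
      unfolding u[OF nz] v[OF nz] by (simp add: add_divide_distrib[symmetric])
  qed
qed

end

section \<open>The background inner product in terms of coefficients\<close>

context polarized_mfd
begin

lemma Sect_comb:
  assumes "\<And>j. j \<in> J \<Longrightarrow> s j \<in> Sect"
  shows "(\<lambda>i p. \<Sum>j\<in>J. a j * s j i p) \<in> Sect"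
  unfolding H0_def mem_Collect_eq
proof (intro conjI allI ballI impI)
  fix i
  show "holo_on_mfd A (frame_dom (bundle_power L k) i) (\<lambda>p. \<Sum>j\<in>J. a j * s j i p)"
    unfolding holo_on_mfd_def
  proof
    fix c assume c: "c \<in> A"
    have "holo_fun_on (\<lambda>y. \<Sum>j\<in>J. a j * (s j i \<circ> chart_inv c) y) (snd c ` (fst c \<inter> fdom i))"
      by (intro holo_fun_on_sum holo_fun_on_mult holo_fun_on_const SectD(1)[OF assms c])
    then show "holo_fun_on ((\<lambda>p. \<Sum>j\<in>J. a j * s j i p) \<circ> chart_inv c) (snd c ` (fst c \<inter> frame_dom (bundle_power L k) i))"
      by (simp add: bundle_power_def o_def)
  qed
next
  fix i i' p assume p: "p \<in> frame_dom (bundle_power L k) i \<inter> frame_dom (bundle_power L k) i'"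
  have "s j i p = transition L i i' p ^ k * s j i' p" if "j \<in> J" for j
    by (rule SectD(2)[OF assms[OF that]]) (use p in \<open>simp_all add: bundle_power_def\<close>)
  then have "(\<Sum>j\<in>J. a j * s j i p) = (\<Sum>j\<in>J. transition L i i' p ^ k * (a j * s j i' p))"
    by (intro sum.cong[OF refl]) (simp only: mult.left_commute)
  then show "(\<Sum>j\<in>J. a j * s j i p) = transition (bundle_power L k) i i' p * (\<Sum>j\<in>J. a j * s j i' p)"
    by (simp add: bundle_power_def sum_distrib_left)
next
  fix i p assume "p \<notin> frame_dom (bundle_power L k) i"
  then have "s j i p = 0" if "j \<in> J" for j
    by (intro SectD(3)[OF assms[OF that]]) (simp add: bundle_power_def)
  then show "(\<Sum>j\<in>J. a j * s j i p) = 0" by simp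
qed

abbreviation "pow_inner h \<equiv> fibre_inner (bundle_power L k) (\<lambda>i p. h i p ^ k)"

text \<open>The factor |g|^(2k) from the metric cancels against the factors g^k of the two sections,
  so the frame chosen inside \<open>fibre_inner\<close> may be replaced by any fixed one. Continuity
  of the pairing rests on this.\<close>

lemma pow_inner_frame:
  assumes h: "hermitian_metric A L h" and st: "s \<in> Sect" "t \<in> Sect" and p: "p \<in> fdom i"
  shows "pow_inner h s t p = s i p * cnj (t i p) * of_real (h i p ^ k)"
proof -
  define j where "j = (SOME i. p \<in> fdom i)"
  have j: "p \<in> fdom j" unfolding j_def using ex_fdom by (rule someI_ex)
  let ?g = "transition L i j p"
  have "h j p = (cmod ?g)\<^sup>2 * h i p" using h p j unfolding hermitian_metric_def by blast
  then have "complex_of_real (h j p ^ k) = (?g * cnj ?g) ^ k * of_real (h i p ^ k)"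
    unfolding complex_norm_square[symmetric] by (simp add: power_mult_distrib)
  moreover have "s i p = ?g ^ k * s j p" "t i p = ?g ^ k * t j p"
    using SectD(2)[OF st(1) p j] SectD(2)[OF st(2) p j] by auto
  ultimately have "s j p * cnj (t j p) * of_real (h j p ^ k) = s i p * cnj (t i p) * of_real (h i p ^ k)"
    by (simp add: power_mult_distrib mult_ac)
  then show ?thesis unfolding fibre_inner_def Let_def j_def by (simp add: bundle_power_def)
qed

lemma pow_inner_continuous:
  assumes h: "hermitian_metric A L h" and st: "s \<in> Sect" "t \<in> Sect"
  shows "continuous_on UNIV (pow_inner h s t)"
proof (rule continuous_at_imp_continuous_on, rule ballI)
  fix p
  obtain i where i: "p \<in> fdom i" using ex_fdom by blast
  have "continuous_on (fdom i) (h i)"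
  proof (rule continuous_on_charts[OF open_fdom])
    fix c assume "c \<in> A"
    then have "smooth_fun_on (h i \<circ> chart_inv c) (snd c ` (fst c \<inter> fdom i))"
      using h unfolding hermitian_metric_def smooth_on_mfd_def by blast
    then show "continuous_on (snd c ` (fst c \<inter> fdom i)) (h i \<circ> chart_inv c)"
      unfolding smooth_fun_on_def using Ck_on_imp_continuous_on by blast
  qed
  then have "continuous_on (fdom i) (\<lambda>p. s i p * cnj (t i p) * of_real (h i p ^ k))"
    by (intro continuous_on_mult continuous_on_cnj continuous_on_of_real continuous_on_power Sect_continuous st)
  then have "continuous_on (fdom i) (pow_inner h s t)"
    by (rule continuous_on_eq) (rule pow_inner_frame[OF h st, symmetric])
  then show "isCont (pow_inner h s t) p" using i open_fdom continuous_on_eq_continuous_at by blast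
qed

lemma volume_form_continuous:
  assumes "smooth_form A 2 \<omega>" "c \<in> A"
  shows "continuous_on (snd c ` fst c) (\<lambda>y. volume_form \<omega> c y vs)"
proof -
  have "continuous_on (snd c ` fst c) (\<lambda>y. \<omega> c y [v, w])" for v w
    by (rule Ck_on_imp_continuous_on[OF smooth_formD(1)[OF assms, of "[v, w]" 0]]) simp
  then show ?thesis
    unfolding volume_form_def
    by (intro continuous_on_divide continuous_on_sum continuous_on_mult continuous_on_const continuous_on_prod) auto
qed

text \<open>Sesquilinearity holds pointwise. To pass it through the integral each summand has to be
  integrable, which follows from continuity on the compact sets containing the pieces.\<close>

lemma background_inner_comb:
  assumes h: "hermitian_metric A L h" and \<omega>: "smooth_form A 2 \<omega>" and s: "\<And>j::'n::finite. s j \<in> Sect"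
  shows "background_inner A L h \<omega> k (\<lambda>i p. \<Sum>l\<in>UNIV. a l * s l i p) (\<lambda>i p. \<Sum>l\<in>UNIV. b l * s l i p) =
    (\<Sum>l\<in>UNIV. \<Sum>m\<in>UNIV. a l * cnj (b m) * background_inner A L h \<omega> k (s l) (s m))"
proof -
  let ?e = "std_frame :: (complex^'m) list"
  let ?v = "\<lambda>c y. volume_form \<omega> c y ?e"
  let ?F = "\<lambda>s t c B. set_lebesgue_integral lborel (snd c ` B) (\<lambda>y. pow_inner h s t (chart_inv c y) * ?v c y)"
  let ?a = "\<lambda>i p. \<Sum>l\<in>UNIV. a l * s l i p" and ?b = "\<lambda>i p. \<Sum>l\<in>UNIV. b l * s l i p"
  have G: "background_inner A L h \<omega> k s t = (\<Sum>(c, B)\<in>pieces. ?F s t c B)" for s t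
    unfolding background_inner_def L2_inner_def mfd_integral_def pieces_def ..
  have pt: "pow_inner h ?a ?b p = (\<Sum>x\<in>UNIV \<times> UNIV. a (fst x) * cnj (b (snd x)) * pow_inner h (s (fst x)) (s (snd x)) p)" for p
    unfolding fibre_inner_def Let_def cnj_sum sum_product sum.cartesian_product
    unfolding sum_distrib_right by (simp add: split_def mult_ac)
  have piece: "?F ?a ?b c B = (\<Sum>x\<in>UNIV \<times> UNIV. a (fst x) * cnj (b (snd x)) * ?F (s (fst x)) (s (snd x)) c B)"
    if cB: "(c, B) \<in> pieces" for c B
  proof -
    note c = pieces[OF cB]
    obtain K where K: "compact K" "B \<subseteq> K" "K \<subseteq> fst c" using c(4) by blast
    have Bb: "snd c ` B \<in> sets lborel"
      using borel_chart_image[OF c(1,2)] c(3) by (simp add: Int_absorb1)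
    have int: "set_integrable lborel (snd c ` B) (\<lambda>y. pow_inner h (s l) (s m) (chart_inv c y) * ?v c y)" for l m
    proof -
      have Kc: "snd c ` K \<subseteq> snd c ` fst c" using K(3) by blast
      have "continuous_on (snd c ` K) (\<lambda>y. pow_inner h (s l) (s m) (chart_inv c y) * ?v c y)"
        by (intro continuous_on_mult continuous_on_compose2[OF pow_inner_continuous[OF h s s] continuous_on_subset[OF chart(4)[OF c(1)] Kc] subset_UNIV]
            continuous_on_subset[OF volume_form_continuous[OF \<omega> c(1)] Kc])
      then have "set_integrable lborel (snd c ` K) (\<lambda>y. pow_inner h (s l) (s m) (chart_inv c y) * ?v c y)"
        unfolding set_integrable_def by (rule borel_integrable_compact[OF compact_chart_image[OF c(1) K(1,3)]])
      then show ?thesis by (rule set_integrable_subset[OF _ Bb]) (use K(2) in blast)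
    qed
    have "?F ?a ?b c B = set_lebesgue_integral lborel (snd c ` B)
        (\<lambda>y. \<Sum>x\<in>UNIV \<times> UNIV. a (fst x) * cnj (b (snd x)) * (pow_inner h (s (fst x)) (s (snd x)) (chart_inv c y) * ?v c y))"
      unfolding pt by (simp only: sum_distrib_right mult.assoc)
    also have "\<dots> = (\<Sum>x\<in>UNIV \<times> UNIV. set_lebesgue_integral lborel (snd c ` B)
        (\<lambda>y. a (fst x) * cnj (b (snd x)) * (pow_inner h (s (fst x)) (s (snd x)) (chart_inv c y) * ?v c y)))"
      by (rule set_integral_sum) (rule set_integrable_mult_right[OF int])
    finally show ?thesis unfolding set_integral_mult_right .
  qed
  have "background_inner A L h \<omega> k ?a ?b = (\<Sum>z\<in>pieces. \<Sum>x\<in>UNIV \<times> UNIV. a (fst x) * cnj (b (snd x)) * ?F (s (fst x)) (s (snd x)) (fst z) (snd z))"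
    unfolding G split_def by (rule sum.cong[OF refl], rule piece) simp
  also have "\<dots> = (\<Sum>x\<in>UNIV \<times> UNIV. a (fst x) * cnj (b (snd x)) * background_inner A L h \<omega> k (s (fst x)) (s (snd x)))"
    unfolding G split_def sum_distrib_left by (rule sum.swap)
  finally show ?thesis by (simp add: sum.cartesian_product split_def)
qed

end

section \<open>Unitary matrices and weights\<close>

definition orthonormal_rows :: "nat \<Rightarrow> (nat \<Rightarrow> 'n::finite \<Rightarrow> complex) \<Rightarrow> bool" where
  "orthonormal_rows r C \<longleftrightarrow> (\<forall>j<r. \<forall>l<r. (\<Sum>m\<in>UNIV. C j m * cnj (C l m)) = (if j = l then 1 else 0))"

text \<open>A square matrix with a zero row is singular, which yields a vector orthogonal to all rows.\<close>

lemma orthonormal_rows_extend: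
  fixes C :: "nat \<Rightarrow> 'n::finite \<Rightarrow> complex"
  assumes "orthonormal_rows r C" "r < CARD('n)"
  shows "\<exists>w. orthonormal_rows (Suc r) (C(r := w))"
proof -
  obtain e where e: "bij_betw e {..<CARD('n)} (UNIV :: 'n set)"
    using ex_bij_betw_nat_finite[OF finite, of UNIV] by (auto simp: atLeast0LessThan)
  define f where "f = inv_into {..<CARD('n)} e"
  have fe: "f (e j) = j" if "j < CARD('n)" for j
    unfolding f_def by (rule bij_betw_inv_into_left[OF e]) (use that in simp)
  define M :: "complex^'n^'n" where "M = (\<chi> a b. if f a < r then C (f a) b else 0)"
  have "\<not> (\<exists>B. B ** M = mat 1)"
  proof
    assume "\<exists>B. B ** M = mat 1"
    then obtain B where "M ** B = mat 1" using matrix_left_right_inverse by blast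
    then have "(M ** B) $ e r $ e r = 1" by (simp add: mat_def)
    moreover have "(M ** B) $ e r $ e r = 0" by (simp add: matrix_matrix_mult_def M_def fe[OF assms(2)])
    ultimately show False by simp
  qed
  then obtain v where v: "M *v v = 0" "v \<noteq> 0" unfolding matrix_left_invertible_ker by blast
  define N where "N = (\<Sum>m\<in>UNIV. (cmod (v $ m))\<^sup>2)"
  obtain m where "v $ m \<noteq> 0" using v(2) by (auto simp: vec_eq_iff)
  then have "0 < (cmod (v $ m))\<^sup>2" by simp
  also have "\<dots> \<le> N" unfolding N_def by (rule member_le_sum) auto
  finally have N: "N > 0" .
  \<comment> \<open>The kernel equation contains no conjugate while orthogonality does, hence w is
    the normalised conjugate of v.\<close>
  define w where "w m = cnj (v $ m) / of_real (sqrt N)" for m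
  have orth: "(\<Sum>m\<in>UNIV. C j m * cnj (w m)) = 0" if "j < r" for j
  proof -
    have "(M *v v) $ e j = (\<Sum>m\<in>UNIV. C j m * v $ m)"
      using that assms(2) by (simp add: matrix_vector_mult_def M_def fe)
    then have "(\<Sum>m\<in>UNIV. C j m * v $ m) = 0" using v(1) by simp
    then show ?thesis by (simp add: w_def sum_divide_distrib[symmetric])
  qed
  have orth': "(\<Sum>m\<in>UNIV. w m * cnj (C j m)) = 0" if "j < r" for j
  proof -
    have "cnj (\<Sum>m\<in>UNIV. C j m * cnj (w m)) = 0" using orth[OF that] by simp
    then show ?thesis by (simp add: mult.commute)
  qed
  have norm: "(\<Sum>m\<in>UNIV. w m * cnj (w m)) = 1"
  proof -
    have "w m * cnj (w m) = of_real ((cmod (v $ m))\<^sup>2 / N)" for m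
    proof -
      have "w m * cnj (w m) = of_real ((cmod (w m))\<^sup>2)" by (rule complex_norm_square[symmetric])
      also have "(cmod (w m))\<^sup>2 = (cmod (v $ m))\<^sup>2 / N" using N by (simp add: w_def norm_divide power_divide)
      finally show ?thesis .
    qed
    then have "(\<Sum>m\<in>UNIV. w m * cnj (w m)) = of_real (\<Sum>m\<in>UNIV. (cmod (v $ m))\<^sup>2 / N)" by simp
    also have "(\<Sum>m\<in>UNIV. (cmod (v $ m))\<^sup>2 / N) = 1"
      using N by (simp add: sum_divide_distrib[symmetric] N_def[symmetric])
    finally show ?thesis by simp
  qed
  have "orthonormal_rows (Suc r) (C(r := w))"
    using assms(1) orth orth' norm unfolding orthonormal_rows_def less_Suc_eq by simp
  then show ?thesis by blast
qed

text \<open>Rows are added one at a time. A bijection with the index type then arranges the numbered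
  rows in a matrix, and e records where the prescribed ones sit.\<close>

lemma unitary_completion:
  fixes C :: "nat \<Rightarrow> 'n::finite \<Rightarrow> complex"
  assumes "orthonormal_rows r C" "r \<le> CARD('n)"
  shows "\<exists>(U :: complex^'n^'n) e. unitary_matrix U \<and> inj_on e {..<r} \<and> (\<forall>j<r. \<forall>l. U $ e j $ l = C j l)"
proof -
  have "\<exists>C'. orthonormal_rows (r + d) C' \<and> (\<forall>j<r. C' j = C j)" if "r + d \<le> CARD('n)" for d
    using that
  proof (induction d)
    case 0
    then show ?case using assms(1) by auto
  next
    case (Suc d)
    then obtain C' where C': "orthonormal_rows (r + d) C'" "\<forall>j<r. C' j = C j" by auto
    obtain w where "orthonormal_rows (Suc (r + d)) (C'(r + d := w))"
      using orthonormal_rows_extend[OF C'(1)] Suc.prems by (auto simp del: fun_upd_apply)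
    moreover have "\<forall>j<r. (C'(r + d := w)) j = C j" using C'(2) by simp
    ultimately show ?case by (intro exI[of _ "C'(r + d := w)"] conjI) (simp_all only: add_Suc_right)
  qed
  from this[of "CARD('n) - r"] obtain C' where C': "orthonormal_rows CARD('n) C'" "\<forall>j<r. C' j = C j"
    using assms(2) by auto
  obtain e where e: "bij_betw e {..<CARD('n)} (UNIV :: 'n set)"
    using ex_bij_betw_nat_finite[OF finite, of UNIV] by (auto simp: atLeast0LessThan)
  define f where "f = inv_into {..<CARD('n)} e"
  have fe: "f (e j) = j" if "j < CARD('n)" for j
    unfolding f_def by (rule bij_betw_inv_into_left[OF e]) (use that in simp)
  have f: "f a < CARD('n)" "e (f a) = a" for a
    using bij_betw_apply[OF bij_betw_inv_into[OF e], of a] bij_betw_inv_into_right[OF e, of a] unfolding f_def by auto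
  define U :: "complex^'n^'n" where "U = (\<chi> a l. C' (f a) l)"
  have "unitary_matrix U"
    unfolding unitary_matrix_def
  proof (rule vec_eq_iff[THEN iffD2], rule allI, rule vec_eq_iff[THEN iffD2], rule allI)
    fix a b
    have "(U ** (\<chi> a b. cnj (U $ b $ a))) $ a $ b = (\<Sum>m\<in>UNIV. C' (f a) m * cnj (C' (f b) m))"
      by (simp add: matrix_matrix_mult_def U_def)
    also have "\<dots> = (if f a = f b then 1 else 0)"
      using C'(1) f(1) unfolding orthonormal_rows_def by blast
    also have "\<dots> = mat 1 $ a $ b"
      using f(2) by (metis (mono_tags, lifting) mat_def vec_lambda_beta)
    finally show "(U ** (\<chi> a b. cnj (U $ b $ a))) $ a $ b = mat 1 $ a $ b" .
  qed
  moreover have "inj_on e {..<r}"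
    by (rule inj_on_subset[OF bij_betw_imp_inj_on[OF e]]) (use assms(2) in auto)
  moreover have "\<forall>j<r. \<forall>l. U $ e j $ l = C j l"
    using C'(2) assms(2) fe by (simp add: U_def)
  ultimately show ?thesis by blast
qed

section \<open>Weights with simple or prescribed maximum\<close>

lemma top_weights_eqI:
  assumes "T \<noteq> {}" "\<And>j. j \<in> T \<Longrightarrow> \<Lambda> $ j = m" "\<And>j. j \<notin> T \<Longrightarrow> \<Lambda> $ j < m"
  shows "top_weights (\<Lambda> :: real^'n::finite) = T"
proof -
  have "Max (range (($) \<Lambda>)) = m"
  proof (rule Max_eqI)
    show "y \<le> m" if "y \<in> range (($) \<Lambda>)" for y
    proof -
      from that obtain j where "y = \<Lambda> $ j" by blast
      then show ?thesis using assms(2,3)[of j] by (cases "j \<in> T") auto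
    qed
    obtain j where "j \<in> T" using assms(1) by blast
    then have "m = \<Lambda> $ j" using assms(2) by simp
    then show "m \<in> range (($) \<Lambda>)" by (rule range_eqI)
  qed simp
  then show ?thesis
    unfolding top_weights_def using assms(2,3) by (auto simp: order.strict_iff_order)
qed

lemma top_weights_le: "(\<Lambda> :: real^'n::finite) $ j \<le> Max (range (($) \<Lambda>))"
  by (rule Max_ge) auto

lemma top_weights_nonempty: "top_weights (\<Lambda> :: real^'n::finite) \<noteq> {}"
proof -
  have "Max (range (($) \<Lambda>)) \<in> range (($) \<Lambda>)" by (rule Max_in) auto
  then obtain j where "\<Lambda> $ j = Max (range (($) \<Lambda>))" by (metis imageE)
  then show ?thesis unfolding top_weights_def by blast
qed

lemma top_multiplicity_eq_1_iff:
  "top_multiplicity (\<Lambda> :: real^'n::finite) = 1 \<longleftrightarrow> (\<exists>j. \<forall>l. l \<noteq> j \<longrightarrow> \<Lambda> $ l < \<Lambda> $ j)"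
proof
  assume "top_multiplicity \<Lambda> = 1"
  then obtain j where j: "top_weights \<Lambda> = {j}" unfolding top_multiplicity_def card_1_singleton_iff One_nat_def by blast
  then have "\<Lambda> $ j = Max (range (($) \<Lambda>))" unfolding top_weights_def by blast
  moreover have "\<Lambda> $ l \<noteq> Max (range (($) \<Lambda>))" if "l \<noteq> j" for l
    using j that unfolding top_weights_def by blast
  ultimately have "\<forall>l. l \<noteq> j \<longrightarrow> \<Lambda> $ l < \<Lambda> $ j" using top_weights_le[of \<Lambda>] by (simp add: order.strict_iff_order)
  then show "\<exists>j. \<forall>l. l \<noteq> j \<longrightarrow> \<Lambda> $ l < \<Lambda> $ j" by blast
next
  assume "\<exists>j. \<forall>l. l \<noteq> j \<longrightarrow> \<Lambda> $ l < \<Lambda> $ j"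
  then obtain j where "\<And>l. l \<noteq> j \<Longrightarrow> \<Lambda> $ l < \<Lambda> $ j" by blast
  then have "top_weights \<Lambda> = {j}" by (intro top_weights_eqI[of _ _ "\<Lambda> $ j"]) auto
  then show "top_multiplicity \<Lambda> = 1" by (simp add: top_multiplicity_def)
qed

lemma open_simple_top: "open {\<Lambda> :: real^'n::finite. top_multiplicity \<Lambda> = 1}"
proof -
  have "{\<Lambda> :: real^'n. top_multiplicity \<Lambda> = 1} = (\<Union>j. \<Inter>l\<in>- {j}. {\<Lambda>. \<Lambda> $ l < \<Lambda> $ j})"
    unfolding top_multiplicity_eq_1_iff by auto
  then show ?thesis
    by (simp only:) (intro open_UN open_INT ballI open_Collect_less continuous_intros finite)
qed

text \<open>A simple maximum is expressed by finitely many strict inequalities, which gives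
  openness. For density, one of the top weights is raised slightly relative to all others.\<close>

lemma simple_top_generic:
  fixes E :: "(real^'n::finite) set" and X :: "'x::metric_space set"
  assumes "E = UNIV \<or> E = {\<Lambda>. (\<Sum>j\<in>UNIV. \<Lambda> $ j) = 0}"
  shows "openin (top_of_set (X \<times> E)) {(U, \<Lambda>). U \<in> X \<and> \<Lambda> \<in> E \<and> top_multiplicity \<Lambda> = 1}"
    and "X \<times> E \<subseteq> closure {(U, \<Lambda>). U \<in> X \<and> \<Lambda> \<in> E \<and> top_multiplicity \<Lambda> = 1}"
proof -
  have "{(U, \<Lambda>). U \<in> X \<and> \<Lambda> \<in> E \<and> top_multiplicity \<Lambda> = 1} = (X \<times> E) \<inter> (UNIV \<times> {\<Lambda>. top_multiplicity \<Lambda> = 1})"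
    by auto
  then show "openin (top_of_set (X \<times> E)) {(U, \<Lambda>). U \<in> X \<and> \<Lambda> \<in> E \<and> top_multiplicity \<Lambda> = 1}"
    using openin_open_Int[OF open_Times[OF open_UNIV open_simple_top]] by simp
  show "X \<times> E \<subseteq> closure {(U, \<Lambda>). U \<in> X \<and> \<Lambda> \<in> E \<and> top_multiplicity \<Lambda> = 1}"
  proof
    fix z assume "z \<in> X \<times> E"
    then obtain U \<Lambda> where z: "z = (U, \<Lambda>)" "U \<in> X" "\<Lambda> \<in> E" by blast
    obtain j where j: "j \<in> top_weights \<Lambda>" using top_weights_nonempty by blast
    then have jm: "\<Lambda> $ l \<le> \<Lambda> $ j" for l
      using top_weights_le[of \<Lambda> l] unfolding top_weights_def by simp
    \<comment> \<open>Subtracting 1/n from all entries, n being their number, gives w trace zero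
      without affecting differences of weights, so the perturbation stays in E in both
      cases.\<close>
    define w :: "real^'n" where "w = (\<chi> l. (if l = j then 1 else 0) - 1 / real CARD('n))"
    have w0: "(\<Sum>l\<in>UNIV. w $ l) = 0" by (simp add: w_def sum_subtractf)
    let ?x = "\<lambda>n. (U, \<Lambda> + inverse (real (Suc n)) *\<^sub>R w)"
    have "?x n \<in> {(U, \<Lambda>). U \<in> X \<and> \<Lambda> \<in> E \<and> top_multiplicity \<Lambda> = 1}" for n
    proof -
      let ?\<epsilon> = "inverse (real (Suc n))"
      have "\<Lambda> + ?\<epsilon> *\<^sub>R w \<in> E"
        using assms z(3) w0 by (auto simp: sum.distrib sum_distrib_left[symmetric])
      moreover have "(\<Lambda> + ?\<epsilon> *\<^sub>R w) $ l < (\<Lambda> + ?\<epsilon> *\<^sub>R w) $ j" if "l \<noteq> j" for l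
      proof -
        have "?\<epsilon> * w $ l < ?\<epsilon> * w $ j"
          by (rule mult_strict_left_mono) (use that in \<open>simp_all add: w_def\<close>)
        then show ?thesis
          unfolding vector_add_component vector_scaleR_component real_scaleR_def by (rule add_le_less_mono[OF jm])
      qed
      ultimately show ?thesis using z(2) unfolding top_multiplicity_eq_1_iff by blast
    qed
    moreover have "?x \<longlonglongrightarrow> (U, \<Lambda> + 0 *\<^sub>R w)"
      by (intro tendsto_intros LIMSEQ_inverse_real_of_nat)
    ultimately show "z \<in> closure {(U, \<Lambda>). U \<in> X \<and> \<Lambda> \<in> E \<and> top_multiplicity \<Lambda> = 1}"
      unfolding closure_sequential z(1) by (intro exI[of _ ?x]) simp
  qed
qed

lemma ex_trace_zero_weights:
  fixes T :: "'n::finite set"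
  assumes "T \<noteq> {}"
  shows "\<exists>\<Lambda> :: real^'n. (\<Sum>j\<in>UNIV. \<Lambda> $ j) = 0 \<and> top_weights \<Lambda> = T"
proof -
  let ?n = "real CARD('n)" and ?r = "real (card T)"
  \<comment> \<open>With n weights and r of them in T, the trace is r n - n r = 0, and the entries
    in T exceed the others by n.\<close>
  define \<Lambda> :: "real^'n" where "\<Lambda> = (\<chi> j. (if j \<in> T then ?n else 0) - ?r)"
  have "(\<Sum>j\<in>UNIV. \<Lambda> $ j) = 0"
    by (simp add: \<Lambda>_def sum_subtractf sum.If_cases)
  moreover have "top_weights \<Lambda> = T"
    by (rule top_weights_eqI[OF assms, of _ "?n - ?r"]) (simp_all add: \<Lambda>_def)
  ultimately show ?thesis by blast
qed

section \<open>Limits of Bergman geodesic rays\<close>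

lemma bergman_ray_eq:
  "bergman_ray k s U \<Lambda> = (\<lambda>t. weighted_potential k UNIV (\<lambda>j. exp (t * \<Lambda> $ j)) (rotated_basis s U))"
  by (simp add: fun_eq_iff bergman_ray_def weighted_potential_def)

lemma log_sum_potential_eq: "log_sum_potential k J \<sigma> = weighted_potential k J (\<lambda>j. 1) \<sigma>"
  by (simp add: fun_eq_iff log_sum_potential_def weighted_potential_def)

lemma zero_potential_eq: "zero_potential k \<sigma> = log_sum_potential k {()} (\<lambda>_. \<sigma>)"
  by (simp add: fun_eq_iff log_sum_potential_def zero_potential_def)

locale bergman_rays = polarized_mfd A L k
  for A :: "('a::t2_space, 'm::finite) chart set" and L :: "('a, 'i) line_bundle" and k :: nat +
  fixes s :: "'n::finite \<Rightarrow> ('a, 'i) sect"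
  assumes basis: "sect_basis A (bundle_power L k) UNIV s"
begin

lemma basis_Sect: "s j \<in> Sect"
  and basis_span: "t \<in> Sect \<Longrightarrow> \<exists>c. t = sect_comb UNIV c s"
  and basis_indep: "sect_comb UNIV c s = (\<lambda>i p. 0) \<Longrightarrow> c j = 0"
  using basis unfolding sect_basis_def by blast+

lemma rotated_Sect: "rotated_basis s U j \<in> Sect"
  unfolding rotated_basis_def by (rule Sect_comb) (rule basis_Sect)

lemma rotated_nonzero:
  assumes "unitary_matrix U"
  shows "rotated_basis s U j \<noteq> (\<lambda>i p. 0)"
proof
  assume "rotated_basis s U j = (\<lambda>i p. 0)"
  then have "sect_comb UNIV (\<lambda>l. U $ j $ l) s = (\<lambda>i p. 0)"
    by (simp add: rotated_basis_def sect_comb_def)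
  from basis_indep[OF this] have z: "U $ j $ l = 0" for l .
  have "(U ** (\<chi> a b. cnj (U $ b $ a))) $ j $ j = 1"
    using assms unfolding unitary_matrix_def by (simp add: mat_def)
  then show False by (simp add: matrix_matrix_mult_def z)
qed

lemma ray_limit:
  assumes "unitary_matrix U" "finite J" "\<And>j. j \<in> J \<Longrightarrow> \<sigma> j \<in> Sect" "l \<in> J" "\<sigma> l \<noteq> (\<lambda>i p. 0)" "b > 0"
    "\<And>i p. (\<Sum>j\<in>J. (cmod (\<sigma> j i p))\<^sup>2) = b * (\<Sum>j\<in>top_weights \<Lambda>. (cmod (rotated_basis s U j i p))\<^sup>2)"
  shows "ddbar_tendsto_weakly A L (bergman_ray k s U \<Lambda>) (log_sum_potential k J \<sigma>)"
proof -
  obtain j where j: "j \<in> top_weights \<Lambda>" using top_weights_nonempty by blast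
  show ?thesis
    unfolding bergman_ray_eq log_sum_potential_eq
    by (rule ray_tendsto_weakly[where m = "Max (range (($) \<Lambda>))" and Top = "top_weights \<Lambda>" and l = j and l' = l and b = b])
      (fact rotated_Sect top_weights_def top_weights_le j rotated_nonzero[OF assms(1)] assms)+
qed

lemma ray_limit_top:
  assumes "unitary_matrix U"
  shows "ddbar_tendsto_weakly A L (bergman_ray k s U \<Lambda>) (log_sum_potential k (top_weights \<Lambda>) (rotated_basis s U))"
proof -
  obtain j where j: "j \<in> top_weights \<Lambda>" using top_weights_nonempty by blast
  show ?thesis
    by (rule ray_limit[OF assms finite rotated_Sect j rotated_nonzero[OF assms], of 1]) simp_all
qed

lemma ex_ray:
  assumes "orthonormal_rows r C" "1 \<le> r" "r \<le> CARD('n)"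
  shows "\<exists>(U :: complex^'n^'n) \<Lambda> e. unitary_matrix U \<and> (\<Sum>j\<in>UNIV. \<Lambda> $ j) = 0 \<and> inj_on e {..<r} \<and>
    top_weights \<Lambda> = e ` {..<r} \<and> (\<forall>j<r. rotated_basis s U (e j) = sect_comb UNIV (C j) s)"
proof -
  obtain U :: "complex^'n^'n" and e where U: "unitary_matrix U" "inj_on e {..<r}" "\<forall>j<r. \<forall>l. U $ e j $ l = C j l"
    using unitary_completion[OF assms(1,3)] by blast
  have "e ` {..<r} \<noteq> {}" using assms(2) by (simp add: lessThan_empty_iff)
  from ex_trace_zero_weights[OF this]
  obtain \<Lambda> :: "real^'n" where "(\<Sum>j\<in>UNIV. \<Lambda> $ j) = 0" "top_weights \<Lambda> = e ` {..<r}" by blast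
  moreover have "\<forall>j<r. rotated_basis s U (e j) = sect_comb UNIV (C j) s"
    using U(3) by (simp add: rotated_basis_def sect_comb_def)
  ultimately show ?thesis using U(1,2) by blast
qed

text \<open>The coefficient vector of \<sigma> divided by its length is a unit row, hence a row of
  some unitary matrix. The squared length N relates |\<sigma>|^2 to the modulus of that rotated
  section and becomes the factor b of \<open>ray_limit\<close>.\<close>

lemma ex_ray_to_section:
  assumes \<sigma>: "\<sigma> \<in> Sect" "\<sigma> \<noteq> (\<lambda>i p. 0)"
  shows "\<exists>(U :: complex^'n^'n) \<Lambda>. unitary_matrix U \<and> (\<Sum>j\<in>UNIV. \<Lambda> $ j) = 0 \<and> top_multiplicity \<Lambda> = 1 \<and>
    ddbar_tendsto_weakly A L (bergman_ray k s U \<Lambda>) (zero_potential k \<sigma>)"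
proof -
  obtain c where c: "\<sigma> = sect_comb UNIV c s" using basis_span[OF \<sigma>(1)] by blast
  define N where "N = (\<Sum>l\<in>UNIV. (cmod (c l))\<^sup>2)"
  have "\<exists>l. c l \<noteq> 0"
    using \<sigma>(2) unfolding c sect_comb_def by (rule contrapos_np) simp
  then obtain l where "c l \<noteq> 0" by blast
  then have "0 < (cmod (c l))\<^sup>2" by simp
  also have "\<dots> \<le> N" unfolding N_def by (rule member_le_sum) auto
  finally have N: "N > 0" .
  define C where "C (j::nat) l = c l / of_real (sqrt N)" for j l
  have "(\<Sum>m\<in>UNIV. C 0 m * cnj (C 0 m)) = of_real (\<Sum>m\<in>UNIV. (cmod (c m))\<^sup>2 / N)"
    unfolding of_real_sum
  proof (rule sum.cong[OF refl])
    fix m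
    have "C 0 m * cnj (C 0 m) = of_real ((cmod (C 0 m))\<^sup>2)" by (rule complex_norm_square[symmetric])
    also have "(cmod (C 0 m))\<^sup>2 = (cmod (c m))\<^sup>2 / N" using N by (simp add: C_def norm_divide power_divide)
    finally show "C 0 m * cnj (C 0 m) = of_real ((cmod (c m))\<^sup>2 / N)" .
  qed
  also have "(\<Sum>m\<in>UNIV. (cmod (c m))\<^sup>2 / N) = 1"
    using N by (simp add: sum_divide_distrib[symmetric] N_def[symmetric])
  finally have "orthonormal_rows 1 C" unfolding orthonormal_rows_def by simp
  from ex_ray[OF this] obtain U :: "complex^'n^'n" and \<Lambda> :: "real^'n" and e
    where U: "unitary_matrix U" "(\<Sum>j\<in>UNIV. \<Lambda> $ j) = 0" "top_weights \<Lambda> = e ` {..<1::nat}"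
      "\<forall>j<1. rotated_basis s U (e j) = sect_comb UNIV (C j) s"
    by auto
  have top: "top_weights \<Lambda> = {e 0}" using U(3) by auto
  have rot: "(cmod (\<sigma> i p))\<^sup>2 = N * (cmod (rotated_basis s U (e 0) i p))\<^sup>2" for i p
  proof -
    have "rotated_basis s U (e 0) i p = \<sigma> i p / of_real (sqrt N)"
      using U(4) by (simp add: c sect_comb_def C_def sum_divide_distrib)
    then show ?thesis using N by (simp add: norm_divide power_divide)
  qed
  have "ddbar_tendsto_weakly A L (bergman_ray k s U \<Lambda>) (zero_potential k \<sigma>)"
    unfolding zero_potential_eq
    by (rule ray_limit[OF U(1), of "{()}" "\<lambda>_. \<sigma>" "()" N]) (simp_all add: \<sigma> N top rot)
  then show ?thesis using U(1,2) top by (intro exI[of _ U] exI[of _ \<Lambda>]) (simp add: top_multiplicity_def)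
qed

text \<open>As s is orthonormal, the inner products of the sections are the Hermitian products of
  their coefficient rows, and orthonormal rows complete to a unitary matrix.\<close>

lemma ex_ray_to_orthonormal_sections:
  assumes h: "hermitian_metric A L h" and \<omega>: "smooth_form A 2 \<omega>"
    and s: "orthonormal_sects (background_inner A L h \<omega> k) UNIV s"
    and r: "1 \<le> r" "r \<le> CARD('n)" and \<sigma>: "\<And>j. j < r \<Longrightarrow> \<sigma> j \<in> Sect"
    and on: "orthonormal_sects (background_inner A L h \<omega> k) {..<r} \<sigma>"
  shows "\<exists>(U :: complex^'n^'n) \<Lambda>. unitary_matrix U \<and> (\<Sum>j\<in>UNIV. \<Lambda> $ j) = 0 \<and> top_multiplicity \<Lambda> = r \<and>
    ddbar_tendsto_weakly A L (bergman_ray k s U \<Lambda>) (log_sum_potential k {..<r} \<sigma>)"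
proof -
  have "\<forall>j. \<exists>c. j < r \<longrightarrow> \<sigma> j = sect_comb UNIV c s" using basis_span \<sigma> by blast
  then obtain C where C: "\<And>j. j < r \<Longrightarrow> \<sigma> j = sect_comb UNIV (C j) s" by metis
  let ?G = "background_inner A L h \<omega> k"
  have "orthonormal_rows r C"
    unfolding orthonormal_rows_def
  proof (intro allI impI)
    fix j l assume jl: "j < r" "l < r"
    have "?G (\<sigma> j) (\<sigma> l) = (\<Sum>a\<in>UNIV. \<Sum>b\<in>UNIV. C j a * cnj (C l b) * ?G (s a) (s b))"
      unfolding C[OF jl(1)] C[OF jl(2)] sect_comb_def by (rule background_inner_comb[OF h \<omega> basis_Sect])
    also have "\<dots> = (\<Sum>a\<in>UNIV. \<Sum>b\<in>UNIV. if a = b then C j a * cnj (C l b) else 0)"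
      using s unfolding orthonormal_sects_def by (intro sum.cong refl) simp
    also have "\<dots> = (\<Sum>a\<in>UNIV. C j a * cnj (C l a))" by simp
    finally show "(\<Sum>m\<in>UNIV. C j m * cnj (C l m)) = (if j = l then 1 else 0)"
      using on jl unfolding orthonormal_sects_def by simp
  qed
  from ex_ray[OF this r] obtain U :: "complex^'n^'n" and \<Lambda> :: "real^'n" and e
    where U: "unitary_matrix U" "(\<Sum>j\<in>UNIV. \<Lambda> $ j) = 0" "inj_on e {..<r}" "top_weights \<Lambda> = e ` {..<r}"
      "\<forall>j<r. rotated_basis s U (e j) = sect_comb UNIV (C j) s"
    by auto
  have rot: "rotated_basis s U (e j) = \<sigma> j" if "j < r" for j using U(5) C that by simp
  have "ddbar_tendsto_weakly A L (bergman_ray k s U \<Lambda>) (log_sum_potential k {..<r} \<sigma>)"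
  proof (rule ray_limit[OF U(1), of "{..<r}" \<sigma> 0 1])
    show "0 \<in> {..<r}" using r(1) by simp
    \<comment> \<open>\<sigma> 0 is a row of a unitary matrix applied to the linearly independent
      sections s.\<close>
    show "\<sigma> 0 \<noteq> (\<lambda>i p. 0)" using rotated_nonzero[OF U(1), of "e 0"] rot[of 0] r(1) by simp
    fix i p
    have "(\<Sum>j\<in>top_weights \<Lambda>. (cmod (rotated_basis s U j i p))\<^sup>2) = (\<Sum>j<r. (cmod (\<sigma> j i p))\<^sup>2)"
      unfolding U(4) sum.reindex[OF U(3)] by (rule sum.cong) (simp_all add: rot)
    then show "(\<Sum>j<r. (cmod (\<sigma> j i p))\<^sup>2) = 1 * (\<Sum>j\<in>top_weights \<Lambda>. (cmod (rotated_basis s U j i p))\<^sup>2)" by simp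
  qed (simp_all add: \<sigma>)
  then show ?thesis
    using U(1,2) card_image[OF U(3)] by (intro exI[of _ U] exI[of _ \<Lambda>]) (simp add: top_multiplicity_def U(4))
qed

end

text \<open>Weights of trace zero are the initial vectors tangent to SL / SU; adding a constant to
  all weights only adds a function of t to the potentials and leaves their currents unchanged. A
  unitary U carries the orthonormal basis to an orthonormal one, so the sections of top weight are
  always orthonormal, and conversely every orthonormal set is shown to occur.\<close>

theorem proposition5p1:
  fixes A :: "('a::t2_space, 'm::finite) chart set"
    and L :: "('a, 'i) line_bundle"
    and \<omega>\<^sub>0 :: "('a, 'm) mform"
    and h :: "'i \<Rightarrow> 'a \<Rightarrow> real"
    and k :: nat
    and s :: "'n::finite \<Rightarrow> ('a, 'i) sect"
  assumes manifold: "compact_complex_manifold A"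
    and kaehler: "kaehler_form A \<omega>\<^sub>0"
    and line: "holo_line_bundle A L"
    and ample: "ample A L"
    and chern: "first_chern_class_is A L \<omega>\<^sub>0"
    and metric: "hermitian_metric A L h"
    and curvature: "has_curvature A L h \<omega>\<^sub>0"
    and k: "1 \<le> k"
    and basis: "sect_basis A (bundle_power L k) UNIV s"
    and embedding: "projective_embedding A (bundle_power L k) UNIV s"
    and orthonormal: "orthonormal_sects (background_inner A L h \<omega>\<^sub>0 k) UNIV s"
  shows
    "\<comment> \<open>the set of initial vectors with simple highest weight is generic (open and dense), with
        or without the normalization to trace zero\<close>
     (\<forall>E \<in> {UNIV, {\<Lambda> :: real^'n. (\<Sum>j\<in>UNIV. \<Lambda> $ j) = 0}}.
        openin (top_of_set ({U :: complex^'n^'n. unitary_matrix U} \<times> E))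
          {(U, \<Lambda>). unitary_matrix U \<and> \<Lambda> \<in> E \<and> top_multiplicity \<Lambda> = 1} \<and>
        {U :: complex^'n^'n. unitary_matrix U} \<times> E
          \<subseteq> closure {(U, \<Lambda>). unitary_matrix U \<and> \<Lambda> \<in> E \<and> top_multiplicity \<Lambda> = 1}) \<and>
     \<comment> \<open>for these the limit is the normalized zero distribution of a section\<close>
     (\<forall>(U :: complex^'n^'n) (\<Lambda> :: real^'n).
        unitary_matrix U \<and> top_multiplicity \<Lambda> = 1 \<longrightarrow>
        (\<exists>j. top_weights \<Lambda> = {j} \<and>
           rotated_basis s U j \<in> H0 A (bundle_power L k) \<and> rotated_basis s U j \<noteq> (\<lambda>i p. 0) \<and>
           ddbar_tendsto_weakly A L (bergman_ray k s U \<Lambda>)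
             (zero_potential k (rotated_basis s U j)))) \<and>
     \<comment> \<open>the limit for arbitrary multiplicity of the highest weight\<close>
     (\<forall>(U :: complex^'n^'n) (\<Lambda> :: real^'n) r.
        unitary_matrix U \<and> top_multiplicity \<Lambda> = r \<longrightarrow>
        1 \<le> r \<and> r \<le> CARD('n) \<and>
        ddbar_tendsto_weakly A L (bergman_ray k s U \<Lambda>)
          (log_sum_potential k (top_weights \<Lambda>) (rotated_basis s U))) \<and>
     \<comment> \<open>every nonzero section, and every orthonormal set of sections, occurs in the limit\<close>
     (\<forall>\<sigma>\<in>H0 A (bundle_power L k). \<sigma> \<noteq> (\<lambda>i p. 0) \<longrightarrow>
        (\<exists>(U :: complex^'n^'n) (\<Lambda> :: real^'n).
           unitary_matrix U \<and> (\<Sum>j\<in>UNIV. \<Lambda> $ j) = 0 \<and> top_multiplicity \<Lambda> = 1 \<and>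
           ddbar_tendsto_weakly A L (bergman_ray k s U \<Lambda>) (zero_potential k \<sigma>))) \<and>
     (\<forall>r (\<sigma> :: nat \<Rightarrow> ('a, 'i) sect).
        1 \<le> r \<and> r \<le> CARD('n) \<and> (\<forall>j<r. \<sigma> j \<in> H0 A (bundle_power L k)) \<and>
        orthonormal_sects (background_inner A L h \<omega>\<^sub>0 k) {..<r} \<sigma> \<longrightarrow>
        (\<exists>(U :: complex^'n^'n) (\<Lambda> :: real^'n).
           unitary_matrix U \<and> (\<Sum>j\<in>UNIV. \<Lambda> $ j) = 0 \<and> top_multiplicity \<Lambda> = r \<and>
           ddbar_tendsto_weakly A L (bergman_ray k s U \<Lambda>) (log_sum_potential k {..<r} \<sigma>)))"
proof -
  interpret bergman_rays A L k s
    by unfold_locales (fact manifold line k basis)+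
  have \<omega>: "smooth_form A 2 \<omega>\<^sub>0"
    using kaehler unfolding kaehler_form_def smooth_form_pq_def one_add_one by blast
  show ?thesis
  proof (intro conjI)
    show "\<forall>E \<in> {UNIV, {\<Lambda> :: real^'n. (\<Sum>j\<in>UNIV. \<Lambda> $ j) = 0}}.
        openin (top_of_set ({U :: complex^'n^'n. unitary_matrix U} \<times> E))
          {(U, \<Lambda>). unitary_matrix U \<and> \<Lambda> \<in> E \<and> top_multiplicity \<Lambda> = 1} \<and>
        {U :: complex^'n^'n. unitary_matrix U} \<times> E
          \<subseteq> closure {(U, \<Lambda>). unitary_matrix U \<and> \<Lambda> \<in> E \<and> top_multiplicity \<Lambda> = 1}"
    proof
      fix E :: "(real^'n) set" assume "E \<in> {UNIV, {\<Lambda>. (\<Sum>j\<in>UNIV. \<Lambda> $ j) = 0}}"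
      then have "E = UNIV \<or> E = {\<Lambda>. (\<Sum>j\<in>UNIV. \<Lambda> $ j) = 0}" by blast
      from simple_top_generic[OF this, of "{U :: complex^'n^'n. unitary_matrix U}"]
      show "openin (top_of_set ({U :: complex^'n^'n. unitary_matrix U} \<times> E))
          {(U, \<Lambda>). unitary_matrix U \<and> \<Lambda> \<in> E \<and> top_multiplicity \<Lambda> = 1} \<and>
        {U :: complex^'n^'n. unitary_matrix U} \<times> E
          \<subseteq> closure {(U, \<Lambda>). unitary_matrix U \<and> \<Lambda> \<in> E \<and> top_multiplicity \<Lambda> = 1}"
        unfolding mem_Collect_eq by (rule conjI)
    qed
    show "\<forall>(U :: complex^'n^'n) (\<Lambda> :: real^'n).
        unitary_matrix U \<and> top_multiplicity \<Lambda> = 1 \<longrightarrow>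
        (\<exists>j. top_weights \<Lambda> = {j} \<and>
           rotated_basis s U j \<in> H0 A (bundle_power L k) \<and> rotated_basis s U j \<noteq> (\<lambda>i p. 0) \<and>
           ddbar_tendsto_weakly A L (bergman_ray k s U \<Lambda>)
             (zero_potential k (rotated_basis s U j)))"
    proof (intro allI impI)
      fix U :: "complex^'n^'n" and \<Lambda> :: "real^'n"
      assume "unitary_matrix U \<and> top_multiplicity \<Lambda> = 1"
      then have U: "unitary_matrix U" and "card (top_weights \<Lambda>) = 1" by (simp_all add: top_multiplicity_def)
      then obtain j where j: "top_weights \<Lambda> = {j}" by (auto simp: card_1_singleton_iff)
      have "ddbar_tendsto_weakly A L (bergman_ray k s U \<Lambda>) (zero_potential k (rotated_basis s U j))"
        unfolding zero_potential_eq
        by (rule ray_limit[OF U, of "{()}" _ "()" 1]) (simp_all add: rotated_Sect rotated_nonzero[OF U] j)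
      then show "\<exists>j. top_weights \<Lambda> = {j} \<and>
           rotated_basis s U j \<in> H0 A (bundle_power L k) \<and> rotated_basis s U j \<noteq> (\<lambda>i p. 0) \<and>
           ddbar_tendsto_weakly A L (bergman_ray k s U \<Lambda>) (zero_potential k (rotated_basis s U j))"
        using j rotated_Sect rotated_nonzero[OF U] by (intro exI[of _ j] conjI)
    qed
    show "\<forall>(U :: complex^'n^'n) (\<Lambda> :: real^'n) r.
        unitary_matrix U \<and> top_multiplicity \<Lambda> = r \<longrightarrow>
        1 \<le> r \<and> r \<le> CARD('n) \<and>
        ddbar_tendsto_weakly A L (bergman_ray k s U \<Lambda>)
          (log_sum_potential k (top_weights \<Lambda>) (rotated_basis s U))"
    proof (intro allI impI)
      fix U :: "complex^'n^'n" and \<Lambda> :: "real^'n" and r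
      assume U: "unitary_matrix U \<and> top_multiplicity \<Lambda> = r"
      have "0 < card (top_weights \<Lambda>)" using top_weights_nonempty by (simp add: card_gt_0_iff)
      then have "1 \<le> r" "r \<le> CARD('n)" using U by (auto simp: top_multiplicity_def intro: card_mono)
      then show "1 \<le> r \<and> r \<le> CARD('n) \<and> ddbar_tendsto_weakly A L (bergman_ray k s U \<Lambda>)
          (log_sum_potential k (top_weights \<Lambda>) (rotated_basis s U))"
        using ray_limit_top U by blast
    qed
    show "\<forall>\<sigma>\<in>H0 A (bundle_power L k). \<sigma> \<noteq> (\<lambda>i p. 0) \<longrightarrow>
        (\<exists>(U :: complex^'n^'n) (\<Lambda> :: real^'n).
           unitary_matrix U \<and> (\<Sum>j\<in>UNIV. \<Lambda> $ j) = 0 \<and> top_multiplicity \<Lambda> = 1 \<and>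
           ddbar_tendsto_weakly A L (bergman_ray k s U \<Lambda>) (zero_potential k \<sigma>))"
      by (intro ballI impI) (rule ex_ray_to_section)
    show "\<forall>r (\<sigma> :: nat \<Rightarrow> ('a, 'i) sect).
        1 \<le> r \<and> r \<le> CARD('n) \<and> (\<forall>j<r. \<sigma> j \<in> H0 A (bundle_power L k)) \<and>
        orthonormal_sects (background_inner A L h \<omega>\<^sub>0 k) {..<r} \<sigma> \<longrightarrow>
        (\<exists>(U :: complex^'n^'n) (\<Lambda> :: real^'n).
           unitary_matrix U \<and> (\<Sum>j\<in>UNIV. \<Lambda> $ j) = 0 \<and> top_multiplicity \<Lambda> = r \<and>
           ddbar_tendsto_weakly A L (bergman_ray k s U \<Lambda>) (log_sum_potential k {..<r} \<sigma>))"
    proof (intro allI impI, elim conjE)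
      fix r and \<sigma> :: "nat \<Rightarrow> ('a, 'i) sect"
      assume r: "1 \<le> r" "r \<le> CARD('n)" and \<sigma>: "\<forall>j<r. \<sigma> j \<in> H0 A (bundle_power L k)"
        and on: "orthonormal_sects (background_inner A L h \<omega>\<^sub>0 k) {..<r} \<sigma>"
      show "\<exists>(U :: complex^'n^'n) (\<Lambda> :: real^'n).
           unitary_matrix U \<and> (\<Sum>j\<in>UNIV. \<Lambda> $ j) = 0 \<and> top_multiplicity \<Lambda> = r \<and>
           ddbar_tendsto_weakly A L (bergman_ray k s U \<Lambda>) (log_sum_potential k {..<r} \<sigma>)"
        by (rule ex_ray_to_orthonormal_sections[OF metric \<omega> orthonormal r _ on]) (use \<sigma> in blast)
    qed
  qed
qed

end
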